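(* Let $\mathcal T\in\mathrm{Tree}(N)$ with $n=|[N]\cap\mathcal T|\ge2$ and let $k\ge0$. Suppose that $\mu_1,\dots,\mu_{N^k}$ are $\mathcal B$-valued laws with mean zero and variance $\eta$. Then there exist self-adjoint random variables $Y$ and $Z$ in a $\mathcal B$-valued probability space $(\mathcal A,E)$ such that (1) $Y$ has law $\mathrm{dil}_{n^{-k/2}}\boxplus_{\mathcal T^{n^k}}(\mu_1,\dots,\mu_{N^k})$; (2) $Z$ has law $\mathrm{dil}_{n^{-k/2}}\boxplus_{\mathcal T}^{n^k}(\nu_{\mathrm{Bool},\eta})$; (3) $\|Z\|\le2\left(\frac{N-1}{n-1}\|\eta(1)\|\right)^{1/2}$; (4) $\|Y-Z\|\le n^{-k/2}\max_j\mathrm{rad}(\mu_j)$.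
   Context: $\mathcal B$ is a unital $C^*$-algebra. For a right Hilbert $\mathcal B$-module $\mathcal H$, $\mathcal L(\mathcal H)$ is the $C^*$-algebra of bounded adjointable right-$\mathcal B$-modular operators. A $\mathcal B$-$\mathcal B$-correspondence is a right Hilbert $\mathcal B$-module with a left action given by a unital $*$-homomorphism $\mathcal B\to\mathcal L(\mathcal H)$. A $\mathcal B$-central unit vector is $\xi\in\mathcal H$ with $\langle\xi,\xi\rangle=1$, $b\xi=\xi b$ for all $b$; then $\mathcal H=\mathcal B\xi\oplus\mathcal H^\circ$, $\mathcal H^\circ=\{h:\langle h,\xi\rangle=0\}$. A $\mathcal B$-valued probability space $(\mathcal A,E)$ is a unital $C^*$-algebra $\mathcal A\supseteq\mathcal B$ (unital inclusion) with a unital completely positive $\mathcal B$-$\mathcal B$-bimodule map $E:\mathcal A\to\mathcal B$ such that $E[a_1aa_2]=0$ for all $a_1,a_2$ implies $a=0$. Laws: $\mathcal B\langle X\rangle$ is the universal unital $*$-algebra generated by $\mathcal B$ and a self-adjoint indeterminate $X$. A $\mathcal B$-valued law is a unital $\mathcal B$-$\mathcal B$-bimodule map $\mu:\mathcal B\langle X\rangle\to\mathcal B$ that is completely positive and exponentially bounded ($\|\mu(b_0Xb_1\cdots Xb_\ell)\|\le MR^\ell\|b_0\|\cdots\|b_\ell\|$ for some $M,R>0$); $\mathrm{rad}(\mu)$ is the infimum of admissible $R$. The law of a self-adjoint $Y\in(\mathcal A,E)$ is $p\mapsto E[p(Y)]$. Mean zero means $\mu(X)=0$; variance $\eta$ then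 means $\mu(XbX)=\eta(b)$ for all $b\in\mathcal B$. $\mathrm{dil}_c(\mu)(f(X))=\mu(f(cX))$. $\nu_{\mathrm{Bool},\eta}$ is the operator-valued Bernoulli law: the law of mean zero whose Boolean cumulants all vanish except the second, which is $\eta$; explicitly, the odd moments $\nu_{\mathrm{Bool},\eta}(b_0Xb_1\cdots Xb_{\ell})$, $\ell$ odd, vanish and $\nu_{\mathrm{Bool},\eta}(b_0Xb_1X\cdots Xb_{2m})=b_0\eta(b_1)b_2\eta(b_3)b_4\cdots\eta(b_{2m-1})b_{2m}$. Trees: $[N]=\{1,\dots,N\}$. A string on $[N]$ is alternating if consecutive letters differ. $\mathcal T_{N,\mathrm{free}}$ is the graph whose vertices are the alternating strings on $[N]$ (including the empty string $\emptyset$), with an edge between $s$ and $js$ whenever $js$ is alternating, rooted at $\emptyset$. $\mathrm{Tree}(N)$ is the set of connected subgraphs containing $\emptyset$, each identified with its vertex set; $[N]\cap\mathcal T$ is the set of one-letter strings in $\mathcal T$. For $\mathcal T\in\mathrm{Tree}(k)$, $\mathcal T_j\in\mathrm{Tree}(n_j)$, with $M=n_1+\dots+n_k$ and $\iota_j:[n_j]\to[M]$, $\iota_j(i)=n_1+\dots+n_{j-1}+i$, the composition $\mathcal T(\mathcal T_1,\dots,\mathcal T_k)\in\mathrm{Tree}(M)$ consists of all strings $(\iota_{i_1})_*(s_1)\cdots(\iota_{i_\ell})_*(s_\ell)$ with $\ell\ge0$, $i_1\cdots i_\ell\in\mathcal T$, $s_m\in\mathcal T_{i_m}\setminus\{\emptyset\}$,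 where $(\iota_j)_*$ applies $\iota_j$ letterwise. For $\mathcal T\in\mathrm{Tree}(N)$, $\mathcal T^{n^k}\in\mathrm{Tree}(N^k)$ is defined by $\mathcal T^{n^0}=\{\emptyset,1\}\in\mathrm{Tree}(1)$ and $\mathcal T^{n^{k+1}}=\mathcal T(\mathcal T^{n^k},\dots,\mathcal T^{n^k})$ ($N$ copies). $\mathcal T$-free convolution: given $(\mathcal H_j,\xi_j)$, $j\in[N]$, put $\mathcal H=\bigoplus_{s\in\mathcal T}\mathcal H_s^\circ$, $\mathcal H_\emptyset^\circ=\mathcal B$, $\mathcal H^\circ_{j_1\cdots j_m}=\mathcal H_{j_1}^\circ\otimes_{\mathcal B}\cdots\otimes_{\mathcal B}\mathcal H_{j_m}^\circ$, $\xi=1\in\mathcal H_\emptyset^\circ$. $\lambda_{\mathcal T,j}:\mathcal L(\mathcal H_j)\to\mathcal L(\mathcal H)$ is the $*$-homomorphism for which $\lambda_{\mathcal T,j}(x)$ acts on $\mathcal H_s^\circ\oplus\mathcal H_{js}^\circ\cong\mathcal H_j\otimes_{\mathcal B}\mathcal H_s^\circ$ as $x\otimes\mathrm{id}$ when $s\in\mathcal T$ does not begin with $j$ and $js\in\mathcal T$, and as zero on $\mathcal H_s^\circ$ when $s\in\mathcal T$ does not begin with $j$ and $js\notin\mathcal T$. For laws $\mu_1,\dots,\mu_N$, with $\mathcal H_j=L^2(\mathcal B\langle X\rangle,\mu_j)$ (separation-completion for $\langle p,q\rangle=\mu_j(p^*q)$), $\xi_j$ the class of $1$, $X_j$ multiplication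 by $X$, $\boxplus_{\mathcal T}(\mu_1,\dots,\mu_N)$ is the law of $\sum_j\lambda_{\mathcal T,j}(X_j)$ with respect to $a\mapsto\langle\xi,a\xi\rangle$. $\boxplus_{\mathcal T}^{1}(\mu)=\mu$ and $\boxplus_{\mathcal T}^{n^{k+1}}(\mu)=\boxplus_{\mathcal T}(\boxplus_{\mathcal T}^{n^k}(\mu),\dots,\boxplus_{\mathcal T}^{n^k}(\mu))$ ($N$ copies), so $\boxplus_{\mathcal T}^{n^k}(\mu)=\boxplus_{\mathcal T^{n^k}}(\mu,\dots,\mu)$. *)

theory Defs
  imports
    "HOL-Analysis.Analysis"
    "HOL-Algebra.Ring"
    "HOL-Library.Poly_Mapping"
begin

section \<open>The coefficient algebra \<open>\<B>\<close>\<close>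

text \<open>\<open>\<B>\<close> is a type. The algebra \<open>\<A>\<close> of a \<open>\<B>\<close>-valued probability space is claimed to exist, so it
  is a carrier with operations (locale \<open>cstar_algebra\<close> below). As usual for unital algebras in
  type classes, \<open>1 \<noteq> 0\<close> in \<open>\<B>\<close>.\<close>

class unital_cstar_algebra = banach + real_normed_algebra_1 +
  fixes scaleC :: "complex \<Rightarrow> 'a \<Rightarrow> 'a"
    and star :: "'a \<Rightarrow> 'a"
  assumes scaleC_add_right: "scaleC c (x + y) = scaleC c x + scaleC c y"
    and scaleC_add_left: "scaleC (c + d) x = scaleC c x + scaleC d x"
    and scaleC_scaleC: "scaleC c (scaleC d x) = scaleC (c * d) x"
    and scaleC_of_real: "scaleC (complex_of_real r) x = scaleR r x"
    and mult_scaleC_left: "scaleC c x * y = scaleC c (x * y)"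
    and mult_scaleC_right: "x * scaleC c y = scaleC c (x * y)"
    and norm_scaleC: "norm (scaleC c x) = cmod c * norm x"
    and star_add: "star (x + y) = star x + star y"
    and star_scaleC: "star (scaleC c x) = scaleC (cnj c) (star x)"
    and star_mult: "star (x * y) = star y * star x"
    and star_star: "star (star x) = x"
    and cstar_identity: "norm (star x * x) = (norm x)\<^sup>2"

lemma star_one: "star 1 = (1 :: 'b::unital_cstar_algebra)"
  by (metis mult.left_neutral mult.right_neutral star_mult star_star)

abbreviation scalar :: "complex \<Rightarrow> 'b::unital_cstar_algebra" where
  "scalar c \<equiv> scaleC c 1"

text \<open>Positivity in the \<open>C\<^sup>*\<close>-algebra \<open>M\<^sub>n(\<B>)\<close>: being of the form \<open>C\<^sup>* C\<close>.\<close>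

definition mat_positive :: "nat \<Rightarrow> (nat \<Rightarrow> nat \<Rightarrow> 'b::unital_cstar_algebra) \<Rightarrow> bool" where
  "mat_positive n M \<longleftrightarrow>
     (\<exists>C. \<forall>i<n. \<forall>j<n. M i j = (\<Sum>k<n. star (C k i) * C k j))"


section \<open>Carrier-based algebras and \<open>\<B>\<close>-valued probability spaces\<close>

record 'a star_struct = "'a ring" +
  cscale :: "complex \<Rightarrow> 'a \<Rightarrow> 'a"
  adj :: "'a \<Rightarrow> 'a"

record 'a cstar_struct = "'a star_struct" +
  cnorm :: "'a \<Rightarrow> real"

locale cstar_algebra = Ring.ring A for A :: "'a cstar_struct" (structure) +
  assumes cscale_closed: "x \<in> carrier A \<Longrightarrow> cscale A c x \<in> carrier A"
    and cscale_add_right: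
      "\<lbrakk>x \<in> carrier A; y \<in> carrier A\<rbrakk> \<Longrightarrow> cscale A c (x \<oplus> y) = cscale A c x \<oplus> cscale A c y"
    and cscale_add_left: "x \<in> carrier A \<Longrightarrow> cscale A (c + d) x = cscale A c x \<oplus> cscale A d x"
    and cscale_cscale: "x \<in> carrier A \<Longrightarrow> cscale A c (cscale A d x) = cscale A (c * d) x"
    and cscale_one: "x \<in> carrier A \<Longrightarrow> cscale A 1 x = x"
    and mult_cscale_left:
      "\<lbrakk>x \<in> carrier A; y \<in> carrier A\<rbrakk> \<Longrightarrow> cscale A c x \<otimes> y = cscale A c (x \<otimes> y)"
    and mult_cscale_right:
      "\<lbrakk>x \<in> carrier A; y \<in> carrier A\<rbrakk> \<Longrightarrow> x \<otimes> cscale A c y = cscale A c (x \<otimes> y)"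
    and adj_closed: "x \<in> carrier A \<Longrightarrow> adj A x \<in> carrier A"
    and adj_add: "\<lbrakk>x \<in> carrier A; y \<in> carrier A\<rbrakk> \<Longrightarrow> adj A (x \<oplus> y) = adj A x \<oplus> adj A y"
    and adj_cscale: "x \<in> carrier A \<Longrightarrow> adj A (cscale A c x) = cscale A (cnj c) (adj A x)"
    and adj_mult: "\<lbrakk>x \<in> carrier A; y \<in> carrier A\<rbrakk> \<Longrightarrow> adj A (x \<otimes> y) = adj A y \<otimes> adj A x"
    and adj_adj: "x \<in> carrier A \<Longrightarrow> adj A (adj A x) = x"
    and cnorm_nonneg: "x \<in> carrier A \<Longrightarrow> 0 \<le> cnorm A x"
    and cnorm_eq_0: "x \<in> carrier A \<Longrightarrow> cnorm A x = 0 \<longleftrightarrow> x = \<zero>"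
    and cnorm_triangle:
      "\<lbrakk>x \<in> carrier A; y \<in> carrier A\<rbrakk> \<Longrightarrow> cnorm A (x \<oplus> y) \<le> cnorm A x + cnorm A y"
    and cnorm_cscale: "x \<in> carrier A \<Longrightarrow> cnorm A (cscale A c x) = cmod c * cnorm A x"
    and cnorm_mult:
      "\<lbrakk>x \<in> carrier A; y \<in> carrier A\<rbrakk> \<Longrightarrow> cnorm A (x \<otimes> y) \<le> cnorm A x * cnorm A y"
    and cnorm_cstar: "x \<in> carrier A \<Longrightarrow> cnorm A (adj A x \<otimes> x) = (cnorm A x)\<^sup>2"
    and complete: "Metric_space.mcomplete (carrier A) (\<lambda>x y. cnorm A (x \<ominus> y))"

text \<open>The inclusion \<open>\<B> \<subseteq> \<A>\<close> is an injective unital \<open>*\<close>-homomorphism \<open>\<iota>\<close>.\<close>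

definition unital_inclusion ::
    "('a, 'm) star_struct_scheme \<Rightarrow> ('b::unital_cstar_algebra \<Rightarrow> 'a) \<Rightarrow> bool" where
  "unital_inclusion A \<iota> \<longleftrightarrow>
     inj \<iota> \<and> range \<iota> \<subseteq> carrier A \<and> \<iota> 1 = \<one>\<^bsub>A\<^esub> \<and>
     (\<forall>b c. \<iota> (b + c) = \<iota> b \<oplus>\<^bsub>A\<^esub> \<iota> c) \<and>
     (\<forall>b c. \<iota> (b * c) = \<iota> b \<otimes>\<^bsub>A\<^esub> \<iota> c) \<and>
     (\<forall>z b. \<iota> (scaleC z b) = cscale A z (\<iota> b)) \<and>
     (\<forall>b. \<iota> (star b) = adj A (\<iota> b))"

text \<open>Complex linearity of a \<open>\<B>\<close>-\<open>\<B>\<close>-bimodule map follows from additivity, as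
  \<open>\<complex>1 \<subseteq> \<B>\<close>. Complete positivity: \<open>E\<^sup>(\<^sup>n\<^sup>)(C\<^sup>* C) \<ge> 0\<close> for all \<open>C \<in> M\<^sub>n(\<A>)\<close>.\<close>

definition unital_cp_bimodule_map ::
    "('a, 'm) star_struct_scheme \<Rightarrow> ('b::unital_cstar_algebra \<Rightarrow> 'a) \<Rightarrow> ('a \<Rightarrow> 'b) \<Rightarrow> bool" where
  "unital_cp_bimodule_map A \<iota> E \<longleftrightarrow>
     E \<one>\<^bsub>A\<^esub> = 1 \<and>
     (\<forall>a\<in>carrier A. \<forall>a'\<in>carrier A. E (a \<oplus>\<^bsub>A\<^esub> a') = E a + E a') \<and>
     (\<forall>b c. \<forall>a\<in>carrier A. E (\<iota> b \<otimes>\<^bsub>A\<^esub> a \<otimes>\<^bsub>A\<^esub> \<iota> c) = b * E a * c) \<and>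
     (\<forall>n C. (\<forall>i<n. \<forall>j<n. C i j \<in> carrier A) \<longrightarrow>
        mat_positive n (\<lambda>i j. E (\<Oplus>\<^bsub>A\<^esub>k\<in>{..<n}. adj A (C k i) \<otimes>\<^bsub>A\<^esub> C k j)))"

definition bvalued_prob_space ::
    "'a cstar_struct \<Rightarrow> ('b::unital_cstar_algebra \<Rightarrow> 'a) \<Rightarrow> ('a \<Rightarrow> 'b) \<Rightarrow> bool" where
  "bvalued_prob_space A \<iota> E \<longleftrightarrow>
     cstar_algebra A \<and> unital_inclusion A \<iota> \<and> unital_cp_bimodule_map A \<iota> E \<and>
     (\<forall>a\<in>carrier A.
        (\<forall>a1\<in>carrier A. \<forall>a2\<in>carrier A. E (a1 \<otimes>\<^bsub>A\<^esub> a \<otimes>\<^bsub>A\<^esub> a2) = 0) \<longrightarrow> a = \<zero>\<^bsub>A\<^esub>)"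

definition self_adjoint :: "('a, 'm) star_struct_scheme \<Rightarrow> 'a \<Rightarrow> bool" where
  "self_adjoint A a \<longleftrightarrow> a \<in> carrier A \<and> adj A a = a"


section \<open>The universal algebra \<open>\<B>\<langle>X\<rangle>\<close>\<close>

datatype 'b bterm = Cst 'b | Var | Add "'b bterm" "'b bterm" | Mul "'b bterm" "'b bterm"

text \<open>The congruence generated by the axioms of a unital complex algebra and by \<open>Cst\<close> being a unital
  algebra homomorphism. Scalars act through \<open>Cst (scalar c)\<close>, so the complex algebra axioms amount
  to the ring axioms and centrality of these elements. No constructor for the involution is
  needed: it is determined by \<open>\<B>\<close>, by \<open>X\<^sup>* = X\<close> and by reversing products.\<close>

inductive bterm_eq :: "'b::unital_cstar_algebra bterm \<Rightarrow> 'b bterm \<Rightarrow> bool" where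
  refl: "bterm_eq p p"
| sym: "bterm_eq p q \<Longrightarrow> bterm_eq q p"
| trans: "bterm_eq p q \<Longrightarrow> bterm_eq q r \<Longrightarrow> bterm_eq p r"
| cong_add: "bterm_eq p p' \<Longrightarrow> bterm_eq q q' \<Longrightarrow> bterm_eq (Add p q) (Add p' q')"
| cong_mul: "bterm_eq p p' \<Longrightarrow> bterm_eq q q' \<Longrightarrow> bterm_eq (Mul p q) (Mul p' q')"
| add_assoc: "bterm_eq (Add (Add p q) r) (Add p (Add q r))"
| add_commute: "bterm_eq (Add p q) (Add q p)"
| add_0: "bterm_eq (Add (Cst 0) p) p"
| add_neg: "bterm_eq (Add (Mul (Cst (- 1)) p) p) (Cst 0)"
| mul_assoc: "bterm_eq (Mul (Mul p q) r) (Mul p (Mul q r))"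
| mul_1_left: "bterm_eq (Mul (Cst 1) p) p"
| mul_1_right: "bterm_eq (Mul p (Cst 1)) p"
| distrib_left: "bterm_eq (Mul p (Add q r)) (Add (Mul p q) (Mul p r))"
| distrib_right: "bterm_eq (Mul (Add p q) r) (Add (Mul p r) (Mul q r))"
| Cst_add: "bterm_eq (Cst (b + c)) (Add (Cst b) (Cst c))"
| Cst_mul: "bterm_eq (Cst (b * c)) (Mul (Cst b) (Cst c))"
| scalar_central: "bterm_eq (Mul (Cst (scalar z)) p) (Mul p (Cst (scalar z)))"

quotient_type (overloaded) 'b bpoly = "'b::unital_cstar_algebra bterm" / bterm_eq
  by (rule equivpI)
    (auto intro!: reflpI sympI transpI intro: bterm_eq.refl bterm_eq.sym bterm_eq.trans)

primrec bterm_star :: "'b::unital_cstar_algebra bterm \<Rightarrow> 'b bterm" where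
  "bterm_star (Cst b) = Cst (star b)"
| "bterm_star Var = Var"
| "bterm_star (Add p q) = Add (bterm_star p) (bterm_star q)"
| "bterm_star (Mul p q) = Mul (bterm_star q) (bterm_star p)"

primrec bterm_at_0 :: "'b::unital_cstar_algebra bterm \<Rightarrow> 'b" where
  "bterm_at_0 (Cst b) = b"
| "bterm_at_0 Var = 0"
| "bterm_at_0 (Add p q) = bterm_at_0 p + bterm_at_0 q"
| "bterm_at_0 (Mul p q) = bterm_at_0 p * bterm_at_0 q"

lemma bterm_eq_at_0: "bterm_eq p q \<Longrightarrow> bterm_at_0 p = bterm_at_0 q"
  by (induction rule: bterm_eq.induct)
    (simp_all add: algebra_simps mult_scaleC_left mult_scaleC_right)

lemma star_neg_one: "star (- 1) = (- 1 :: 'b::unital_cstar_algebra)"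
  using star_scaleC[of "- 1" "1 :: 'b"] scaleC_of_real[of "- 1" "1 :: 'b"]
  by (simp add: star_one)

lemma star_zero: "star 0 = (0 :: 'b::unital_cstar_algebra)"
  using star_add[of "0 :: 'b" 0] by simp

lemma bterm_eq_neg_comm:
  "bterm_eq (Mul p (Cst (- 1 :: 'b::unital_cstar_algebra))) (Mul (Cst (- 1)) p)"
  using bterm_eq.sym[OF bterm_eq.scalar_central[of "- 1 :: complex" p]]
    scaleC_of_real[of "- 1" "1 :: 'b"] by simp

lemma bterm_eq_star: "bterm_eq p q \<Longrightarrow> bterm_eq (bterm_star p) (bterm_star q)"
proof (induction rule: bterm_eq.induct)
  case (sym p q)
  from sym.IH show ?case by (rule bterm_eq.sym)
next
  case (trans p q r)
  from trans.IH show ?case by (rule bterm_eq.trans)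
next
  case (mul_assoc p q r)
  show ?case by (simp add: bterm_eq.sym[OF bterm_eq.mul_assoc])
next
  case (add_neg p)
  show ?case
    using bterm_eq.trans[OF bterm_eq.cong_add[OF bterm_eq_neg_comm bterm_eq.refl] bterm_eq.add_neg]
    by (simp add: star_neg_one star_zero)
next
  case (scalar_central z p)
  show ?case
    by (simp add: star_scaleC star_one bterm_eq.sym[OF bterm_eq.scalar_central])
qed (simp_all add: star_one star_zero star_add star_mult bterm_eq.refl bterm_eq.cong_add
    bterm_eq.cong_mul bterm_eq.add_assoc bterm_eq.add_commute bterm_eq.add_0 bterm_eq.mul_1_left
    bterm_eq.mul_1_right bterm_eq.distrib_left bterm_eq.distrib_right bterm_eq.Cst_add
    bterm_eq.Cst_mul)

instantiation bpoly :: (unital_cstar_algebra) ring_1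
begin

lift_definition zero_bpoly :: "'a bpoly" is "Cst 0" .
lift_definition one_bpoly :: "'a bpoly" is "Cst 1" .
lift_definition plus_bpoly :: "'a bpoly \<Rightarrow> 'a bpoly \<Rightarrow> 'a bpoly" is Add
  by (rule bterm_eq.cong_add)
lift_definition times_bpoly :: "'a bpoly \<Rightarrow> 'a bpoly \<Rightarrow> 'a bpoly" is Mul
  by (rule bterm_eq.cong_mul)
lift_definition uminus_bpoly :: "'a bpoly \<Rightarrow> 'a bpoly" is "Mul (Cst (- 1))"
  by (rule bterm_eq.cong_mul[OF bterm_eq.refl])
definition minus_bpoly :: "'a bpoly \<Rightarrow> 'a bpoly \<Rightarrow> 'a bpoly" where
  "minus_bpoly p q = p + - q"

instance
proof
  fix a b c :: "'a bpoly"
  show "a + b + c = a + (b + c)" by transfer (rule bterm_eq.add_assoc)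
  show "a + b = b + a" by transfer (rule bterm_eq.add_commute)
  show "0 + a = a" by transfer (rule bterm_eq.add_0)
  show "- a + a = 0" by transfer (rule bterm_eq.add_neg)
  show "a - b = a + - b" by (rule minus_bpoly_def)
  show "a * b * c = a * (b * c)" by transfer (rule bterm_eq.mul_assoc)
  show "1 * a = a" by transfer (rule bterm_eq.mul_1_left)
  show "a * 1 = a" by transfer (rule bterm_eq.mul_1_right)
  show "(a + b) * c = a * c + b * c" by transfer (rule bterm_eq.distrib_right)
  show "a * (b + c) = a * b + a * c" by transfer (rule bterm_eq.distrib_left)
  show "(0 :: 'a bpoly) \<noteq> 1"
    by transfer (use bterm_eq_at_0 in fastforce)
qed

end

lift_definition const :: "'b::unital_cstar_algebra \<Rightarrow> 'b bpoly" is Cst .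

lift_definition X :: "'b::unital_cstar_algebra bpoly" is Var .

lift_definition bpoly_star :: "'b::unital_cstar_algebra bpoly \<Rightarrow> 'b bpoly" is bterm_star
  by (rule bterm_eq_star)

definition bpoly_alg :: "'b::unital_cstar_algebra bpoly star_struct" where
  "bpoly_alg = \<lparr>carrier = UNIV, mult = (*), one = 1, zero = 0, add = (+),
     cscale = (\<lambda>c p. const (scalar c) * p), adj = bpoly_star\<rparr>"

primrec bterm_eval ::
    "('a, 'm) ring_scheme \<Rightarrow> ('b \<Rightarrow> 'a) \<Rightarrow> 'a \<Rightarrow> 'b::unital_cstar_algebra bterm \<Rightarrow> 'a" where
  "bterm_eval A \<iota> Y (Cst b) = \<iota> b"
| "bterm_eval A \<iota> Y Var = Y"
| "bterm_eval A \<iota> Y (Add p q) = bterm_eval A \<iota> Y p \<oplus>\<^bsub>A\<^esub> bterm_eval A \<iota> Y q"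
| "bterm_eval A \<iota> Y (Mul p q) = bterm_eval A \<iota> Y p \<otimes>\<^bsub>A\<^esub> bterm_eval A \<iota> Y q"

text \<open>\<open>p(Y)\<close>, computed on a representative of \<open>p\<close>. The choice is immaterial if \<open>A\<close> is a
  unital complex algebra, \<open>\<iota>\<close> a unital homomorphism into it and \<open>Y \<in> carrier A\<close>.\<close>

definition bpoly_eval ::
    "('a, 'm) ring_scheme \<Rightarrow> ('b \<Rightarrow> 'a) \<Rightarrow> 'a \<Rightarrow> 'b::unital_cstar_algebra bpoly \<Rightarrow> 'a" where
  "bpoly_eval A \<iota> Y p = bterm_eval A \<iota> Y (rep_bpoly p)"


section \<open>Laws\<close>

text \<open>\<open>monomial b\<^sub>0 [b\<^sub>1, \<dots>, b\<^sub>l] = b\<^sub>0 X b\<^sub>1 X \<cdots> X b\<^sub>l\<close>\<close>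

definition monomial :: "'b::unital_cstar_algebra \<Rightarrow> 'b list \<Rightarrow> 'b bpoly" where
  "monomial b0 bs = foldl (\<lambda>p b. p * X * const b) (const b0) bs"

definition exp_bounded_by :: "real \<Rightarrow> real \<Rightarrow> ('b::unital_cstar_algebra bpoly \<Rightarrow> 'b) \<Rightarrow> bool" where
  "exp_bounded_by M R \<mu> \<longleftrightarrow>
     (\<forall>b0 bs. norm (\<mu> (monomial b0 bs))
        \<le> M * R ^ length bs * norm b0 * prod_list (map norm bs))"

definition bvalued_law :: "('b::unital_cstar_algebra bpoly \<Rightarrow> 'b) \<Rightarrow> bool" where
  "bvalued_law \<mu> \<longleftrightarrow>
     unital_cp_bimodule_map bpoly_alg const \<mu> \<and> (\<exists>M>0. \<exists>R>0. exp_bounded_by M R \<mu>)"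

definition rad :: "('b::unital_cstar_algebra bpoly \<Rightarrow> 'b) \<Rightarrow> real" where
  "rad \<mu> = Inf {R. R > 0 \<and> (\<exists>M>0. exp_bounded_by M R \<mu>)}"

definition mean_zero :: "('b::unital_cstar_algebra bpoly \<Rightarrow> 'b) \<Rightarrow> bool" where
  "mean_zero \<mu> \<longleftrightarrow> \<mu> X = 0"

definition has_variance ::
    "('b::unital_cstar_algebra bpoly \<Rightarrow> 'b) \<Rightarrow> ('b \<Rightarrow> 'b) \<Rightarrow> bool" where
  "has_variance \<mu> \<eta> \<longleftrightarrow> (\<forall>b. \<mu> (X * const b * X) = \<eta> b)"

definition law_of ::
    "('a, 'm) ring_scheme \<Rightarrow> ('b \<Rightarrow> 'a) \<Rightarrow> ('a \<Rightarrow> 'b) \<Rightarrow> 'a \<Rightarrow>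
     'b::unital_cstar_algebra bpoly \<Rightarrow> 'b" where
  "law_of A \<iota> E Y = (\<lambda>p. E (bpoly_eval A \<iota> Y p))"

definition dil ::
    "real \<Rightarrow> ('b::unital_cstar_algebra bpoly \<Rightarrow> 'b) \<Rightarrow> 'b bpoly \<Rightarrow> 'b" where
  "dil c \<mu> = (\<lambda>p. \<mu> (bpoly_eval bpoly_alg const (const (of_real c) * X) p))"

text \<open>\<open>b\<^sub>0 \<eta>(b\<^sub>1) b\<^sub>2 \<eta>(b\<^sub>3) \<cdots> \<eta>(b\<^bsub>2m-1\<^esub>) b\<^bsub>2m\<^esub>\<close>, and \<open>0\<close> in odd degree\<close>

fun bool_moment :: "('b \<Rightarrow> 'b) \<Rightarrow> 'b::unital_cstar_algebra \<Rightarrow> 'b list \<Rightarrow> 'b" where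
  "bool_moment \<eta> b0 [] = b0"
| "bool_moment \<eta> b0 [b1] = 0"
| "bool_moment \<eta> b0 (b1 # b2 # bs) = b0 * \<eta> b1 * bool_moment \<eta> b2 bs"

definition nu_bool :: "('b \<Rightarrow> 'b) \<Rightarrow> 'b::unital_cstar_algebra bpoly \<Rightarrow> 'b" where
  "nu_bool \<eta> = (THE \<nu>. bvalued_law \<nu> \<and> (\<forall>b0 bs. \<nu> (monomial b0 bs) = bool_moment \<eta> b0 bs))"


section \<open>\<open>\<B>\<close>-\<open>\<B>\<close>-correspondences\<close>

text \<open>Scalars act on a right \<open>\<B>\<close>-module through \<open>\<complex>1 \<subseteq> \<B>\<close>.
  The inner product is \<open>\<B>\<close>-linear on the right. The same record carries pre-Hilbert modules, with
  a possibly degenerate inner product.\<close>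

record ('b, 'h) bimod =
  elems :: "'h set"
  hzero :: 'h
  hadd :: "'h \<Rightarrow> 'h \<Rightarrow> 'h"
  lact :: "'b \<Rightarrow> 'h \<Rightarrow> 'h"
  ract :: "'h \<Rightarrow> 'b \<Rightarrow> 'h"
  inn :: "'h \<Rightarrow> 'h \<Rightarrow> 'b"

definition hnorm :: "('b::unital_cstar_algebra, 'h) bimod \<Rightarrow> 'h \<Rightarrow> real" where
  "hnorm H h = sqrt (norm (inn H h h))"

definition hminus :: "('b::unital_cstar_algebra, 'h) bimod \<Rightarrow> 'h \<Rightarrow> 'h \<Rightarrow> 'h" where
  "hminus H h k = hadd H h (ract H k (- 1))"

subsection \<open>Separation-completion\<close>

definition cauchy_seqs :: "('b::unital_cstar_algebra, 'v) bimod \<Rightarrow> (nat \<Rightarrow> 'v) set" where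
  "cauchy_seqs V = {x. range x \<subseteq> elems V \<and>
     (\<forall>\<epsilon>>0. \<exists>M. \<forall>m\<ge>M. \<forall>n\<ge>M. hnorm V (hminus V (x m) (x n)) < \<epsilon>)}"

definition null_rel :: "('b::unital_cstar_algebra, 'v) bimod \<Rightarrow> ((nat \<Rightarrow> 'v) \<times> (nat \<Rightarrow> 'v)) set" where
  "null_rel V = {(x, y). x \<in> cauchy_seqs V \<and> y \<in> cauchy_seqs V \<and>
     (\<lambda>n. hnorm V (hminus V (x n) (y n))) \<longlonglongrightarrow> 0}"

definition cls :: "('b::unital_cstar_algebra, 'v) bimod \<Rightarrow> (nat \<Rightarrow> 'v) \<Rightarrow> (nat \<Rightarrow> 'v) set" where
  "cls V x = null_rel V `` {x}"

definition repr :: "(nat \<Rightarrow> 'v) set \<Rightarrow> nat \<Rightarrow> 'v" where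
  "repr c = (SOME x. x \<in> c)"

definition completion ::
    "('b::unital_cstar_algebra, 'v) bimod \<Rightarrow> ('b, (nat \<Rightarrow> 'v) set) bimod" where
  "completion V = \<lparr>
     elems = cauchy_seqs V // null_rel V,
     hzero = cls V (\<lambda>_. hzero V),
     hadd = (\<lambda>c d. cls V (\<lambda>n. hadd V (repr c n) (repr d n))),
     lact = (\<lambda>b c. cls V (\<lambda>n. lact V b (repr c n))),
     ract = (\<lambda>c b. cls V (\<lambda>n. ract V (repr c n) b)),
     inn = (\<lambda>c d. lim (\<lambda>n. inn V (repr c n) (repr d n)))\<rparr>"

definition emb :: "('b::unital_cstar_algebra, 'v) bimod \<Rightarrow> 'v \<Rightarrow> (nat \<Rightarrow> 'v) set" where
  "emb V v = cls V (\<lambda>_. v)"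

subsection \<open>Adjointable operators\<close>

text \<open>Operators are functions that are \<open>undefined\<close> outside the module.\<close>

definition adjointable :: "('b::unital_cstar_algebra, 'h) bimod \<Rightarrow> ('h \<Rightarrow> 'h) set" where
  "adjointable H = {T \<in> elems H \<rightarrow>\<^sub>E elems H.
     (\<forall>h\<in>elems H. \<forall>k\<in>elems H. T (hadd H h k) = hadd H (T h) (T k)) \<and>
     (\<forall>h\<in>elems H. \<forall>b. T (ract H h b) = ract H (T h) b) \<and>
     (\<exists>C\<ge>0. \<forall>h\<in>elems H. hnorm H (T h) \<le> C * hnorm H h) \<and>
     (\<exists>S \<in> elems H \<rightarrow> elems H. \<forall>h\<in>elems H. \<forall>k\<in>elems H. inn H (T h) k = inn H h (S k))}"

definition Lop :: "('b::unital_cstar_algebra, 'h) bimod \<Rightarrow> ('h \<Rightarrow> 'h) cstar_struct" where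
  "Lop H = \<lparr>
     carrier = adjointable H,
     mult = compose (elems H),
     one = (\<lambda>h\<in>elems H. h),
     zero = (\<lambda>h\<in>elems H. hzero H),
     add = (\<lambda>S T. \<lambda>h\<in>elems H. hadd H (S h) (T h)),
     cscale = (\<lambda>c T. \<lambda>h\<in>elems H. ract H (T h) (scalar c)),
     adj = (\<lambda>T. THE S. S \<in> adjointable H \<and>
              (\<forall>h\<in>elems H. \<forall>k\<in>elems H. inn H (T h) k = inn H h (S k))),
     cnorm = (\<lambda>T. Inf {C. C \<ge> 0 \<and> (\<forall>h\<in>elems H. hnorm H (T h) \<le> C * hnorm H h)})\<rparr>"

definition left_mult :: "('b::unital_cstar_algebra, 'h) bimod \<Rightarrow> 'b \<Rightarrow> 'h \<Rightarrow> 'h" where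
  "left_mult H b = (\<lambda>h\<in>elems H. lact H b h)"


subsection \<open>\<open>L\<^sup>2(\<B>\<langle>X\<rangle>, \<mu>)\<close>\<close>

definition pre_L2 ::
    "('b::unital_cstar_algebra bpoly \<Rightarrow> 'b) \<Rightarrow> ('b, 'b bpoly) bimod" where
  "pre_L2 \<mu> = \<lparr>elems = UNIV, hzero = 0, hadd = (+),
     lact = (\<lambda>b p. const b * p), ract = (\<lambda>p b. p * const b),
     inn = (\<lambda>p q. \<mu> (bpoly_star p * q))\<rparr>"

type_synonym 'b L2_elem = "(nat \<Rightarrow> 'b bpoly) set"

definition L2 :: "('b::unital_cstar_algebra bpoly \<Rightarrow> 'b) \<Rightarrow> ('b, 'b L2_elem) bimod" where
  "L2 \<mu> = completion (pre_L2 \<mu>)"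

definition L2_one :: "('b::unital_cstar_algebra bpoly \<Rightarrow> 'b) \<Rightarrow> 'b L2_elem" where
  "L2_one \<mu> = emb (pre_L2 \<mu>) 1"

definition L2_X :: "('b::unital_cstar_algebra bpoly \<Rightarrow> 'b) \<Rightarrow> 'b L2_elem \<Rightarrow> 'b L2_elem" where
  "L2_X \<mu> = (\<lambda>c\<in>elems (L2 \<mu>). cls (pre_L2 \<mu>) (\<lambda>n. X * repr c n))"


section \<open>Trees\<close>

definition alt_strings :: "nat \<Rightarrow> nat list set" where
  "alt_strings N = {s. set s \<subseteq> {1..N} \<and> distinct_adj s}"

definition free_edges :: "nat \<Rightarrow> (nat list \<times> nat list) set" where
  "free_edges N = {(s, j # s) | s j. j # s \<in> alt_strings N}"

text \<open>The ambient graph is a tree, so a connected subgraph contains all edges between its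
  vertices; connectedness is therefore tested in the induced subgraph.\<close>

definition Tree :: "nat \<Rightarrow> nat list set set" where
  "Tree N = {T. T \<subseteq> alt_strings N \<and> [] \<in> T \<and>
     (\<forall>s\<in>T. \<forall>t\<in>T. (s, t) \<in> ((free_edges N \<union> (free_edges N)\<inverse>) \<inter> T \<times> T)\<^sup>*)}"

definition iota :: "(nat \<Rightarrow> nat) \<Rightarrow> nat \<Rightarrow> nat \<Rightarrow> nat" where
  "iota ns j i = (\<Sum>l = 1..<j. ns l) + i"

definition tree_comp ::
    "nat list set \<Rightarrow> (nat \<Rightarrow> nat) \<Rightarrow> (nat \<Rightarrow> nat list set) \<Rightarrow> nat list set" where
  "tree_comp T ns Ts =
     {concat (map2 (\<lambda>j s. map (iota ns j) s) is ss) | is ss.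
        is \<in> T \<and> list_all2 (\<lambda>j s. s \<in> Ts j - {[]}) is ss}"

text \<open>\<open>tree_pow N T k\<close> is \<open>T\<close> to the power \<open>n\<^sup>k\<close>, an element of \<open>Tree (N ^ k)\<close>.\<close>

primrec tree_pow :: "nat \<Rightarrow> nat list set \<Rightarrow> nat \<Rightarrow> nat list set" where
  "tree_pow N T 0 = {[], [1]}"
| "tree_pow N T (Suc k) = tree_comp T (\<lambda>_. N ^ k) (\<lambda>_. tree_pow N T k)"


section \<open>\<open>T\<close>-free products and convolution\<close>

definition hcirc :: "('b::unital_cstar_algebra, 'h) bimod \<Rightarrow> 'h \<Rightarrow> 'h set" where
  "hcirc H \<xi> = {h \<in> elems H. inn H h \<xi> = 0}"

text \<open>\<open>\<langle>h\<^sub>1 \<otimes> \<cdots> \<otimes> h\<^sub>m, b k\<^sub>1 \<otimes> \<cdots> \<otimes> k\<^sub>m\<rangle>\<close>, using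
  \<open>\<langle>h \<otimes> h', k \<otimes> k'\<rangle> = \<langle>h', \<langle>h, k\<rangle> k'\<rangle>\<close>\<close>

fun tensor_inn ::
    "(nat \<Rightarrow> ('b::unital_cstar_algebra, 'h) bimod) \<Rightarrow> nat list \<Rightarrow> 'b \<Rightarrow> 'h list \<Rightarrow> 'h list \<Rightarrow> 'b" where
  "tensor_inn H [] b [] [] = b"
| "tensor_inn H (j # s) b (h # hs) (k # ks) =
     tensor_inn H s (inn (H j) h (lact (H j) b k)) hs ks"
| "tensor_inn H _ b _ _ = 0"

text \<open>The generator \<open>(s, [h\<^sub>1, \<dots>, h\<^sub>m])\<close> with \<open>s = j\<^sub>1 \<cdots> j\<^sub>m\<close> stands for
  \<open>h\<^sub>1 \<otimes> \<cdots> \<otimes> h\<^sub>m\<close> in the summand at \<open>s\<close>, and \<open>([], [])\<close> for \<open>1 \<in> \<B>\<close> in the summand at the empty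
  string. Finite formal right \<open>\<B>\<close>-combinations of generators form the algebraic direct sum of
  the tensor products before separation; the relations of \<open>\<otimes>\<^sub>\<B>\<close> hold up to vectors of
  norm \<open>0\<close>. Separation-completion hence gives the Hilbert module direct sum
  \<open>\<Oplus>\<^bsub>s\<in>T\<^esub> \<H>\<^bsub>j\<^sub>1\<^esub>\<^sup>\<circ> \<otimes>\<^sub>\<B> \<cdots> \<otimes>\<^sub>\<B> \<H>\<^bsub>j\<^sub>m\<^esub>\<^sup>\<circ>\<close>.\<close>

type_synonym 'h gen = "nat list \<times> 'h list"

definition simple_tensors ::
    "(nat \<Rightarrow> ('b::unital_cstar_algebra, 'h) bimod) \<Rightarrow> (nat \<Rightarrow> 'h) \<Rightarrow> nat list \<Rightarrow> 'h list set" where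
  "simple_tensors H \<xi> s = {hs. list_all2 (\<lambda>j h. h \<in> hcirc (H j) (\<xi> j)) s hs}"

definition gen_inn ::
    "(nat \<Rightarrow> ('b::unital_cstar_algebra, 'h) bimod) \<Rightarrow> 'h gen \<Rightarrow> 'h gen \<Rightarrow> 'b" where
  "gen_inn H x y =
     (if fst x = fst y then tensor_inn H (fst x) 1 (snd x) (snd y) else 0)"

text \<open>\<open>b (h\<^sub>1 \<otimes> \<cdots> \<otimes> h\<^sub>m) c = (b h\<^sub>1) \<otimes> \<cdots> \<otimes> h\<^sub>m c\<close>, and \<open>b 1 c = 1 (b c)\<close> in \<open>\<B>\<close>\<close>

fun gen_lact ::
    "(nat \<Rightarrow> ('b::unital_cstar_algebra, 'h) bimod) \<Rightarrow> 'b \<Rightarrow> 'h gen \<Rightarrow> 'b \<Rightarrow> 'h gen \<Rightarrow>\<^sub>0 'b" where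
  "gen_lact H b (j # s, h # hs) c = Poly_Mapping.single (j # s, lact (H j) b h # hs) c"
| "gen_lact H b x c = Poly_Mapping.single x (b * c)"

definition pre_tfree ::
    "nat list set \<Rightarrow> (nat \<Rightarrow> ('b::unital_cstar_algebra, 'h) bimod) \<Rightarrow> (nat \<Rightarrow> 'h) \<Rightarrow>
     ('b, 'h gen \<Rightarrow>\<^sub>0 'b) bimod" where
  "pre_tfree T H \<xi> = \<lparr>
     elems = {v. \<forall>x\<in>Poly_Mapping.keys v. fst x \<in> T \<and> snd x \<in> simple_tensors H \<xi> (fst x)},
     hzero = 0,
     hadd = (+),
     lact = (\<lambda>b v. \<Sum>x\<in>Poly_Mapping.keys v. gen_lact H b x (Poly_Mapping.lookup v x)),
     ract = (\<lambda>v b. Poly_Mapping.map (\<lambda>a. a * b) v),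
     inn = (\<lambda>v w. \<Sum>x\<in>Poly_Mapping.keys v. \<Sum>y\<in>Poly_Mapping.keys w.
       star (Poly_Mapping.lookup v x) * gen_inn H x y * Poly_Mapping.lookup w y)\<rparr>"

type_synonym ('b, 'h) tfree_elem = "(nat \<Rightarrow> 'h gen \<Rightarrow>\<^sub>0 'b) set"

definition tfree ::
    "nat list set \<Rightarrow> (nat \<Rightarrow> ('b::unital_cstar_algebra, 'h) bimod) \<Rightarrow> (nat \<Rightarrow> 'h) \<Rightarrow>
     ('b, ('b, 'h) tfree_elem) bimod" where
  "tfree T H \<xi> = completion (pre_tfree T H \<xi>)"

definition simple ::
    "nat list set \<Rightarrow> (nat \<Rightarrow> ('b::unital_cstar_algebra, 'h) bimod) \<Rightarrow> (nat \<Rightarrow> 'h) \<Rightarrow>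
     nat list \<Rightarrow> 'h list \<Rightarrow> ('b, 'h) tfree_elem" where
  "simple T H \<xi> s hs = emb (pre_tfree T H \<xi>) (Poly_Mapping.single (s, hs) 1)"

definition tfree_vec ::
    "nat list set \<Rightarrow> (nat \<Rightarrow> ('b::unital_cstar_algebra, 'h) bimod) \<Rightarrow> (nat \<Rightarrow> 'h) \<Rightarrow>
     ('b, 'h) tfree_elem" where
  "tfree_vec T H \<xi> = simple T H \<xi> [] []"

text \<open>The image of \<open>h \<otimes> w\<close>, with \<open>w\<close> the simple tensor \<open>hs\<close> at \<open>s\<close>, under
  \<open>\<H>\<^sub>j \<otimes>\<^sub>\<B> \<H>\<^sub>s\<^sup>\<circ> \<cong> \<H>\<^sub>s\<^sup>\<circ> \<oplus> \<H>\<^bsub>js\<^esub>\<^sup>\<circ>\<close>: writing \<open>h = b \<xi>\<^sub>j + h'\<close> with \<open>b = \<langle>\<xi>\<^sub>j, h\<rangle>\<close> and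
  \<open>h' \<in> \<H>\<^sub>j\<^sup>\<circ>\<close>, it is \<open>b w + h' \<otimes> w\<close>.\<close>

definition tensor_left ::
    "nat list set \<Rightarrow> (nat \<Rightarrow> ('b::unital_cstar_algebra, 'h) bimod) \<Rightarrow> (nat \<Rightarrow> 'h) \<Rightarrow>
     nat \<Rightarrow> 'h \<Rightarrow> nat list \<Rightarrow> 'h list \<Rightarrow> ('b, 'h) tfree_elem" where
  "tensor_left T H \<xi> j h s hs =
     (let b = inn (H j) (\<xi> j) h;
          h' = hminus (H j) h (lact (H j) b (\<xi> j))
      in hadd (tfree T H \<xi>)
           (lact (tfree T H \<xi>) b (simple T H \<xi> s hs))
           (simple T H \<xi> (j # s) (h' # hs)))"

text \<open>\<open>\<lambda>\<^bsub>T,j\<^esub>(x)\<close> acts as \<open>x \<otimes> id\<close> on \<open>\<H>\<^sub>j \<otimes>\<^sub>\<B> \<H>\<^sub>s\<^sup>\<circ>\<close> if \<open>js \<in> T\<close>, and as zero on \<open>\<H>\<^sub>s\<^sup>\<circ>\<close> otherwise. It is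
  prescribed on vectors spanning a dense right \<open>\<B>\<close>-submodule and so is unique.\<close>

definition lambda_op ::
    "nat list set \<Rightarrow> (nat \<Rightarrow> ('b::unital_cstar_algebra, 'h) bimod) \<Rightarrow> (nat \<Rightarrow> 'h) \<Rightarrow>
     nat \<Rightarrow> ('h \<Rightarrow> 'h) \<Rightarrow> ('b, 'h) tfree_elem \<Rightarrow> ('b, 'h) tfree_elem" where
  "lambda_op T H \<xi> j x = (THE L. L \<in> adjointable (tfree T H \<xi>) \<and>
     (\<forall>s\<in>T. (s = [] \<or> hd s \<noteq> j) \<longrightarrow> (\<forall>hs\<in>simple_tensors H \<xi> s.
        if j # s \<in> T
        then \<forall>h\<in>elems (H j). L (tensor_left T H \<xi> j h s hs) = tensor_left T H \<xi> j (x h) s hs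
        else L (simple T H \<xi> s hs) = hzero (tfree T H \<xi>))))"

definition boxplus ::
    "nat \<Rightarrow> nat list set \<Rightarrow> (nat \<Rightarrow> 'b::unital_cstar_algebra bpoly \<Rightarrow> 'b) \<Rightarrow> 'b bpoly \<Rightarrow> 'b" where
  "boxplus N T \<mu> =
     (let Hj = (\<lambda>j. L2 (\<mu> j)); \<xi>j = (\<lambda>j. L2_one (\<mu> j));
          H = tfree T Hj \<xi>j; \<xi> = tfree_vec T Hj \<xi>j
      in law_of (Lop H) (left_mult H) (\<lambda>a. inn H \<xi> (a \<xi>))
           (\<Oplus>\<^bsub>Lop H\<^esub>j\<in>{1..N}. lambda_op T Hj \<xi>j j (L2_X (\<mu> j))))"

primrec boxplus_pow ::
    "nat \<Rightarrow> nat list set \<Rightarrow> nat \<Rightarrow> ('b::unital_cstar_algebra bpoly \<Rightarrow> 'b) \<Rightarrow> 'b bpoly \<Rightarrow> 'b" where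
  "boxplus_pow N T 0 \<mu> = \<mu>"
| "boxplus_pow N T (Suc k) \<mu> = boxplus N T (\<lambda>_. boxplus_pow N T k \<mu>)"

text \<open>Elements of the algebra \<open>\<A>\<close> in an existence statement need a type. Operators on \<open>T\<close>-free
  products of \<open>L\<^sup>2\<close>-spaces of laws have this one.\<close>

type_synonym 'b operator = "('b, 'b L2_elem) tfree_elem \<Rightarrow> ('b, 'b L2_elem) tfree_elem"

end

theory Submission
  imports Defs "HOL-Library.Sublist"
begin

text \<open>Let \<open>X\<^sub>j\<close> be multiplication by \<open>X\<close> on \<open>L\<^sup>2(\<mu>\<^sub>j)\<close>, let \<open>P\<^sub>j\<close> be the projection onto \<open>\<B>\<xi>\<^sub>j\<close> and
  \<open>Q\<^sub>j = 1 - P\<^sub>j\<close>. As \<open>\<mu>\<^sub>j\<close> has mean zero, \<open>X\<^sub>j = B\<^sub>j + Q\<^sub>jX\<^sub>jQ\<^sub>j\<close> with \<open>B\<^sub>j = Q\<^sub>jX\<^sub>jP\<^sub>j + P\<^sub>jX\<^sub>jQ\<^sub>j\<close>, and \<open>B\<^sub>j\<close> has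
  the Bernoulli law of variance \<open>\<eta>\<close>. Up to the factor \<open>n\<^bsup>-k/2\<^esup>\<close>, take \<open>Y = \<Sum>\<^sub>j \<lambda>\<^sub>j(X\<^sub>j)\<close> and
  \<open>Z = \<Sum>\<^sub>j \<lambda>\<^sub>j(B\<^sub>j)\<close> on one and the same tree-free product.

  The operators \<open>\<lambda>\<^sub>j(Q\<^sub>jX\<^sub>jQ\<^sub>j)\<close> are mutually orthogonal, so the norm of their sum \<open>Y - Z\<close> is at most the
  largest of theirs. For \<open>L = \<Sum>\<^sub>j \<lambda>\<^sub>j(Q\<^sub>jX\<^sub>jP\<^sub>j)\<close>, the operator \<open>L\<^sup>*L\<close> is \<open>\<eta>(1)\<close> times the number of children of
  \<open>s\<close> on the summand at \<open>s\<close>, and a vertex of \<open>T\<close> to the power \<open>n\<^sup>k\<close> has at most \<open>(N - 1)n\<^sup>k/(n - 1)\<close>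
  children; this bounds \<open>Z = L + L\<^sup>*\<close>. Finally, \<open>Z\<close> has the law of the iterated convolution because
  block sums of a family that is free for a composed tree are free for the outer tree, and tree
  freeness determines the law of the sum.\<close>

text \<open>One principle yields all operator bounds: a symmetric operator whose orbits grow at most
  like \<open>K R^m\<close>, with \<open>K\<close> depending on the vector, is bounded by
  \<open>R\<close>. Crude estimates therefore suffice. Exponential boundedness bounds multiplication
  by \<open>X\<close> by \<open>rad\<close>, with the constant \<open>M\<close> gone; the triangle
  inequality bounds the embeddings on finite sums of tensors; an orthogonal sum of \<open>N\<close>
  operators loses only a factor that disappears. The constant \<open>(N - 1)/(n - 1)\<close> is a
  geometric sum. At each of \<open>k\<close> levels a nonempty string of the composed tree is
  continued inside its current block or by opening one of at most \<open>N - 1\<close> other blocks,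
  which adds up to \<open>(N - 1)(1 + n + ... + n^(k-1))\<close> children at most. The order
  \<open>n^k\<close> of this number cancels against the square of the dilation. The spaces of the
  iterated convolution are built on \<open>L2\<close> of the previous law and differ from the space
  that carries \<open>Z\<close>. Equality of laws is therefore shown by running the same words in
  two families, and the spaces themselves are never identified.\<close>

section \<open>Scalars, involution and norm in a unital C*-algebra\<close>

lemma scaleC_zero_left: "scaleC 0 x = (0::'b::unital_cstar_algebra)"
  using scaleC_add_left[of 0 0 x] by simp

lemma scaleC_zero_right: "scaleC c 0 = (0::'b::unital_cstar_algebra)"
  using scaleC_add_right[of c 0 0] by simp

lemma scaleC_minus_right: "scaleC c (- x) = - scaleC c (x::'b::unital_cstar_algebra)"
  using scaleC_add_right[of c x "- x"] by (simp add: scaleC_zero_right eq_neg_iff_add_eq_0 add.commute)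

lemma scaleC_diff_right: "scaleC c (x - y) = scaleC c x - scaleC c (y::'b::unital_cstar_algebra)"
  using scaleC_add_right[of c x "- y"] by (simp add: scaleC_minus_right)

lemma scaleC_one: "scaleC 1 x = (x::'b::unital_cstar_algebra)"
  using scaleC_of_real[of 1 x] by simp

lemma scaleC_minus_left: "scaleC (- c) x = - scaleC c (x::'b::unital_cstar_algebra)"
  using scaleC_add_left[of c "- c" x] by (simp add: scaleC_zero_left eq_neg_iff_add_eq_0 add.commute)

lemma star_minus: "star (- x) = - star (x::'b::unital_cstar_algebra)"
  using star_add[of x "- x"] by (simp add: star_zero eq_neg_iff_add_eq_0 add.commute)

lemma star_diff: "star (x - y) = star x - star (y::'b::unital_cstar_algebra)"
  using star_add[of x "- y"] by (simp add: star_minus)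

lemma star_scaleR: "star (scaleR r x) = scaleR r (star (x::'b::unital_cstar_algebra))"
  using star_scaleC[of "complex_of_real r" x] by (simp add: scaleC_of_real)

lemma star_of_real: "star (of_real r) = (of_real r::'b::unital_cstar_algebra)"
  by (simp add: of_real_def star_scaleR star_one)

lemma star_sum: "star (sum f A) = (\<Sum>i\<in>A. star (f i::'b::unital_cstar_algebra))"
  by (induction A rule: infinite_finite_induct) (simp_all add: star_zero star_add)

lemma star_power: "star (x ^ n) = star (x::'b::unital_cstar_algebra) ^ n"
  by (induction n) (simp_all add: star_one star_mult power_commutes)

text \<open>The C*-identity and submultiplicativity bound the square of \<open>norm x\<close> by
  \<open>norm (star x) * norm x\<close>; the reverse inequality is the same one for
  \<open>star x\<close>.\<close>

lemma norm_star [simp]: "norm (star x) = norm (x::'b::unital_cstar_algebra)"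
proof -
  have le: "norm x \<le> norm (star x)" for x :: 'b
  proof (cases "x = 0")
    case False
    have "(norm x)\<^sup>2 \<le> norm (star x) * norm x"
      using norm_mult_ineq[of "star x" x] by (simp add: cstar_identity)
    then show ?thesis using False by (simp add: power2_eq_square)
  qed simp
  show ?thesis using le[of x] le[of "star x"] by (simp add: star_star)
qed

lemma norm_mult_star: "norm (x * star x) = (norm (x::'b::unital_cstar_algebra))\<^sup>2"
  using cstar_identity[of "star x"] by (simp add: star_star)

lemma star_mult_eq_0: "star x * x = 0 \<Longrightarrow> x = (0::'b::unital_cstar_algebra)"
  using cstar_identity[of x] by simp

lemma bounded_linear_star: "bounded_linear (star :: 'b::unital_cstar_algebra \<Rightarrow> 'b)"
  by (rule bounded_linear_intro[of _ 1]) (simp_all add: star_add star_scaleR)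

lemmas tendsto_star = bounded_linear.tendsto[OF bounded_linear_star]

subsection \<open>The binomial series for the square root\<close>

text \<open>Taylor coefficients of the square root of \<open>1 - z\<close>. All but the zeroth are
  nonpositive, and this is what gives absolute convergence up to the boundary of the unit
  disc.\<close>

definition sqrt_coeff :: "nat \<Rightarrow> real" where
  "sqrt_coeff m = (- 1) ^ m * ((1/2) gchoose m)"

lemma sqrt_coeff_0 [simp]: "sqrt_coeff 0 = 1"
  by (simp add: sqrt_coeff_def)

lemma sqrt_coeff_Suc: "sqrt_coeff (Suc m) = sqrt_coeff m * ((of_nat m - 1/2) / of_nat (Suc m))"
proof -
  have "((1/2::real) gchoose Suc m) = ((1/2) gchoose m) * (1/2 - of_nat m) / of_nat (Suc m)"
    by (simp add: gbinomial_prod_rev atLeast0LessThan field_simps)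
  moreover have "(- 1) ^ Suc m * (g * d / e) = (- 1) ^ m * g * (- d / e)" for g d e :: real
    by simp
  ultimately have "sqrt_coeff (Suc m) = sqrt_coeff m * (- (1/2 - of_nat m) / of_nat (Suc m))"
    unfolding sqrt_coeff_def by (simp only:)
  then show ?thesis by (simp only: minus_diff_eq)
qed

lemma sqrt_coeff_nonpos: "m > 0 \<Longrightarrow> sqrt_coeff m \<le> 0"
proof (induction m)
  case (Suc m)
  show ?case
  proof (cases "m = 0")
    case True
    then show ?thesis by (simp add: sqrt_coeff_Suc)
  next
    case False
    then have "sqrt_coeff m \<le> 0" "of_nat m - 1/2 \<ge> (0::real)" using Suc by auto
    then show ?thesis unfolding sqrt_coeff_Suc
      by (intro mult_nonpos_nonneg divide_nonneg_nonneg) auto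
  qed
qed simp

text \<open>The partial sums have a closed form, a negative multiple of the next coefficient, whose
  sign is known. Together with the signs of the terms this bounds the sum of their absolute
  values.\<close>

lemma sqrt_coeff_partial_sum: "(\<Sum>m\<le>n. sqrt_coeff m) \<ge> 0"
proof -
  have eq: "(\<Sum>m\<le>n. sqrt_coeff m) = - 2 * of_nat (Suc n) * sqrt_coeff (Suc n)"
  proof (induction n)
    case (Suc n)
    have "of_nat (Suc (Suc n)) * sqrt_coeff (Suc (Suc n)) = sqrt_coeff (Suc n) * (of_nat (Suc n) - 1/2)"
      by (subst sqrt_coeff_Suc) simp
    with Suc show ?case by (simp add: algebra_simps)
  qed (simp add: sqrt_coeff_Suc)
  have "sqrt_coeff (Suc n) \<le> 0" by (rule sqrt_coeff_nonpos) simp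
  then show ?thesis unfolding eq
    by (metis mult_nonpos_nonpos mult_minus_left neg_le_0_iff_le mult_nonneg_nonneg of_nat_0_le_iff zero_le_numeral)
qed

lemma sqrt_coeff_abs_sum: "(\<Sum>m<n. \<bar>sqrt_coeff (Suc m)\<bar>) \<le> 1"
proof -
  have "(\<Sum>m<n. \<bar>sqrt_coeff (Suc m)\<bar>) = - (\<Sum>m<n. sqrt_coeff (Suc m))"
    by (simp add: sum_negf[symmetric] sqrt_coeff_nonpos abs_of_nonpos)
  also have "\<dots> = 1 - (\<Sum>m\<le>n. sqrt_coeff m)"
    by (simp add: sum.atMost_shift)
  finally show ?thesis using sqrt_coeff_partial_sum[of n] by simp
qed

lemma summable_sqrt_coeff: "summable (\<lambda>m. \<bar>sqrt_coeff m\<bar>)"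
proof -
  have "summable (\<lambda>m. \<bar>sqrt_coeff (Suc m)\<bar>)"
    by (rule summableI_nonneg_bounded[of _ 1]) (simp_all add: sqrt_coeff_abs_sum)
  then show ?thesis by (rule summable_Suc_iff[THEN iffD1])
qed

lemma sqrt_coeff_suminf: "suminf (\<lambda>m. \<bar>sqrt_coeff (Suc m)\<bar>) \<le> 1"
  using summable_sqrt_coeff by (intro suminf_le_const) (auto simp: sqrt_coeff_abs_sum summable_Suc_iff[of "\<lambda>m. \<bar>sqrt_coeff m\<bar>"])

text \<open>Vandermonde's identity with \<open>1/2 + 1/2 = 1\<close>; the right-hand side lists the
  coefficients of \<open>1 - z\<close>.\<close>

lemma sqrt_coeff_convolution:
  "(\<Sum>i\<le>m. sqrt_coeff i * sqrt_coeff (m - i)) = (if m = 0 then 1 else if m = 1 then - 1 else 0)"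
proof -
  have "(\<Sum>i\<le>m. sqrt_coeff i * sqrt_coeff (m - i))
      = (- 1) ^ m * (\<Sum>i\<le>m. ((1/2::real) gchoose i) * ((1/2) gchoose (m - i)))"
    unfolding sum_distrib_left
    by (rule sum.cong) (simp_all add: sqrt_coeff_def power_add[symmetric])
  also have "\<dots> = (- 1) ^ m * ((1::real) gchoose m)"
    using gbinomial_Vandermonde[of "1/2::real" "1/2" m] by (simp add: atMost_atLeast0)
  also have "\<dots> = (if m = 0 then 1 else if m = 1 then - 1 else 0)"
  proof -
    have "real (1 choose m) = (if m \<le> 1 then 1 else 0)"
      by (cases "m = 0 \<or> m = 1") (auto simp: binomial_eq_0)
    then show ?thesis using binomial_gbinomial[of 1 m, where ?'a = real] by (auto split: if_splits)
  qed
  finally show ?thesis .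
qed

text \<open>The square root of \<open>1 - k\<close>, not of \<open>k\<close>, for \<open>k\<close>
  in the closed unit ball.\<close>

definition sqrt_ser :: "'b::unital_cstar_algebra \<Rightarrow> 'b" where
  "sqrt_ser k = suminf (\<lambda>m. scaleR (sqrt_coeff m) (k ^ m))"

lemma sqrt_ser_summable_norm:
  fixes k :: "'b::unital_cstar_algebra"
  assumes "norm k \<le> 1"
  shows "summable (\<lambda>m. norm (scaleR (sqrt_coeff m) (k ^ m)))"
proof (rule summable_comparison_test'[OF summable_sqrt_coeff])
  fix m
  have "norm (k ^ m) \<le> 1" using norm_power_ineq[of k m] power_le_one[OF norm_ge_zero assms] 
    by (meson order_trans)
  then show "norm (norm (scaleR (sqrt_coeff m) (k ^ m))) \<le> \<bar>sqrt_coeff m\<bar>"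
    by (simp add: mult_left_le)
qed

lemmas sqrt_ser_summable = summable_norm_cancel[OF sqrt_ser_summable_norm]

lemma sqrt_ser_square:
  fixes k :: "'b::unital_cstar_algebra"
  assumes "norm k \<le> 1"
  shows "sqrt_ser k * sqrt_ser k = 1 - k"
proof -
  let ?f = "\<lambda>m. scaleR (sqrt_coeff m) (k ^ m)"
  have "sqrt_ser k * sqrt_ser k = suminf (\<lambda>m. \<Sum>i\<le>m. ?f i * ?f (m - i))"
    unfolding sqrt_ser_def using sqrt_ser_summable_norm[OF assms] by (intro Cauchy_product) auto
  also have "(\<lambda>m. \<Sum>i\<le>m. ?f i * ?f (m - i))
      = (\<lambda>m. scaleR (if m = 0 then 1 else if m = 1 then - 1 else 0) (k ^ m))"
  proof
    fix m
    have "(\<Sum>i\<le>m. ?f i * ?f (m - i)) = (\<Sum>i\<le>m. scaleR (sqrt_coeff i * sqrt_coeff (m - i)) (k ^ m))"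
      by (rule sum.cong) (simp_all add: power_add[symmetric])
    then show "(\<Sum>i\<le>m. ?f i * ?f (m - i))
        = scaleR (if m = 0 then 1 else if m = 1 then - 1 else 0) (k ^ m)"
      by (simp add: scaleR_left.sum[symmetric] sqrt_coeff_convolution)
  qed
  also have "(suminf (\<lambda>m. scaleR (if m = 0 then 1 else if m = 1 then - 1 else 0) (k ^ m)))
      = (\<Sum>m\<in>{0,1}. scaleR (if m = 0 then 1 else if m = 1 then - 1 else 0) (k ^ m))"
    by (rule suminf_finite) auto
  also have "\<dots> = 1 - k" by simp
  finally show ?thesis .
qed

text \<open>The relation passes to powers and from there to the series. Different \<open>k\<close>
  and \<open>l\<close> occur in \<open>neg_star_mult_pos\<close>, where \<open>y\<close> intertwines
  two positive elements.\<close>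

lemma sqrt_ser_intertwine:
  fixes k l :: "'b::unital_cstar_algebra"
  assumes "norm k \<le> 1" "norm l \<le> 1" "k * y = y * l"
  shows "sqrt_ser k * y = y * sqrt_ser l"
proof -
  have pow: "k ^ m * y = y * l ^ m" for m
  proof (induction m)
    case (Suc m)
    have "k ^ Suc m * y = k * y * l ^ m" using Suc by (simp add: mult.assoc)
    then show ?case by (simp add: assms(3) mult.assoc)
  qed simp
  show ?thesis unfolding sqrt_ser_def
    by (subst suminf_mult2[OF sqrt_ser_summable[OF assms(1)]],
        subst suminf_mult[OF sqrt_ser_summable[OF assms(2)], symmetric]) (simp add: pow)
qed

lemma star_sqrt_ser:
  fixes k :: "'b::unital_cstar_algebra"
  assumes "norm k \<le> 1" "star k = k"
  shows "star (sqrt_ser k) = sqrt_ser k"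
  unfolding sqrt_ser_def
  by (subst bounded_linear.suminf[OF bounded_linear_star sqrt_ser_summable[OF assms(1)]])
    (simp add: star_scaleR star_power assms(2))

text \<open>The constant term cancels and the remaining coefficients have absolute sum at most 1.
  This makes the root positive in the metric sense of \<open>pos\<close>.\<close>

lemma norm_1_minus_sqrt_ser:
  fixes k :: "'b::unital_cstar_algebra"
  assumes "norm k \<le> 1"
  shows "norm (1 - sqrt_ser k) \<le> 1"
proof -
  let ?f = "\<lambda>m. scaleR (sqrt_coeff m) (k ^ m)"
  have S: "summable (\<lambda>m. norm (?f (Suc m)))"
    using sqrt_ser_summable_norm[OF assms] by (subst summable_Suc_iff)
  have "sqrt_ser k = suminf (\<lambda>m. ?f (Suc m)) + ?f 0"
    unfolding sqrt_ser_def using suminf_split_head[OF sqrt_ser_summable[OF assms]] by simp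
  then have "norm (1 - sqrt_ser k) = norm (suminf (\<lambda>m. ?f (Suc m)))" by (simp add: norm_minus_commute)
  also have "\<dots> \<le> suminf (\<lambda>m. norm (?f (Suc m)))" by (rule summable_norm[OF S])
  also have "\<dots> \<le> suminf (\<lambda>m. \<bar>sqrt_coeff (Suc m)\<bar>)"
  proof (rule suminf_le[OF _ S])
    show "summable (\<lambda>m. \<bar>sqrt_coeff (Suc m)\<bar>)" using summable_sqrt_coeff by (subst summable_Suc_iff)
    fix m
    have "norm (k ^ Suc m) \<le> 1"
      using norm_power_ineq[of k "Suc m"] power_le_one[OF norm_ge_zero assms] by (meson order_trans)
    then show "norm (?f (Suc m)) \<le> \<bar>sqrt_coeff (Suc m)\<bar>"
      by (simp add: mult_left_le del: power_Suc)
  qed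
  also have "\<dots> \<le> 1" by (rule sqrt_coeff_suminf)
  finally show ?thesis .
qed

subsection \<open>Positive elements\<close>

text \<open>Positivity is defined metrically; the spectrum does not occur.\<close>

definition pos :: "'b::unital_cstar_algebra \<Rightarrow> bool" where
  "pos h \<longleftrightarrow> star h = h \<and> (\<exists>t\<ge>0. norm (of_real t - h) \<le> t)"

text \<open>With \<open>k = 1 - h / t\<close> this is the root of \<open>t (1 - k) = h\<close>. The
  scale \<open>t\<close> is explicit because two roots are intertwined only when both are computed
  at the same scale.\<close>

definition root_at :: "real \<Rightarrow> 'b::unital_cstar_algebra \<Rightarrow> 'b" where
  "root_at t h = scaleR (sqrt t) (sqrt_ser (1 - scaleR (1/t) h))"

lemma pos_star: "pos h \<Longrightarrow> star h = h"
  by (simp add: pos_def)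

lemma norm_1_minus_scaled:
  fixes h :: "'b::unital_cstar_algebra"
  assumes "t > 0" "norm (of_real t - h) \<le> t"
  shows "norm (1 - scaleR (1/t) h) \<le> 1"
proof -
  have "1 - scaleR (1/t) h = scaleR (1/t) (of_real t - h)"
    using assms(1) by (simp add: scaleR_diff_right of_real_def)
  then have "norm (1 - scaleR (1/t) h) = norm (of_real t - h) / t" using assms(1) by simp
  then show ?thesis using assms by simp
qed

lemma root_at_square:
  assumes "t > 0" "norm (of_real t - h) \<le> t"
  shows "root_at t h * root_at t h = h"
  using assms sqrt_ser_square[OF norm_1_minus_scaled[OF assms]] by (simp add: root_at_def)

lemma root_at_star:
  assumes "t > 0" "norm (of_real t - h) \<le> t" "star h = h"
  shows "star (root_at t h) = root_at t h"
  using assms star_sqrt_ser[OF norm_1_minus_scaled[OF assms(1,2)]]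
  by (simp add: root_at_def star_scaleR star_diff star_one)

lemma root_at_intertwine:
  assumes "t > 0" "norm (of_real t - h) \<le> t" "norm (of_real t - l) \<le> t" "h * y = y * l"
  shows "root_at t h * y = y * root_at t l"
  using sqrt_ser_intertwine[OF norm_1_minus_scaled[OF assms(1,2)] norm_1_minus_scaled[OF assms(1,3)], of y] assms(4)
  by (simp add: root_at_def left_diff_distrib right_diff_distrib)

lemma root_at_pos:
  assumes "t > 0" "norm (of_real t - h) \<le> t" "star h = h"
  shows "pos (root_at t h)"
proof -
  let ?r = "sqrt_ser (1 - scaleR (1/t) h)"
  have "norm (of_real (sqrt t) - root_at t h) = sqrt t * norm (1 - ?r)"
    using assms(1) by (simp add: root_at_def of_real_def norm_scaleR flip: scaleR_diff_right)
  also have "\<dots> \<le> sqrt t"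
    using assms(1) norm_1_minus_sqrt_ser[OF norm_1_minus_scaled[OF assms(1,2)]] by (simp add: mult_left_le)
  finally show ?thesis unfolding pos_def using root_at_star[OF assms] assms(1) by (metis less_imp_le real_sqrt_ge_zero)
qed

text \<open>The definition of \<open>pos\<close> admits \<open>t = 0\<close>; raising
  \<open>t\<close> by 1 allows division by it.\<close>

lemma pos_obtain:
  fixes h :: "'b::unital_cstar_algebra"
  assumes "pos h"
  obtains t where "t > 0" "norm (of_real t - h) \<le> t"
proof -
  obtain t where t: "t \<ge> 0" "norm (of_real t - h) \<le> t" using assms by (auto simp: pos_def)
  have "norm (of_real (t + 1) - h) \<le> norm (of_real t - h) + norm (1::'b)"
    by (metis add.commute add_diff_eq norm_triangle_ineq of_real_1 of_real_add)
  then show ?thesis using t that[of "t + 1"] by simp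
qed

text \<open>The last conclusion stands in for functional calculus: the root is a power series in an
  affine function of \<open>h\<close>, so it commutes with whatever commutes with
  \<open>h\<close>.\<close>

lemma pos_root:
  fixes h :: "'b::unital_cstar_algebra"
  assumes "pos h"
  obtains s where "star s = s" "s * s = h" "pos s" "\<And>y. h * y = y * h \<Longrightarrow> s * y = y * s"
proof -
  obtain t where t: "t > 0" "norm (of_real t - h) \<le> t" using pos_obtain[OF assms] .
  show ?thesis
  proof (rule that)
    show "star (root_at t h) = root_at t h" "root_at t h * root_at t h = h" "pos (root_at t h)"
      using t root_at_star root_at_square root_at_pos pos_star[OF assms] by blast+
    show "root_at t h * y = y * root_at t h" if "h * y = y * h" for y
      using root_at_intertwine[OF t(1) t(2) t(2) that] .
  qed
qed

lemma scaleC_ii_ii: "scaleC \<i> (scaleC \<i> x) = - (x::'b::unital_cstar_algebra)"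
  using scaleC_minus_left[of 1 x] by (simp add: scaleC_scaleC scaleC_one)

lemma star_scaleC_ii: "star (scaleC \<i> x) = - scaleC \<i> (star (x::'b::unital_cstar_algebra))"
  by (simp add: star_scaleC scaleC_minus_left)

lemma star_mult_complex:
  fixes z w :: "'b::unital_cstar_algebra"
  assumes "star z = z" "star w = w" "z * w = w * z"
  shows "star (z + scaleC \<i> w) * (z + scaleC \<i> w) = z * z + w * w"
  using assms
  by (simp add: star_add star_scaleC_ii algebra_simps mult_scaleC_left mult_scaleC_right scaleC_ii_ii scaleC_minus_right
      scaleC_diff_right)

lemma norm_le_complex:
  fixes z w :: "'b::unital_cstar_algebra"
  assumes "star z = z" "star w = w"
  shows "norm z \<le> norm (z + scaleC \<i> w)" "norm w \<le> norm (z + scaleC \<i> w)"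
proof -
  let ?x = "z + scaleC \<i> w"
  have "scaleR 2 z = ?x + star ?x" "scaleC \<i> (scaleR 2 w) = ?x - star ?x"
    using assms by (simp_all add: star_add star_scaleC_ii scaleR_2 scaleC_add_right)
  then have "2 * norm z = norm (?x + star ?x)" "2 * norm w = norm (?x - star ?x)"
    by (metis norm_scaleR abs_numeral, metis norm_scaleR abs_numeral norm_scaleC norm_ii mult_1)
  then show "norm z \<le> norm ?x" "norm w \<le> norm ?x"
    using norm_triangle_ineq[of ?x "star ?x"] norm_triangle_ineq4[of ?x "star ?x"] by simp_all
qed

lemma norm_sa_square: "star h = h \<Longrightarrow> norm (h * h) = (norm (h::'b::unital_cstar_algebra))\<^sup>2"
  using cstar_identity[of h] by simp

text \<open>With \<open>r = (1 - s\<^sup>2)\<^bsup>1/2\<^esup>\<close>, the element \<open>s + i r\<close> is unitary, so \<open>\<parallel>r\<parallel> \<le> 1\<close>.\<close>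

lemma norm_1_minus_square:
  fixes s :: "'b::unital_cstar_algebra"
  assumes "star s = s" "norm s \<le> 1"
  shows "norm (1 - s * s) \<le> 1"
proof -
  have k: "norm (s * s) \<le> 1" "star (s * s) = s * s"
    using assms by (simp_all add: norm_sa_square star_mult power_le_one)
  define r where "r = sqrt_ser (s * s)"
  have r: "star r = r" "r * r = 1 - s * s" "s * r = r * s"
    using star_sqrt_ser[OF k] sqrt_ser_square[OF k(1)] sqrt_ser_intertwine[OF k(1) k(1), of s]
    by (simp_all add: r_def mult.assoc)
  have "(norm (s + scaleC \<i> r))\<^sup>2 = norm (s * s + r * r)"
    unfolding cstar_identity[symmetric] using star_mult_complex[of s r] assms r by simp
  also have "\<dots> = 1" by (simp add: r(2))
  finally have "(norm (s + scaleC \<i> r))\<^sup>2 \<le> 1\<^sup>2" by simp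
  then have "norm (s + scaleC \<i> r) \<le> 1" by (rule power2_le_imp_le) simp
  then have "norm r \<le> 1" using norm_le_complex(2)[OF assms(1) r(1)] by (rule order_trans[rotated])
  then have "(norm r)\<^sup>2 \<le> 1" by (simp add: power_le_one)
  then show ?thesis by (simp only: r(2)[symmetric] norm_sa_square[OF r(1)])
qed

text \<open>Rescaling by the square root of \<open>t\<close> reduces this to the unit ball, where
  \<open>norm_1_minus_square\<close> applies.\<close>

lemma norm_diff_square:
  fixes s :: "'b::unital_cstar_algebra"
  assumes "star s = s" "(norm s)\<^sup>2 \<le> t"
  shows "norm (of_real t - s * s) \<le> t"
proof (cases "t = 0")
  case True
  then show ?thesis using assms by simp
next
  case False
  then have t: "t > 0" using assms(2) by (metis le_less_trans zero_le_power2 antisym_conv2 order_trans)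
  let ?s = "scaleR (1 / sqrt t) s"
  have "(norm s / sqrt t)\<^sup>2 \<le> 1\<^sup>2" using assms t by (simp add: power_divide)
  then have "norm s / sqrt t \<le> 1" by (rule power2_le_imp_le) simp
  then have "norm (1 - ?s * ?s) \<le> 1"
    using assms t by (intro norm_1_minus_square) (simp_all add: star_scaleR)
  moreover have "of_real t - s * s = scaleR t (1 - ?s * ?s)"
    using t by (simp add: scaleR_diff_right of_real_def)
  ultimately show ?thesis using t by (simp add: mult_left_le)
qed

lemma pos_sa_square: "star s = s \<Longrightarrow> pos (s * s)"
  unfolding pos_def using norm_diff_square[of s "(norm s)\<^sup>2"]
  by (intro conjI exI[of _ "(norm s)\<^sup>2"]) (simp_all add: star_mult del: of_real_power)

text \<open>As the square of its root, \<open>h\<close> falls under \<open>norm_diff_square\<close>.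
  One \<open>t\<close> thus serves a whole bounded family of positive elements, which makes
  positivity stable under limits.\<close>

lemma pos_norm_diff:
  fixes h :: "'b::unital_cstar_algebra"
  assumes "pos h" "norm h \<le> t"
  shows "norm (of_real t - h) \<le> t"
proof -
  obtain s where s: "star s = s" "s * s = h" using pos_root[OF assms(1)] by metis
  then show ?thesis using norm_diff_square[of s t] norm_sa_square[of s] assms(2) by simp
qed

lemma posI: "star h = h \<Longrightarrow> norm (of_real t - h) \<le> t \<Longrightarrow> pos h"
  unfolding pos_def using norm_ge_zero order_trans by blast

text \<open>For the metric definition this is the triangle inequality at
  \<open>s + t\<close>.\<close>

lemma pos_add:
  fixes h k :: "'b::unital_cstar_algebra"
  assumes "pos h" "pos k"
  shows "pos (h + k)"
proof -
  obtain s t where st: "norm (of_real s - h) \<le> s" "norm (of_real t - k) \<le> t"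
    using assms by (auto simp: pos_def)
  have "norm (of_real (s + t) - (h + k)) = norm ((of_real s - h) + (of_real t - k))"
    by (simp add: algebra_simps)
  also have "\<dots> \<le> s + t" using norm_triangle_ineq[of "of_real s - h" "of_real t - k"] st by linarith
  finally show ?thesis by (rule posI[rotated]) (use assms in \<open>simp add: pos_def star_add\<close>)
qed

lemma pos_zero [simp]: "pos 0"
  using pos_sa_square[of 0] by (simp add: star_zero)

lemma pos_sum: "(\<And>i. i \<in> A \<Longrightarrow> pos (f i)) \<Longrightarrow> pos (sum f A)"
  by (induction A rule: infinite_finite_induct) (simp_all add: pos_add)

lemma pos_scaleR:
  fixes h :: "'b::unital_cstar_algebra"
  assumes "pos h" "r \<ge> 0"
  shows "pos (scaleR r h)"
proof -
  obtain s where s: "star s = s" "s * s = h" using pos_root[OF assms(1)] by metis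
  have "pos (scaleR (sqrt r) s * scaleR (sqrt r) s)" using s by (intro pos_sa_square) (simp add: star_scaleR)
  then show ?thesis using s assms by simp
qed

lemma pos_norm_minus: "star h = h \<Longrightarrow> norm h \<le> t \<Longrightarrow> pos (of_real t - h)"
  by (rule posI[of _ t]) (simp_all add: star_diff star_of_real)

lemma pos_tendsto:
  fixes f :: "nat \<Rightarrow> 'b::unital_cstar_algebra"
  assumes "\<And>n. pos (f n)" "f \<longlonglongrightarrow> h"
  shows "pos h"
proof -
  have "Bseq f" using assms(2) by (meson convergentI convergent_imp_Bseq)
  then obtain t where t: "\<And>n. norm (f n) \<le> t" by (auto simp: Bseq_def)
  have "norm (of_real t - f n) \<le> t" for n by (rule pos_norm_diff[OF assms(1) t])
  then have n: "norm (of_real t - h) \<le> t"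
    by (intro LIMSEQ_le_const2[OF tendsto_norm[OF tendsto_diff[OF tendsto_const assms(2)]]]) auto
  have "(\<lambda>n. star (f n)) \<longlonglongrightarrow> star h" by (rule tendsto_star[OF assms(2)])
  then have "f \<longlonglongrightarrow> star h" using assms(1) by (simp add: pos_def)
  then show ?thesis using posI n assms(2) LIMSEQ_unique by blast
qed

text \<open>The roots \<open>g\<close> of \<open>h\<close> and \<open>f\<close> of
  \<open>- h\<close> commute, so the squared modulus of \<open>f + i g\<close> is
  \<open>f^2 + g^2 = 0\<close>.\<close>

lemma pos_neg_zero:
  fixes h :: "'b::unital_cstar_algebra"
  assumes "pos h" "pos (- h)"
  shows "h = 0"
proof -
  obtain g where g: "star g = g" "g * g = h" "\<And>y. h * y = y * h \<Longrightarrow> g * y = y * g"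
    using pos_root[OF assms(1)] by metis
  obtain f where f: "star f = f" "f * f = - h" "\<And>y. - h * y = y * - h \<Longrightarrow> f * y = y * f"
    using pos_root[OF assms(2)] by metis
  have "f * g = g * f" by (rule f(3)) (metis g(2) mult.assoc mult_minus_left mult_minus_right)
  then have "star (f + scaleC \<i> g) * (f + scaleC \<i> g) = 0"
    using star_mult_complex[OF f(1) g(1)] f(2) g(2) by simp
  then have "f + scaleC \<i> g = 0" by (rule star_mult_eq_0)
  then have "norm g \<le> 0" using norm_le_complex(2)[OF f(1) g(1)] by simp
  then show ?thesis using g(2) by simp
qed

text \<open>With \<open>d = w - k\<close>, the elements \<open>d w d\<close> and
  \<open>d k d\<close> are positive and add up to \<open>(w^2 - k^2) d = 0\<close>, so both vanish.
  Their difference is \<open>d^3\<close>, and a self-adjoint element with vanishing cube is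
  0.\<close>

lemma pos_root_unique:
  fixes k w :: "'b::unital_cstar_algebra"
  assumes "pos k" "pos w" "k * k = w * w" "k * w = w * k"
  shows "k = w"
proof -
  define d where "d = w - k"
  have d: "star d = d" "d * w = w * d" "d * k = k * d"
    using assms by (simp_all add: d_def star_diff pos_star algebra_simps)
  have *: "pos (d * v * d)" if v: "pos v" "d * v = v * d" for v
  proof -
    obtain s where s: "star s = s" "s * s = v" "\<And>y. v * y = y * v \<Longrightarrow> s * y = y * s"
      using pos_root[OF v(1)] by metis
    have sd: "s * d = d * s" by (rule s(3)) (rule v(2)[symmetric])
    have "star (s * d) = s * d" by (simp add: star_mult s(1) d(1) sd)
    then have "pos ((s * d) * (s * d))" by (rule pos_sa_square)
    also have "(s * d) * (s * d) = d * (s * s) * d" by (metis sd mult.assoc)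
    finally show ?thesis by (simp only: s(2))
  qed
  have "d * (w + k) * d = (w * w - k * k) * d"
    using assms(4) by (simp add: d_def algebra_simps)
  then have sum0: "d * w * d + d * k * d = 0" using assms(3) by (simp add: algebra_simps)
  then have "d * w * d = 0" "d * k * d = 0"
  proof -
    have eq: "d * w * d = - (d * k * d)" using sum0 by (simp add: eq_neg_iff_add_eq_0)
    then show "d * k * d = 0" using *[OF assms(2) d(2)] *[OF assms(1) d(3)] by (intro pos_neg_zero) simp_all
    then show "d * w * d = 0" using eq by simp
  qed
  moreover have "d * (w - k) * d = d * w * d - d * k * d" by (simp add: algebra_simps)
  ultimately have "d * d * d = 0" by (simp flip: d_def)
  then have "(d * d) * (d * d) = 0" by (metis mult.assoc mult_zero_left)
  then have "d * d = 0" using norm_sa_square[of "d * d"] d(1) by (simp add: star_mult)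
  then have "d = 0" using norm_sa_square[OF d(1)] by simp
  then show ?thesis by (simp add: d_def)
qed

text \<open>Positivity of \<open>x\<^sup>*x\<close>. First, \<open>-y\<^sup>*y \<ge> 0\<close> forces \<open>y = 0\<close>: then \<open>k = yy\<^sup>*\<close> and \<open>m = -y\<^sup>*y\<close> are both positive
  and \<open>ky = -ym\<close>, while \<open>k\<^sup>2y = ym\<^sup>2\<close> gives \<open>ky = ym\<close> on taking roots.\<close>

lemma neg_star_mult_pos:
  fixes y :: "'b::unital_cstar_algebra"
  assumes "pos (- (star y * y))"
  shows "y = 0"
proof -
  define m where "m = - (star y * y)"
  define k where "k = y * star y"
  define a where "a = scaleR (1/2) (y + star y)"
  define b where "b = scaleC (- \<i>) (scaleR (1/2) (y - star y))"
  have sa: "star a = a" "star b = b"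
    by (simp_all add: a_def b_def star_scaleR star_add star_star add.commute star_scaleC star_diff
        scaleC_minus_left scaleR_diff_right scaleC_diff_right)
  have "scaleC \<i> b = scaleR (1/2) (y - star y)"
    by (simp add: b_def scaleC_scaleC scaleC_one)
  then have y: "y = a + scaleC \<i> b"
    by (simp add: a_def scaleR_add_right scaleR_diff_right flip: scaleR_left.add)
  have "star y = a - scaleC \<i> b" using sa by (simp add: y star_add star_scaleC_ii)
  \<comment> \<open>The identity \<open>y * star y + star y * y = 2 (a^2 + b^2)\<close> exhibits
    \<open>k\<close> as \<open>m\<close> plus squares, hence as positive.\<close>
  then have "k - m = (a + scaleC \<i> b) * (a - scaleC \<i> b) + (a - scaleC \<i> b) * (a + scaleC \<i> b)"
    by (simp add: k_def m_def flip: y)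
  also have "\<dots> = scaleR 2 (a * a + b * b)"
    by (simp add: algebra_simps mult_scaleC_left mult_scaleC_right scaleC_ii_ii scaleC_add_right
        scaleC_diff_right scaleR_2)
  finally have "k - m = scaleR 2 (a * a + b * b)" .
  then have "k = m + scaleR 2 (a * a + b * b)" by (metis add.commute diff_add_cancel)
  moreover have pm: "pos m" using assms by (simp add: m_def)
  ultimately have pk: "pos k"
    using sa by (metis pos_add pos_scaleR pos_sa_square zero_le_numeral)
  have ky: "k * y = - (y * m)" by (simp add: k_def m_def mult.assoc)
  have "(k * k) * y = - (k * y * m)" by (metis ky mult.assoc mult_minus_right)
  also have "k * y * m = - (y * m) * m" by (simp only: ky)
  finally have "(k * k) * y = - (- (y * m) * m)" .
  then have kky: "(k * k) * y = y * (m * m)" by (simp add: mult.assoc)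
  define t where "t = norm (k * k) + norm (m * m) + 1"
  have t: "t > 0" by (simp add: t_def add_nonneg_pos)
  have pkk: "pos (k * k)" "pos (m * m)" using pk pm by (simp_all add: pos_sa_square pos_star)
  have tk: "norm (of_real t - k * k) \<le> t" "norm (of_real t - m * m) \<le> t"
    by (rule pos_norm_diff[OF pkk(1)], simp add: t_def, rule pos_norm_diff[OF pkk(2)], simp add: t_def)
  \<comment> \<open>At the common scale \<open>t\<close> the series reproduces \<open>k\<close> and
    \<open>m\<close> as the roots of their squares, by uniqueness among commuting positive
    roots.\<close>
  have root: "root_at t (u * u) = u" if "pos u" "norm (of_real t - u * u) \<le> t" for u :: 'b
  proof (rule pos_root_unique)
    show "pos (root_at t (u * u))" using that t pos_star[OF that(1)] by (intro root_at_pos) (auto simp: star_mult)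
    show "root_at t (u * u) * root_at t (u * u) = u * u" using that t by (intro root_at_square)
    show "root_at t (u * u) * u = u * root_at t (u * u)"
      using that t by (intro root_at_intertwine) (auto simp: mult.assoc)
  qed (rule that(1))
  have "k * y = y * m"
    using root_at_intertwine[OF t tk kky] root[OF pk tk(1)] root[OF pm tk(2)] by simp
  then have "scaleR 2 (k * y) = 0" by (metis scaleR_2 add.right_inverse ky)
  then have "k * k = 0" by (metis k_def mult.assoc mult_zero_left scaleR_eq_0_iff zero_neq_numeral)
  then have "k = 0" using norm_sa_square[OF pos_star[OF pk]] by simp
  then show ?thesis unfolding k_def using norm_mult_star[of y] by simp
qed

text \<open>Let \<open>p\<close> be the modulus of the self-adjoint \<open>h = star x * x\<close>
  and \<open>w = p - h\<close>, which is twice its negative part. Since \<open>h w = - p w\<close>,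
  the element \<open>star (x * w) * (x * w)\<close> equals \<open>- w p w\<close> and is negative.
  So \<open>x * w = 0\<close> by \<open>neg_star_mult_pos\<close>, then \<open>w * w = 0\<close>,
  and \<open>h = p\<close> is positive.\<close>

lemma pos_star_mult:
  fixes x :: "'b::unital_cstar_algebra"
  shows "pos (star x * x)"
proof -
  define h where "h = star x * x"
  have sh: "star h = h" by (simp add: h_def star_mult star_star)
  obtain p where p: "star p = p" "p * p = h * h" "pos p" "\<And>y. h * h * y = y * (h * h) \<Longrightarrow> p * y = y * p"
    using pos_root[OF pos_sa_square[OF sh]] by metis
  have ph: "p * h = h * p" using p(4)[of h] by (simp add: mult.assoc)
  obtain q where q: "star q = q" "q * q = p" "\<And>y. p * y = y * p \<Longrightarrow> q * y = y * q"
    using pos_root[OF p(3)] by metis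
  define w where "w = p - h"
  have w: "star w = w" "p * w = w * p" "h * w = - (p * w)"
    using p(1,2) sh ph by (simp_all add: w_def star_diff algebra_simps)
  have qw: "q * w = w * q" by (rule q(3)) (rule w(2))
  have "star (x * w) * (x * w) = w * (h * w)"
    using w(1) by (simp add: star_mult h_def mult.assoc)
  also have "\<dots> = - ((q * w) * (q * w))"
  proof -
    have "w * (h * w) = - (w * p * w)" by (simp only: w(3)) (simp add: mult.assoc)
    also have "w * p * w = (q * w) * (q * w)" by (metis q(2) qw mult.assoc)
    finally show ?thesis .
  qed
  finally have eq: "star (x * w) * (x * w) = - ((q * w) * (q * w))" .
  have sqw: "star (q * w) = q * w" using q(1) w(1) qw by (simp add: star_mult)
  have "x * w = 0"
    by (rule neg_star_mult_pos) (simp add: eq pos_sa_square[OF sqw])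
  then have hw: "h * w = 0" by (simp add: h_def mult.assoc)
  then have "w * w = 0" using w(3) by (simp add: w_def left_diff_distrib[of p h])
  then have "w = 0" using norm_sa_square[OF w(1)] by simp
  then show ?thesis using p(3) by (simp add: w_def h_def)
qed

lemma pos_conj:
  fixes h :: "'b::unital_cstar_algebra"
  assumes "pos h"
  shows "pos (star a * h * a)"
proof -
  obtain s where s: "star s = s" "s * s = h" using pos_root[OF assms(1)] by metis
  have "star a * h * a = star (s * a) * (s * a)" using s by (simp add: star_mult mult.assoc flip: s(2))
  then show ?thesis by (simp add: pos_star_mult)
qed

text \<open>The roots \<open>w\<close> of \<open>x\<close> and \<open>z\<close> of
  \<open>t - x\<close> commute, so \<open>z + i w\<close> has squared norm \<open>t\<close>; its
  imaginary part \<open>w\<close> has no larger norm.\<close>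

lemma norm_le_if_pos_diff:
  fixes x :: "'b::unital_cstar_algebra"
  assumes "pos x" "pos (of_real t - x)" "t \<ge> 0"
  shows "norm x \<le> t"
proof -
  obtain w where w: "star w = w" "w * w = x" "\<And>y. x * y = y * x \<Longrightarrow> w * y = y * w"
    using pos_root[OF assms(1)] by metis
  obtain z where z: "star z = z" "z * z = of_real t - x"
      "\<And>y. (of_real t - x) * y = y * (of_real t - x) \<Longrightarrow> z * y = y * z"
    using pos_root[OF assms(2)] by metis
  have "x * w = w * x" using w(2) by (metis mult.assoc)
  then have "z * w = w * z" by (intro z(3)) (simp add: left_diff_distrib right_diff_distrib of_real_def)
  then have "star (z + scaleC \<i> w) * (z + scaleC \<i> w) = of_real t"
    using star_mult_complex[OF z(1) w(1)] z(2) w(2) by simp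
  then have "(norm (z + scaleC \<i> w))\<^sup>2 = t"
    using cstar_identity[of "z + scaleC \<i> w"] assms(3) by simp
  moreover have "(norm w)\<^sup>2 \<le> (norm (z + scaleC \<i> w))\<^sup>2"
    using norm_le_complex(2)[OF z(1) w(1)] by (simp add: power_mono)
  ultimately show ?thesis using norm_sa_square[OF w(1)] w(2) by simp
qed

lemma norm_mono_pos:
  fixes x y :: "'b::unital_cstar_algebra"
  assumes "pos x" "pos (y - x)"
  shows "norm x \<le> norm y"
proof (rule norm_le_if_pos_diff[OF assms(1)])
  have "pos y" using pos_add[OF assms] by simp
  then have "pos (of_real (norm y) - y)" by (intro pos_norm_minus) (simp_all add: pos_star)
  from pos_add[OF this assms(2)] show "pos (of_real (norm y) - x)" by simp
qed simp

text \<open>A polarisation step; \<open>law_star\<close> uses it to get hermitian symmetry of a law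
  from its positivity alone.\<close>

lemma sa_imp_star_eq:
  fixes x y :: "'b::unital_cstar_algebra"
  assumes "star (x + y) = x + y" "star (scaleC \<i> (x - y)) = scaleC \<i> (x - y)"
  shows "star x = y"
proof -
  have "scaleC \<i> (star x - star y) = scaleC \<i> (y - x)"
    using assms(2) by (simp add: star_scaleC_ii star_diff scaleC_diff_right algebra_simps)
  then have "scaleC (- \<i>) (scaleC \<i> (star x - star y)) = scaleC (- \<i>) (scaleC \<i> (y - x))" by simp
  then have "star x - star y = y - x" by (simp add: scaleC_scaleC scaleC_one)
  moreover have "star x + star y = x + y" using assms(1) by (simp add: star_add)
  ultimately have "(star x - star y) + (star x + star y) = (y - x) + (x + y)" by simp
  then have "scaleR 2 (star x) = scaleR 2 y" by (simp add: scaleR_2)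
  then show ?thesis by simp
qed

text \<open>Cauchy--Schwarz for a positive form with \<open>p = \<langle>v,v\<rangle>\<close>, \<open>r = \<langle>v,w\<rangle>\<close>, \<open>q = \<langle>w,w\<rangle>\<close>.\<close>

lemma cauchy_schwarz_pos:
  fixes p q r :: "'b::unital_cstar_algebra"
  assumes "pos p" and *: "\<And>a. pos (star a * p * a + star a * r + star r * a + q)"
  shows "(norm r)\<^sup>2 \<le> norm p * norm q"
proof -
  \<comment> \<open>The choice \<open>a = - r / t\<close> uses a scalar bound on \<open>p\<close> in
    place of an inverse of \<open>p\<close>, which may not exist. Afterwards \<open>t\<close>
    decreases to \<open>norm p\<close>, which may be 0.\<close>
  have le: "(norm r)\<^sup>2 \<le> t * norm q" if t: "t > 0" "norm p \<le> t" for t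
  proof -
    have 1: "pos (star (- scaleR (1/t) r) * p * (- scaleR (1/t) r) + star (- scaleR (1/t) r) * r
        + star r * (- scaleR (1/t) r) + q)" by (rule *)
    have "pos (star r * (of_real t - p) * r)"
      using t assms(1) by (intro pos_conj pos_norm_minus) (simp_all add: pos_star)
    then have 2: "pos (scaleR ((1/t) * (1/t)) (star r * (of_real t - p) * r))"
      by (rule pos_scaleR) simp
    have eq: "(star (- scaleR (1/t) r) * p * (- scaleR (1/t) r) + star (- scaleR (1/t) r) * r
        + star r * (- scaleR (1/t) r) + q) + scaleR ((1/t) * (1/t)) (star r * (of_real t - p) * r)
      = q - scaleR (1/t) (star r * r)"
      using t(1) by (simp add: star_minus star_scaleR algebra_simps of_real_def)
    have "pos (q - scaleR (1/t) (star r * r))" using pos_add[OF 1 2] unfolding eq .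
    moreover have "pos (scaleR (1/t) (star r * r))" using t by (intro pos_scaleR pos_star_mult) simp
    ultimately have "norm (scaleR (1/t) (star r * r)) \<le> norm q" by (intro norm_mono_pos)
    then show ?thesis using t(1) by (simp add: cstar_identity field_simps)
  qed
  show ?thesis
  proof (rule field_le_epsilon)
    fix e :: real assume "e > 0"
    define d where "d = e / (norm q + 1)"
    have q1: "norm q + 1 > 0" using norm_ge_zero[of q] by linarith
    have d: "d > 0" using \<open>e > 0\<close> q1 by (simp add: d_def)
    have "(norm r)\<^sup>2 \<le> (norm p + d) * norm q" using d norm_ge_zero[of p] by (intro le) linarith+
    also have "\<dots> \<le> norm p * norm q + d * (norm q + 1)" using d by (simp add: algebra_simps)
    also have "d * (norm q + 1) = e" using q1 by (simp add: d_def)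
    finally show "(norm r)\<^sup>2 \<le> norm p * norm q + e" .
  qed
qed

subsection \<open>Square roots of positive matrices\<close>

text \<open>Matrices over the algebra are handled through this form and through their entries, so
  that the C*-norm of the matrix algebra does not have to be constructed.\<close>

definition mform :: "'i set \<Rightarrow> ('i \<Rightarrow> 'i \<Rightarrow> 'b::unital_cstar_algebra) \<Rightarrow> ('i \<Rightarrow> 'b) \<Rightarrow> ('i \<Rightarrow> 'b) \<Rightarrow> 'b" where
  "mform I M v w = (\<Sum>i\<in>I. \<Sum>j\<in>I. star (v i) * M i j * w j)"

definition mid :: "'i \<Rightarrow> 'i \<Rightarrow> 'b::unital_cstar_algebra" where
  "mid i j = (if i = j then 1 else 0)"

primrec mpow :: "'i set \<Rightarrow> ('i \<Rightarrow> 'i \<Rightarrow> 'b::unital_cstar_algebra) \<Rightarrow> nat \<Rightarrow> 'i \<Rightarrow> 'i \<Rightarrow> 'b" where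
  "mpow I K 0 = mid"
| "mpow I K (Suc m) = (\<lambda>i j. \<Sum>l\<in>I. K i l * mpow I K m l j)"

lemma mform_add_left: "mform I M (\<lambda>i. v i + v' i) w = mform I M v w + mform I M v' w"
  by (simp add: mform_def star_add algebra_simps sum.distrib)

lemma mform_add_right: "mform I M v (\<lambda>i. w i + w' i) = mform I M v w + mform I M v w'"
  by (simp add: mform_def algebra_simps sum.distrib)

lemma mform_mult_left: "mform I M (\<lambda>i. v i * a) w = star a * mform I M v w"
  by (simp add: mform_def star_mult sum_distrib_left mult.assoc)

lemma mform_mult_right: "mform I M v (\<lambda>i. w i * a) = mform I M v w * a"
  by (simp add: mform_def sum_distrib_right mult.assoc)

lemma mform_star:
  assumes "\<And>i j. i \<in> I \<Longrightarrow> j \<in> I \<Longrightarrow> star (M i j) = M j i"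
  shows "star (mform I M v w) = mform I M w v"
  unfolding mform_def
  by (subst sum.swap) (simp add: star_sum star_mult star_star assms mult.assoc)

lemma mform_cauchy_schwarz:
  assumes herm: "\<And>i j. i \<in> I \<Longrightarrow> j \<in> I \<Longrightarrow> star (M i j) = M j i"
    and pos: "\<And>v. pos (mform I M v v)"
  shows "(norm (mform I M v w))\<^sup>2 \<le> norm (mform I M v v) * norm (mform I M w w)"
proof (rule cauchy_schwarz_pos[OF pos])
  fix a
  have "pos (mform I M (\<lambda>i. v i * a + w i) (\<lambda>i. v i * a + w i))" by (rule pos)
  also have "mform I M (\<lambda>i. v i * a + w i) (\<lambda>i. v i * a + w i)
      = star a * mform I M v v * a + star a * mform I M v w + star (mform I M v w) * a + mform I M w w"
    by (simp only: mform_add_left mform_add_right mform_mult_left mform_mult_right mform_star[OF herm]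
        distrib_left mult.assoc add.assoc)
  finally show "pos (star a * mform I M v v * a + star a * mform I M v w + star (mform I M v w) * a + mform I M w w)" .
qed

lemma mform_mid: "finite I \<Longrightarrow> mform I mid v w = (\<Sum>i\<in>I. star (v i) * w i)"
  unfolding mform_def mid_def
  by (rule sum.cong) (simp_all add: if_distrib[of "\<lambda>x. _ * x * _"] if_distrib[of "\<lambda>x. x * _"] sum.delta cong: if_cong)

lemma norm_component_le:
  assumes "finite I" "i \<in> I"
  shows "(norm (v i))\<^sup>2 \<le> norm (mform I mid v v)"
proof -
  have "norm (star (v i) * v i) \<le> norm (mform I mid v v)"
  proof (rule norm_mono_pos[OF pos_star_mult])
    have "mform I mid v v - star (v i) * v i = (\<Sum>i\<in>I - {i}. star (v i) * v i)"
      using assms by (simp add: mform_mid sum_diff1)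
    then show "pos (mform I mid v v - star (v i) * v i)" by (simp add: pos_sum pos_star_mult)
  qed
  then show ?thesis by (simp add: cstar_identity)
qed

text \<open>A symmetric matrix \<open>0 \<le> K \<le> 1\<close> is a contraction, by Cauchy--Schwarz for its own form.\<close>

lemma mform_contraction:
  fixes K :: "'i \<Rightarrow> 'i \<Rightarrow> 'b::unital_cstar_algebra"
  assumes I: "finite I"
    and herm: "\<And>i j. i \<in> I \<Longrightarrow> j \<in> I \<Longrightarrow> star (K i j) = K j i"
    and pos: "\<And>v. pos (mform I K v v)" and le: "\<And>v. pos (mform I mid v v - mform I K v v)"
  shows "norm (mform I mid (\<lambda>i. \<Sum>l\<in>I. K i l * v l) (\<lambda>i. \<Sum>l\<in>I. K i l * v l)) \<le> norm (mform I mid v v)"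
proof -
  let ?w = "\<lambda>i. \<Sum>l\<in>I. K i l * v l"
  let ?n = "\<lambda>v. norm (mform I mid v v)"
  have "mform I K v ?w = mform I mid ?w ?w"
  proof -
    have "mform I K v ?w = (\<Sum>j\<in>I. (\<Sum>i\<in>I. star (v i) * K i j) * ?w j)"
      unfolding mform_def by (subst sum.swap) (simp add: sum_distrib_right)
    also have "\<dots> = (\<Sum>j\<in>I. star (?w j) * ?w j)"
      by (intro sum.cong arg_cong2[where f = "(*)"]) (simp_all add: star_sum star_mult herm)
    finally show ?thesis using I by (simp add: mform_mid)
  qed
  then have "(?n ?w)\<^sup>2 \<le> norm (mform I K v v) * norm (mform I K ?w ?w)"
    using mform_cauchy_schwarz[of I K v ?w, OF herm pos] by simp
  also have "\<dots> \<le> ?n v * ?n ?w"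
    by (intro mult_mono norm_mono_pos pos le) simp_all
  finally have "?n ?w * ?n ?w \<le> ?n v * ?n ?w" by (simp add: power2_eq_square)
  then show ?thesis by (cases "?n ?w = 0") (simp_all add: mult_le_cancel_right)
qed

lemma mpow_add:
  assumes "finite I" "i \<in> I"
  shows "(\<Sum>l\<in>I. mpow I K a i l * mpow I K b l j) = mpow I K (a + b) i j"
  using assms(2)
proof (induction a arbitrary: i)
  case 0
  then show ?case using assms(1) by (simp add: mid_def if_distrib[of "\<lambda>x. x * _"] sum.delta cong: if_cong)
next
  case (Suc a)
  have "(\<Sum>l\<in>I. mpow I K (Suc a) i l * mpow I K b l j)
      = (\<Sum>m\<in>I. K i m * (\<Sum>l\<in>I. mpow I K a m l * mpow I K b l j))"
    unfolding mpow.simps sum_distrib_right sum_distrib_left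
    by (subst sum.swap) (simp add: mult.assoc)
  also have "\<dots> = mpow I K (Suc a + b) i j" using Suc by simp
  finally show ?case .
qed

lemma mpow_1:
  assumes "finite I" "j \<in> I"
  shows "mpow I K 1 i j = K i j"
  using assms by (simp add: mid_def if_distrib[of "\<lambda>x. _ * x"] sum.delta' cong: if_cong)

lemma star_mpow:
  assumes I: "finite I" and herm: "\<And>i j. i \<in> I \<Longrightarrow> j \<in> I \<Longrightarrow> star (K i j) = K j i"
    and "i \<in> I" "j \<in> I"
  shows "star (mpow I K m i j) = mpow I K m j i"
  using assms(3,4)
proof (induction m arbitrary: i j)
  case 0
  then show ?case by (simp add: mid_def star_one star_zero)
next
  case (Suc m)
  have "star (mpow I K (Suc m) i j) = (\<Sum>l\<in>I. mpow I K m j l * K l i)"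
    using Suc by (simp add: star_sum star_mult herm)
  also have "\<dots> = (\<Sum>l\<in>I. mpow I K m j l * mpow I K 1 l i)"
    using mpow_1[OF I Suc.prems(1), of K] by simp
  finally show ?case using mpow_add[OF I Suc.prems(2), of K m 1 i] by simp
qed

text \<open>By \<open>mform_contraction\<close> each column of a power stays in the unit ball, since
  it starts as a column of the identity. The uniform bound on entries makes the binomial series
  converge entry by entry.\<close>

lemma norm_mpow_le:
  fixes K :: "'i \<Rightarrow> 'i \<Rightarrow> 'b::unital_cstar_algebra"
  assumes I: "finite I"
    and herm: "\<And>i j. i \<in> I \<Longrightarrow> j \<in> I \<Longrightarrow> star (K i j) = K j i"
    and pos: "\<And>v. pos (mform I K v v)" and le: "\<And>v. pos (mform I mid v v - mform I K v v)"
    and ij: "i \<in> I" "j \<in> I"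
  shows "norm (mpow I K m i j) \<le> 1"
proof -
  have "norm (mform I mid (\<lambda>i. mpow I K m i j) (\<lambda>i. mpow I K m i j)) \<le> 1"
  proof (induction m)
    case 0
    have "(\<Sum>i\<in>I. star (mid i j) * mid i j) = (\<Sum>i\<in>I. if i = j then 1 else 0 :: 'b)"
      by (intro sum.cong) (simp_all add: mid_def star_one)
    then show ?case using I ij by (simp add: mform_mid)
  next
    case (Suc m)
    show ?case
      using mform_contraction[OF I herm pos le, of "\<lambda>i. mpow I K m i j"] Suc by simp
  qed
  then have "(norm (mpow I K m i j))\<^sup>2 \<le> 1\<^sup>2"
    using norm_component_le[OF I ij(1), of "\<lambda>i. mpow I K m i j"] by simp
  then show ?thesis by (rule power2_le_imp_le) simp
qed

text \<open>Expanding \<open>star u * u\<close> for \<open>u = v i - M i j * v j\<close> controls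
  the term at \<open>(i, j)\<close> together with its mirror image. Summing over all pairs bounds
  twice the form of \<open>M\<close> by \<open>card I + S\<close> times the identity form; the extra
  1 keeps the constant positive.\<close>

lemma mform_bounded:
  fixes M :: "'i \<Rightarrow> 'i \<Rightarrow> 'b::unital_cstar_algebra"
  assumes I: "finite I" and herm: "\<And>i j. i \<in> I \<Longrightarrow> j \<in> I \<Longrightarrow> star (M i j) = M j i"
  obtains t where "t > 0" "\<And>v. pos (scaleR t (mform I mid v v) - mform I M v v)"
proof -
  define S where "S = (\<Sum>i\<in>I. \<Sum>j\<in>I. (norm (M i j))\<^sup>2)"
  define t where "t = real (card I) + S + 1"
  have S: "S \<ge> 0" by (simp add: S_def sum_nonneg)
  have "pos (scaleR (t/2) (mform I mid v v) - mform I M v v)" for v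
  proof -
    have ij: "pos (star (v i) * v i + scaleR ((norm (M i j))\<^sup>2) (star (v j) * v j)
        - (star (v i) * M i j * v j + star (v j) * M j i * v i))" if "i \<in> I" "j \<in> I" for i j
    proof -
      have 1: "pos (star (v i - M i j * v j) * (v i - M i j * v j))" by (rule pos_star_mult)
      have "pos (star (v j) * (of_real ((norm (M i j))\<^sup>2) - star (M i j) * M i j) * v j)"
        by (intro pos_conj pos_norm_minus) (simp_all add: star_mult star_star cstar_identity)
      from pos_add[OF 1 this] show ?thesis using herm[OF that]
        by (simp add: star_diff star_mult algebra_simps of_real_def del: of_real_power)
    qed
    have nm: "mform I mid v v = (\<Sum>i\<in>I. star (v i) * v i)" using I by (simp add: mform_mid)
    have "pos (\<Sum>i\<in>I. \<Sum>j\<in>I. star (v i) * v i + scaleR ((norm (M i j))\<^sup>2) (star (v j) * v j)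
        - (star (v i) * M i j * v j + star (v j) * M j i * v i))"
      by (intro pos_sum ij)
    also have "(\<Sum>i\<in>I. \<Sum>j\<in>I. star (v i) * v i + scaleR ((norm (M i j))\<^sup>2) (star (v j) * v j)
        - (star (v i) * M i j * v j + star (v j) * M j i * v i))
      = scaleR (card I) (mform I mid v v) + (\<Sum>i\<in>I. \<Sum>j\<in>I. scaleR ((norm (M i j))\<^sup>2) (star (v j) * v j))
        - scaleR 2 (mform I M v v)"
    proof -
      have "(\<Sum>i\<in>I. \<Sum>j\<in>I. star (v j) * M j i * v i) = mform I M v v"
        unfolding mform_def by (rule sum.swap)
      moreover have "(\<Sum>i\<in>I. \<Sum>j\<in>I. star (v i) * M i j * v j) = mform I M v v"
        by (simp add: mform_def)
      moreover have "(\<Sum>i\<in>I. \<Sum>j\<in>I. star (v i) * v i) = scaleR (card I) (mform I mid v v)"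
        by (simp add: nm scaleR_conv_of_real sum_distrib_left)
      ultimately show ?thesis by (simp add: sum.distrib sum_subtractf scaleR_2)
    qed
    finally have 1: "pos \<dots>" .
    have "pos (\<Sum>i\<in>I. \<Sum>j\<in>I. scaleR ((norm (M i j))\<^sup>2) (mform I mid v v - star (v j) * v j))"
    proof (intro pos_sum pos_scaleR)
      fix j assume "j \<in> I"
      then have "mform I mid v v - star (v j) * v j = (\<Sum>i\<in>I - {j}. star (v i) * v i)"
        using I by (simp add: nm sum_diff1)
      then show "pos (mform I mid v v - star (v j) * v j)" by (simp add: pos_sum pos_star_mult)
    qed simp
    also have "(\<Sum>i\<in>I. \<Sum>j\<in>I. scaleR ((norm (M i j))\<^sup>2) (mform I mid v v - star (v j) * v j))
      = scaleR S (mform I mid v v) - (\<Sum>i\<in>I. \<Sum>j\<in>I. scaleR ((norm (M i j))\<^sup>2) (star (v j) * v j))"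
      by (simp add: S_def scaleR_diff_right sum_subtractf scaleR_sum_left)
    finally have 2: "pos \<dots>" .
    have 3: "pos (mform I mid v v)" by (simp add: nm pos_sum pos_star_mult)
    have "pos (scaleR (1/2) (scaleR t (mform I mid v v) - scaleR 2 (mform I M v v)))"
      using pos_add[OF pos_add[OF 1 2] 3] by (intro pos_scaleR) (simp_all add: t_def scaleR_add_left algebra_simps)
    then show ?thesis by (simp add: scaleR_diff_right)
  qed
  moreover have "t / 2 > 0" using S by (simp add: t_def add_nonneg_pos)
  ultimately show ?thesis using that by blast
qed

text \<open>After scaling, \<open>K = 1 - M / t\<close> lies between 0 and 1. The binomial series in
  the powers of \<open>K\<close>, summed entrywise and multiplied by \<open>sqrt t\<close>, is a
  hermitian root of \<open>M\<close>.\<close>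

theorem matrix_square_root:
  fixes M :: "'i \<Rightarrow> 'i \<Rightarrow> 'b::unital_cstar_algebra"
  assumes I: "finite I" and herm: "\<And>i j. i \<in> I \<Longrightarrow> j \<in> I \<Longrightarrow> star (M i j) = M j i"
    and pos: "\<And>v. pos (mform I M v v)"
  shows "\<exists>C. \<forall>i\<in>I. \<forall>j\<in>I. M i j = (\<Sum>k\<in>I. star (C k i) * C k j)"
proof -
  obtain t where t: "t > 0" "\<And>v. pos (scaleR t (mform I mid v v) - mform I M v v)"
    by (rule mform_bounded[OF I], rule herm, assumption, assumption, blast)
  define K where "K = (\<lambda>i j. mid i j - scaleR (1/t) (M i j))"
  have Kherm: "star (K i j) = K j i" if "i \<in> I" "j \<in> I" for i j
    unfolding K_def star_diff star_scaleR herm[OF that] by (auto simp: mid_def star_one star_zero)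
  have Kform: "mform I K v v = mform I mid v v - scaleR (1/t) (mform I M v v)" for v
    by (simp add: mform_def K_def left_diff_distrib right_diff_distrib sum_subtractf scaleR_sum_right)
  have Kpos: "pos (mform I K v v)" for v
  proof -
    have "pos (scaleR (1/t) (scaleR t (mform I mid v v) - mform I M v v))"
      using t by (intro pos_scaleR) simp_all
    then show ?thesis using t(1) by (simp add: Kform scaleR_diff_right)
  qed
  have Kle: "pos (mform I mid v v - mform I K v v)" for v
    using pos_scaleR[OF pos, of "1/t" v] t(1) by (simp add: Kform)
  have np: "norm (mpow I K m i j) \<le> 1" if "i \<in> I" "j \<in> I" for m i j
    by (rule norm_mpow_le[OF I Kherm Kpos Kle that])
  let ?f = "\<lambda>i j m. scaleR (sqrt_coeff m) (mpow I K m i j)"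
  define S where "S = (\<lambda>i j. suminf (?f i j))"
  have sn: "summable (\<lambda>m. norm (?f i j m))" if "i \<in> I" "j \<in> I" for i j
    by (rule summable_comparison_test'[OF summable_sqrt_coeff])
      (use np[OF that] in \<open>simp add: mult_left_le\<close>)
  have Sherm: "star (S i j) = S j i" if "i \<in> I" "j \<in> I" for i j
    unfolding S_def
    by (subst bounded_linear.suminf[OF bounded_linear_star summable_norm_cancel[OF sn[OF that]]])
      (simp add: star_scaleR star_mpow[OF I Kherm that])
  have SS: "(\<Sum>k\<in>I. S i k * S k j) = scaleR (1/t) (M i j)" if ij: "i \<in> I" "j \<in> I" for i j
  proof -
    have "(\<lambda>m. \<Sum>a\<le>m. ?f i k a * ?f k j (m - a)) sums (S i k * S k j)" if "k \<in> I" for k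
      unfolding S_def by (intro Cauchy_product_sums sn ij that)
    then have "(\<lambda>m. \<Sum>k\<in>I. \<Sum>a\<le>m. ?f i k a * ?f k j (m - a)) sums (\<Sum>k\<in>I. S i k * S k j)"
      by (intro sums_sum)
    moreover have "(\<Sum>k\<in>I. \<Sum>a\<le>m. ?f i k a * ?f k j (m - a))
        = scaleR (if m = 0 then 1 else if m = 1 then - 1 else 0) (mpow I K m i j)" for m
    proof -
      have "(\<Sum>k\<in>I. \<Sum>a\<le>m. ?f i k a * ?f k j (m - a))
          = (\<Sum>a\<le>m. scaleR (sqrt_coeff a * sqrt_coeff (m - a)) (\<Sum>k\<in>I. mpow I K a i k * mpow I K (m - a) k j))"
        by (subst sum.swap) (simp add: scaleR_sum_right mult.commute)
      also have "\<dots> = (\<Sum>a\<le>m. scaleR (sqrt_coeff a * sqrt_coeff (m - a)) (mpow I K m i j))"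
        by (intro sum.cong) (simp_all add: mpow_add[OF I ij(1)])
      finally show ?thesis by (simp add: scaleR_left.sum[symmetric] sqrt_coeff_convolution)
    qed
    ultimately have "(\<lambda>m. scaleR (if m = 0 then 1 else if m = 1 then - 1 else 0) (mpow I K m i j))
        sums (\<Sum>k\<in>I. S i k * S k j)" by simp
    moreover have "(\<lambda>m. scaleR (if m = 0 then 1 else if m = 1 then - 1 else 0) (mpow I K m i j))
        sums (\<Sum>m\<in>{0,1}. scaleR (if m = 0 then 1 else if m = 1 then - 1 else 0) (mpow I K m i j))"
      by (rule sums_finite) auto
    ultimately have "(\<Sum>k\<in>I. S i k * S k j)
        = (\<Sum>m\<in>{0,1::nat}. scaleR (if m = 0 then 1 else if m = 1 then - 1 else 0) (mpow I K m i j))"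
      by (rule sums_unique2)
    also have "\<dots> = mid i j - K i j" using mpow_1[OF I ij(2), of K i] by simp
    finally show ?thesis by (simp add: K_def)
  qed
  have "M i j = (\<Sum>k\<in>I. star (scaleR (sqrt t) (S k i)) * scaleR (sqrt t) (S k j))" if ij: "i \<in> I" "j \<in> I" for i j
  proof -
    have "(\<Sum>k\<in>I. star (scaleR (sqrt t) (S k i)) * scaleR (sqrt t) (S k j)) = scaleR t (\<Sum>k\<in>I. S i k * S k j)"
      using t(1) ij by (simp add: star_scaleR Sherm scaleR_sum_right)
    then show ?thesis using t(1) SS[OF ij] by simp
  qed
  then show ?thesis by (intro exI[of _ "\<lambda>i j. scaleR (sqrt t) (S i j)"]) blast
qed

lemma mat_positiveI:
  assumes "\<And>i j. i < n \<Longrightarrow> j < n \<Longrightarrow> star (M i j) = M j i"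
    and "\<And>v. pos (mform {..<n} M v v)"
  shows "mat_positive n M"
  using matrix_square_root[of "{..<n}" M] assms by (simp add: mat_positive_def Ball_def)

subsection \<open>Pre-Hilbert bimodules\<close>

text \<open>Sums, products and scalars of the left action are governed only under the inner product.
  For formal combinations of tensors these laws hold up to null vectors; in a \<open>hilb\<close>
  they become equations.\<close>

locale prehilb =
  fixes V :: "('b::unital_cstar_algebra, 'v) bimod"
  assumes zero_closed [simp, intro]: "hzero V \<in> elems V"
    and add_closed [simp, intro]: "u \<in> elems V \<Longrightarrow> v \<in> elems V \<Longrightarrow> hadd V u v \<in> elems V"
    and lact_closed [simp, intro]: "v \<in> elems V \<Longrightarrow> lact V b v \<in> elems V"
    and ract_closed [simp, intro]: "v \<in> elems V \<Longrightarrow> ract V v b \<in> elems V"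
    and add_assoc: "u \<in> elems V \<Longrightarrow> v \<in> elems V \<Longrightarrow> w \<in> elems V \<Longrightarrow>
      hadd V (hadd V u v) w = hadd V u (hadd V v w)"
    and add_comm: "u \<in> elems V \<Longrightarrow> v \<in> elems V \<Longrightarrow> hadd V u v = hadd V v u"
    and add_zero: "u \<in> elems V \<Longrightarrow> hadd V (hzero V) u = u"
    and ract_add_left: "u \<in> elems V \<Longrightarrow> v \<in> elems V \<Longrightarrow> ract V (hadd V u v) b = hadd V (ract V u b) (ract V v b)"
    and ract_add_right: "u \<in> elems V \<Longrightarrow> ract V u (b + c) = hadd V (ract V u b) (ract V u c)"
    and ract_mult: "u \<in> elems V \<Longrightarrow> ract V u (b * c) = ract V (ract V u b) c"
    and ract_one: "u \<in> elems V \<Longrightarrow> ract V u 1 = u"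
    and ract_zero: "u \<in> elems V \<Longrightarrow> ract V u 0 = hzero V"
    and inn_add_right: "u \<in> elems V \<Longrightarrow> v \<in> elems V \<Longrightarrow> w \<in> elems V \<Longrightarrow>
      inn V u (hadd V v w) = inn V u v + inn V u w"
    and inn_ract: "u \<in> elems V \<Longrightarrow> v \<in> elems V \<Longrightarrow> inn V u (ract V v b) = inn V u v * b"
    and star_inn: "u \<in> elems V \<Longrightarrow> v \<in> elems V \<Longrightarrow> star (inn V u v) = inn V v u"
    and inn_pos: "u \<in> elems V \<Longrightarrow> pos (inn V u u)"
    and inn_lact: "u \<in> elems V \<Longrightarrow> v \<in> elems V \<Longrightarrow> inn V (lact V b u) v = inn V u (lact V (star b) v)"
    and inn_lact_add: "u \<in> elems V \<Longrightarrow> v \<in> elems V \<Longrightarrow>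
      inn V u (lact V (b + c) v) = inn V u (lact V b v) + inn V u (lact V c v)"
    and inn_lact_mult: "u \<in> elems V \<Longrightarrow> v \<in> elems V \<Longrightarrow>
      inn V u (lact V (b * c) v) = inn V u (lact V b (lact V c v))"
    and inn_lact_one: "u \<in> elems V \<Longrightarrow> v \<in> elems V \<Longrightarrow> inn V u (lact V 1 v) = inn V u v"
    and inn_lact_scalar: "u \<in> elems V \<Longrightarrow> v \<in> elems V \<Longrightarrow>
      inn V u (lact V (scalar z) v) = inn V u v * scalar z"
begin

lemma inn_add_left: "u \<in> elems V \<Longrightarrow> v \<in> elems V \<Longrightarrow> w \<in> elems V \<Longrightarrow>
    inn V (hadd V u v) w = inn V u w + inn V v w"
  using star_inn[of w "hadd V u v"] star_inn[of w u] star_inn[of w v] by (simp add: inn_add_right star_add)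

lemma inn_ract_left: "u \<in> elems V \<Longrightarrow> v \<in> elems V \<Longrightarrow> inn V (ract V u b) v = star b * inn V u v"
  using star_inn[of v "ract V u b"] star_inn[of v u] by (simp add: inn_ract star_mult)

lemma inn_zero_right [simp]: "u \<in> elems V \<Longrightarrow> inn V u (hzero V) = 0"
  using inn_ract[of u u 0] by (simp add: ract_zero)

lemma inn_zero_left [simp]: "u \<in> elems V \<Longrightarrow> inn V (hzero V) u = 0"
  by (metis inn_zero_right star_inn star_zero zero_closed)

lemma hminus_closed [simp, intro]: "u \<in> elems V \<Longrightarrow> v \<in> elems V \<Longrightarrow> hminus V u v \<in> elems V"
  by (simp add: hminus_def)

lemma inn_hminus_right: "u \<in> elems V \<Longrightarrow> v \<in> elems V \<Longrightarrow> w \<in> elems V \<Longrightarrow>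
    inn V u (hminus V v w) = inn V u v - inn V u w"
  by (simp add: hminus_def inn_add_right inn_ract)

lemma inn_hminus_left: "u \<in> elems V \<Longrightarrow> v \<in> elems V \<Longrightarrow> w \<in> elems V \<Longrightarrow>
    inn V (hminus V v w) u = inn V v u - inn V w u"
  by (simp add: hminus_def inn_add_left inn_ract_left star_neg_one)

lemmas inn_simps = inn_add_right inn_add_left inn_ract inn_ract_left inn_hminus_right inn_hminus_left

lemma add_zero_right: "u \<in> elems V \<Longrightarrow> hadd V u (hzero V) = u"
  by (metis add_comm add_zero zero_closed)

lemma hminus_self: "u \<in> elems V \<Longrightarrow> hminus V u u = hzero V"
  using ract_add_right[of u 1 "- 1"] by (simp add: hminus_def ract_one ract_zero)

lemma hminus_add:
  assumes "u \<in> elems V" "v \<in> elems V"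
  shows "hadd V (hminus V u v) v = u"
proof -
  have "hadd V (ract V v (- 1)) v = hzero V"
    using assms ract_add_right[of v "- 1" 1, symmetric] by (simp add: ract_one ract_zero)
  then show ?thesis using assms by (simp add: hminus_def add_assoc add_zero_right)
qed

lemma hminus_eq_zero_imp: 
  assumes "u \<in> elems V" "v \<in> elems V" "hminus V u v = hzero V"
  shows "u = v"
  using hminus_add[OF assms(1,2)] assms by (simp add: add_zero)

lemma hnorm_nonneg [simp]: "0 \<le> hnorm V u"
  by (simp add: hnorm_def)

lemma hnorm_sq: "(hnorm V u)\<^sup>2 = norm (inn V u u)"
  by (simp add: hnorm_def)

lemma hnorm_eqI: "inn V u u = inn V v v \<Longrightarrow> hnorm V u = hnorm V v"
  by (simp add: hnorm_def)

lemma hnorm_le_iff: "c \<ge> 0 \<Longrightarrow> hnorm V u \<le> c \<longleftrightarrow> norm (inn V u u) \<le> c\<^sup>2"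
  using abs_le_square_iff[of "hnorm V u" c] by (simp add: hnorm_sq)

lemma cauchy_schwarz:
  assumes "u \<in> elems V" "v \<in> elems V"
  shows "norm (inn V u v) \<le> hnorm V u * hnorm V v"
proof -
  have "(norm (inn V u v))\<^sup>2 \<le> norm (inn V u u) * norm (inn V v v)"
  proof (rule cauchy_schwarz_pos)
    show "pos (inn V u u)" using assms by (simp add: inn_pos)
    fix a
    have "pos (inn V (hadd V (ract V u a) v) (hadd V (ract V u a) v))" using assms by (simp add: inn_pos)
    then show "pos (star a * inn V u u * a + star a * inn V u v + star (inn V u v) * a + inn V v v)"
      using assms by (simp add: inn_simps star_inn algebra_simps)
  qed
  also have "\<dots> = (hnorm V u * hnorm V v)\<^sup>2" by (simp add: power_mult_distrib hnorm_sq)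
  finally show ?thesis by (rule power2_le_imp_le) simp
qed

lemma hnorm_triangle:
  assumes "u \<in> elems V" "v \<in> elems V"
  shows "hnorm V (hadd V u v) \<le> hnorm V u + hnorm V v"
proof -
  have "norm (inn V (hadd V u v) (hadd V u v))
      \<le> norm (inn V u u) + norm (inn V u v) + norm (inn V v u) + norm (inn V v v)"
  proof -
    have "inn V (hadd V u v) (hadd V u v) = inn V u u + inn V u v + inn V v u + inn V v v"
      using assms by (simp add: inn_simps algebra_simps)
    then have "norm (inn V (hadd V u v) (hadd V u v)) = norm (inn V u u + inn V u v + inn V v u + inn V v v)"
      by (rule arg_cong)
    then show ?thesis
      using norm_triangle_ineq[of "inn V u u + inn V u v + inn V v u" "inn V v v"]
        norm_triangle_ineq[of "inn V u u + inn V u v" "inn V v u"] norm_triangle_ineq[of "inn V u u" "inn V u v"]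
      by linarith
  qed
  also have "\<dots> \<le> (hnorm V u + hnorm V v)\<^sup>2"
    using cauchy_schwarz[OF assms] cauchy_schwarz[OF assms(2,1)]
    by (simp add: power2_sum hnorm_sq) (simp add: algebra_simps)
  finally show ?thesis by (subst hnorm_le_iff) auto
qed

lemma hnorm_zero [simp]: "hnorm V (hzero V) = 0"
  by (simp add: hnorm_def)

lemma hnorm_ract:
  assumes "u \<in> elems V"
  shows "hnorm V (ract V u b) \<le> hnorm V u * norm b"
proof -
  have "norm (inn V (ract V u b) (ract V u b)) \<le> norm (star b) * norm (inn V u u) * norm b"
  proof -
    have "norm (star b * inn V u u * b) \<le> norm (star b * inn V u u) * norm b" by (rule norm_mult_ineq)
    also have "\<dots> \<le> norm (star b) * norm (inn V u u) * norm b"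
      by (intro mult_right_mono norm_mult_ineq) simp
    finally show ?thesis using assms by (simp add: inn_ract inn_ract_left mult.assoc)
  qed
  then show ?thesis by (subst hnorm_le_iff) (simp_all add: power_mult_distrib hnorm_sq power2_eq_square[of "norm b"] mult_ac)
qed

lemma hnorm_ract_scalar:
  assumes "u \<in> elems V"
  shows "hnorm V (ract V u (scalar z)) = cmod z * hnorm V u"
proof -
  have "inn V (ract V u (scalar z)) (ract V u (scalar z)) = scaleC (z * cnj z) (inn V u u)"
    using assms by (simp add: inn_simps star_scaleC star_one mult_scaleC_left mult_scaleC_right scaleC_scaleC mult.commute)
  then show ?thesis by (simp add: hnorm_def norm_scaleC norm_mult real_sqrt_mult)
qed

lemma hnorm_ract_minus [simp]: "u \<in> elems V \<Longrightarrow> hnorm V (ract V u (- 1)) = hnorm V u"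
  by (rule hnorm_eqI) (simp add: inn_simps star_neg_one)

lemma hnorm_hminus_commute: "u \<in> elems V \<Longrightarrow> v \<in> elems V \<Longrightarrow> hnorm V (hminus V u v) = hnorm V (hminus V v u)"
  by (rule hnorm_eqI) (simp add: inn_simps algebra_simps)

lemma hnorm_hminus_triangle:
  assumes "u \<in> elems V" "v \<in> elems V" "w \<in> elems V"
  shows "hnorm V (hminus V u w) \<le> hnorm V (hminus V u v) + hnorm V (hminus V v w)"
proof -
  have "hnorm V (hminus V u w) = hnorm V (hadd V (hminus V u v) (hminus V v w))"
    using assms by (intro hnorm_eqI) (simp add: inn_simps algebra_simps)
  also have "\<dots> \<le> hnorm V (hminus V u v) + hnorm V (hminus V v w)"
    using assms by (intro hnorm_triangle) auto
  finally show ?thesis .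
qed

lemma hnorm_diff_le:
  assumes "u \<in> elems V" "v \<in> elems V"
  shows "\<bar>hnorm V u - hnorm V v\<bar> \<le> hnorm V (hminus V u v)"
proof -
  have le: "hnorm V u \<le> hnorm V (hminus V u v) + hnorm V v" if "u \<in> elems V" "v \<in> elems V" for u v
  proof -
    have "hnorm V u = hnorm V (hadd V (hminus V u v) v)"
      using that by (simp add: hminus_add)
    also have "\<dots> \<le> hnorm V (hminus V u v) + hnorm V v" using that by (intro hnorm_triangle) auto
    finally show ?thesis .
  qed
  show ?thesis using le[OF assms] le[OF assms(2,1)] hnorm_hminus_commute[OF assms] by simp
qed

lemma inn_diff_le:
  assumes "u \<in> elems V" "v \<in> elems V" "u' \<in> elems V" "v' \<in> elems V"
  shows "norm (inn V u v - inn V u' v') \<le> hnorm V (hminus V u u') * hnorm V v + hnorm V u' * hnorm V (hminus V v v')"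
proof -
  have "inn V u v - inn V u' v' = inn V (hminus V u u') v + inn V u' (hminus V v v')"
    using assms by (simp add: inn_simps)
  then have "norm (inn V u v - inn V u' v') \<le> norm (inn V (hminus V u u') v) + norm (inn V u' (hminus V v v'))"
    by (metis norm_triangle_ineq)
  then show ?thesis
    using cauchy_schwarz[of "hminus V u u'" v] cauchy_schwarz[of u' "hminus V v v'"] assms by simp
qed

text \<open>Equality after separation. Identities between formal tensors are proved in this shape;
  by Cauchy-Schwarz it amounts to distance 0.\<close>

definition eqv :: "'v \<Rightarrow> 'v \<Rightarrow> bool" where
  "eqv u v \<longleftrightarrow> (\<forall>z\<in>elems V. inn V z u = inn V z v)"

lemma eqv_hnorm_hminus:
  assumes "u \<in> elems V" "v \<in> elems V"
  shows "eqv u v \<longleftrightarrow> hnorm V (hminus V u v) = 0"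
proof
  assume "eqv u v"
  then have "inn V (hminus V u v) (hminus V u v) = 0" using assms by (simp add: eqv_def inn_hminus_right)
  then show "hnorm V (hminus V u v) = 0" by (simp add: hnorm_def)
next
  assume "hnorm V (hminus V u v) = 0"
  then have "norm (inn V z (hminus V u v)) \<le> 0" if "z \<in> elems V" for z
    using cauchy_schwarz[OF that, of "hminus V u v"] assms by simp
  then show "eqv u v" using assms by (simp add: eqv_def inn_hminus_right)
qed

lemma eqv_inn_left: "eqv u v \<Longrightarrow> u \<in> elems V \<Longrightarrow> v \<in> elems V \<Longrightarrow> z \<in> elems V \<Longrightarrow> inn V u z = inn V v z"
  using star_inn[of z u] star_inn[of z v] by (simp add: eqv_def)

lemma eqv_hnorm: "eqv u v \<Longrightarrow> u \<in> elems V \<Longrightarrow> v \<in> elems V \<Longrightarrow> hnorm V u = hnorm V v"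
  using eqv_inn_left[of u v u] by (intro hnorm_eqI) (simp add: eqv_def)

text \<open>The element \<open>(norm b)^2 - star b * b\<close> is positive and so of the form
  \<open>star d * d\<close>. The gap between the two squared norms is then the inner product of
  \<open>d u\<close> with itself.\<close>

lemma hnorm_lact:
  assumes "u \<in> elems V"
  shows "hnorm V (lact V b u) \<le> norm b * hnorm V u"
proof -
  define h where "h = of_real ((norm b)\<^sup>2) - star b * b"
  have h: "pos h" unfolding h_def
    by (intro pos_norm_minus) (simp_all add: star_mult star_star cstar_identity)
  obtain d where d: "star d = d" "d * d = h" using pos_root[OF h] by metis
  have sc: "of_real r = (scalar (complex_of_real r) :: 'b)" for r
    by (simp only: scaleC_of_real of_real_def[where ?'a = 'b])
  have "inn V u u * of_real ((norm b)\<^sup>2) = inn V u (lact V (of_real ((norm b)\<^sup>2)) u)"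
    using assms by (simp only: sc inn_lact_scalar)
  also have "\<dots> = inn V u (lact V (star b * b + star d * d) u)"
    using d by (simp add: h_def del: of_real_power)
  also have "\<dots> = inn V (lact V b u) (lact V b u) + inn V (lact V d u) (lact V d u)"
    using assms by (simp add: inn_lact_add inn_lact_mult inn_lact star_star)
  finally have eq: "scaleR ((norm b)\<^sup>2) (inn V u u) - inn V (lact V b u) (lact V b u) = inn V (lact V d u) (lact V d u)"
    by (simp add: of_real_def)
  have "norm (inn V (lact V b u) (lact V b u)) \<le> norm (scaleR ((norm b)\<^sup>2) (inn V u u))"
    by (rule norm_mono_pos) (use assms in \<open>simp_all add: inn_pos eq\<close>)
  then show ?thesis by (subst hnorm_le_iff) (simp_all add: power_mult_distrib hnorm_sq)
qed

text \<open>A spectral radius argument: symmetry gives \<open>\<parallel>tv\<parallel>\<^bsup>2^j\<^esup> \<le> \<parallel>v\<parallel>\<^bsup>2^j - 1\<^esup> \<parallel>t\<^bsup>2^j\<^esup> v\<parallel>\<close>, so that a geometric bound on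
  the orbit of each vector, with a constant depending on the vector, already bounds \<open>t\<close>.\<close>

lemma symmetric_bound:
  assumes t: "\<And>u. u \<in> elems V \<Longrightarrow> t u \<in> elems V"
    and sym: "\<And>u v. u \<in> elems V \<Longrightarrow> v \<in> elems V \<Longrightarrow> inn V (t u) v = inn V u (t v)"
    and v: "v \<in> elems V" and R: "R \<ge> 0" and bd: "\<And>m. hnorm V ((t ^^ m) v) \<le> K * R ^ m"
  shows "hnorm V (t v) \<le> R * hnorm V v"
proof -
  define a where "a = (\<lambda>m. hnorm V ((t ^^ m) v))"
  have cl: "(t ^^ m) u \<in> elems V" if "u \<in> elems V" for m u using that by (induction m) (auto intro: t)
  have move: "inn V ((t ^^ m) u) w = inn V u ((t ^^ m) w)" if "u \<in> elems V" "w \<in> elems V" for m u w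
    using that
  proof (induction m arbitrary: w)
    case (Suc m)
    have "inn V ((t ^^ Suc m) u) w = inn V ((t ^^ m) u) (t w)" using Suc cl sym by simp
    also have "\<dots> = inn V u ((t ^^ m) (t w))" using Suc t by simp
    finally show ?case by (simp add: funpow_swap1)
  qed simp
  have step: "(a m)\<^sup>2 \<le> a 0 * a (m + m)" for m
  proof -
    have "(a m)\<^sup>2 = norm (inn V v ((t ^^ (m + m)) v))"
      using v cl by (simp add: a_def hnorm_sq move funpow_add)
    also have "\<dots> \<le> a 0 * a (m + m)" using cauchy_schwarz[OF v cl[OF v]] by (simp add: a_def)
    finally show ?thesis .
  qed
  have a_nonneg: "a m \<ge> 0" for m by (simp add: a_def)
  have iter: "(a 1) ^ (2 ^ j) * a 0 \<le> (a 0) ^ (2 ^ j) * a (2 ^ j)" for j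
  proof (induction j)
    case 0
    then show ?case by (simp add: mult.commute)
  next
    case (Suc j)
    have "((a 1) ^ (2 ^ j) * a 0)\<^sup>2 \<le> ((a 0) ^ (2 ^ j) * a (2 ^ j))\<^sup>2"
      using Suc a_nonneg by (intro power_mono) auto
    also have "\<dots> \<le> ((a 0) ^ (2 ^ j))\<^sup>2 * (a 0 * a (2 ^ j + 2 ^ j))"
      unfolding power_mult_distrib using step a_nonneg by (intro mult_left_mono) auto
    finally have le: "((a 1) ^ (2 ^ j))\<^sup>2 * (a 0)\<^sup>2 \<le> ((a 0) ^ (2 ^ j))\<^sup>2 * (a 0 * a (2 ^ j + 2 ^ j))"
      by (simp only: power_mult_distrib)
    have sq: "x ^ 2 ^ Suc j = (x ^ 2 ^ j)\<^sup>2" for x :: real by (simp add: power_even_eq)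
    have le2: "((a 1) ^ 2 ^ Suc j * a 0) * a 0 \<le> ((a 0) ^ 2 ^ Suc j * a (2 ^ Suc j)) * a 0"
      unfolding sq using le by (simp add: power2_eq_square[of "a 0"] mult_2 mult.assoc mult.commute mult.left_commute)
    then show ?case
    proof (cases "a 0 = 0")
      case True
      have "0 \<le> (a 0) ^ 2 ^ Suc j * a (2 ^ Suc j)" by (intro mult_nonneg_nonneg zero_le_power a_nonneg)
      then show ?thesis by (simp only: True mult_zero_right)
    next
      case False
      then have "a 0 > 0" using a_nonneg[of 0] by linarith
      then show ?thesis using le2 by (rule mult_right_le_imp_le[rotated])
    qed
  qed
  have "a 1 \<le> (R + e) * a 0" if e: "e > 0" for e
  proof (rule ccontr)
    assume "\<not> a 1 \<le> (R + e) * a 0"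
    then have gt: "a 1 > (R + e) * a 0" by (rule not_le_imp_less)
    have Re: "R + e > 0" using R e by simp
    have a0: "a 0 > 0"
    proof (rule ccontr)
      assume "\<not> a 0 > 0"
      then have "a 0 = 0" using a_nonneg[of 0] by simp
      then show False using step[of 1] gt by simp
    qed
    \<comment> \<open>Under the assumption to be refuted \<open>q\<close> exceeds 1, while
      \<open>iter\<close> and the orbit bound keep all \<open>q^(2^n)\<close> below
      \<open>K / a 0\<close>.\<close>
    define q where "q = a 1 / ((R + e) * a 0)"
    have q: "q > 1" using gt Re a0 by (simp add: q_def)
    obtain n where n: "K / a 0 + 1 < q ^ n" using real_arch_pow[OF q] by blast
    have "q ^ n \<le> q ^ (2 ^ n)" using q by (intro power_increasing) (simp_all add: less_imp_le)
    also have "q ^ 2 ^ n = a 1 ^ 2 ^ n / ((R + e) ^ 2 ^ n * a 0 ^ 2 ^ n)"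
      by (simp add: q_def power_divide power_mult_distrib)
    also have "\<dots> \<le> (a 0 ^ 2 ^ n * a (2 ^ n) / a 0) / ((R + e) ^ 2 ^ n * a 0 ^ 2 ^ n)"
      using iter[of n] a0 Re by (intro divide_right_mono) (simp_all add: field_simps)
    also have "\<dots> = a (2 ^ n) / (a 0 * (R + e) ^ 2 ^ n)" using a0 Re by (simp add: field_simps)
    also have "\<dots> \<le> (K * R ^ 2 ^ n) / (a 0 * (R + e) ^ 2 ^ n)"
      using bd[of "2 ^ n"] a0 Re by (intro divide_right_mono) (simp_all add: a_def)
    also have "\<dots> \<le> K / a 0"
    proof -
      have "K \<ge> 0" using bd[of 0] order_trans[OF hnorm_nonneg] by simp
      moreover have "R ^ 2 ^ n \<le> (R + e) ^ 2 ^ n" using R e by (intro power_mono) simp_all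
      ultimately have "K * R ^ 2 ^ n \<le> K * (R + e) ^ 2 ^ n" by (intro mult_left_mono)
      then show ?thesis using a0 Re by (simp add: field_simps)
    qed
    finally show False using n by simp
  qed
  then have "a 1 \<le> R * a 0 + e" if "e > 0" for e
  proof (cases "a 0 = 0")
    case True
    then show ?thesis using \<open>\<And>e. e > 0 \<Longrightarrow> a 1 \<le> (R + e) * a 0\<close>[OF that] that by simp
  next
    case False
    then have "a 0 > 0" using a_nonneg[of 0] by simp
    then show ?thesis using \<open>\<And>e. e > 0 \<Longrightarrow> a 1 \<le> (R + e) * a 0\<close>[of "e / a 0"] that
      by (simp add: algebra_simps)
  qed
  then have "a 1 \<le> R * a 0" by (rule field_le_epsilon)
  then show ?thesis by (simp add: a_def)
qed

end

locale hilb = prehilb V for V :: "('b::unital_cstar_algebra, 'v) bimod" +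
  assumes inn_definite: "u \<in> elems V \<Longrightarrow> inn V u u = 0 \<Longrightarrow> u = hzero V"
    and cauchy_limit: "x \<in> cauchy_seqs V \<Longrightarrow> \<exists>l\<in>elems V. (\<lambda>n. hnorm V (hminus V (x n) l)) \<longlonglongrightarrow> 0"
begin

lemma inn_eqI:
  assumes "u \<in> elems V" "v \<in> elems V" "\<And>z. z \<in> elems V \<Longrightarrow> inn V z u = inn V z v"
  shows "u = v"
proof -
  have "inn V (hminus V u v) (hminus V u v) = 0"
    using assms(3)[of "hminus V u v"] assms(1,2) by (simp add: inn_hminus_right)
  then have "hminus V u v = hzero V" using assms by (intro inn_definite) auto
  then show ?thesis by (rule hminus_eq_zero_imp[OF assms(1,2)])
qed

lemma hnorm_eq_0: "u \<in> elems V \<Longrightarrow> hnorm V u = 0 \<Longrightarrow> u = hzero V"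
  by (rule inn_definite) (simp_all add: hnorm_def)

lemma lact_add_left: "v \<in> elems V \<Longrightarrow> lact V (b + c) v = hadd V (lact V b v) (lact V c v)"
  by (rule inn_eqI) (simp_all add: inn_lact_add inn_simps)

lemma lact_mult: "v \<in> elems V \<Longrightarrow> lact V (b * c) v = lact V b (lact V c v)"
  by (rule inn_eqI) (simp_all add: inn_lact_mult)

lemma lact_one: "v \<in> elems V \<Longrightarrow> lact V 1 v = v"
  by (rule inn_eqI) (simp_all add: inn_lact_one)

lemma lact_scalar: "v \<in> elems V \<Longrightarrow> lact V (scalar z) v = ract V v (scalar z)"
  by (rule inn_eqI) (simp_all add: inn_lact_scalar inn_ract)

lemma inn_lact_right: "u \<in> elems V \<Longrightarrow> v \<in> elems V \<Longrightarrow> inn V u (lact V b v) = inn V (lact V (star b) u) v"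
  by (simp add: inn_lact star_star)

lemma lact_add_right: "u \<in> elems V \<Longrightarrow> v \<in> elems V \<Longrightarrow> lact V b (hadd V u v) = hadd V (lact V b u) (lact V b v)"
  by (rule inn_eqI) (simp_all add: inn_lact_right inn_simps)

lemma lact_ract: "u \<in> elems V \<Longrightarrow> lact V b (ract V u c) = ract V (lact V b u) c"
  by (rule inn_eqI) (simp_all add: inn_lact_right inn_simps)

lemma lact_zero_left: "v \<in> elems V \<Longrightarrow> lact V 0 v = hzero V"
  using lact_scalar[of v 0] by (simp add: scaleC_zero_left ract_zero)

lemma lact_zero_right: "lact V b (hzero V) = hzero V"
  by (rule inn_eqI) (simp_all add: inn_lact_right)

lemma ract_zero_left: "ract V (hzero V) b = hzero V"
  by (rule inn_eqI) (simp_all add: inn_ract)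

end

subsection \<open>Separation-completion\<close>

context prehilb
begin

lemma cauchy_seqs_iff: "x \<in> cauchy_seqs V \<longleftrightarrow> (\<forall>n. x n \<in> elems V) \<and>
    (\<forall>\<epsilon>>0. \<exists>M. \<forall>m\<ge>M. \<forall>n\<ge>M. hnorm V (hminus V (x m) (x n)) < \<epsilon>)"
  by (auto simp: cauchy_seqs_def)

lemma cauchy_elem [simp]: "x \<in> cauchy_seqs V \<Longrightarrow> x n \<in> elems V"
  by (simp add: cauchy_seqs_iff)

lemma cauchy_const: "v \<in> elems V \<Longrightarrow> (\<lambda>_. v) \<in> cauchy_seqs V"
  by (simp add: cauchy_seqs_iff hminus_self)

lemma cauchy_seqsD:
  "x \<in> cauchy_seqs V \<Longrightarrow> \<epsilon> > 0 \<Longrightarrow> \<exists>M. \<forall>m\<ge>M. \<forall>n\<ge>M. hnorm V (hminus V (x m) (x n)) < \<epsilon>"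
  by (simp add: cauchy_seqs_iff)

lemma cauchy_lipschitz:
  assumes "x \<in> cauchy_seqs V" "\<And>n. y n \<in> elems V"
    and "\<And>m n. hnorm V (hminus V (y m) (y n)) \<le> C * hnorm V (hminus V (x m) (x n))" "C \<ge> 0"
  shows "y \<in> cauchy_seqs V"
  unfolding cauchy_seqs_iff
proof (intro conjI allI impI)
  fix \<epsilon> :: real assume \<epsilon>: "\<epsilon> > 0"
  then have "\<epsilon> / (C + 1) > 0" using assms(4) by simp
  then obtain M where M: "\<And>m n. m \<ge> M \<Longrightarrow> n \<ge> M \<Longrightarrow> hnorm V (hminus V (x m) (x n)) < \<epsilon> / (C + 1)"
    using cauchy_seqsD[OF assms(1)] by blast
  have "hnorm V (hminus V (y m) (y n)) < \<epsilon>" if "m \<ge> M" "n \<ge> M" for m n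
  proof -
    have "hnorm V (hminus V (y m) (y n)) \<le> C * hnorm V (hminus V (x m) (x n))" by (rule assms(3))
    also have "\<dots> \<le> C * (\<epsilon> / (C + 1))" using M[OF that] assms(4) by (intro mult_left_mono) auto
    also have "\<dots> < \<epsilon>" using assms(4) \<epsilon> by (simp add: field_simps)
    finally show ?thesis .
  qed
  then show "\<exists>M. \<forall>m\<ge>M. \<forall>n\<ge>M. hnorm V (hminus V (y m) (y n)) < \<epsilon>" by blast
qed (rule assms(2))

lemma hnorm_hminus_add:
  assumes "u \<in> elems V" "v \<in> elems V" "u' \<in> elems V" "v' \<in> elems V"
  shows "hnorm V (hminus V (hadd V u v) (hadd V u' v')) \<le> hnorm V (hminus V u u') + hnorm V (hminus V v v')"
proof -
  have "hnorm V (hminus V (hadd V u v) (hadd V u' v')) = hnorm V (hadd V (hminus V u u') (hminus V v v'))"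
    using assms by (intro hnorm_eqI) (simp add: inn_simps algebra_simps)
  also have "\<dots> \<le> hnorm V (hminus V u u') + hnorm V (hminus V v v')"
    using assms by (intro hnorm_triangle) auto
  finally show ?thesis .
qed

lemma cauchy_add:
  assumes "x \<in> cauchy_seqs V" "y \<in> cauchy_seqs V"
  shows "(\<lambda>n. hadd V (x n) (y n)) \<in> cauchy_seqs V"
  unfolding cauchy_seqs_iff
proof (intro conjI allI impI)
  fix \<epsilon> :: real assume "\<epsilon> > 0"
  then have "\<epsilon> / 2 > 0" by simp
  obtain M1 where M1: "\<And>m n. m \<ge> M1 \<Longrightarrow> n \<ge> M1 \<Longrightarrow> hnorm V (hminus V (x m) (x n)) < \<epsilon> / 2"
    using cauchy_seqsD[OF assms(1) \<open>\<epsilon> / 2 > 0\<close>] by blast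
  obtain M2 where M2: "\<And>m n. m \<ge> M2 \<Longrightarrow> n \<ge> M2 \<Longrightarrow> hnorm V (hminus V (y m) (y n)) < \<epsilon> / 2"
    using cauchy_seqsD[OF assms(2) \<open>\<epsilon> / 2 > 0\<close>] by blast
  have "hnorm V (hminus V (hadd V (x m) (y m)) (hadd V (x n) (y n))) < \<epsilon>"
    if "m \<ge> max M1 M2" "n \<ge> max M1 M2" for m n
  proof -
    have "hnorm V (hminus V (x m) (x n)) < \<epsilon> / 2" "hnorm V (hminus V (y m) (y n)) < \<epsilon> / 2"
      using that M1[of m n] M2[of m n] by simp_all
    then show ?thesis using hnorm_hminus_add[of "x m" "y m" "x n" "y n"] assms by simp
  qed
  then show "\<exists>M. \<forall>m\<ge>M. \<forall>n\<ge>M. hnorm V (hminus V (hadd V (x m) (y m)) (hadd V (x n) (y n))) < \<epsilon>"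
    by blast
qed (use assms in auto)

lemma hnorm_hminus_ract:
  assumes "u \<in> elems V" "v \<in> elems V"
  shows "hnorm V (hminus V (ract V u b) (ract V v b)) \<le> norm b * hnorm V (hminus V u v)"
proof -
  have "hnorm V (hminus V (ract V u b) (ract V v b)) = hnorm V (ract V (hminus V u v) b)"
    using assms by (intro hnorm_eqI) (simp add: inn_simps algebra_simps)
  also have "\<dots> \<le> hnorm V (hminus V u v) * norm b" using assms by (intro hnorm_ract) auto
  finally show ?thesis by (simp add: mult.commute)
qed

lemma cauchy_ract: "x \<in> cauchy_seqs V \<Longrightarrow> (\<lambda>n. ract V (x n) b) \<in> cauchy_seqs V"
  by (rule cauchy_lipschitz[of x _ "norm b"]) (auto simp: hnorm_hminus_ract)

lemma cauchy_hminus: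
  "x \<in> cauchy_seqs V \<Longrightarrow> y \<in> cauchy_seqs V \<Longrightarrow> (\<lambda>n. hminus V (x n) (y n)) \<in> cauchy_seqs V"
  unfolding hminus_def by (intro cauchy_add cauchy_ract)

definition sim :: "(nat \<Rightarrow> 'v) \<Rightarrow> (nat \<Rightarrow> 'v) \<Rightarrow> bool" where
  "sim x y \<longleftrightarrow> (\<lambda>n. hnorm V (hminus V (x n) (y n))) \<longlonglongrightarrow> 0"

lemma sim_refl: "x \<in> cauchy_seqs V \<Longrightarrow> sim x x"
  by (simp add: sim_def hminus_self)

lemma sim_sym:
  assumes "x \<in> cauchy_seqs V" "y \<in> cauchy_seqs V" "sim x y"
  shows "sim y x"
proof -
  have "hnorm V (hminus V (y n) (x n)) = hnorm V (hminus V (x n) (y n))" for n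
    using assms by (intro hnorm_hminus_commute) auto
  then show ?thesis using assms(3) unfolding sim_def by (simp only:)
qed

lemma sim_boundI:
  assumes "sim x y" "\<And>n. hnorm V (hminus V (x' n) (y' n)) \<le> C * hnorm V (hminus V (x n) (y n))"
  shows "sim x' y'"
  unfolding sim_def
proof (rule Lim_null_comparison)
  show "(\<lambda>n. C * hnorm V (hminus V (x n) (y n))) \<longlonglongrightarrow> 0"
    using tendsto_mult_right_zero[OF assms(1)[unfolded sim_def]] .
qed (simp add: assms(2))

lemma sim_trans:
  assumes "x \<in> cauchy_seqs V" "y \<in> cauchy_seqs V" "z \<in> cauchy_seqs V" "sim x y" "sim y z"
  shows "sim x z"
  unfolding sim_def
proof (rule Lim_null_comparison)
  show "(\<lambda>n. hnorm V (hminus V (x n) (y n)) + hnorm V (hminus V (y n) (z n))) \<longlonglongrightarrow> 0"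
    using tendsto_add_zero[OF assms(4,5)[unfolded sim_def]] .
qed (use assms in \<open>simp add: hnorm_hminus_triangle\<close>)

lemma sim_add:
  assumes "x \<in> cauchy_seqs V" "y \<in> cauchy_seqs V" "x' \<in> cauchy_seqs V" "y' \<in> cauchy_seqs V" "sim x x'" "sim y y'"
  shows "sim (\<lambda>n. hadd V (x n) (y n)) (\<lambda>n. hadd V (x' n) (y' n))"
  unfolding sim_def
proof (rule Lim_null_comparison)
  show "(\<lambda>n. hnorm V (hminus V (x n) (x' n)) + hnorm V (hminus V (y n) (y' n))) \<longlonglongrightarrow> 0"
    using tendsto_add_zero[OF assms(5,6)[unfolded sim_def]] .
qed (use assms in \<open>simp add: hnorm_hminus_add\<close>)

lemma mem_cls_iff: "y \<in> cls V x \<longleftrightarrow> x \<in> cauchy_seqs V \<and> y \<in> cauchy_seqs V \<and> sim x y"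
  by (auto simp: cls_def null_rel_def sim_def)

lemma cls_eqI:
  assumes "x \<in> cauchy_seqs V" "y \<in> cauchy_seqs V" "sim x y"
  shows "cls V x = cls V y"
proof (rule Set.set_eqI)
  fix z
  have "sim y x" by (rule sim_sym[OF assms])
  then show "z \<in> cls V x \<longleftrightarrow> z \<in> cls V y"
    using assms sim_trans[of y x z] sim_trans[of x y z] by (auto simp: mem_cls_iff)
qed

lemma repr_cls:
  assumes "x \<in> cauchy_seqs V"
  shows "repr (cls V x) \<in> cauchy_seqs V" "sim x (repr (cls V x))"
proof -
  have "repr (cls V x) \<in> cls V x"
    unfolding repr_def by (rule someI[of "\<lambda>y. y \<in> cls V x" x]) (simp add: mem_cls_iff assms sim_refl)
  then show "repr (cls V x) \<in> cauchy_seqs V" "sim x (repr (cls V x))" by (simp_all add: mem_cls_iff)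
qed

lemma elems_completion: "elems (completion V) = cls V ` cauchy_seqs V"
  by (auto simp: completion_def quotient_def cls_def)

lemma cls_closed: "x \<in> cauchy_seqs V \<Longrightarrow> cls V x \<in> elems (completion V)"
  by (simp add: elems_completion)

lemma completionE:
  assumes "c \<in> elems (completion V)"
  obtains x where "x \<in> cauchy_seqs V" "c = cls V x"
  using assms by (auto simp: elems_completion)

lemma hzero_completion: "hzero (completion V) = cls V (\<lambda>_. hzero V)"
  by (simp add: completion_def)

lemma hadd_cls:
  assumes "x \<in> cauchy_seqs V" "y \<in> cauchy_seqs V"
  shows "hadd (completion V) (cls V x) (cls V y) = cls V (\<lambda>n. hadd V (x n) (y n))"
proof -
  have "hadd (completion V) (cls V x) (cls V y)
      = cls V (\<lambda>n. hadd V (repr (cls V x) n) (repr (cls V y) n))" by (simp add: completion_def)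
  also have "\<dots> = cls V (\<lambda>n. hadd V (x n) (y n))"
    using assms repr_cls[OF assms(1)] repr_cls[OF assms(2)]
    by (intro cls_eqI[symmetric] cauchy_add sim_add) auto
  finally show ?thesis .
qed

lemma ract_cls:
  assumes "x \<in> cauchy_seqs V"
  shows "ract (completion V) (cls V x) b = cls V (\<lambda>n. ract V (x n) b)"
proof -
  have "ract (completion V) (cls V x) b = cls V (\<lambda>n. ract V (repr (cls V x) n) b)" by (simp add: completion_def)
  also have "\<dots> = cls V (\<lambda>n. ract V (x n) b)"
  proof (rule cls_eqI[symmetric])
    show "sim (\<lambda>n. ract V (x n) b) (\<lambda>n. ract V (repr (cls V x) n) b)"
      by (rule sim_boundI[OF repr_cls(2)[OF assms], of _ _ "norm b"])
        (use assms repr_cls(1)[OF assms] in \<open>simp add: hnorm_hminus_ract\<close>)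
  qed (use assms repr_cls[OF assms] in \<open>simp_all add: cauchy_ract\<close>)
  finally show ?thesis .
qed

lemma hminus_cls:
  assumes "x \<in> cauchy_seqs V" "y \<in> cauchy_seqs V"
  shows "hminus (completion V) (cls V x) (cls V y) = cls V (\<lambda>n. hminus V (x n) (y n))"
  unfolding hminus_def using assms by (simp add: ract_cls hadd_cls cauchy_ract)

text \<open>Operators on the completion are induced by functions with a formal adjoint that are
  bounded for the seminorm; such functions are linear up to null vectors.\<close>

definition adj_pair :: "('v \<Rightarrow> 'v) \<Rightarrow> ('v \<Rightarrow> 'v) \<Rightarrow> real \<Rightarrow> bool" where
  "adj_pair t t' C \<longleftrightarrow> (\<forall>u\<in>elems V. t u \<in> elems V \<and> t' u \<in> elems V) \<and> C \<ge> 0 \<and>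
     (\<forall>u\<in>elems V. \<forall>v\<in>elems V. inn V (t u) v = inn V u (t' v)) \<and>
     (\<forall>u\<in>elems V. hnorm V (t u) \<le> C * hnorm V u)"

lemma adj_pairD:
  assumes "adj_pair t t' C"
  shows "u \<in> elems V \<Longrightarrow> t u \<in> elems V" "u \<in> elems V \<Longrightarrow> t' u \<in> elems V" "C \<ge> 0"
    "u \<in> elems V \<Longrightarrow> v \<in> elems V \<Longrightarrow> inn V (t u) v = inn V u (t' v)"
    "u \<in> elems V \<Longrightarrow> v \<in> elems V \<Longrightarrow> inn V u (t v) = inn V (t' u) v"
    "u \<in> elems V \<Longrightarrow> hnorm V (t u) \<le> C * hnorm V u"
proof -
  show "u \<in> elems V \<Longrightarrow> v \<in> elems V \<Longrightarrow> inn V u (t v) = inn V (t' u) v"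
    using assms star_inn[of "t v" u] star_inn[of v "t' u"] by (simp add: adj_pair_def)
qed (use assms in \<open>auto simp: adj_pair_def\<close>)

text \<open>The square of \<open>hnorm V (t' u)\<close> is the norm of
  \<open>inn V (t (t' u)) u\<close>, so Cauchy-Schwarz and the bound for \<open>t\<close> give the
  same bound for \<open>t'\<close>.\<close>

lemma adj_pair_sym:
  assumes "adj_pair t t' C"
  shows "adj_pair t' t C"
proof -
  note D = adj_pairD[OF assms]
  have "hnorm V (t' u) \<le> C * hnorm V u" if u: "u \<in> elems V" for u
  proof -
    have "(hnorm V (t' u))\<^sup>2 = norm (inn V (t (t' u)) u)" using u D by (simp add: hnorm_sq)
    also have "\<dots> \<le> hnorm V (t (t' u)) * hnorm V u" using u D by (intro cauchy_schwarz) auto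
    also have "\<dots> \<le> (C * hnorm V (t' u)) * hnorm V u" using u D by (intro mult_right_mono) auto
    finally have "hnorm V (t' u) * hnorm V (t' u) \<le> (C * hnorm V u) * hnorm V (t' u)"
      by (simp add: power2_eq_square mult_ac)
    then show ?thesis using D(3) by (cases "hnorm V (t' u) = 0") (auto simp: mult_le_cancel_right order.strict_iff_order)
  qed
  then show ?thesis using D unfolding adj_pair_def by auto
qed

text \<open>Additivity of \<open>t\<close> is available only up to null vectors:
  \<open>t u - t v\<close> and \<open>t (u - v)\<close> have the same inner products, as moving
  \<open>t\<close> to the other side shows.\<close>

lemma adj_pair_lipschitz:
  assumes "adj_pair t t' C" "u \<in> elems V" "v \<in> elems V"
  shows "hnorm V (hminus V (t u) (t v)) \<le> C * hnorm V (hminus V u v)"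
proof -
  note D = adj_pairD[OF assms(1)]
  have "eqv (hminus V (t u) (t v)) (t (hminus V u v))"
    using assms(2,3) D(1,2) by (simp add: eqv_def D(5) inn_hminus_right)
  then have "hnorm V (hminus V (t u) (t v)) = hnorm V (t (hminus V u v))"
    by (rule eqv_hnorm) (use assms(2,3) D(1) in auto)
  then show ?thesis using D(6)[of "hminus V u v"] assms(2,3) by simp
qed

lemma adj_pair_cauchy:
  assumes "adj_pair t t' C" "x \<in> cauchy_seqs V"
  shows "(\<lambda>n. t (x n)) \<in> cauchy_seqs V"
proof (rule cauchy_lipschitz[OF assms(2)])
  show "t (x n) \<in> elems V" for n using assms(2) by (intro adj_pairD(1)[OF assms(1)]) simp
  show "hnorm V (hminus V (t (x m)) (t (x n))) \<le> C * hnorm V (hminus V (x m) (x n))" for m n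
    using assms(2) by (intro adj_pair_lipschitz[OF assms(1)]) auto
qed (rule adj_pairD(3)[OF assms(1)])

lemma adj_pair_repr:
  assumes "adj_pair t t' C" "x \<in> cauchy_seqs V"
  shows "cls V (\<lambda>n. t (repr (cls V x) n)) = cls V (\<lambda>n. t (x n))"
proof (rule cls_eqI[symmetric])
  show "sim (\<lambda>n. t (x n)) (\<lambda>n. t (repr (cls V x) n))"
    by (rule sim_boundI[OF repr_cls(2)[OF assms(2)]], rule adj_pair_lipschitz[OF assms(1)])
      (use assms(2) repr_cls(1)[OF assms(2)] in auto)
qed (intro adj_pair_cauchy[OF assms(1)] assms(2) repr_cls)+

lemma adj_pair_lact: "adj_pair (lact V b) (lact V (star b)) (norm b)"
  by (auto simp: adj_pair_def inn_lact hnorm_lact)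

lemma lact_cls:
  "x \<in> cauchy_seqs V \<Longrightarrow> lact (completion V) b (cls V x) = cls V (\<lambda>n. lact V b (x n))"
  using adj_pair_repr[OF adj_pair_lact] by (simp add: completion_def)

lemma cauchy_lact: "x \<in> cauchy_seqs V \<Longrightarrow> (\<lambda>n. lact V b (x n)) \<in> cauchy_seqs V"
  by (rule adj_pair_cauchy[OF adj_pair_lact])

lemma cauchy_hnorm_convergent:
  assumes "x \<in> cauchy_seqs V"
  shows "convergent (\<lambda>n. hnorm V (x n))"
proof -
  have "Cauchy (\<lambda>n. hnorm V (x n))"
    unfolding Cauchy_def dist_real_def
  proof (intro allI impI)
    fix e :: real assume "e > 0"
    then obtain M where M: "\<forall>m\<ge>M. \<forall>n\<ge>M. hnorm V (hminus V (x m) (x n)) < e"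
      using cauchy_seqsD[OF assms] by blast
    have "\<bar>hnorm V (x m) - hnorm V (x n)\<bar> < e" if "m \<ge> M" "n \<ge> M" for m n
      using hnorm_diff_le[of "x m" "x n"] assms M that by (meson cauchy_elem le_less_trans)
    then show "\<exists>M. \<forall>m\<ge>M. \<forall>n\<ge>M. \<bar>hnorm V (x m) - hnorm V (x n)\<bar> < e" by blast
  qed
  then show ?thesis by (simp add: Cauchy_convergent_iff)
qed

lemma cauchy_bounded:
  assumes "x \<in> cauchy_seqs V"
  obtains K where "K > 0" "\<And>n. hnorm V (x n) \<le> K"
proof -
  have "Bseq (\<lambda>n. hnorm V (x n))" using cauchy_hnorm_convergent[OF assms] by (rule convergent_imp_Bseq)
  then show ?thesis using that unfolding Bseq_def by auto
qed

lemma inn_convergent: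
  assumes "x \<in> cauchy_seqs V" "y \<in> cauchy_seqs V"
  shows "convergent (\<lambda>n. inn V (x n) (y n))"
proof -
  obtain K where K: "K > 0" "\<And>n. hnorm V (x n) \<le> K" using cauchy_bounded[OF assms(1)] by metis
  obtain L where L: "L > 0" "\<And>n. hnorm V (y n) \<le> L" using cauchy_bounded[OF assms(2)] by metis
  have "Cauchy (\<lambda>n. inn V (x n) (y n))"
    unfolding Cauchy_def dist_norm
  proof (intro allI impI)
    fix e :: real assume e: "e > 0"
    have "e / (2 * L) > 0" "e / (2 * K) > 0" using e K(1) L(1) by auto
    obtain M1 where M1: "\<And>m n. m \<ge> M1 \<Longrightarrow> n \<ge> M1 \<Longrightarrow> hnorm V (hminus V (x m) (x n)) < e / (2 * L)"
      using cauchy_seqsD[OF assms(1) \<open>e / (2 * L) > 0\<close>] by blast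
    obtain M2 where M2: "\<And>m n. m \<ge> M2 \<Longrightarrow> n \<ge> M2 \<Longrightarrow> hnorm V (hminus V (y m) (y n)) < e / (2 * K)"
      using cauchy_seqsD[OF assms(2) \<open>e / (2 * K) > 0\<close>] by blast
    have "norm (inn V (x m) (y m) - inn V (x n) (y n)) < e" if "m \<ge> max M1 M2" "n \<ge> max M1 M2" for m n
    proof -
      have *: "hnorm V (hminus V (x m) (x n)) < e / (2 * L)" "hnorm V (hminus V (y m) (y n)) < e / (2 * K)"
        using that M1[of m n] M2[of m n] by simp_all
      have "hnorm V (hminus V (x m) (x n)) * hnorm V (y m) \<le> e / (2 * L) * L"
        using less_imp_le[OF *(1)] L(2)[of m] L(1) e by (intro mult_mono) auto
      moreover have "hnorm V (hminus V (y m) (y n)) * K < e / (2 * K) * K"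
        using *(2) K(1) by (rule mult_strict_right_mono)
      moreover have "hnorm V (x n) * hnorm V (hminus V (y m) (y n)) \<le> hnorm V (hminus V (y m) (y n)) * K"
        using K(2)[of n] by (subst mult.commute) (intro mult_left_mono, simp_all)
      moreover have "e / (2 * L) * L = e / 2" "e / (2 * K) * K = e / 2" using K(1) L(1) by simp_all
      moreover have "norm (inn V (x m) (y m) - inn V (x n) (y n))
          \<le> hnorm V (hminus V (x m) (x n)) * hnorm V (y m) + hnorm V (x n) * hnorm V (hminus V (y m) (y n))"
        using assms by (intro inn_diff_le) auto
      ultimately show ?thesis by linarith
    qed
    then show "\<exists>M. \<forall>m\<ge>M. \<forall>n\<ge>M. norm (inn V (x m) (y m) - inn V (x n) (y n)) < e" by blast
  qed
  then show ?thesis by (simp add: Cauchy_convergent_iff)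
qed

lemma inn_cls:
  assumes "x \<in> cauchy_seqs V" "y \<in> cauchy_seqs V"
  shows "(\<lambda>n. inn V (x n) (y n)) \<longlonglongrightarrow> inn (completion V) (cls V x) (cls V y)"
proof -
  let ?x = "repr (cls V x)" and ?y = "repr (cls V y)"
  note rx = repr_cls[OF assms(1)] and ry = repr_cls[OF assms(2)]
  have l: "(\<lambda>n. inn V (?x n) (?y n)) \<longlonglongrightarrow> inn (completion V) (cls V x) (cls V y)"
    using inn_convergent[OF rx(1) ry(1)] by (simp add: completion_def convergent_LIMSEQ_iff)
  obtain K where K: "K > 0" "\<And>n. hnorm V (?x n) \<le> K" using cauchy_bounded[OF rx(1)] by metis
  obtain L where L: "L > 0" "\<And>n. hnorm V (y n) \<le> L" using cauchy_bounded[OF assms(2)] by metis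
  have "(\<lambda>n. inn V (x n) (y n) - inn V (?x n) (?y n)) \<longlonglongrightarrow> 0"
  proof (rule Lim_null_comparison)
    show "(\<lambda>n. hnorm V (hminus V (x n) (?x n)) * L + K * hnorm V (hminus V (y n) (?y n))) \<longlonglongrightarrow> 0"
      using rx(2) ry(2) unfolding sim_def
      by (intro tendsto_add_zero tendsto_mult_left_zero tendsto_mult_right_zero)
    show "\<forall>\<^sub>F n in sequentially. norm (inn V (x n) (y n) - inn V (?x n) (?y n))
        \<le> hnorm V (hminus V (x n) (?x n)) * L + K * hnorm V (hminus V (y n) (?y n))"
    proof (intro always_eventually allI)
      fix n
      have "norm (inn V (x n) (y n) - inn V (?x n) (?y n))
          \<le> hnorm V (hminus V (x n) (?x n)) * hnorm V (y n) + hnorm V (?x n) * hnorm V (hminus V (y n) (?y n))"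
        using assms rx(1) ry(1) by (intro inn_diff_le) auto
      also have "\<dots> \<le> hnorm V (hminus V (x n) (?x n)) * L + K * hnorm V (hminus V (y n) (?y n))"
        using K(2) L(2) by (intro add_mono mult_left_mono mult_right_mono) auto
      finally show "norm (inn V (x n) (y n) - inn V (?x n) (?y n))
          \<le> hnorm V (hminus V (x n) (?x n)) * L + K * hnorm V (hminus V (y n) (?y n))" .
    qed
  qed
  from tendsto_add[OF this l] show ?thesis by simp
qed

lemma hnorm_cls:
  assumes "x \<in> cauchy_seqs V"
  shows "(\<lambda>n. hnorm V (x n)) \<longlonglongrightarrow> hnorm (completion V) (cls V x)"
  unfolding hnorm_def by (intro tendsto_intros inn_cls assms)

lemma inn_cls_eqI:
  assumes "x \<in> cauchy_seqs V" "y \<in> cauchy_seqs V" "(\<lambda>n. inn V (x n) (y n)) \<longlonglongrightarrow> l"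
  shows "inn (completion V) (cls V x) (cls V y) = l"
  using inn_cls[OF assms(1,2)] assms(3) by (rule LIMSEQ_unique)

lemma prehilb_completion: "prehilb (completion V)"
proof
  note cs = cauchy_add cauchy_ract cauchy_lact cauchy_const
  note ev = hzero_completion hadd_cls ract_cls lact_cls
  fix c d e :: "(nat \<Rightarrow> 'v) set" and a b :: 'b and z :: complex
  show "hzero (completion V) \<in> elems (completion V)"
    by (simp add: hzero_completion cls_closed cauchy_const)
  assume "c \<in> elems (completion V)"
  then obtain x where x: "x \<in> cauchy_seqs V" "c = cls V x" by (rule completionE)
  show "lact (completion V) b c \<in> elems (completion V)" "ract (completion V) c b \<in> elems (completion V)"
    "hadd (completion V) (hzero (completion V)) c = c"
    "ract (completion V) c (a + b) = hadd (completion V) (ract (completion V) c a) (ract (completion V) c b)"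
    "ract (completion V) c (a * b) = ract (completion V) (ract (completion V) c a) b"
    "ract (completion V) c 1 = c" "ract (completion V) c 0 = hzero (completion V)"
    using x(1) by (simp_all add: x(2) ev cs cls_closed add_zero ract_add_right ract_mult ract_one ract_zero)
  show "pos (inn (completion V) c c)"
    using x by (auto intro!: pos_tendsto[OF _ inn_cls] inn_pos)
  assume "d \<in> elems (completion V)"
  then obtain y where y: "y \<in> cauchy_seqs V" "d = cls V y" by (rule completionE)
  show "hadd (completion V) c d = hadd (completion V) d c"
  proof -
    have "(\<lambda>n. hadd V (x n) (y n)) = (\<lambda>n. hadd V (y n) (x n))"
      using x(1) y(1) by (intro ext add_comm) auto
    then show ?thesis by (simp only: x(2) y(2) hadd_cls[OF x(1) y(1)] hadd_cls[OF y(1) x(1)])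
  qed
  show "hadd (completion V) c d \<in> elems (completion V)"
    "ract (completion V) (hadd (completion V) c d) b = hadd (completion V) (ract (completion V) c b) (ract (completion V) d b)"
    using x(1) y(1) by (simp_all add: x(2) y(2) ev cs cls_closed ract_add_left)
  note xy = inn_cls[OF x(1) y(1), folded x(2) y(2)]
  have yx: "(\<lambda>n. inn V (y n) (x n)) \<longlonglongrightarrow> inn (completion V) d c"
    using inn_cls[OF y(1) x(1)] by (simp add: x(2) y(2))
  show "inn (completion V) c (ract (completion V) d b) = inn (completion V) c d * b"
    using x y tendsto_mult_right[OF xy, of b] by (simp add: ev cs inn_cls_eqI inn_ract)
  show "star (inn (completion V) c d) = inn (completion V) d c"
  proof (rule LIMSEQ_unique[OF tendsto_star[OF xy]])
    show "(\<lambda>n. star (inn V (x n) (y n))) \<longlonglongrightarrow> inn (completion V) d c"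
      using x(1) y(1) yx by (simp add: star_inn)
  qed
  have lb_tendsto: "(\<lambda>n. inn V (x n) (lact V b (y n))) \<longlonglongrightarrow> inn (completion V) c (lact (completion V) b d)" for b
    unfolding x(2) y(2) lact_cls[OF y(1)] by (rule inn_cls[OF x(1) cauchy_lact[OF y(1)]])
  show "inn (completion V) (lact (completion V) b c) d = inn (completion V) c (lact (completion V) (star b) d)"
  proof -
    have "(\<lambda>n. inn V (lact V b (x n)) (y n)) \<longlonglongrightarrow> inn (completion V) c (lact (completion V) (star b) d)"
      using lb_tendsto[of "star b"] x(1) y(1) by (simp add: inn_lact)
    then show ?thesis unfolding x(2) y(2) lact_cls[OF x(1)]
      by (intro inn_cls_eqI[OF cauchy_lact[OF x(1)] y(1)])
  qed
  show "inn (completion V) c (lact (completion V) (a + b) d)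
      = inn (completion V) c (lact (completion V) a d) + inn (completion V) c (lact (completion V) b d)"
  proof (rule LIMSEQ_unique[OF lb_tendsto])
    show "(\<lambda>n. inn V (x n) (lact V (a + b) (y n)))
      \<longlonglongrightarrow> inn (completion V) c (lact (completion V) a d) + inn (completion V) c (lact (completion V) b d)"
      using tendsto_add[OF lb_tendsto[of a] lb_tendsto[of b]] x(1) y(1) by (simp add: inn_lact_add)
  qed
  show "inn (completion V) c (lact (completion V) (a * b) d)
      = inn (completion V) c (lact (completion V) a (lact (completion V) b d))"
  proof (rule LIMSEQ_unique[OF lb_tendsto])
    have "(\<lambda>n. inn V (x n) (lact V a (lact V b (y n)))) \<longlonglongrightarrow> inn (completion V) (cls V x) (cls V (\<lambda>n. lact V a (lact V b (y n))))"
      by (rule inn_cls[OF x(1) cauchy_lact[OF cauchy_lact[OF y(1)]]])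
    then show "(\<lambda>n. inn V (x n) (lact V (a * b) (y n)))
      \<longlonglongrightarrow> inn (completion V) c (lact (completion V) a (lact (completion V) b d))"
      using x(1) y(1) by (simp add: inn_lact_mult x(2) y(2) lact_cls cauchy_lact)
  qed
  show "inn (completion V) c (lact (completion V) 1 d) = inn (completion V) c d"
  proof (rule LIMSEQ_unique[OF lb_tendsto])
    show "(\<lambda>n. inn V (x n) (lact V 1 (y n))) \<longlonglongrightarrow> inn (completion V) c d"
      using xy x(1) y(1) by (simp add: inn_lact_one)
  qed
  show "inn (completion V) c (lact (completion V) (scalar z) d) = inn (completion V) c d * scalar z"
  proof (rule LIMSEQ_unique[OF lb_tendsto])
    show "(\<lambda>n. inn V (x n) (lact V (scalar z) (y n))) \<longlonglongrightarrow> inn (completion V) c d * scalar z"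
      using tendsto_mult_right[OF xy, of "scalar z"] x(1) y(1) by (simp add: inn_lact_scalar)
  qed
  assume "e \<in> elems (completion V)"
  then obtain w where w: "w \<in> cauchy_seqs V" "e = cls V w" by (rule completionE)
  show "hadd (completion V) (hadd (completion V) c d) e = hadd (completion V) c (hadd (completion V) d e)"
    using x(1) y(1) w(1) by (simp add: x(2) y(2) w(2) ev cs add_assoc)
  have xw: "(\<lambda>n. inn V (x n) (w n)) \<longlonglongrightarrow> inn (completion V) c e"
    using inn_cls[OF x(1) w(1)] by (simp add: x(2) w(2))
  show "inn (completion V) c (hadd (completion V) d e) = inn (completion V) c d + inn (completion V) c e"
    using x y w tendsto_add[OF xy xw] by (simp add: ev cs inn_cls_eqI inn_add_right)
qed

lemma emb_closed: "v \<in> elems V \<Longrightarrow> emb V v \<in> elems (completion V)"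
  by (simp add: emb_def cls_closed cauchy_const)

lemma inn_emb: "u \<in> elems V \<Longrightarrow> v \<in> elems V \<Longrightarrow> inn (completion V) (emb V u) (emb V v) = inn V u v"
  unfolding emb_def by (rule inn_cls_eqI) (auto simp: cauchy_const)

lemma hnorm_emb: "v \<in> elems V \<Longrightarrow> hnorm (completion V) (emb V v) = hnorm V v"
  by (simp add: hnorm_def inn_emb)

lemma emb_add: "u \<in> elems V \<Longrightarrow> v \<in> elems V \<Longrightarrow> emb V (hadd V u v) = hadd (completion V) (emb V u) (emb V v)"
  by (simp add: emb_def hadd_cls cauchy_const)

lemma emb_ract: "u \<in> elems V \<Longrightarrow> emb V (ract V u b) = ract (completion V) (emb V u) b"
  by (simp add: emb_def ract_cls cauchy_const)

lemma emb_lact: "u \<in> elems V \<Longrightarrow> emb V (lact V b u) = lact (completion V) b (emb V u)"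
  by (simp add: emb_def lact_cls cauchy_const)

lemma emb_hminus: "u \<in> elems V \<Longrightarrow> v \<in> elems V \<Longrightarrow> emb V (hminus V u v) = hminus (completion V) (emb V u) (emb V v)"
  by (simp add: hminus_def emb_add emb_ract)

lemma emb_zero: "emb V (hzero V) = hzero (completion V)"
  by (simp add: emb_def hzero_completion)

lemma emb_eqI: "eqv u v \<Longrightarrow> u \<in> elems V \<Longrightarrow> v \<in> elems V \<Longrightarrow> emb V u = emb V v"
  unfolding emb_def by (intro cls_eqI) (simp_all add: cauchy_const sim_def eqv_hnorm_hminus)

lemma emb_tendsto:
  assumes "x \<in> cauchy_seqs V"
  shows "(\<lambda>n. hnorm (completion V) (hminus (completion V) (emb V (x n)) (cls V x))) \<longlonglongrightarrow> 0"
proof (rule LIMSEQ_I)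
  fix r :: real assume "r > 0"
  then have "r / 2 > 0" by simp
  obtain M where M: "\<And>m n. m \<ge> M \<Longrightarrow> n \<ge> M \<Longrightarrow> hnorm V (hminus V (x m) (x n)) < r / 2"
    using cauchy_seqsD[OF assms \<open>r / 2 > 0\<close>] by blast
  have "hnorm (completion V) (hminus (completion V) (emb V (x n)) (cls V x)) \<le> r / 2" if "n \<ge> M" for n
  proof (rule LIMSEQ_le_const2)
    show "(\<lambda>m. hnorm V (hminus V (x n) (x m))) \<longlonglongrightarrow> hnorm (completion V) (hminus (completion V) (emb V (x n)) (cls V x))"
      using hnorm_cls[OF cauchy_hminus[OF cauchy_const assms]] assms
      by (simp add: emb_def hminus_cls cauchy_const)
    show "\<exists>N. \<forall>m\<ge>N. hnorm V (hminus V (x n) (x m)) \<le> r / 2"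
      using M[OF that] by (intro exI[of _ M]) (auto intro: less_imp_le)
  qed
  then show "\<exists>no. \<forall>n\<ge>no. norm (hnorm (completion V) (hminus (completion V) (emb V (x n)) (cls V x)) - 0) < r"
    using \<open>r > 0\<close> by (intro exI[of _ M]) (fastforce simp: hnorm_def)
qed

lemma emb_dense:
  assumes "c \<in> elems (completion V)" "r > 0"
  obtains v where "v \<in> elems V" "hnorm (completion V) (hminus (completion V) (emb V v) c) < r"
proof -
  obtain x where x: "x \<in> cauchy_seqs V" "c = cls V x" using assms(1) by (rule completionE)
  obtain n where "norm (hnorm (completion V) (hminus (completion V) (emb V (x n)) c) - 0) < r"
    using LIMSEQ_D[OF emb_tendsto[OF x(1)] assms(2)] x(2) by blast
  then show ?thesis using x(1) by (intro that[of "x n"]) auto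
qed

text \<open>A Cauchy sequence of classes is approximated by embedded vectors \<open>v n\<close>, the
  \<open>n\<close>-th within \<open>1 / (n + 1)\<close>. The \<open>v n\<close> form a Cauchy
  sequence in \<open>V\<close>, and its class is the limit.\<close>

lemma hilb_completion: "hilb (completion V)"
proof -
  interpret C: prehilb "completion V" by (rule prehilb_completion)
  show ?thesis
  proof
    fix c assume c: "c \<in> elems (completion V)" "inn (completion V) c c = 0"
    then obtain x where x: "x \<in> cauchy_seqs V" "c = cls V x" by (rule_tac completionE)
    have "sim x (\<lambda>_. hzero V)"
    proof -
      have "(\<lambda>n. hnorm V (x n)) \<longlonglongrightarrow> 0" using hnorm_cls[OF x(1)] c(2) x(2) by (simp add: hnorm_def)
      moreover have "hnorm V (hminus V (x n) (hzero V)) = hnorm V (x n)" for n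
        using x(1) by (intro hnorm_eqI) (simp add: inn_simps)
      ultimately show ?thesis by (simp add: sim_def)
    qed
    then show "c = hzero (completion V)"
      using x by (simp add: hzero_completion cls_eqI cauchy_const)
  next
    fix c assume c: "c \<in> cauchy_seqs (completion V)"
    have "\<exists>v\<in>elems V. hnorm (completion V) (hminus (completion V) (emb V v) (c n)) < inverse (Suc n)" for n
      using emb_dense[of "c n" "inverse (Suc n)"] c C.cauchy_elem by (metis inverse_positive_iff_positive of_nat_0_less_iff zero_less_Suc)
    then obtain v where v: "\<And>n. v n \<in> elems V"
        "\<And>n. hnorm (completion V) (hminus (completion V) (emb V (v n)) (c n)) < inverse (Suc n)" by metis
    have vc: "v \<in> cauchy_seqs V"
      unfolding cauchy_seqs_iff
    proof (intro conjI allI impI v(1))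
      fix \<epsilon> :: real assume \<epsilon>: "\<epsilon> > 0"
      then have "\<epsilon> / 3 > 0" by simp
      obtain M where M: "\<And>m n. m \<ge> M \<Longrightarrow> n \<ge> M \<Longrightarrow> hnorm (completion V) (hminus (completion V) (c m) (c n)) < \<epsilon> / 3"
        using C.cauchy_seqsD[OF c \<open>\<epsilon> / 3 > 0\<close>] by blast
      obtain K where K: "inverse (Suc K) < \<epsilon> / 3" using reals_Archimedean[OF \<open>\<epsilon> / 3 > 0\<close>] by blast
      have "hnorm V (hminus V (v m) (v n)) < \<epsilon>" if mn: "m \<ge> max M K" "n \<ge> max M K" for m n
      proof -
        have small: "hnorm (completion V) (hminus (completion V) (emb V (v k)) (c k)) < \<epsilon> / 3" if "k \<ge> max M K" for k
        proof -
          have "inverse (Suc k) \<le> inverse (real (Suc K))" using that by (simp add: le_imp_inverse_le)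
          then show ?thesis using v(2)[of k] K by linarith
        qed
        have "hnorm V (hminus V (v m) (v n)) = hnorm (completion V) (hminus (completion V) (emb V (v m)) (emb V (v n)))"
          using v(1) by (simp add: emb_hminus[symmetric] hnorm_emb)
        also have "\<dots> \<le> hnorm (completion V) (hminus (completion V) (emb V (v m)) (c m))
            + hnorm (completion V) (hminus (completion V) (c m) (emb V (v n)))"
          using v(1) c by (intro C.hnorm_hminus_triangle) (auto simp: emb_closed C.cauchy_elem)
        also have "hnorm (completion V) (hminus (completion V) (c m) (emb V (v n)))
            \<le> hnorm (completion V) (hminus (completion V) (c m) (c n)) + hnorm (completion V) (hminus (completion V) (c n) (emb V (v n)))"
          using v(1) c by (intro C.hnorm_hminus_triangle) (auto simp: emb_closed C.cauchy_elem)
        also have "hnorm (completion V) (hminus (completion V) (c n) (emb V (v n)))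
            = hnorm (completion V) (hminus (completion V) (emb V (v n)) (c n))"
          using v(1) c by (intro C.hnorm_hminus_commute) (auto simp: emb_closed C.cauchy_elem)
        finally show ?thesis using small[OF mn(1)] small[OF mn(2)] M[of m n] mn by simp
      qed
      then show "\<exists>M. \<forall>m\<ge>M. \<forall>n\<ge>M. hnorm V (hminus V (v m) (v n)) < \<epsilon>" by blast
    qed
    have "(\<lambda>n. hnorm (completion V) (hminus (completion V) (c n) (cls V v))) \<longlonglongrightarrow> 0"
    proof (rule Lim_null_comparison)
      show "(\<lambda>n. inverse (real (Suc n)) + hnorm (completion V) (hminus (completion V) (emb V (v n)) (cls V v))) \<longlonglongrightarrow> 0"
        by (intro tendsto_add_zero LIMSEQ_inverse_real_of_nat emb_tendsto vc)
      show "\<forall>\<^sub>F n in sequentially. norm (hnorm (completion V) (hminus (completion V) (c n) (cls V v)))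
          \<le> inverse (real (Suc n)) + hnorm (completion V) (hminus (completion V) (emb V (v n)) (cls V v))"
      proof (intro always_eventually allI)
        fix n
        have "hnorm (completion V) (hminus (completion V) (c n) (cls V v))
          \<le> hnorm (completion V) (hminus (completion V) (c n) (emb V (v n))) + hnorm (completion V) (hminus (completion V) (emb V (v n)) (cls V v))"
          using v(1) c vc by (intro C.hnorm_hminus_triangle) (auto simp: emb_closed cls_closed C.cauchy_elem)
        moreover have "hnorm (completion V) (hminus (completion V) (c n) (emb V (v n)))
            = hnorm (completion V) (hminus (completion V) (emb V (v n)) (c n))"
          using v(1) c by (intro C.hnorm_hminus_commute) (auto simp: emb_closed C.cauchy_elem)
        ultimately show "norm (hnorm (completion V) (hminus (completion V) (c n) (cls V v)))
          \<le> inverse (real (Suc n)) + hnorm (completion V) (hminus (completion V) (emb V (v n)) (cls V v))"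
          using v(2)[of n] by simp
      qed
    qed
    then show "\<exists>l\<in>elems (completion V). (\<lambda>n. hnorm (completion V) (hminus (completion V) (c n) l)) \<longlonglongrightarrow> 0"
      using cls_closed[OF vc] by blast
  qed
qed

definition extend :: "('v \<Rightarrow> 'v) \<Rightarrow> (nat \<Rightarrow> 'v) set \<Rightarrow> (nat \<Rightarrow> 'v) set" where
  "extend t = (\<lambda>c\<in>elems (completion V). cls V (\<lambda>n. t (repr c n)))"

lemma extend_cls:
  "adj_pair t t' C \<Longrightarrow> x \<in> cauchy_seqs V \<Longrightarrow> extend t (cls V x) = cls V (\<lambda>n. t (x n))"
  using adj_pair_repr[of t t' C x] by (simp add: extend_def cls_closed)

lemma extend_emb:
  assumes "adj_pair t t' C" "v \<in> elems V"
  shows "extend t (emb V v) = emb V (t v)"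
  unfolding emb_def by (rule extend_cls[OF assms(1) cauchy_const[OF assms(2)]])

lemma extend_closed:
  assumes "adj_pair t t' C" "c \<in> elems (completion V)"
  shows "extend t c \<in> elems (completion V)"
proof -
  obtain x where x: "x \<in> cauchy_seqs V" "c = cls V x" using assms(2) by (rule completionE)
  then show ?thesis using extend_cls[OF assms(1)] adj_pair_cauchy[OF assms(1)] by (simp add: cls_closed)
qed

lemma extend_bound:
  assumes "adj_pair t t' C" "c \<in> elems (completion V)"
  shows "hnorm (completion V) (extend t c) \<le> C * hnorm (completion V) c"
proof -
  obtain x where x: "x \<in> cauchy_seqs V" "c = cls V x" using assms(2) by (rule completionE)
  have "(\<lambda>n. hnorm V (t (x n))) \<longlonglongrightarrow> hnorm (completion V) (extend t c)"
    using hnorm_cls[OF adj_pair_cauchy[OF assms(1) x(1)]] extend_cls[OF assms(1) x(1)] x(2) by simp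
  moreover have "(\<lambda>n. C * hnorm V (x n)) \<longlonglongrightarrow> C * hnorm (completion V) c"
    using hnorm_cls[OF x(1)] x(2) by (intro tendsto_mult_left) simp
  ultimately show ?thesis
    by (rule LIMSEQ_le) (use adj_pairD(6)[OF assms(1)] x(1) in auto)
qed

lemma extend_adjoint:
  assumes "adj_pair t t' C" "c \<in> elems (completion V)" "d \<in> elems (completion V)"
  shows "inn (completion V) (extend t c) d = inn (completion V) c (extend t' d)"
proof -
  obtain x where x: "x \<in> cauchy_seqs V" "c = cls V x" using assms(2) by (rule completionE)
  obtain y where y: "y \<in> cauchy_seqs V" "d = cls V y" using assms(3) by (rule completionE)
  note s = adj_pair_sym[OF assms(1)]
  have "(\<lambda>n. inn V (x n) (t' (y n))) \<longlonglongrightarrow> inn (completion V) c (extend t' d)"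
    using inn_cls[OF x(1) adj_pair_cauchy[OF s y(1)]] extend_cls[OF s y(1)] x y by simp
  then show ?thesis
    using x y extend_cls[OF assms(1) x(1)] adj_pair_cauchy[OF assms(1) x(1)] adj_pairD(4)[OF assms(1)]
    by (simp add: inn_cls_eqI)
qed

end

subsection \<open>Adjointable operators\<close>

context hilb
begin

text \<open>Where the inner product is definite, a function with a formal adjoint is automatically
  linear.\<close>

lemma adj_pair_additive:
  assumes "adj_pair t t' C" "u \<in> elems V" "v \<in> elems V"
  shows "t (hadd V u v) = hadd V (t u) (t v)"
proof -
  note D = adj_pairD[OF assms(1)]
  show ?thesis
  proof (rule inn_eqI)
    fix z assume "z \<in> elems V"
    then show "inn V z (t (hadd V u v)) = inn V z (hadd V (t u) (t v))"
      using assms(2,3) D(1,2) by (simp add: D(5) inn_add_right)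
  qed (use assms(2,3) D(1) in auto)
qed

lemma adj_pair_ract:
  assumes "adj_pair t t' C" "u \<in> elems V"
  shows "t (ract V u b) = ract V (t u) b"
proof -
  note D = adj_pairD[OF assms(1)]
  show ?thesis
  proof (rule inn_eqI)
    fix z assume "z \<in> elems V"
    then show "inn V z (t (ract V u b)) = inn V z (ract V (t u) b)"
      using assms(2) D(1,2) by (simp add: D(5) inn_ract)
  qed (use assms(2) D(1) in auto)
qed

lemma adjointableI:
  assumes "adj_pair T S C" "T \<in> extensional (elems V)"
  shows "T \<in> adjointable V"
  unfolding adjointable_def
proof (intro CollectI conjI)
  note D = adj_pairD[OF assms(1)]
  show "T \<in> elems V \<rightarrow>\<^sub>E elems V" using assms(2) D(1) by (auto simp: PiE_def)
  show "\<exists>S\<in>elems V \<rightarrow> elems V. \<forall>h\<in>elems V. \<forall>k\<in>elems V. inn V (T h) k = inn V h (S k)"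
    using D(2,4) by (intro bexI[of _ S]) auto
  show "\<exists>C\<ge>0. \<forall>h\<in>elems V. hnorm V (T h) \<le> C * hnorm V h" using D(3,6) by blast
qed (use adj_pair_additive[OF assms(1)] adj_pair_ract[OF assms(1)] in auto)

lemma restrict_adjointable:
  assumes "adj_pair t t' C"
  shows "restrict t (elems V) \<in> adjointable V"
  by (rule adjointableI[of _ t' C]) (use assms in \<open>auto simp: adj_pair_def\<close>)

lemma adjointableE:
  assumes "T \<in> adjointable V"
  obtains S C where "adj_pair T S C"
proof -
  have "\<exists>C\<ge>0. \<forall>h\<in>elems V. hnorm V (T h) \<le> C * hnorm V h" using assms by (simp add: adjointable_def)
  then obtain C where C: "C \<ge> 0" "\<forall>h\<in>elems V. hnorm V (T h) \<le> C * hnorm V h" by (elim exE conjE)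
  have "\<exists>S\<in>elems V \<rightarrow> elems V. \<forall>h\<in>elems V. \<forall>k\<in>elems V. inn V (T h) k = inn V h (S k)"
    using assms by (simp add: adjointable_def)
  then obtain S where S: "S \<in> elems V \<rightarrow> elems V" "\<forall>h\<in>elems V. \<forall>k\<in>elems V. inn V (T h) k = inn V h (S k)"
    by (elim bexE)
  have "T \<in> elems V \<rightarrow> elems V" using assms by (auto simp: adjointable_def)
  then have "adj_pair T S C"
    unfolding adj_pair_def using S C by (intro conjI ballI) auto
  then show ?thesis by (rule that)
qed

lemma op_closed: "T \<in> adjointable V \<Longrightarrow> h \<in> elems V \<Longrightarrow> T h \<in> elems V"
  by (auto simp: adjointable_def)

lemma op_add: "T \<in> adjointable V \<Longrightarrow> h \<in> elems V \<Longrightarrow> k \<in> elems V \<Longrightarrow> T (hadd V h k) = hadd V (T h) (T k)"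
  by (auto simp: adjointable_def)

lemma op_ract: "T \<in> adjointable V \<Longrightarrow> h \<in> elems V \<Longrightarrow> T (ract V h b) = ract V (T h) b"
  by (auto simp: adjointable_def)

lemma op_zero: "T \<in> adjointable V \<Longrightarrow> T (hzero V) = hzero V"
  using op_ract[of T "hzero V" 0] by (simp add: ract_zero op_closed)

lemma op_hminus: "T \<in> adjointable V \<Longrightarrow> h \<in> elems V \<Longrightarrow> k \<in> elems V \<Longrightarrow> T (hminus V h k) = hminus V (T h) (T k)"
  by (simp add: hminus_def op_add op_ract)

lemma op_eqI:
  assumes "S \<in> adjointable V" "T \<in> adjointable V" "\<And>h. h \<in> elems V \<Longrightarrow> S h = T h"
  shows "S = T"
  by (rule extensionalityI[of _ "elems V"]) (use assms in \<open>auto simp: adjointable_def PiE_def\<close>)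

lemma left_mult_apply [simp]: "h \<in> elems V \<Longrightarrow> left_mult V b h = lact V b h"
  by (simp add: left_mult_def)

lemma left_mult_adjointable: "left_mult V b \<in> adjointable V"
  unfolding left_mult_def by (rule restrict_adjointable[OF adj_pair_lact])

end

lemma (in prehilb) extend_adj_pair:
  assumes "adj_pair t t' C"
  shows "prehilb.adj_pair (completion V) (extend t) (extend t') C"
proof -
  interpret C: hilb "completion V" by (rule hilb_completion)
  show ?thesis
    unfolding C.adj_pair_def
    using extend_closed[OF assms] extend_closed[OF adj_pair_sym[OF assms]] extend_adjoint[OF assms]
      extend_bound[OF assms] adj_pairD(3)[OF assms] by blast
qed

lemma (in prehilb) extend_adjointable:
  assumes "adj_pair t t' C"
  shows "extend t \<in> adjointable (completion V)"
proof -
  interpret C: hilb "completion V" by (rule hilb_completion)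
  show ?thesis
    by (rule C.adjointableI[OF extend_adj_pair[OF assms]]) (simp add: extend_def)
qed

text \<open>\<open>A\<close> has the operations of \<open>Lop V\<close>, with addition unspecified off the carrier.\<close>

locale op_algebra = hilb V for V :: "('b::unital_cstar_algebra, 'v) bimod" +
  fixes A :: "('v \<Rightarrow> 'v) cstar_struct"
  assumes carrier_A: "carrier A = adjointable V"
    and mult_A: "mult A = mult (Lop V)" and one_A: "one A = one (Lop V)" and zero_A: "zero A = zero (Lop V)"
    and cscale_A: "cscale A = cscale (Lop V)" and adj_A: "adj A = adj (Lop V)"
    and cnorm_A: "cnorm A = cnorm (Lop V)"
    and add_A: "S \<in> adjointable V \<Longrightarrow> T \<in> adjointable V \<Longrightarrow> add A S T = add (Lop V) S T"
begin

lemma mult_apply [simp]: "h \<in> elems V \<Longrightarrow> (S \<otimes>\<^bsub>A\<^esub> T) h = S (T h)"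
  by (simp add: mult_A Lop_def compose_def)

lemma one_apply [simp]: "h \<in> elems V \<Longrightarrow> \<one>\<^bsub>A\<^esub> h = h"
  by (simp add: one_A Lop_def)

lemma zero_apply [simp]: "h \<in> elems V \<Longrightarrow> \<zero>\<^bsub>A\<^esub> h = hzero V"
  by (simp add: zero_A Lop_def)

lemma add_apply: "S \<in> adjointable V \<Longrightarrow> T \<in> adjointable V \<Longrightarrow> h \<in> elems V \<Longrightarrow> (S \<oplus>\<^bsub>A\<^esub> T) h = hadd V (S h) (T h)"
  by (simp add: add_A) (simp add: Lop_def)

lemma cscale_apply [simp]: "h \<in> elems V \<Longrightarrow> cscale A c T h = ract V (T h) (scalar c)"
  by (simp add: cscale_A Lop_def)

lemma one_adjointable: "\<one>\<^bsub>A\<^esub> \<in> adjointable V"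
proof -
  have "adj_pair (\<lambda>h. h) (\<lambda>h. h) 1" by (simp add: adj_pair_def)
  then show ?thesis unfolding one_A by (simp add: Lop_def restrict_adjointable)
qed

lemma zero_adjointable: "\<zero>\<^bsub>A\<^esub> \<in> adjointable V"
proof -
  have "adj_pair (\<lambda>h. hzero V) (\<lambda>h. hzero V) 0" by (simp add: adj_pair_def)
  then show ?thesis unfolding zero_A by (simp add: Lop_def restrict_adjointable)
qed

lemma adj_pair_mult:
  assumes "adj_pair S S' C" "adj_pair T T' D"
  shows "adj_pair (\<lambda>h. S (T h)) (\<lambda>h. T' (S' h)) (C * D)"
proof -
  note s = adj_pairD[OF assms(1)] and t = adj_pairD[OF assms(2)]
  have "hnorm V (S (T u)) \<le> C * D * hnorm V u" if "u \<in> elems V" for u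
  proof -
    have "hnorm V (S (T u)) \<le> C * hnorm V (T u)" by (rule s(6)[OF t(1)[OF that]])
    also have "\<dots> \<le> C * (D * hnorm V u)" by (rule mult_left_mono[OF t(6)[OF that] s(3)])
    finally show ?thesis by (simp add: mult.assoc)
  qed
  moreover have "inn V (S (T u)) v = inn V u (T' (S' v))" if "u \<in> elems V" "v \<in> elems V" for u v
    using s(4)[OF t(1)[OF that(1)] that(2)] t(4)[OF that(1) s(2)[OF that(2)]] by simp
  ultimately show ?thesis unfolding adj_pair_def using s(1-3) t(1-3) by (intro conjI ballI mult_nonneg_nonneg) simp_all
qed

lemma mult_adjointable:
  assumes "S \<in> adjointable V" "T \<in> adjointable V"
  shows "S \<otimes>\<^bsub>A\<^esub> T \<in> adjointable V"
proof -
  obtain S' C where S: "adj_pair S S' C" using assms(1) by (rule adjointableE)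
  obtain T' D where T: "adj_pair T T' D" using assms(2) by (rule adjointableE)
  show ?thesis using restrict_adjointable[OF adj_pair_mult[OF S T]] by (simp add: mult_A Lop_def compose_def)
qed

lemma add_adjointable:
  assumes "S \<in> adjointable V" "T \<in> adjointable V"
  shows "S \<oplus>\<^bsub>A\<^esub> T \<in> adjointable V"
proof -
  obtain S' C where S: "adj_pair S S' C" using assms(1) by (rule adjointableE)
  obtain T' D where T: "adj_pair T T' D" using assms(2) by (rule adjointableE)
  note s = adj_pairD[OF S] and t = adj_pairD[OF T]
  have "hnorm V (hadd V (S u) (T u)) \<le> (C + D) * hnorm V u" if "u \<in> elems V" for u
    using hnorm_triangle[OF s(1)[OF that] t(1)[OF that]] s(6)[OF that] t(6)[OF that] by (simp add: algebra_simps)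
  moreover have "inn V (hadd V (S u) (T u)) v = inn V u (hadd V (S' v) (T' v))" if "u \<in> elems V" "v \<in> elems V" for u v
    using that s(4)[OF that] t(4)[OF that] s(1)[OF that(1)] s(2)[OF that(2)] t(1)[OF that(1)] t(2)[OF that(2)]
    by (simp add: inn_add_left inn_add_right)
  ultimately have "adj_pair (\<lambda>h. hadd V (S h) (T h)) (\<lambda>h. hadd V (S' h) (T' h)) (C + D)"
    unfolding adj_pair_def using s(1-3) t(1-3) by auto
  then show ?thesis using restrict_adjointable add_A[OF assms] by (simp add: Lop_def)
qed

lemma star_scalar: "star (scalar c) = (scalar (cnj c) :: 'b)"
  by (simp add: star_scaleC star_one)

lemma mult_scalar: "x * scalar c = scaleC c (x :: 'b)" "scalar c * x = scaleC c (x :: 'b)"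
  by (simp_all add: mult_scaleC_right mult_scaleC_left)

lemma cscale_adjointable:
  assumes "T \<in> adjointable V"
  shows "cscale A c T \<in> adjointable V"
proof -
  obtain T' D where T: "adj_pair T T' D" using assms by (rule adjointableE)
  note t = adj_pairD[OF T]
  have "adj_pair (\<lambda>h. ract V (T h) (scalar c)) (\<lambda>h. ract V (T' h) (scalar (cnj c))) (cmod c * D)"
    unfolding adj_pair_def using t(1-4,6)
    by (auto simp: inn_ract inn_ract_left star_scalar mult_scalar hnorm_ract_scalar mult.assoc intro!: mult_left_mono)
  then show ?thesis using restrict_adjointable by (simp add: cscale_A Lop_def)
qed

lemma ring_A: "Ring.ring A"
proof (rule ringI)
  show "abelian_group A"
  proof (rule abelian_groupI)
    fix S assume S: "S \<in> carrier A"
    show "\<exists>T\<in>carrier A. T \<oplus>\<^bsub>A\<^esub> S = \<zero>\<^bsub>A\<^esub>"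
    proof
      show "cscale A (- 1) S \<in> carrier A" using S by (simp add: carrier_A cscale_adjointable)
      have m1: "scalar (- 1) = (- 1 :: 'b)" by (simp add: scaleC_minus_left scaleC_one)
      show "cscale A (- 1) S \<oplus>\<^bsub>A\<^esub> S = \<zero>\<^bsub>A\<^esub>"
        using S by (intro op_eqI add_adjointable zero_adjointable)
          (auto simp: carrier_A cscale_adjointable add_apply op_closed m1 add_comm[of "ract V _ _"] hminus_self[unfolded hminus_def])
    qed
  qed (auto simp: carrier_A add_adjointable zero_adjointable add_apply op_closed add_assoc add_zero intro!: op_eqI add_comm)
  show "Group.monoid A"
    by (rule Group.monoidI) (auto simp: carrier_A mult_adjointable one_adjointable op_closed intro!: op_eqI)
qed (auto simp: carrier_A mult_adjointable add_adjointable add_apply op_closed op_add intro!: op_eqI)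

sublocale Ring.ring A by (rule ring_A)

lemma neg_one: "scalar (- 1) = (- 1 :: 'b)"
  by (simp add: scaleC_minus_left scaleC_one)

lemma a_inv_A:
  assumes "T \<in> adjointable V"
  shows "\<ominus>\<^bsub>A\<^esub> T = cscale A (- 1) T"
proof (rule minus_equality)
  show "cscale A (- 1) T \<oplus>\<^bsub>A\<^esub> T = \<zero>\<^bsub>A\<^esub>"
    using assms by (intro op_eqI add_adjointable zero_adjointable)
      (auto simp: cscale_adjointable add_apply op_closed neg_one add_comm[of "ract V _ _"] hminus_self[unfolded hminus_def])
qed (use assms in \<open>auto simp: carrier_A cscale_adjointable\<close>)

lemma minus_apply:
  assumes "S \<in> adjointable V" "T \<in> adjointable V" "h \<in> elems V"
  shows "(S \<ominus>\<^bsub>A\<^esub> T) h = hminus V (S h) (T h)"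
  using assms by (simp add: a_minus_def a_inv_A add_apply cscale_adjointable neg_one hminus_def)

lemma minus_adjointable: "S \<in> adjointable V \<Longrightarrow> T \<in> adjointable V \<Longrightarrow> S \<ominus>\<^bsub>A\<^esub> T \<in> adjointable V"
  using minus_closed by (simp add: carrier_A)

text \<open>This settles the definite description in \<open>adj\<close>: the adjoint is unique
  because the inner product is definite and operators are \<open>undefined\<close> off the
  module.\<close>

lemma adj_props:
  assumes "T \<in> adjointable V"
  shows "adj A T \<in> adjointable V \<and> (\<forall>h\<in>elems V. \<forall>k\<in>elems V. inn V (T h) k = inn V h (adj A T k))"
proof -
  obtain T' D where T: "adj_pair T T' D" using assms by (rule adjointableE)
  note t = adj_pairD[OF T]
  have ex1: "\<exists>!S. S \<in> adjointable V \<and> (\<forall>h\<in>elems V. \<forall>k\<in>elems V. inn V (T h) k = inn V h (S k))"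
  proof (intro ex1I conjI)
    show "restrict T' (elems V) \<in> adjointable V" by (rule restrict_adjointable[OF adj_pair_sym[OF T]])
    show "\<forall>h\<in>elems V. \<forall>k\<in>elems V. inn V (T h) k = inn V h (restrict T' (elems V) k)"
      using t(4) by simp
    fix S assume S: "S \<in> adjointable V \<and> (\<forall>h\<in>elems V. \<forall>k\<in>elems V. inn V (T h) k = inn V h (S k))"
    show "S = restrict T' (elems V)"
    proof (rule op_eqI)
      fix k assume k: "k \<in> elems V"
      have "S k = T' k"
      proof (rule inn_eqI)
        fix z assume z: "z \<in> elems V"
        have "inn V (T z) k = inn V z (S k)" using S z k by blast
        then show "inn V z (S k) = inn V z (T' k)" using t(4)[OF z k] by simp
      qed (use S k t(2) op_closed in auto)
      then show "S k = restrict T' (elems V) k" using k by simp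
    qed (use S restrict_adjointable[OF adj_pair_sym[OF T]] in auto)
  qed
  have eq: "adj A T = (THE S. S \<in> adjointable V \<and> (\<forall>h\<in>elems V. \<forall>k\<in>elems V. inn V (T h) k = inn V h (S k)))"
    by (simp add: adj_A Lop_def)
  show ?thesis unfolding eq by (rule theI'[OF ex1])
qed

lemma adj_adjointable: "T \<in> adjointable V \<Longrightarrow> adj A T \<in> adjointable V"
  using adj_props by blast

lemma inn_adj: "T \<in> adjointable V \<Longrightarrow> h \<in> elems V \<Longrightarrow> k \<in> elems V \<Longrightarrow> inn V (T h) k = inn V h (adj A T k)"
  using adj_props by blast

lemma inn_adj_right: "T \<in> adjointable V \<Longrightarrow> h \<in> elems V \<Longrightarrow> k \<in> elems V \<Longrightarrow> inn V h (T k) = inn V (adj A T h) k"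
  using inn_adj[of T k h] star_inn[of "T k" h] star_inn[of k "adj A T h"] by (simp add: op_closed adj_adjointable)

lemma adj_eqI:
  assumes "T \<in> adjointable V" "S \<in> adjointable V"
    and "\<And>h k. h \<in> elems V \<Longrightarrow> k \<in> elems V \<Longrightarrow> inn V (T h) k = inn V h (S k)"
  shows "adj A T = S"
proof (rule op_eqI)
  fix k assume k: "k \<in> elems V"
  show "adj A T k = S k"
  proof (rule inn_eqI)
    fix z assume "z \<in> elems V"
    then show "inn V z (adj A T k) = inn V z (S k)"
      using inn_adj[OF assms(1), of z k] assms(3)[of z k] k by simp
  qed (use k assms adj_adjointable op_closed in auto)
qed (use assms adj_adjointable in auto)

lemma cnorm_def': "cnorm A T = Inf {C. C \<ge> 0 \<and> (\<forall>h\<in>elems V. hnorm V (T h) \<le> C * hnorm V h)}"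
  by (simp add: cnorm_A Lop_def)

lemma cnorm_le:
  assumes "C \<ge> 0" "\<And>h. h \<in> elems V \<Longrightarrow> hnorm V (T h) \<le> C * hnorm V h"
  shows "cnorm A T \<le> C"
  unfolding cnorm_def' by (rule cInf_lower) (use assms in \<open>auto intro!: bdd_belowI[of _ 0]\<close>)

lemma cnorm_set_nonempty:
  assumes "T \<in> adjointable V"
  shows "{C. C \<ge> 0 \<and> (\<forall>h\<in>elems V. hnorm V (T h) \<le> C * hnorm V h)} \<noteq> {}"
proof -
  have "\<exists>C\<ge>0. \<forall>h\<in>elems V. hnorm V (T h) \<le> C * hnorm V h" using assms by (simp add: adjointable_def)
  then show ?thesis by (elim exE) auto
qed

lemma cnorm_nonneg':
  assumes "T \<in> adjointable V"
  shows "cnorm A T \<ge> 0"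
  unfolding cnorm_def' by (rule cInf_greatest[OF cnorm_set_nonempty[OF assms]]) auto

lemma cnorm_bound:
  assumes "T \<in> adjointable V" "h \<in> elems V"
  shows "hnorm V (T h) \<le> cnorm A T * hnorm V h"
proof (cases "hnorm V h = 0")
  case True
  obtain C where "hnorm V (T h) \<le> C * hnorm V h" using cnorm_set_nonempty[OF assms(1)] assms(2) by blast
  then show ?thesis using True by simp
next
  case False
  then have pos: "hnorm V h > 0" using hnorm_nonneg[of h] by linarith
  have "hnorm V (T h) / hnorm V h \<le> cnorm A T"
    unfolding cnorm_def'
  proof (rule cInf_greatest[OF cnorm_set_nonempty[OF assms(1)]])
    fix C assume "C \<in> {C. C \<ge> 0 \<and> (\<forall>h\<in>elems V. hnorm V (T h) \<le> C * hnorm V h)}"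
    then have "hnorm V (T h) \<le> C * hnorm V h" using assms(2) by simp
    then show "hnorm V (T h) / hnorm V h \<le> C" using pos by (simp add: pos_divide_le_eq)
  qed
  then show ?thesis using pos by (simp add: pos_divide_le_eq)
qed

lemma cnorm_adj_pair:
  assumes "T \<in> adjointable V"
  shows "adj_pair T (adj A T) (cnorm A T)"
  unfolding adj_pair_def
  using op_closed[OF assms] op_closed[OF adj_adjointable[OF assms]] cnorm_nonneg'[OF assms]
    inn_adj[OF assms] cnorm_bound[OF assms] by simp

lemma cnorm_adj_le: "T \<in> adjointable V \<Longrightarrow> cnorm A (adj A T) \<le> cnorm A T"
  by (rule cnorm_le[OF cnorm_nonneg' adj_pairD(6)[OF adj_pair_sym[OF cnorm_adj_pair]]])

lemma cnorm_mult_le: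
  assumes "S \<in> adjointable V" "T \<in> adjointable V"
  shows "cnorm A (S \<otimes>\<^bsub>A\<^esub> T) \<le> cnorm A S * cnorm A T"
proof (rule cnorm_le)
  fix h assume h: "h \<in> elems V"
  show "hnorm V ((S \<otimes>\<^bsub>A\<^esub> T) h) \<le> cnorm A S * cnorm A T * hnorm V h"
    unfolding mult_apply[OF h]
    by (rule adj_pairD(6)[OF adj_pair_mult[OF cnorm_adj_pair[OF assms(1)] cnorm_adj_pair[OF assms(2)]] h])
qed (intro mult_nonneg_nonneg cnorm_nonneg' assms)

lemma cnorm_add_le:
  assumes "S \<in> adjointable V" "T \<in> adjointable V"
  shows "cnorm A (S \<oplus>\<^bsub>A\<^esub> T) \<le> cnorm A S + cnorm A T"
proof (rule cnorm_le)
  fix h assume h: "h \<in> elems V"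
  show "hnorm V ((S \<oplus>\<^bsub>A\<^esub> T) h) \<le> (cnorm A S + cnorm A T) * hnorm V h"
    using hnorm_triangle[OF op_closed[OF assms(1) h] op_closed[OF assms(2) h]]
      cnorm_bound[OF assms(1) h] cnorm_bound[OF assms(2) h]
    unfolding add_apply[OF assms h] comm_semiring_class.distrib by linarith
qed (use assms in \<open>simp add: cnorm_nonneg'\<close>)

lemma cnorm_eq_zero:
  assumes "T \<in> adjointable V"
  shows "cnorm A T = 0 \<longleftrightarrow> T = \<zero>\<^bsub>A\<^esub>"
proof
  assume 0: "cnorm A T = 0"
  show "T = \<zero>\<^bsub>A\<^esub>"
  proof (rule op_eqI[OF assms zero_adjointable])
    fix h assume h: "h \<in> elems V"
    have "hnorm V (T h) = 0" using cnorm_bound[OF assms h] 0 hnorm_nonneg[of "T h"] by simp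
    then show "T h = \<zero>\<^bsub>A\<^esub> h" using h assms by (simp add: hnorm_eq_0 op_closed)
  qed
next
  assume T: "T = \<zero>\<^bsub>A\<^esub>"
  have "cnorm A T \<le> 0" by (rule cnorm_le) (simp_all add: T)
  then show "cnorm A T = 0" using cnorm_nonneg'[OF assms] by simp
qed

lemma cnorm_cscale':
  assumes "T \<in> adjointable V"
  shows "cnorm A (cscale A c T) = cmod c * cnorm A T"
proof (cases "c = 0")
  case True
  have "cnorm A (cscale A c T) \<le> 0"
    by (rule cnorm_le) (use assms in \<open>simp_all add: True op_closed scaleC_zero_left ract_zero\<close>)
  then show ?thesis using cnorm_nonneg'[OF cscale_adjointable[OF assms, of c]] True by simp
next
  case False
  have le: "cnorm A (cscale A c T) \<le> cmod c * cnorm A T" if "T \<in> adjointable V" for c T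
  proof (rule cnorm_le)
    fix h assume h: "h \<in> elems V"
    show "hnorm V (cscale A c T h) \<le> cmod c * cnorm A T * hnorm V h"
      using cnorm_bound[OF that h] h that by (simp add: hnorm_ract_scalar op_closed mult.assoc mult_left_mono)
  qed (use that in \<open>simp add: cnorm_nonneg'\<close>)
  have T: "cscale A (inverse c) (cscale A c T) = T"
    using assms False by (intro op_eqI cscale_adjointable)
      (auto simp: op_closed ract_mult[symmetric] mult_scalar scaleC_scaleC scaleC_one ract_one)
  have "cnorm A T \<le> inverse (cmod c) * cnorm A (cscale A c T)"
    using le[OF cscale_adjointable[OF assms], of "inverse c" c] by (simp add: T norm_inverse)
  then have "cmod c * cnorm A T \<le> cnorm A (cscale A c T)"
    using False by (simp add: field_simps)
  then show ?thesis using le[OF assms] by (simp add: order_antisym)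
qed

lemma cnorm_cstar':
  assumes "T \<in> adjointable V"
  shows "cnorm A (adj A T \<otimes>\<^bsub>A\<^esub> T) = (cnorm A T)\<^sup>2"
proof (rule order_antisym)
  have "cnorm A (adj A T \<otimes>\<^bsub>A\<^esub> T) \<le> cnorm A (adj A T) * cnorm A T"
    using assms by (intro cnorm_mult_le adj_adjointable)
  also have "\<dots> \<le> cnorm A T * cnorm A T"
    using assms by (intro mult_right_mono cnorm_adj_le cnorm_nonneg')
  finally show "cnorm A (adj A T \<otimes>\<^bsub>A\<^esub> T) \<le> (cnorm A T)\<^sup>2" by (simp add: power2_eq_square)
  let ?N = "cnorm A (adj A T \<otimes>\<^bsub>A\<^esub> T)"
  have tt: "adj A T \<otimes>\<^bsub>A\<^esub> T \<in> adjointable V" using assms by (intro mult_adjointable adj_adjointable)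
  have N: "?N \<ge> 0" by (rule cnorm_nonneg'[OF tt])
  have "cnorm A T \<le> sqrt ?N"
  proof (rule cnorm_le)
    fix h assume h: "h \<in> elems V"
    have "(hnorm V (T h))\<^sup>2 = norm (inn V h ((adj A T \<otimes>\<^bsub>A\<^esub> T) h))"
      using h assms by (simp add: hnorm_sq inn_adj op_closed)
    also have "\<dots> \<le> hnorm V h * hnorm V ((adj A T \<otimes>\<^bsub>A\<^esub> T) h)"
      using h op_closed[OF tt h] by (rule cauchy_schwarz)
    also have "\<dots> \<le> hnorm V h * (?N * hnorm V h)"
      using cnorm_bound[OF tt h] by (intro mult_left_mono) auto
    also have "\<dots> = (sqrt ?N * hnorm V h)\<^sup>2" using N by (simp add: power_mult_distrib power2_eq_square[of "hnorm V h"])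
    finally show "hnorm V (T h) \<le> sqrt ?N * hnorm V h" by (rule power2_le_imp_le) (use N in simp)
  qed (use N in simp)
  then show "(cnorm A T)\<^sup>2 \<le> ?N"
    using cnorm_nonneg'[OF assms] N by (metis power_mono real_sqrt_pow2)
qed

lemma cnorm_minus_commute:
  assumes "S \<in> adjointable V" "T \<in> adjointable V"
  shows "cnorm A (S \<ominus>\<^bsub>A\<^esub> T) = cnorm A (T \<ominus>\<^bsub>A\<^esub> S)"
proof -
  have le: "cnorm A (S \<ominus>\<^bsub>A\<^esub> T) \<le> cnorm A (T \<ominus>\<^bsub>A\<^esub> S)" if st: "S \<in> adjointable V" "T \<in> adjointable V" for S T
  proof (rule cnorm_le)
    fix h assume h: "h \<in> elems V"
    have "hnorm V ((S \<ominus>\<^bsub>A\<^esub> T) h) = hnorm V ((T \<ominus>\<^bsub>A\<^esub> S) h)"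
      using hnorm_hminus_commute[OF op_closed[OF st(1) h] op_closed[OF st(2) h]]
      by (simp add: minus_apply[OF st h] minus_apply[OF st(2,1) h])
    then show "hnorm V ((S \<ominus>\<^bsub>A\<^esub> T) h) \<le> cnorm A (T \<ominus>\<^bsub>A\<^esub> S) * hnorm V h"
      using cnorm_bound[OF minus_adjointable[OF st(2,1)] h] by simp
  qed (intro cnorm_nonneg' minus_adjointable st)
  show ?thesis by (rule order_antisym[OF le[OF assms] le[OF assms(2,1)]])
qed

lemma cnorm_minus_triangle:
  assumes "R \<in> adjointable V" "S \<in> adjointable V" "T \<in> adjointable V"
  shows "cnorm A (R \<ominus>\<^bsub>A\<^esub> T) \<le> cnorm A (R \<ominus>\<^bsub>A\<^esub> S) + cnorm A (S \<ominus>\<^bsub>A\<^esub> T)"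
proof -
  have "R \<ominus>\<^bsub>A\<^esub> T = (R \<ominus>\<^bsub>A\<^esub> S) \<oplus>\<^bsub>A\<^esub> (S \<ominus>\<^bsub>A\<^esub> T)"
  proof (rule op_eqI)
    fix h assume h: "h \<in> elems V"
    have cl: "R h \<in> elems V" "S h \<in> elems V" "T h \<in> elems V" using h assms by (simp_all add: op_closed)
    show "(R \<ominus>\<^bsub>A\<^esub> T) h = ((R \<ominus>\<^bsub>A\<^esub> S) \<oplus>\<^bsub>A\<^esub> (S \<ominus>\<^bsub>A\<^esub> T)) h"
      using assms h cl
      by (intro inn_eqI) (auto simp: minus_apply add_apply minus_adjointable inn_add_right inn_hminus_right)
  qed (intro minus_adjointable add_adjointable assms)+
  then show ?thesis using assms by (simp add: cnorm_add_le minus_adjointable)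
qed

text \<open>Limits are taken pointwise. The adjoints form a Cauchy sequence too, since taking
  adjoints does not increase the norm, and their pointwise limit is an adjoint of the limit.\<close>

lemma cauchy_ops_limit:
  fixes \<sigma> :: "nat \<Rightarrow> 'v \<Rightarrow> 'v"
  assumes cl: "\<And>n. \<sigma> n \<in> adjointable V"
    and cauchy: "\<And>\<epsilon>. \<epsilon> > 0 \<Longrightarrow> \<exists>N. \<forall>m\<ge>N. \<forall>n\<ge>N. cnorm A (\<sigma> m \<ominus>\<^bsub>A\<^esub> \<sigma> n) < \<epsilon>"
  shows "\<exists>L\<in>adjointable V. \<forall>\<epsilon>>0. \<exists>N. \<forall>n\<ge>N. cnorm A (\<sigma> n \<ominus>\<^bsub>A\<^esub> L) < \<epsilon>"
proof -
  have pt: "\<exists>l\<in>elems V. (\<lambda>n. hnorm V (hminus V (\<tau> n h) l)) \<longlonglongrightarrow> 0"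
    if \<tau>: "\<And>n. \<tau> n \<in> adjointable V"
      and c: "\<And>\<epsilon>. \<epsilon> > 0 \<Longrightarrow> \<exists>N. \<forall>m\<ge>N. \<forall>n\<ge>N. cnorm A (\<tau> m \<ominus>\<^bsub>A\<^esub> \<tau> n) < \<epsilon>"
      and h: "h \<in> elems V" for \<tau> :: "nat \<Rightarrow> 'v \<Rightarrow> 'v" and h
  proof (rule cauchy_limit)
    show "(\<lambda>n. \<tau> n h) \<in> cauchy_seqs V"
      unfolding cauchy_seqs_iff
    proof (intro conjI allI impI)
      fix \<epsilon> :: real assume "\<epsilon> > 0"
      then have "\<epsilon> / (hnorm V h + 1) > 0" using add_nonneg_pos[OF hnorm_nonneg[of h] zero_less_one] by (rule divide_pos_pos)
      then obtain N where N: "\<forall>m\<ge>N. \<forall>n\<ge>N. cnorm A (\<tau> m \<ominus>\<^bsub>A\<^esub> \<tau> n) < \<epsilon> / (hnorm V h + 1)"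
        using c by blast
      have "hnorm V (hminus V (\<tau> m h) (\<tau> n h)) < \<epsilon>" if "m \<ge> N" "n \<ge> N" for m n
      proof -
        have "hnorm V (hminus V (\<tau> m h) (\<tau> n h)) \<le> cnorm A (\<tau> m \<ominus>\<^bsub>A\<^esub> \<tau> n) * hnorm V h"
          using cnorm_bound[OF minus_adjointable[OF \<tau> \<tau>] h, of m n] by (simp add: minus_apply \<tau> h)
        also have "\<dots> \<le> \<epsilon> / (hnorm V h + 1) * hnorm V h"
          using N that by (intro mult_right_mono[OF less_imp_le]) auto
        also have "\<dots> < \<epsilon>"
          using \<open>\<epsilon> > 0\<close> pos_divide_less_eq[OF add_nonneg_pos[OF hnorm_nonneg[of h] zero_less_one], of "\<epsilon> * hnorm V h" \<epsilon>]
          by (simp add: algebra_simps)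
        finally show ?thesis .
      qed
      then show "\<exists>M. \<forall>m\<ge>M. \<forall>n\<ge>M. hnorm V (hminus V (\<tau> m h) (\<tau> n h)) < \<epsilon>" by blast
    qed (use \<tau> h op_closed in auto)
  qed
  have adj_minus: "adj A (\<sigma> m) \<ominus>\<^bsub>A\<^esub> adj A (\<sigma> n) = adj A (\<sigma> m \<ominus>\<^bsub>A\<^esub> \<sigma> n)" for m n
    using cl by (intro adj_eqI[symmetric] minus_adjointable adj_adjointable)
      (auto simp: minus_apply adj_adjointable inn_hminus_left inn_hminus_right op_closed inn_adj)
  have cauchy': "\<exists>N. \<forall>m\<ge>N. \<forall>n\<ge>N. cnorm A (adj A (\<sigma> m) \<ominus>\<^bsub>A\<^esub> adj A (\<sigma> n)) < \<epsilon>" if "\<epsilon> > 0" for \<epsilon>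
    unfolding adj_minus using cauchy[OF that] cnorm_adj_le[OF minus_adjointable[OF cl cl]]
    by (meson le_less_trans)
  obtain L where L: "\<And>h. h \<in> elems V \<Longrightarrow> L h \<in> elems V"
      "\<And>h. h \<in> elems V \<Longrightarrow> (\<lambda>n. hnorm V (hminus V (\<sigma> n h) (L h))) \<longlonglongrightarrow> 0"
    using pt[OF cl cauchy] by metis
  obtain L' where L': "\<And>h. h \<in> elems V \<Longrightarrow> L' h \<in> elems V"
      "\<And>h. h \<in> elems V \<Longrightarrow> (\<lambda>n. hnorm V (hminus V (adj A (\<sigma> n) h) (L' h))) \<longlonglongrightarrow> 0"
    using pt[OF adj_adjointable[OF cl] cauchy'] by metis
  have inn_lim: "(\<lambda>n. inn V (x n) k) \<longlonglongrightarrow> inn V l k"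
    if "\<And>n. x n \<in> elems V" "l \<in> elems V" "k \<in> elems V" "(\<lambda>n. hnorm V (hminus V (x n) l)) \<longlonglongrightarrow> 0" for x l k
  proof (rule LIM_zero_cancel, rule Lim_null_comparison)
    show "(\<lambda>n. hnorm V (hminus V (x n) l) * hnorm V k) \<longlonglongrightarrow> 0"
      using tendsto_mult_left_zero[OF that(4)] .
    show "\<forall>\<^sub>F n in sequentially. norm (inn V (x n) k - inn V l k) \<le> hnorm V (hminus V (x n) l) * hnorm V k"
      using that cauchy_schwarz[of "hminus V (x _) l" k] by (intro always_eventually allI) (simp add: inn_hminus_left[symmetric])
  qed
  have inn_L: "inn V (L h) k = inn V h (L' k)" if hk: "h \<in> elems V" "k \<in> elems V" for h k
  proof (rule LIMSEQ_unique)
    show "(\<lambda>n. inn V (\<sigma> n h) k) \<longlonglongrightarrow> inn V (L h) k"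
      using cl hk L op_closed by (intro inn_lim) auto
    have "(\<lambda>n. inn V (adj A (\<sigma> n) k) h) \<longlonglongrightarrow> inn V (L' k) h"
      using cl hk L' op_closed adj_adjointable by (intro inn_lim) auto
    then have "(\<lambda>n. star (inn V (adj A (\<sigma> n) k) h)) \<longlonglongrightarrow> star (inn V (L' k) h)" by (rule tendsto_star)
    then show "(\<lambda>n. inn V (\<sigma> n h) k) \<longlonglongrightarrow> inn V h (L' k)"
    proof -
      have "star (inn V (adj A (\<sigma> n) k) h) = inn V (\<sigma> n h) k" for n
        using star_inn[OF op_closed[OF adj_adjointable[OF cl] hk(2)] hk(1)] inn_adj[OF cl hk] by simp
      moreover have "star (inn V (L' k) h) = inn V h (L' k)" by (rule star_inn[OF L'(1)[OF hk(2)] hk(1)])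
      ultimately show ?thesis using \<open>(\<lambda>n. star _) \<longlonglongrightarrow> _\<close> by simp
    qed
  qed
  have close: "hnorm V (hminus V (\<sigma> n h) (L h)) \<le> \<epsilon> * hnorm V h"
    if N: "\<forall>m\<ge>N. \<forall>n\<ge>N. cnorm A (\<sigma> m \<ominus>\<^bsub>A\<^esub> \<sigma> n) < \<epsilon>" and n: "n \<ge> N" and h: "h \<in> elems V" for \<epsilon> N n h
  proof -
    have "hnorm V (hminus V (\<sigma> n h) (L h)) \<le> \<epsilon> * hnorm V h + 0"
    proof (rule LIMSEQ_le_const)
    show "(\<lambda>m. \<epsilon> * hnorm V h + hnorm V (hminus V (\<sigma> m h) (L h))) \<longlonglongrightarrow> \<epsilon> * hnorm V h + 0"
      by (intro tendsto_add tendsto_const L(2) h)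
    show "\<exists>K. \<forall>m\<ge>K. hnorm V (hminus V (\<sigma> n h) (L h)) \<le> \<epsilon> * hnorm V h + hnorm V (hminus V (\<sigma> m h) (L h))"
    proof (intro exI allI impI)
      fix m assume m: "m \<ge> N"
      have "hnorm V (hminus V (\<sigma> n h) (\<sigma> m h)) \<le> cnorm A (\<sigma> n \<ominus>\<^bsub>A\<^esub> \<sigma> m) * hnorm V h"
        using cnorm_bound[OF minus_adjointable[OF cl cl] h, of n m] by (simp add: minus_apply cl h)
      also have "\<dots> \<le> \<epsilon> * hnorm V h"
        using N n m by (intro mult_right_mono[OF less_imp_le]) auto
      finally show "hnorm V (hminus V (\<sigma> n h) (L h)) \<le> \<epsilon> * hnorm V h + hnorm V (hminus V (\<sigma> m h) (L h))"
        using hnorm_hminus_triangle[of "\<sigma> n h" "\<sigma> m h" "L h"] cl h L(1) by (simp add: op_closed)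
    qed
    qed
    then show ?thesis by simp
  qed
  obtain N1 where N1: "\<forall>m\<ge>N1. \<forall>n\<ge>N1. cnorm A (\<sigma> m \<ominus>\<^bsub>A\<^esub> \<sigma> n) < 1" using cauchy[of 1] by auto
  have bound: "hnorm V (L h) \<le> (1 + cnorm A (\<sigma> N1)) * hnorm V h" if h: "h \<in> elems V" for h
  proof -
    have "\<bar>hnorm V (L h) - hnorm V (\<sigma> N1 h)\<bar> \<le> hnorm V (hminus V (L h) (\<sigma> N1 h))"
      by (rule hnorm_diff_le[OF L(1)[OF h] op_closed[OF cl h]])
    also have "\<dots> = hnorm V (hminus V (\<sigma> N1 h) (L h))"
      by (rule hnorm_hminus_commute[OF L(1)[OF h] op_closed[OF cl h]])
    also have "\<dots> \<le> 1 * hnorm V h" by (rule close[OF N1 order_refl h])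
    finally show ?thesis using cnorm_bound[OF cl h, of N1] by (simp add: algebra_simps)
  qed
  have "adj_pair L L' (1 + cnorm A (\<sigma> N1))"
    unfolding adj_pair_def using L(1) L'(1) inn_L bound cnorm_nonneg'[OF cl] by (auto simp: add_nonneg_nonneg)
  then have LL: "restrict L (elems V) \<in> adjointable V" by (rule restrict_adjointable)
  show ?thesis
  proof (intro bexI[OF _ LL] allI impI)
    fix \<epsilon> :: real assume e: "\<epsilon> > 0"
    then have "\<epsilon> / 2 > 0" by simp
    then obtain N where N: "\<forall>m\<ge>N. \<forall>n\<ge>N. cnorm A (\<sigma> m \<ominus>\<^bsub>A\<^esub> \<sigma> n) < \<epsilon> / 2" using cauchy by blast
    have "cnorm A (\<sigma> n \<ominus>\<^bsub>A\<^esub> restrict L (elems V)) < \<epsilon>" if "n \<ge> N" for n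
    proof -
      have "cnorm A (\<sigma> n \<ominus>\<^bsub>A\<^esub> restrict L (elems V)) \<le> \<epsilon> / 2"
        using close[OF N that] e by (intro cnorm_le) (simp_all add: minus_apply cl LL)
      then show ?thesis using e by simp
    qed
    then show "\<exists>N. \<forall>n\<ge>N. cnorm A (\<sigma> n \<ominus>\<^bsub>A\<^esub> restrict L (elems V)) < \<epsilon>" by blast
  qed
qed

end

lemma (in hilb) op_algebra_Lop: "op_algebra V (Lop V)"
  by unfold_locales (simp_all add: Lop_def)

context op_algebra
begin

lemma cscale_add_right': "S \<in> adjointable V \<Longrightarrow> T \<in> adjointable V \<Longrightarrow>
    cscale A c (S \<oplus>\<^bsub>A\<^esub> T) = cscale A c S \<oplus>\<^bsub>A\<^esub> cscale A c T"
  by (rule op_eqI) (simp_all add: cscale_adjointable add_adjointable add_apply op_closed ract_add_left)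

lemma cscale_add_left': "S \<in> adjointable V \<Longrightarrow> cscale A (c + d) S = cscale A c S \<oplus>\<^bsub>A\<^esub> cscale A d S"
  by (rule op_eqI) (simp_all add: cscale_adjointable add_adjointable add_apply op_closed ract_add_right scaleC_add_left)

lemma cscale_cscale': "S \<in> adjointable V \<Longrightarrow> cscale A c (cscale A d S) = cscale A (c * d) S"
  by (rule op_eqI) (simp_all add: cscale_adjointable op_closed ract_mult[symmetric] mult_scalar scaleC_scaleC mult.commute)

lemma cscale_one': "S \<in> adjointable V \<Longrightarrow> cscale A 1 S = S"
  by (rule op_eqI) (simp_all add: cscale_adjointable op_closed scaleC_one ract_one)

lemma mult_cscale_left': "S \<in> adjointable V \<Longrightarrow> T \<in> adjointable V \<Longrightarrow>
    cscale A c S \<otimes>\<^bsub>A\<^esub> T = cscale A c (S \<otimes>\<^bsub>A\<^esub> T)"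
  by (rule op_eqI) (simp_all add: cscale_adjointable mult_adjointable op_closed)

lemma mult_cscale_right': "S \<in> adjointable V \<Longrightarrow> T \<in> adjointable V \<Longrightarrow>
    S \<otimes>\<^bsub>A\<^esub> cscale A c T = cscale A c (S \<otimes>\<^bsub>A\<^esub> T)"
  by (rule op_eqI) (simp_all add: cscale_adjointable mult_adjointable op_closed op_ract)

lemma adj_add': "S \<in> adjointable V \<Longrightarrow> T \<in> adjointable V \<Longrightarrow> adj A (S \<oplus>\<^bsub>A\<^esub> T) = adj A S \<oplus>\<^bsub>A\<^esub> adj A T"
  by (rule adj_eqI) (simp_all add: add_adjointable adj_adjointable add_apply op_closed inn_add_left inn_add_right inn_adj)

lemma adj_cscale': "S \<in> adjointable V \<Longrightarrow> adj A (cscale A c S) = cscale A (cnj c) (adj A S)"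
  by (rule adj_eqI)
    (simp_all add: cscale_adjointable adj_adjointable op_closed inn_ract_left inn_ract inn_adj star_scalar mult_scalar)

lemma adj_mult': "S \<in> adjointable V \<Longrightarrow> T \<in> adjointable V \<Longrightarrow> adj A (S \<otimes>\<^bsub>A\<^esub> T) = adj A T \<otimes>\<^bsub>A\<^esub> adj A S"
  by (rule adj_eqI) (simp_all add: mult_adjointable adj_adjointable op_closed inn_adj)

lemma adj_adj': "S \<in> adjointable V \<Longrightarrow> adj A (adj A S) = S"
  by (rule adj_eqI) (simp_all add: adj_adjointable op_closed inn_adj_right)

lemma inn_finsum:
  assumes "finite F" "\<And>i. i \<in> F \<Longrightarrow> f i \<in> adjointable V" "h \<in> elems V" "z \<in> elems V"
  shows "inn V z ((\<Oplus>\<^bsub>A\<^esub>i\<in>F. f i) h) = (\<Sum>i\<in>F. inn V z (f i h))"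
  using assms(1,2)
proof (induction F rule: finite_induct)
  case empty
  then show ?case using assms by simp
next
  case (insert i F)
  have "(\<Oplus>\<^bsub>A\<^esub>i\<in>F. f i) \<in> adjointable V"
    using insert finsum_closed[of f F] by (auto simp: carrier_A)
  then show ?case using insert assms
    by (simp add: finsum_insert carrier_A Pi_iff add_apply op_closed inn_add_right)
qed

lemma finsum_adjointable: "(\<And>i. i \<in> F \<Longrightarrow> f i \<in> adjointable V) \<Longrightarrow> (\<Oplus>\<^bsub>A\<^esub>i\<in>F. f i) \<in> adjointable V"
  using finsum_closed[of f F] by (auto simp: carrier_A)

lemma left_mult_hom:
  "left_mult V 1 = \<one>\<^bsub>A\<^esub>" "left_mult V (b + c) = left_mult V b \<oplus>\<^bsub>A\<^esub> left_mult V c"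
  "left_mult V (b * c) = left_mult V b \<otimes>\<^bsub>A\<^esub> left_mult V c" "left_mult V (scaleC z b) = cscale A z (left_mult V b)"
  "left_mult V (star b) = adj A (left_mult V b)"
proof -
  show "left_mult V 1 = \<one>\<^bsub>A\<^esub>"
    by (rule op_eqI) (simp_all add: left_mult_adjointable one_adjointable lact_one)
  show "left_mult V (b + c) = left_mult V b \<oplus>\<^bsub>A\<^esub> left_mult V c"
    by (rule op_eqI) (simp_all add: left_mult_adjointable add_adjointable add_apply lact_add_left)
  show "left_mult V (b * c) = left_mult V b \<otimes>\<^bsub>A\<^esub> left_mult V c"
    by (rule op_eqI) (simp_all add: left_mult_adjointable mult_adjointable lact_mult)
  show "left_mult V (scaleC z b) = cscale A z (left_mult V b)"
  proof (rule op_eqI)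
    fix h assume h: "h \<in> elems V"
    have "scaleC z b = scalar z * b" by (simp add: mult_scalar)
    then show "left_mult V (scaleC z b) h = cscale A z (left_mult V b) h"
      using h by (simp only: left_mult_apply cscale_apply lact_mult lact_scalar lact_closed)
  qed (simp_all add: left_mult_adjointable cscale_adjointable)
  show "left_mult V (star b) = adj A (left_mult V b)"
    by (rule adj_eqI[symmetric]) (simp_all add: left_mult_adjointable inn_lact)
qed

end

text \<open>\<open>Metric_space\<close> requires symmetry of the distance for all, also junk, arguments. Therefore the
  addition treats every function that is not an adjointable operator as zero.\<close>

definition Lop_total :: "('b::unital_cstar_algebra, 'h) bimod \<Rightarrow> ('h \<Rightarrow> 'h) cstar_struct" where
  "Lop_total H = (Lop H)\<lparr>add := \<lambda>S T. add (Lop H)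
     (if S \<in> adjointable H then S else zero (Lop H)) (if T \<in> adjointable H then T else zero (Lop H))\<rparr>"

lemma (in hilb) op_algebra_Lop_total: "op_algebra V (Lop_total V)"
  by unfold_locales (simp_all add: Lop_total_def Lop_def)

lemma (in hilb) cstar_algebra_Lop_total: "cstar_algebra (Lop_total V)"
proof -
  interpret A: op_algebra V "Lop_total V" by (rule op_algebra_Lop_total)
  let ?A = "Lop_total V"
  let ?p = "\<lambda>S. if S \<in> adjointable V then S else zero ?A"
  let ?d = "\<lambda>x y. cnorm ?A (x \<ominus>\<^bsub>?A\<^esub> y)"
  note c = A.carrier_A
  have add_total: "S \<oplus>\<^bsub>?A\<^esub> T = ?p S \<oplus>\<^bsub>?A\<^esub> ?p T" for S T
    by (simp add: Lop_total_def)
  have p: "?p S \<in> adjointable V" for S using A.zero_adjointable by simp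
  have inv_total: "\<ominus>\<^bsub>?A\<^esub> T = \<ominus>\<^bsub>?A\<^esub> (?p T)" for T
  proof (cases "T \<in> adjointable V")
    case False
    \<comment> \<open>For \<open>T\<close> outside the carrier the addition sees zero. Hence zero is
      the only candidate for its additive inverse, and the definite description in
      \<open>a_inv\<close> evaluates to it.\<close>
    have eq: "T \<oplus>\<^bsub>?A\<^esub> y = y" "y \<oplus>\<^bsub>?A\<^esub> T = y" if "y \<in> carrier ?A" for y
      using that False add_total[of T y] add_total[of y T] A.zero_adjointable by (simp_all add: c[symmetric])
    have "(THE y. y \<in> carrier ?A \<and> T \<oplus>\<^bsub>?A\<^esub> y = \<zero>\<^bsub>?A\<^esub> \<and> y \<oplus>\<^bsub>?A\<^esub> T = \<zero>\<^bsub>?A\<^esub>) = \<zero>\<^bsub>?A\<^esub>"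
      by (rule the_equality) (use eq in auto)
    then have "\<ominus>\<^bsub>?A\<^esub> T = \<zero>\<^bsub>?A\<^esub>" by (simp add: a_inv_def m_inv_def)
    then show ?thesis using False A.minus_zero by simp
  qed simp
  have d_total: "?d S T = ?d (?p S) (?p T)" for S T
  proof -
    have "S \<ominus>\<^bsub>?A\<^esub> T = S \<oplus>\<^bsub>?A\<^esub> (\<ominus>\<^bsub>?A\<^esub> (?p T))" using inv_total[of T] by (simp only: a_minus_def)
    also have "\<dots> = ?p S \<oplus>\<^bsub>?A\<^esub> ?p (\<ominus>\<^bsub>?A\<^esub> (?p T))" by (rule add_total)
    also have "?p (\<ominus>\<^bsub>?A\<^esub> (?p T)) = \<ominus>\<^bsub>?A\<^esub> (?p T)"
      using A.add.inv_closed[of "?p T"] p[of T] by (simp add: c[symmetric])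
    finally show ?thesis by (simp only: a_minus_def)
  qed
  interpret M: Metric_space "carrier ?A" ?d
  proof
    show "0 \<le> ?d x y" for x y
      unfolding d_total[of x y] by (intro A.cnorm_nonneg' A.minus_adjointable p)
    show "?d x y = ?d y x" for x y
      unfolding d_total[of x y] d_total[of y x] by (intro A.cnorm_minus_commute p)
    show "?d x y = 0 \<longleftrightarrow> x = y" if "x \<in> carrier ?A" "y \<in> carrier ?A" for x y
    proof -
      have xy: "x \<in> adjointable V" "y \<in> adjointable V" using that by (simp_all add: c)
      show ?thesis
      proof
        assume "?d x y = 0"
        then have 0: "x \<ominus>\<^bsub>?A\<^esub> y = \<zero>\<^bsub>?A\<^esub>" using A.cnorm_eq_zero[OF A.minus_adjointable[OF xy]] by simp
        show "x = y"
        proof (rule op_eqI[OF xy])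
          fix h assume h: "h \<in> elems V"
          then have "hminus V (x h) (y h) = hzero V" using A.minus_apply[OF xy h] by (simp add: 0)
          then show "x h = y h" by (rule hminus_eq_zero_imp[OF op_closed[OF xy(1) h] op_closed[OF xy(2) h]])
        qed
      next
        assume "x = y"
        then show "?d x y = 0" using xy that A.cnorm_eq_zero[OF A.zero_adjointable] by (simp add: a_minus_def A.r_neg)
      qed
    qed
    show "?d x z \<le> ?d x y + ?d y z" if "x \<in> carrier ?A" "y \<in> carrier ?A" "z \<in> carrier ?A" for x y z
      using that by (intro A.cnorm_minus_triangle) (simp_all add: c)
  qed
  have complete: "M.mcomplete"
    unfolding M.mcomplete_def M.MCauchy_def M.limit_metric_sequentially
  proof (intro allI impI)
    fix \<sigma> :: "nat \<Rightarrow> 'v \<Rightarrow> 'v"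
    assume \<sigma>: "range \<sigma> \<subseteq> carrier ?A \<and> (\<forall>\<epsilon>>0. \<exists>N. \<forall>n n'. N \<le> n \<longrightarrow> N \<le> n' \<longrightarrow> ?d (\<sigma> n) (\<sigma> n') < \<epsilon>)"
    have "\<exists>L\<in>adjointable V. \<forall>\<epsilon>>0. \<exists>N. \<forall>n\<ge>N. ?d (\<sigma> n) L < \<epsilon>"
    proof (rule A.cauchy_ops_limit)
      show "\<sigma> n \<in> adjointable V" for n using \<sigma> by (auto simp: c)
      show "\<exists>N. \<forall>m\<ge>N. \<forall>n\<ge>N. ?d (\<sigma> m) (\<sigma> n) < \<epsilon>" if "\<epsilon> > 0" for \<epsilon>
        using \<sigma> that by simp
    qed
    then show "\<exists>L. L \<in> carrier ?A \<and> (\<forall>\<epsilon>>0. \<exists>N. \<forall>n\<ge>N. \<sigma> n \<in> carrier ?A \<and> ?d (\<sigma> n) L < \<epsilon>)"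
      using \<sigma> unfolding c by (auto simp: image_subset_iff)
  qed
  show ?thesis
    by (intro cstar_algebra.intro cstar_algebra_axioms.intro A.ring_A complete)
      (simp_all add: c A.cscale_adjointable A.cscale_add_right' A.cscale_add_left' A.cscale_cscale' A.cscale_one'
        A.mult_cscale_left' A.mult_cscale_right' A.adj_adjointable A.adj_add' A.adj_cscale' A.adj_mult' A.adj_adj'
        A.cnorm_nonneg' A.cnorm_eq_zero A.cnorm_add_le A.cnorm_cscale' A.cnorm_mult_le A.cnorm_cstar')
qed

section \<open>Gram matrices and the state of a central unit vector\<close>

text \<open>The double sum is \<open>inn V u u\<close> for the combination \<open>u\<close> of the
  \<open>x i\<close> with coefficients \<open>v i\<close>. The vector \<open>u\<close> is built by
  induction and then used only through its inner products.\<close>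

lemma (in prehilb) gram_pos:
  assumes "finite I" "\<And>i. i \<in> I \<Longrightarrow> x i \<in> elems V"
  shows "pos (\<Sum>i\<in>I. \<Sum>j\<in>I. star (v i) * inn V (x i) (x j) * v j)"
proof -
  have "\<exists>u\<in>elems V. \<forall>z\<in>elems V. inn V z u = (\<Sum>i\<in>I. inn V z (x i) * v i)"
    using assms
  proof (induction I rule: finite_induct)
    case empty
    show ?case by (rule bexI[of _ "hzero V"]) auto
  next
    case (insert i I)
    then obtain u where u: "u \<in> elems V" "\<forall>z\<in>elems V. inn V z u = (\<Sum>i\<in>I. inn V z (x i) * v i)" by auto
    then show ?case using insert
      by (intro bexI[of _ "hadd V (ract V (x i) (v i)) u"]) (auto simp: inn_add_right inn_ract)
  qed
  then obtain u where u: "u \<in> elems V" "\<And>z. z \<in> elems V \<Longrightarrow> inn V z u = (\<Sum>i\<in>I. inn V z (x i) * v i)"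
    by auto
  have "inn V u (x j) = (\<Sum>i\<in>I. star (v i) * inn V (x i) (x j))" if "j \<in> I" for j
  proof -
    have "inn V u (x j) = star (inn V (x j) u)" by (rule star_inn[OF assms(2)[OF that] u(1), symmetric])
    also have "\<dots> = star (\<Sum>i\<in>I. inn V (x j) (x i) * v i)" using u assms(2)[OF that] by simp
    also have "\<dots> = (\<Sum>i\<in>I. star (v i) * inn V (x i) (x j))"
      using assms(2) that by (simp add: star_sum star_mult star_inn)
    finally show ?thesis .
  qed
  then have "inn V u u = (\<Sum>j\<in>I. (\<Sum>i\<in>I. star (v i) * inn V (x i) (x j)) * v j)" using u by simp
  also have "\<dots> = (\<Sum>i\<in>I. \<Sum>j\<in>I. star (v i) * inn V (x i) (x j) * v j)"
    by (simp add: sum_distrib_right) (rule sum.swap)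
  finally show ?thesis using inn_pos[OF u(1)] by simp
qed

locale pointed_hilb = hilb V for V :: "('b::unital_cstar_algebra, 'v) bimod" +
  fixes \<xi> :: 'v
  assumes xi_closed [simp]: "\<xi> \<in> elems V"
    and xi_central: "lact V b \<xi> = ract V \<xi> b"
    and inn_xi: "inn V \<xi> \<xi> = 1"
begin

lemma vacuum_bimodule:
  assumes "op_algebra V A" "a \<in> adjointable V"
  shows "inn V \<xi> ((left_mult V b \<otimes>\<^bsub>A\<^esub> a \<otimes>\<^bsub>A\<^esub> left_mult V c) \<xi>) = b * inn V \<xi> (a \<xi>) * c"
proof -
  interpret A: op_algebra V A by (rule assms)
  show ?thesis using assms(2)
    by (simp add: op_closed xi_central op_ract lact_ract inn_ract inn_lact_right inn_ract_left star_star)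
qed

text \<open>Each \<open>k\<close> contributes a Gram matrix. Complete positivity of the vector state
  on operators and of the laws it induces on polynomials both reduce to this.\<close>

lemma vacuum_matrix_pos:
  assumes "\<And>k i. k < n \<Longrightarrow> i < n \<Longrightarrow> x k i \<in> elems V"
  shows "mat_positive n (\<lambda>i j. \<Sum>k<n. inn V (x k i) (x k j))"
proof (rule mat_positiveI)
  fix v :: "nat \<Rightarrow> 'b"
  have "mform {..<n} (\<lambda>i j. \<Sum>k<n. inn V (x k i) (x k j)) v v
      = (\<Sum>i<n. \<Sum>j<n. \<Sum>k<n. star (v i) * inn V (x k i) (x k j) * v j)"
    by (simp add: mform_def sum_distrib_left sum_distrib_right)
  also have "\<dots> = (\<Sum>i<n. \<Sum>k<n. \<Sum>j<n. star (v i) * inn V (x k i) (x k j) * v j)"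
    by (rule sum.cong[OF HOL.refl], rule sum.swap)
  also have "\<dots> = (\<Sum>k<n. \<Sum>i<n. \<Sum>j<n. star (v i) * inn V (x k i) (x k j) * v j)"
    by (rule sum.swap)
  finally have eq: "mform {..<n} (\<lambda>i j. \<Sum>k<n. inn V (x k i) (x k j)) v v
      = (\<Sum>k<n. \<Sum>i<n. \<Sum>j<n. star (v i) * inn V (x k i) (x k j) * v j)" .
  show "pos (mform {..<n} (\<lambda>i j. \<Sum>k<n. inn V (x k i) (x k j)) v v)"
    unfolding eq by (rule pos_sum, rule gram_pos) (use assms in auto)
qed (use assms in \<open>simp add: star_sum star_inn\<close>)

lemma bvalued_prob_space_Lop_total:
  "bvalued_prob_space (Lop_total V) (left_mult V) (\<lambda>a. inn V \<xi> (a \<xi>))"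
proof -
  interpret A: op_algebra V "Lop_total V" by (rule op_algebra_Lop_total)
  let ?A = "Lop_total V"
  note c = A.carrier_A
  have inj: "inj (left_mult V)"
  proof (rule injI)
    fix b c assume "left_mult V b = left_mult V c"
    then have "inn V \<xi> (left_mult V b \<xi>) = inn V \<xi> (left_mult V c \<xi>)" by simp
    then show "b = c" by (simp add: xi_central inn_ract inn_xi)
  qed
  have incl: "unital_inclusion ?A (left_mult V)"
    unfolding unital_inclusion_def
    using inj by (auto simp: c left_mult_adjointable A.left_mult_hom)
  have cp: "mat_positive n (\<lambda>i j. inn V \<xi> ((\<Oplus>\<^bsub>?A\<^esub>k\<in>{..<n}. adj ?A (C k i) \<otimes>\<^bsub>?A\<^esub> C k j) \<xi>))"
    if C: "\<forall>i<n. \<forall>j<n. C i j \<in> carrier ?A" for n C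
  proof -
    have "inn V \<xi> ((\<Oplus>\<^bsub>?A\<^esub>k\<in>{..<n}. adj ?A (C k i) \<otimes>\<^bsub>?A\<^esub> C k j) \<xi>) = (\<Sum>k<n. inn V (C k i \<xi>) (C k j \<xi>))"
      if "i < n" "j < n" for i j
      using C that
      by (subst A.inn_finsum) (simp_all add: c A.mult_adjointable A.adj_adjointable op_closed A.inn_adj[symmetric])
    moreover have "mat_positive n (\<lambda>i j. \<Sum>k<n. inn V (C k i \<xi>) (C k j \<xi>))"
      using C by (intro vacuum_matrix_pos) (simp add: c op_closed)
    ultimately show ?thesis by (simp add: mat_positive_def)
  qed
  have faithful: "a = \<zero>\<^bsub>?A\<^esub>"
    if a: "a \<in> carrier ?A" and 0: "\<forall>a1\<in>carrier ?A. \<forall>a2\<in>carrier ?A. inn V \<xi> ((a1 \<otimes>\<^bsub>?A\<^esub> a \<otimes>\<^bsub>?A\<^esub> a2) \<xi>) = 0" for a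
  proof (rule op_eqI)
    fix h assume h: "h \<in> elems V"
    \<comment> \<open>Between the rank-one operators \<open>u |-> xi <k, u>\<close> and
      \<open>u |-> h <xi, u>\<close>, the expectation of \<open>a\<close> becomes
      \<open>inn V k (a h)\<close>; its vanishing for all \<open>h\<close> and \<open>k\<close>
      forces \<open>a = 0\<close>.\<close>
    have rank1: "restrict (\<lambda>u. ract V x (inn V y u)) (elems V) \<in> adjointable V"
      if "x \<in> elems V" "y \<in> elems V" for x y
    proof (rule restrict_adjointable)
      have "hnorm V (ract V x (inn V y u)) \<le> hnorm V x * hnorm V y * hnorm V u" if "u \<in> elems V" for u
      proof -
        have "hnorm V (ract V x (inn V y u)) \<le> hnorm V x * norm (inn V y u)" by (rule hnorm_ract) fact
        also have "\<dots> \<le> hnorm V x * (hnorm V y * hnorm V u)"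
          by (rule mult_left_mono[OF cauchy_schwarz]) (simp_all add: \<open>y \<in> elems V\<close> that)
        finally show ?thesis by (simp add: mult.assoc)
      qed
      then show "adj_pair (\<lambda>u. ract V x (inn V y u)) (\<lambda>u. ract V y (inn V x u)) (hnorm V x * hnorm V y)"
        using that by (simp add: adj_pair_def inn_ract inn_ract_left star_inn)
    qed
    have "inn V k (a h) = 0" if k: "k \<in> elems V" for k
      using 0[THEN bspec[of _ _ "restrict (\<lambda>u. ract V \<xi> (inn V k u)) (elems V)"],
            THEN bspec[of _ _ "restrict (\<lambda>u. ract V h (inn V \<xi> u)) (elems V)"]]
        rank1[OF xi_closed k] rank1[OF h xi_closed] a h k
      by (simp add: c inn_xi ract_one op_closed inn_ract)
    then show "a h = \<zero>\<^bsub>?A\<^esub> h" using a h by (intro inn_eqI) (simp_all add: c op_closed)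
  qed (use a A.zero_adjointable in \<open>simp_all add: c\<close>)
  have "unital_cp_bimodule_map ?A (left_mult V) (\<lambda>a. inn V \<xi> (a \<xi>))"
    unfolding unital_cp_bimodule_map_def
    using cp vacuum_bimodule[OF op_algebra_Lop_total]
    by (auto simp: c inn_xi A.add_apply op_closed inn_add_right)
  then show ?thesis
    unfolding bvalued_prob_space_def using incl faithful cstar_algebra_Lop_total by blast
qed

end

subsection \<open>Evaluation of polynomials\<close>

lemma abs_bpoly_rep: "abs_bpoly (rep_bpoly p) = p"
  by (rule Quotient3_abs_rep[OF Quotient3_bpoly])

lemma bpoly_induct [case_names const X add mult]:
  assumes "\<And>b. P (const b)" "P X" "\<And>p q. P p \<Longrightarrow> P q \<Longrightarrow> P (p + q)" "\<And>p q. P p \<Longrightarrow> P q \<Longrightarrow> P (p * q)"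
  shows "P p"
proof -
  have "P (abs_bpoly t)" for t
  proof (induction t)
    case (Cst b)
    then show ?case using assms(1)[of b] by (simp add: const.abs_eq)
  next
    case Var
    then show ?case using assms(2) by (simp add: X_def)
  next
    case (Add t u)
    then show ?case using assms(3)[of "abs_bpoly t" "abs_bpoly u"] by (simp add: plus_bpoly.abs_eq)
  next
    case (Mul t u)
    then show ?case using assms(4)[of "abs_bpoly t" "abs_bpoly u"] by (simp add: times_bpoly.abs_eq)
  qed
  from this[of "rep_bpoly p"] show ?thesis by (simp add: abs_bpoly_rep)
qed

lemma const_add: "const (b + c) = const b + const c"
  by transfer (rule bterm_eq.Cst_add)

lemma const_mult: "const (b * c) = const b * const c"
  by transfer (rule bterm_eq.Cst_mul)

lemma const_one: "const 1 = 1"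
  by transfer (rule bterm_eq.refl)

lemma const_zero: "const 0 = 0"
  by transfer (rule bterm_eq.refl)

lemma const_scalar_commute: "const (scalar z) * p = p * const (scalar z)"
  by transfer (rule bterm_eq.scalar_central)

lemma bpoly_star_add: "bpoly_star (p + q) = bpoly_star p + bpoly_star q"
  by transfer (simp add: bterm_eq.refl)

lemma bpoly_star_mult: "bpoly_star (p * q) = bpoly_star q * bpoly_star p"
  by transfer (simp add: bterm_eq.refl)

lemma bpoly_star_const: "bpoly_star (const b) = const (star b)"
  by transfer (simp add: bterm_eq.refl)

lemma bpoly_star_X: "bpoly_star X = X"
  by transfer (simp add: bterm_eq.refl)

lemma bpoly_star_one: "bpoly_star 1 = 1"
  using bpoly_star_const[of 1] by (simp add: const_one star_one)

lemma bpoly_star_star: "bpoly_star (bpoly_star p) = p"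
  by (induction p rule: bpoly_induct)
    (simp_all add: bpoly_star_add bpoly_star_mult bpoly_star_const bpoly_star_X star_star)

text \<open>The assumptions supply the defining relations of the universal algebra, so that
  evaluation does not depend on the representative chosen in \<open>bpoly_eval\<close>.\<close>

locale bpoly_hom = Ring.ring A for A :: "('a, 'm) ring_scheme" (structure) +
  fixes \<iota> :: "'b::unital_cstar_algebra \<Rightarrow> 'a" and Y :: 'a
  assumes iota_closed [simp]: "\<iota> b \<in> carrier A" and iota_one: "\<iota> 1 = \<one>"
    and iota_add: "\<iota> (b + c) = \<iota> b \<oplus> \<iota> c" and iota_mult: "\<iota> (b * c) = \<iota> b \<otimes> \<iota> c"
    and iota_central: "x \<in> carrier A \<Longrightarrow> \<iota> (scalar z) \<otimes> x = x \<otimes> \<iota> (scalar z)"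
    and Y_closed [simp]: "Y \<in> carrier A"
begin

lemma iota_zero: "\<iota> 0 = \<zero>"
  using iota_add[of 0 0] add.l_cancel_one[of "\<iota> 0" "\<iota> 0"] by simp

lemma bterm_eval_closed [simp]: "bterm_eval A \<iota> Y t \<in> carrier A"
  by (induction t) auto

lemma iota_neg: "x \<in> carrier A \<Longrightarrow> \<iota> (- 1) \<otimes> x \<oplus> x = \<zero>"
proof -
  assume x: "x \<in> carrier A"
  have "\<iota> (- 1) \<otimes> x \<oplus> x = (\<iota> (- 1) \<oplus> \<iota> 1) \<otimes> x" using x by (simp add: l_distr iota_one)
  also have "\<dots> = \<zero>" using x by (simp add: iota_add[symmetric] iota_zero)
  finally show ?thesis .
qed

lemma bterm_eq_eval: "bterm_eq s t \<Longrightarrow> bterm_eval A \<iota> Y s = bterm_eval A \<iota> Y t"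
  by (induction rule: bterm_eq.induct)
    (simp_all add: iota_one iota_zero iota_add iota_mult iota_central iota_neg a_assoc m_assoc l_distr r_distr, rule a_comm, simp_all)

lemma eval_abs: "bpoly_eval A \<iota> Y (abs_bpoly t) = bterm_eval A \<iota> Y t"
  unfolding bpoly_eval_def
  by (rule bterm_eq_eval) (rule Quotient3_rep_abs[OF Quotient3_bpoly bterm_eq.refl])

lemma eval_closed [simp]: "bpoly_eval A \<iota> Y p \<in> carrier A"
  by (simp add: bpoly_eval_def)

lemma eval_const: "bpoly_eval A \<iota> Y (const b) = \<iota> b"
  by (simp add: const.abs_eq eval_abs)

lemma eval_X: "bpoly_eval A \<iota> Y X = Y"
  by (simp add: X_def eval_abs)

lemma eval_add: "bpoly_eval A \<iota> Y (p + q) = bpoly_eval A \<iota> Y p \<oplus> bpoly_eval A \<iota> Y q"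
  using eval_abs[of "Add (rep_bpoly p) (rep_bpoly q)"] eval_abs[of "rep_bpoly p"] eval_abs[of "rep_bpoly q"]
  by (simp add: plus_bpoly.abs_eq[symmetric] abs_bpoly_rep)

lemma eval_mult: "bpoly_eval A \<iota> Y (p * q) = bpoly_eval A \<iota> Y p \<otimes> bpoly_eval A \<iota> Y q"
  using eval_abs[of "Mul (rep_bpoly p) (rep_bpoly q)"] eval_abs[of "rep_bpoly p"] eval_abs[of "rep_bpoly q"]
  by (simp add: times_bpoly.abs_eq[symmetric] abs_bpoly_rep)

lemmas eval_simps = eval_const eval_X eval_add eval_mult

end

lemma ring_bpoly_alg: "Ring.ring (bpoly_alg :: 'b::unital_cstar_algebra bpoly star_struct)"
proof (rule ringI)
  show "abelian_group (bpoly_alg :: 'b bpoly star_struct)"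
  proof (rule abelian_groupI)
    fix x :: "'b bpoly"
    show "\<exists>y\<in>carrier bpoly_alg. y \<oplus>\<^bsub>bpoly_alg\<^esub> x = \<zero>\<^bsub>bpoly_alg\<^esub>"
      by (rule bexI[of _ "- x"]) (simp_all add: bpoly_alg_def)
  qed (simp_all add: bpoly_alg_def algebra_simps)
  show "Group.monoid (bpoly_alg :: 'b bpoly star_struct)"
    by (rule Group.monoidI) (simp_all add: bpoly_alg_def mult.assoc)
qed (simp_all add: bpoly_alg_def algebra_simps)

lemma bpoly_hom_bpoly_alg:
  fixes p :: "'b::unital_cstar_algebra bpoly"
  shows "bpoly_hom bpoly_alg const p"
proof -
  interpret Ring.ring "bpoly_alg :: 'b bpoly star_struct" by (rule ring_bpoly_alg)
  show "bpoly_hom bpoly_alg const p"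
    by unfold_locales (simp_all add: bpoly_alg_def const_one const_add const_mult const_scalar_commute)
qed

lemma finsum_bpoly_alg:
  fixes f :: "'i \<Rightarrow> 'b::unital_cstar_algebra bpoly"
  shows "finite F \<Longrightarrow> (\<Oplus>\<^bsub>bpoly_alg\<^esub>k\<in>F. f k) = (\<Sum>k\<in>F. f k)"
proof -
  interpret Ring.ring "bpoly_alg :: 'b bpoly star_struct" by (rule ring_bpoly_alg)
  show "finite F \<Longrightarrow> (\<Oplus>\<^bsub>bpoly_alg\<^esub>k\<in>F. f k) = (\<Sum>k\<in>F. f k)"
  proof (induction F rule: finite_induct)
    case empty
    then show ?case by (simp only: finsum_empty) (simp add: bpoly_alg_def)
  next
    case (insert x F)
    have c: "carrier (bpoly_alg :: 'b bpoly star_struct) = UNIV" by (simp add: bpoly_alg_def)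
    have "(\<Oplus>\<^bsub>bpoly_alg\<^esub>k\<in>insert x F. f k) = f x \<oplus>\<^bsub>bpoly_alg\<^esub> (\<Sum>k\<in>F. f k)"
      using insert by (simp add: finsum_insert c)
    then show ?case using insert by (simp add: bpoly_alg_def)
  qed
qed

text \<open>Both sides respect sums and products in \<open>p\<close> and agree on constants and on
  \<open>X\<close>. This turns scaling of an operator into \<open>dil\<close> of its law.\<close>

lemma (in bpoly_hom) eval_dilate:
  "bpoly_eval A \<iota> (\<iota> c \<otimes> Y) p = bpoly_eval A \<iota> Y (bpoly_eval bpoly_alg const (const c * X) p)"
proof -
  interpret d: bpoly_hom A \<iota> "\<iota> c \<otimes> Y" by unfold_locales (simp_all add: iota_one iota_add iota_mult iota_central)
  interpret P: bpoly_hom bpoly_alg const "const c * X" by (rule bpoly_hom_bpoly_alg)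
  have alg: "p \<oplus>\<^bsub>bpoly_alg\<^esub> q = p + q" "p \<otimes>\<^bsub>bpoly_alg\<^esub> q = p * q" for p q :: "'b bpoly"
    by (simp_all add: bpoly_alg_def)
  show ?thesis
    by (induction p rule: bpoly_induct) (simp_all add: d.eval_simps P.eval_simps eval_simps alg)
qed

subsection \<open>Monomials\<close>

lemma monomial_Nil: "monomial b [] = const b"
  by (simp add: monomial_def)

lemma monomial_snoc: "monomial b0 (bs @ [b]) = monomial b0 bs * X * const b"
  by (simp add: monomial_def)

lemma monomial_append: "monomial b0 (bs @ [b] @ cs) = monomial b0 bs * X * monomial b cs"
proof (induction cs rule: rev_induct)
  case Nil
  then show ?case by (simp add: monomial_snoc monomial_Nil)
next
  case (snoc c cs)
  have "monomial b0 (bs @ [b] @ cs @ [c]) = monomial b0 ((bs @ [b] @ cs) @ [c])" by simp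
  also have "\<dots> = monomial b0 bs * X * (monomial b cs * X * const c)"
    unfolding monomial_snoc snoc by (simp only: mult.assoc)
  finally show ?case by (simp only: monomial_snoc)
qed

lemma monomial_Cons: "monomial b0 (b # bs) = const b0 * X * monomial b bs"
  using monomial_append[of b0 "[]" b bs] by (simp add: monomial_Nil)

lemma const_mult_monomial: "const c * monomial b bs = monomial (c * b) bs"
  by (induction bs rule: rev_induct)
    (simp_all add: monomial_Nil monomial_snoc const_mult mult.assoc[symmetric])

text \<open>A monomial has many presentations, and \<open>w\<close> bounds the product of norms in
  one of them. In a product of two monomials the adjacent end coefficients are multiplied, which can
  only lower the product of norms.\<close>

definition mono_bound :: "nat \<Rightarrow> real \<Rightarrow> 'b::unital_cstar_algebra bpoly \<Rightarrow> bool" where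
  "mono_bound n w p \<longleftrightarrow> (\<exists>b0 bs. p = monomial b0 bs \<and> length bs = n \<and> norm b0 * prod_list (map norm bs) \<le> w)"

lemma prod_list_norm_nonneg: "0 \<le> prod_list (map norm (bs :: 'b::unital_cstar_algebra list))"
  by (induction bs) auto

lemma mono_bound_mult:
  fixes p q :: "'b::unital_cstar_algebra bpoly"
  assumes "mono_bound m v p" "mono_bound n w q"
  shows "mono_bound (m + n) (v * w) (p * q)"
proof -
  obtain b0 bs where p: "p = monomial b0 bs" "length bs = m" "norm b0 * prod_list (map norm bs) \<le> v"
    using assms(1) by (auto simp: mono_bound_def)
  obtain c0 cs where q: "q = monomial c0 cs" "length cs = n" "norm c0 * prod_list (map norm cs) \<le> w"
    using assms(2) by (auto simp: mono_bound_def)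
  let ?B = "norm b0 * prod_list (map norm bs)" and ?C = "norm c0 * prod_list (map norm cs)"
  have "0 \<le> ?B" "0 \<le> ?C" by (simp_all add: prod_list_norm_nonneg)
  then have vw: "?B * ?C \<le> v * w"
    using p(3) q(3) by (intro mult_mono) linarith+
  show ?thesis
  proof (cases bs rule: rev_cases)
    case Nil
    have "p * q = monomial (b0 * c0) cs" using Nil by (simp add: p(1) q(1) monomial_Nil const_mult_monomial)
    moreover have "norm (b0 * c0) * prod_list (map norm cs) \<le> ?B * ?C"
      using mult_right_mono[OF norm_mult_ineq[of b0 c0] prod_list_norm_nonneg[of cs]] by (simp add: Nil mult.assoc)
    ultimately show ?thesis using vw p(2) q(2) Nil
      unfolding mono_bound_def by (intro exI[of _ "b0 * c0"] exI[of _ cs]) simp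
  next
    case (snoc ds d)
    have "p * q = monomial b0 ds * X * (const d * monomial c0 cs)"
      by (simp only: p(1) q(1) snoc monomial_snoc mult.assoc)
    also have "\<dots> = monomial b0 (ds @ [d * c0] @ cs)" by (simp only: monomial_append const_mult_monomial)
    finally have eq: "p * q = monomial b0 (ds @ [d * c0] @ cs)" .
    let ?r = "norm b0 * prod_list (map norm ds)"
    have "?r * prod_list (map norm cs) * norm (d * c0) \<le> ?r * prod_list (map norm cs) * (norm d * norm c0)"
      by (intro mult_left_mono norm_mult_ineq mult_nonneg_nonneg prod_list_norm_nonneg) simp
    then have "norm b0 * prod_list (map norm (ds @ [d * c0] @ cs)) \<le> ?B * ?C"
      by (simp add: snoc mult_ac)
    then have "norm b0 * prod_list (map norm (ds @ [d * c0] @ cs)) \<le> v * w" using vw by linarith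
    moreover have "length (ds @ [d * c0] @ cs) = m + n" using p(2) q(2) snoc by simp
    ultimately show ?thesis unfolding mono_bound_def using eq by blast
  qed
qed

lemma mono_bound_X: "mono_bound 1 1 (X :: 'b::unital_cstar_algebra bpoly)"
proof -
  have "monomial 1 [1] = (X :: 'b bpoly)"
    by (simp add: monomial_Cons monomial_Nil const_one)
  then show "mono_bound 1 1 (X :: 'b bpoly)"
    unfolding mono_bound_def by (intro exI[of _ 1] exI[of _ "[1]"]) simp
qed

lemma mono_bound_X_power: "mono_bound m 1 (X ^ m :: 'b::unital_cstar_algebra bpoly)"
proof (induction m)
  case 0
  have "monomial 1 [] = (1 :: 'b bpoly)" by (simp add: monomial_Nil const_one)
  then show "mono_bound 0 1 (X ^ 0 :: 'b bpoly)"
    unfolding mono_bound_def by (intro exI[of _ 1] exI[of _ "[]"]) simp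
next
  case (Suc m)
  from mono_bound_mult[OF mono_bound_X this] show ?case by simp
qed

text \<open>Finite sums of monomials contain the generators and are closed under addition and
  multiplication.\<close>

lemma bpoly_monomial_induct [case_names monomial add]:
  assumes "\<And>b0 bs. P (monomial b0 bs)" "\<And>p q. P p \<Longrightarrow> P q \<Longrightarrow> P (p + q)"
  shows "P p"
proof -
  define S where "S p \<longleftrightarrow> (\<exists>l. p = sum_list (map (\<lambda>(b0, bs). monomial b0 bs) l))" for p :: "'a bpoly"
  have S_add: "S (p + q)" if "S p" "S q" for p q
    using that unfolding S_def by (metis map_append sum_list_append)
  have S_mono: "S (monomial b0 bs)" for b0 bs
    unfolding S_def by (intro exI[of _ "[(b0, bs)]"]) simp
  have mm: "\<exists>d0 ds. monomial b0 bs * monomial c0 cs = monomial d0 ds" for b0 c0 :: 'a and bs cs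
    using mono_bound_mult[of "length bs" "norm b0 * prod_list (map norm bs)" "monomial b0 bs"
        "length cs" "norm c0 * prod_list (map norm cs)" "monomial c0 cs"]
    unfolding mono_bound_def by blast
  have S_zero: "S 0" unfolding S_def by (intro exI[of _ "[]"]) simp
  have S_mult1: "S (monomial b0 bs * sum_list (map (\<lambda>(b0, bs). monomial b0 bs) l))" for b0 bs l
  proof (induction l)
    case Nil
    then show ?case using S_zero by simp
  next
    case (Cons a l)
    obtain c0 cs where a: "a = (c0, cs)" by (cases a)
    obtain d0 ds where "monomial b0 bs * monomial c0 cs = monomial d0 ds" using mm by blast
    then show ?case using S_add[OF S_mono[of d0 ds] Cons] by (simp add: a ring_class.ring_distribs)
  qed
  have S_mult2: "S (sum_list (map (\<lambda>(b0, bs). monomial b0 bs) l) * q)" if "S q" for l q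
  proof (induction l)
    case Nil
    then show ?case using S_zero by simp
  next
    case (Cons a l)
    obtain c0 cs where a: "a = (c0, cs)" by (cases a)
    have "S (monomial c0 cs * q)" using that S_mult1 unfolding S_def by blast
    from S_add[OF this Cons] show ?case by (simp add: a ring_class.ring_distribs)
  qed
  have "S p"
  proof (induction p rule: bpoly_induct)
    case (const b)
    show ?case using S_mono[of b "[]"] by (simp add: monomial_Nil)
  next
    case X
    show ?case using S_mono[of 1 "[1]"] by (simp add: monomial_Cons monomial_Nil const_one)
  next
    case (add p q)
    then show ?case by (rule S_add)
  next
    case (mult p q)
    then show ?case using S_mult2[of q] unfolding S_def[of p] by blast
  qed
  then obtain l where "p = sum_list (map (\<lambda>(b0, bs). monomial b0 bs) l)" unfolding S_def by blast
  moreover have "P (sum_list (map (\<lambda>(b0, bs). monomial b0 bs) l))" for l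
  proof (induction l)
    case Nil
    show ?case using assms(1)[of 0 "[]"] by (simp add: monomial_Nil const_zero)
  next
    case (Cons a l)
    then show ?case using assms by (cases a) simp
  qed
  ultimately show ?thesis by simp
qed

subsection \<open>Laws and their \<open>L\<^sup>2\<close>-spaces\<close>

locale law =
  fixes \<mu> :: "'b::unital_cstar_algebra bpoly \<Rightarrow> 'b"
  assumes bvalued: "bvalued_law \<mu>"
begin

lemma cp: "unital_cp_bimodule_map bpoly_alg const \<mu>"
  using bvalued by (simp add: bvalued_law_def)

lemma law_one: "\<mu> 1 = 1"
  using cp by (simp add: unital_cp_bimodule_map_def) (simp add: bpoly_alg_def)

lemma law_add: "\<mu> (p + q) = \<mu> p + \<mu> q"
proof -
  have "\<forall>a\<in>carrier bpoly_alg. \<forall>a'\<in>carrier bpoly_alg. \<mu> (a \<oplus>\<^bsub>bpoly_alg\<^esub> a') = \<mu> a + \<mu> a'"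
    using cp unfolding unital_cp_bimodule_map_def by blast
  then show ?thesis by (simp add: bpoly_alg_def)
qed

lemma law_bimodule: "\<mu> (const b * p * const c) = b * \<mu> p * c"
proof -
  have "\<forall>b c. \<forall>a\<in>carrier bpoly_alg. \<mu> (const b \<otimes>\<^bsub>bpoly_alg\<^esub> a \<otimes>\<^bsub>bpoly_alg\<^esub> const c) = b * \<mu> a * c"
    using cp unfolding unital_cp_bimodule_map_def by blast
  then show ?thesis by (simp add: bpoly_alg_def)
qed

lemma law_left: "\<mu> (const b * p) = b * \<mu> p"
  using law_bimodule[of b p 1] by (simp add: const_one)

lemma law_right: "\<mu> (p * const c) = \<mu> p * c"
  using law_bimodule[of 1 p c] by (simp add: const_one)

lemma law_const: "\<mu> (const b) = b"
  using law_left[of b 1] by (simp add: law_one)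

lemma law_pos: "pos (\<mu> (bpoly_star p * p))"
proof -
  have "\<forall>n C. (\<forall>i<n. \<forall>j<n. C i j \<in> carrier bpoly_alg) \<longrightarrow>
      mat_positive n (\<lambda>i j. \<mu> (\<Oplus>\<^bsub>bpoly_alg\<^esub>k\<in>{..<n}. adj bpoly_alg (C k i) \<otimes>\<^bsub>bpoly_alg\<^esub> C k j))"
    using cp unfolding unital_cp_bimodule_map_def by blast
  from this[rule_format, of 1 "\<lambda>_ _. p"]
  have "mat_positive 1 (\<lambda>i j. \<mu> (\<Oplus>\<^bsub>bpoly_alg\<^esub>k\<in>{..<1::nat}. adj bpoly_alg p \<otimes>\<^bsub>bpoly_alg\<^esub> p))"
    by (simp add: bpoly_alg_def)
  then have "mat_positive 1 (\<lambda>i j. \<mu> (bpoly_star p * p))"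
    by (simp add: finsum_bpoly_alg) (simp add: bpoly_alg_def)
  then obtain c where "\<mu> (bpoly_star p * p) = star c * c"
    unfolding mat_positive_def by auto
  then show ?thesis by (simp add: pos_star_mult)
qed

text \<open>The values at \<open>bpoly_star q * q\<close> are self-adjoint for \<open>q = p\<close>,
  \<open>q = 1 + p\<close> and \<open>q = 1 + i p\<close>. Subtracting the self-adjoint terms leaves
  the two hypotheses of \<open>sa_imp_star_eq\<close>.\<close>

lemma law_star: "\<mu> (bpoly_star p) = star (\<mu> p)"
proof -
  have exp1: "\<mu> (bpoly_star (1 + p) * (1 + p)) = 1 + (\<mu> p + \<mu> (bpoly_star p)) + \<mu> (bpoly_star p * p)"
    by (simp add: bpoly_star_add bpoly_star_one algebra_simps law_add law_one)
  let ?i = "const (scalar \<i>)"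
  have star_i: "bpoly_star ?i = const (scalar (- \<i>))"
    by (simp add: bpoly_star_const star_scaleC star_one)
  have ii: "\<mu> ((bpoly_star p * const (scalar (- \<i>))) * (?i * p)) = \<mu> (bpoly_star p * p)"
  proof -
    have "(bpoly_star p * const (scalar (- \<i>))) * (?i * p) = bpoly_star p * const (scalar (- \<i>) * scalar \<i>) * p"
      by (simp add: const_mult mult.assoc)
    also have "scalar (- \<i>) * scalar \<i> = (1 :: 'b)" by (simp add: mult_scaleC_left scaleC_scaleC scaleC_one)
    finally show ?thesis by (simp add: const_one)
  qed
  have m1: "\<mu> (?i * p) = scaleC \<i> (\<mu> p)" by (simp add: law_left mult_scaleC_left)
  have m2: "\<mu> (bpoly_star p * const (scalar (- \<i>))) = - scaleC \<i> (\<mu> (bpoly_star p))"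
    by (simp add: law_right mult_scaleC_right scaleC_minus_left)
  have exp2: "\<mu> (bpoly_star (1 + ?i * p) * (1 + ?i * p))
      = 1 + scaleC \<i> (\<mu> p - \<mu> (bpoly_star p)) + \<mu> (bpoly_star p * p)"
    by (simp add: bpoly_star_add bpoly_star_mult bpoly_star_one star_i ring_class.ring_distribs law_add law_one ii m1 m2 scaleC_diff_right)
  have sa: "star (\<mu> (bpoly_star q * q)) = \<mu> (bpoly_star q * q)" for q
    by (rule pos_star[OF law_pos])
  have "star (\<mu> p + \<mu> (bpoly_star p)) = \<mu> p + \<mu> (bpoly_star p)"
    using sa[of "1 + p"] sa[of p] unfolding exp1 by (simp add: star_add star_one)
  moreover have "star (scaleC \<i> (\<mu> p - \<mu> (bpoly_star p))) = scaleC \<i> (\<mu> p - \<mu> (bpoly_star p))"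
    using sa[of "1 + ?i * p"] sa[of p] unfolding exp2 by (simp add: star_add star_one)
  ultimately show ?thesis by (intro sa_imp_star_eq[symmetric])
qed

lemma prehilb_pre_L2: "prehilb (pre_L2 \<mu>)"
proof -
  have "star (\<mu> (bpoly_star p * q)) = \<mu> (bpoly_star q * p)" for p q
    by (simp add: law_star[symmetric] bpoly_star_mult bpoly_star_star)
  moreover have "\<mu> (p * (const (scalar z) * q)) = \<mu> (p * q) * scalar z" for p q z
    by (simp add: const_scalar_commute law_right mult.assoc[symmetric])
  ultimately show ?thesis
    by unfold_locales (simp_all add: pre_L2_def law_pos const_add const_mult const_one const_zero algebra_simps law_add
        law_right bpoly_star_mult bpoly_star_const law_right[symmetric])
qed

sublocale pre: prehilb "pre_L2 \<mu>" by (rule prehilb_pre_L2)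

lemma pre_L2_simps: "elems (pre_L2 \<mu>) = UNIV" "inn (pre_L2 \<mu>) p q = \<mu> (bpoly_star p * q)"
  "hadd (pre_L2 \<mu>) p q = p + q" "lact (pre_L2 \<mu>) b p = const b * p" "ract (pre_L2 \<mu>) p b = p * const b"
  "hzero (pre_L2 \<mu>) = 0"
  by (simp_all add: pre_L2_def)

lemma mono_bound_law:
  assumes "exp_bounded_by M R \<mu>" "M \<ge> 0" "R \<ge> 0" "mono_bound n w p"
  shows "norm (\<mu> p) \<le> M * R ^ n * w"
proof -
  obtain b0 bs where p: "p = monomial b0 bs" "length bs = n" "norm b0 * prod_list (map norm bs) \<le> w"
    using assms(4) by (auto simp: mono_bound_def)
  have "norm (\<mu> p) \<le> M * R ^ n * norm b0 * prod_list (map norm bs)"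
    using assms(1) p(2) by (auto simp: p(1) exp_bounded_by_def)
  also have "\<dots> \<le> M * R ^ n * w"
    using mult_left_mono[OF p(3), of "M * R ^ n"] assms(2,3) by (simp add: mult.assoc)
  finally show ?thesis .
qed

text \<open>The constant depends on \<open>p\<close> and \<open>q\<close>, but the growth rate is
  \<open>R\<close> for all of them; this is the input that \<open>symmetric_bound\<close> asks
  for.\<close>

lemma law_X_power_bound:
  assumes "exp_bounded_by M R \<mu>" "M > 0" "R > 0"
  shows "\<exists>C\<ge>0. \<forall>m. norm (\<mu> (q * X ^ m * p)) \<le> C * R ^ m"
proof -
  have sum: "\<exists>C\<ge>0. \<forall>m. norm (f m + g m) \<le> C * R ^ m"
    if f: "\<exists>C\<ge>0. \<forall>m. norm (f m) \<le> C * R ^ m" and g: "\<exists>C\<ge>0. \<forall>m. norm (g m) \<le> C * R ^ m" for f g :: "nat \<Rightarrow> 'b"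
  proof -
    obtain C D where C: "C \<ge> 0" "\<And>m. norm (f m) \<le> C * R ^ m" and D: "D \<ge> 0" "\<And>m. norm (g m) \<le> D * R ^ m"
      using f g by auto
    have "norm (f m + g m) \<le> (C + D) * R ^ m" for m
      using norm_triangle_ineq[of "f m" "g m"] C(2)[of m] D(2)[of m] by (simp add: ring_class.ring_distribs)
    then show ?thesis using C(1) D(1) by (intro exI[of _ "C + D"]) simp
  qed
  show ?thesis
  proof (induction p rule: bpoly_monomial_induct)
    case (monomial c0 cs)
    show ?case
    proof (induction q rule: bpoly_monomial_induct)
      case (monomial b0 bs)
      let ?v = "norm b0 * prod_list (map norm bs)" and ?w = "norm c0 * prod_list (map norm cs)"
      have vw: "?v \<ge> 0" "?w \<ge> 0" by (simp_all add: prod_list_norm_nonneg)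
      have "norm (\<mu> (monomial b0 bs * X ^ m * monomial c0 cs)) \<le> (M * R ^ (length bs + length cs) * (?v * ?w)) * R ^ m" for m
      proof -
        have "mono_bound (length bs) ?v (monomial b0 bs)" "mono_bound (length cs) ?w (monomial c0 cs)"
          unfolding mono_bound_def by blast+
        then have "mono_bound (length bs + m + length cs) (?v * 1 * ?w) (monomial b0 bs * X ^ m * monomial c0 cs)"
          by (intro mono_bound_mult mono_bound_X_power)
        from mono_bound_law[OF assms(1) _ _ this] assms(2,3) show ?thesis
          by (simp add: power_add mult_ac)
      qed
      moreover have "M * R ^ (length bs + length cs) * (?v * ?w) \<ge> 0" using assms(2,3) vw by simp
      ultimately show ?case by blast
    next
      case (add q q')
      then show ?case using sum[of "\<lambda>m. \<mu> (q * X ^ m * monomial c0 cs)" "\<lambda>m. \<mu> (q' * X ^ m * monomial c0 cs)"]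
        by (simp add: ring_class.ring_distribs law_add)
    qed
  next
    case (add p p')
    then show ?case using sum[of "\<lambda>m. \<mu> (q * X ^ m * p)" "\<lambda>m. \<mu> (q * X ^ m * p')"]
      by (simp add: ring_class.ring_distribs law_add)
  qed
qed

lemma funpow_X: "((\<lambda>p. X * p) ^^ m) p = X ^ m * (p :: 'b bpoly)"
  by (induction m) (simp_all add: mult.assoc)

lemma bpoly_star_X_power: "bpoly_star (X ^ m) = (X ^ m :: 'b bpoly)"
  by (induction m) (simp_all add: bpoly_star_one bpoly_star_mult bpoly_star_X power_commutes)

text \<open>The constant \<open>M\<close> enters only through the orbit constant of
  \<open>p\<close>, and \<open>symmetric_bound\<close> removes it.\<close>

lemma hnorm_X_le:
  assumes "exp_bounded_by M R \<mu>" "M > 0" "R > 0"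
  shows "hnorm (pre_L2 \<mu>) (X * p) \<le> R * hnorm (pre_L2 \<mu>) p"
proof -
  obtain C where C: "C \<ge> 0" "\<And>m. norm (\<mu> (bpoly_star p * X ^ m * p)) \<le> C * R ^ m"
    using law_X_power_bound[OF assms, of "bpoly_star p" p] by blast
  show ?thesis
  proof (rule pre.symmetric_bound[where K = "sqrt C"])
    fix m
    have "norm (inn (pre_L2 \<mu>) (X ^ m * p) (X ^ m * p)) \<le> C * R ^ (m + m)"
      using C(2)[of "m + m"]
      by (simp add: pre_L2_simps bpoly_star_mult bpoly_star_X_power power_add mult.assoc)
    also have "\<dots> = (sqrt C * R ^ m)\<^sup>2"
      using C(1) by (simp add: power_mult_distrib power_add power2_eq_square[of "R ^ m"])
    finally show "hnorm (pre_L2 \<mu>) (((\<lambda>p. X * p) ^^ m) p) \<le> sqrt C * R ^ m"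
      unfolding funpow_X using C(1) assms(3) by (subst pre.hnorm_le_iff) simp_all
  qed (use assms(3) in \<open>simp_all add: pre_L2_simps bpoly_star_mult bpoly_star_X mult.assoc\<close>)
qed

lemma rad_set_nonempty: "{R. R > 0 \<and> (\<exists>M>0. exp_bounded_by M R \<mu>)} \<noteq> {}"
  using bvalued by (auto simp: bvalued_law_def)

lemma rad_nonneg: "rad \<mu> \<ge> 0"
  unfolding rad_def by (rule cInf_greatest[OF rad_set_nonempty]) auto

text \<open>The bounds for all admissible radii pass to their infimum, after division by
  \<open>hnorm (pre_L2 \<mu>) p\<close> if this is not 0. This is the source of the radii in the
  estimate of \<open>Y - Z\<close>.\<close>

lemma hnorm_X_le_rad: "hnorm (pre_L2 \<mu>) (X * p) \<le> rad \<mu> * hnorm (pre_L2 \<mu>) p"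
proof (cases "hnorm (pre_L2 \<mu>) p = 0")
  case True
  obtain M R where "M > 0" "R > 0" "exp_bounded_by M R \<mu>" using rad_set_nonempty by blast
  from hnorm_X_le[OF this(3,1,2), of p] show ?thesis by (simp add: True)
next
  case False
  then have p: "hnorm (pre_L2 \<mu>) p > 0" using pre.hnorm_nonneg[of p] by linarith
  have "hnorm (pre_L2 \<mu>) (X * p) / hnorm (pre_L2 \<mu>) p \<le> rad \<mu>"
    unfolding rad_def
  proof (rule cInf_greatest[OF rad_set_nonempty])
    fix R assume "R \<in> {R. R > 0 \<and> (\<exists>M>0. exp_bounded_by M R \<mu>)}"
    then show "hnorm (pre_L2 \<mu>) (X * p) / hnorm (pre_L2 \<mu>) p \<le> R"
      using hnorm_X_le[of _ R p] p by (auto simp: pos_divide_le_eq)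
  qed
  then show ?thesis using p by (simp add: pos_divide_le_eq)
qed

lemma adj_pair_X: "pre.adj_pair (\<lambda>p. X * p) (\<lambda>p. X * p) (rad \<mu>)"
  unfolding pre.adj_pair_def using hnorm_X_le_rad rad_nonneg
  by (simp add: pre_L2_simps bpoly_star_mult bpoly_star_X mult.assoc)

lemma L2_X_eq: "L2_X \<mu> = pre.extend (\<lambda>p. X * p)"
  by (simp add: L2_X_def pre.extend_def L2_def)

sublocale L2: pointed_hilb "L2 \<mu>" "L2_one \<mu>"
proof (intro pointed_hilb.intro pointed_hilb_axioms.intro)
  show "hilb (L2 \<mu>)" unfolding L2_def by (rule pre.hilb_completion)
  show "L2_one \<mu> \<in> elems (L2 \<mu>)" unfolding L2_def L2_one_def by (rule pre.emb_closed) (simp add: pre_L2_simps)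
  show "lact (L2 \<mu>) b (L2_one \<mu>) = ract (L2 \<mu>) (L2_one \<mu>) b" for b
    unfolding L2_def L2_one_def
    using pre.emb_lact[of 1 b] pre.emb_ract[of 1 b] by (simp add: pre_L2_simps)
  show "inn (L2 \<mu>) (L2_one \<mu>) (L2_one \<mu>) = 1"
    unfolding L2_def L2_one_def by (subst pre.inn_emb) (simp_all add: pre_L2_simps bpoly_star_one law_one)
qed

lemma L2_X_adjointable: "L2_X \<mu> \<in> adjointable (L2 \<mu>)"
  unfolding L2_X_eq L2_def by (rule pre.extend_adjointable[OF adj_pair_X])

lemma L2_X_symmetric: "h \<in> elems (L2 \<mu>) \<Longrightarrow> k \<in> elems (L2 \<mu>) \<Longrightarrow> inn (L2 \<mu>) (L2_X \<mu> h) k = inn (L2 \<mu>) h (L2_X \<mu> k)"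
  unfolding L2_X_eq L2_def by (rule pre.extend_adjoint[OF adj_pair_X])

lemma L2_X_bound: "h \<in> elems (L2 \<mu>) \<Longrightarrow> hnorm (L2 \<mu>) (L2_X \<mu> h) \<le> rad \<mu> * hnorm (L2 \<mu>) h"
  unfolding L2_X_eq L2_def by (rule pre.extend_bound[OF adj_pair_X])

lemma L2_X_emb: "L2_X \<mu> (emb (pre_L2 \<mu>) p) = emb (pre_L2 \<mu>) (X * p)"
  unfolding L2_X_eq by (rule pre.extend_emb[OF adj_pair_X]) (simp add: pre_L2_simps)

end

subsection \<open>Laws of operators\<close>

definition peval :: "('b::unital_cstar_algebra, 'h) bimod \<Rightarrow> ('h \<Rightarrow> 'h) \<Rightarrow> 'b bpoly \<Rightarrow> 'h \<Rightarrow> 'h" where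
  "peval H Y p = bpoly_eval (Lop H) (left_mult H) Y p"

definition vlaw :: "('b::unital_cstar_algebra, 'h) bimod \<Rightarrow> 'h \<Rightarrow> ('h \<Rightarrow> 'h) \<Rightarrow> 'b bpoly \<Rightarrow> 'b" where
  "vlaw H \<xi> Y p = inn H \<xi> (peval H Y p \<xi>)"

lemma law_of_Lop: "law_of (Lop H) (left_mult H) (\<lambda>a. inn H \<xi> (a \<xi>)) Y = vlaw H \<xi> Y"
  by (simp add: law_of_def vlaw_def peval_def fun_eq_iff)

lemma (in op_algebra) bpoly_hom_op:
  assumes "Y \<in> adjointable V"
  shows "bpoly_hom A (left_mult V) Y"
proof unfold_locales
  fix x z assume x: "x \<in> carrier A"
  have "left_mult V (scalar z) = cscale A z \<one>\<^bsub>A\<^esub>" using left_mult_hom(4)[of z 1] left_mult_hom(1) by simp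
  then show "left_mult V (scalar z) \<otimes>\<^bsub>A\<^esub> x = x \<otimes>\<^bsub>A\<^esub> left_mult V (scalar z)"
    using x by (simp add: carrier_A mult_cscale_left' mult_cscale_right' one_adjointable)
qed (use assms in \<open>simp_all add: carrier_A left_mult_adjointable left_mult_hom\<close>)

lemma (in op_algebra) bpoly_eval_eq_peval:
  assumes "Y \<in> adjointable V"
  shows "bpoly_eval A (left_mult V) Y p = peval V Y p"
proof -
  interpret L: op_algebra V "Lop V" by (rule op_algebra_Lop)
  interpret a: bpoly_hom A "left_mult V" Y by (rule bpoly_hom_op[OF assms])
  interpret l: bpoly_hom "Lop V" "left_mult V" Y by (rule L.bpoly_hom_op[OF assms])
  show ?thesis
    unfolding peval_def
  proof (induction p rule: bpoly_induct)
    case (add p q)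
    then show ?case
      using add_A[of "bpoly_eval (Lop V) (left_mult V) Y p" "bpoly_eval (Lop V) (left_mult V) Y q"]
        l.eval_closed[of p] l.eval_closed[of q] by (simp add: a.eval_simps l.eval_simps L.carrier_A)
  qed (simp_all add: a.eval_simps l.eval_simps mult_A)
qed

context hilb
begin

lemma peval_adjointable:
  assumes "Y \<in> adjointable V"
  shows "peval V Y p \<in> adjointable V"
proof -
  interpret L: op_algebra V "Lop V" by (rule op_algebra_Lop)
  interpret l: bpoly_hom "Lop V" "left_mult V" Y by (rule L.bpoly_hom_op[OF assms])
  show ?thesis using l.eval_closed[of p] by (simp add: L.carrier_A peval_def)
qed

lemma peval_closed: "Y \<in> adjointable V \<Longrightarrow> h \<in> elems V \<Longrightarrow> peval V Y p h \<in> elems V"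
  by (rule op_closed[OF peval_adjointable])

lemma peval_simps:
  assumes "Y \<in> adjointable V" "h \<in> elems V"
  shows "peval V Y (const b) h = lact V b h" "peval V Y X h = Y h"
    "peval V Y (p + q) h = hadd V (peval V Y p h) (peval V Y q h)"
    "peval V Y (p * q) h = peval V Y p (peval V Y q h)"
proof -
  interpret L: op_algebra V "Lop V" by (rule op_algebra_Lop)
  interpret l: bpoly_hom "Lop V" "left_mult V" Y by (rule L.bpoly_hom_op[OF assms(1)])
  have cl: "bpoly_eval (Lop V) (left_mult V) Y p \<in> adjointable V" for p
    using l.eval_closed[of p] by (simp add: L.carrier_A)
  show "peval V Y (const b) h = lact V b h" "peval V Y X h = Y h"
    "peval V Y (p + q) h = hadd V (peval V Y p h) (peval V Y q h)"
    "peval V Y (p * q) h = peval V Y p (peval V Y q h)"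
    using assms by (simp_all add: peval_def l.eval_simps L.add_apply cl)
qed

lemma peval_one: "Y \<in> adjointable V \<Longrightarrow> h \<in> elems V \<Longrightarrow> peval V Y 1 h = h"
  using peval_simps(1)[of Y h 1] by (simp add: const_one lact_one)

lemma peval_star:
  assumes "Y \<in> adjointable V" "\<And>h k. h \<in> elems V \<Longrightarrow> k \<in> elems V \<Longrightarrow> inn V (Y h) k = inn V h (Y k)"
    "h \<in> elems V" "k \<in> elems V"
  shows "inn V (peval V Y p h) k = inn V h (peval V Y (bpoly_star p) k)"
  using assms(3,4)
proof (induction p arbitrary: h k rule: bpoly_induct)
  case (mult p q)
  then show ?case using assms(1) by (simp add: peval_simps bpoly_star_mult peval_closed)
qed (use assms(1,2) in \<open>simp_all add: peval_simps bpoly_star_const bpoly_star_X bpoly_star_add inn_lact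
      inn_add_left inn_add_right peval_closed\<close>)

end

context pointed_hilb
begin

lemma hnorm_xi: "hnorm V \<xi> = 1"
  by (simp add: hnorm_def inn_xi)

lemma vlaw_simps:
  assumes "Y \<in> adjointable V"
  shows "vlaw V \<xi> Y (p + q) = vlaw V \<xi> Y p + vlaw V \<xi> Y q" "vlaw V \<xi> Y (const b * p * const c) = b * vlaw V \<xi> Y p * c"
    "vlaw V \<xi> Y 1 = 1" "vlaw V \<xi> Y (const b) = b"
proof -
  have pc: "peval V Y p h \<in> elems V" if "h \<in> elems V" for p h by (rule peval_closed[OF assms that])
  show "vlaw V \<xi> Y (p + q) = vlaw V \<xi> Y p + vlaw V \<xi> Y q"
    using assms by (simp add: vlaw_def peval_simps inn_add_right pc)
  show "vlaw V \<xi> Y (const b * p * const c) = b * vlaw V \<xi> Y p * c"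
    using assms op_ract[OF peval_adjointable[OF assms]]
    by (simp add: vlaw_def peval_simps pc xi_central inn_lact_right inn_ract inn_ract_left star_star)
  show "vlaw V \<xi> Y 1 = 1" using assms by (simp add: vlaw_def peval_one inn_xi)
  show "vlaw V \<xi> Y (const b) = b" using assms by (simp add: vlaw_def peval_simps xi_central inn_ract inn_xi)
qed

lemma bvalued_law_vlaw:
  assumes Y: "Y \<in> adjointable V" and sym: "\<And>h k. h \<in> elems V \<Longrightarrow> k \<in> elems V \<Longrightarrow> inn V (Y h) k = inn V h (Y k)"
  shows "bvalued_law (vlaw V \<xi> Y)"
proof -
  note pc = peval_closed[OF Y]
  have vsum: "vlaw V \<xi> Y (\<Sum>k\<in>F. f k) = (\<Sum>k\<in>F. vlaw V \<xi> Y (f k))" for f :: "nat \<Rightarrow> 'b bpoly" and F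
  proof (induction F rule: infinite_finite_induct)
    case (insert x F)
    then show ?case by (simp add: vlaw_simps(1)[OF Y])
  qed (use vlaw_simps(4)[OF Y, of 0] in \<open>simp_all add: const_zero\<close>)
  have cp: "mat_positive n (\<lambda>i j. vlaw V \<xi> Y (\<Oplus>\<^bsub>bpoly_alg\<^esub>k\<in>{..<n}. adj bpoly_alg (C k i) \<otimes>\<^bsub>bpoly_alg\<^esub> C k j))" for n C
  proof -
    have "vlaw V \<xi> Y (\<Oplus>\<^bsub>bpoly_alg\<^esub>k\<in>{..<n}. adj bpoly_alg (C k i) \<otimes>\<^bsub>bpoly_alg\<^esub> C k j)
        = (\<Sum>k<n. inn V (peval V Y (C k i) \<xi>) (peval V Y (C k j) \<xi>))" for i j
    proof -
      have "(\<Oplus>\<^bsub>bpoly_alg\<^esub>k\<in>{..<n}. adj bpoly_alg (C k i) \<otimes>\<^bsub>bpoly_alg\<^esub> C k j) = (\<Sum>k<n. bpoly_star (C k i) * C k j)"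
        by (simp add: finsum_bpoly_alg) (simp add: bpoly_alg_def)
      moreover have "vlaw V \<xi> Y (bpoly_star p * q) = inn V (peval V Y p \<xi>) (peval V Y q \<xi>)" for p q
        using peval_star[OF Y sym xi_closed pc[OF xi_closed], of p q] by (simp add: vlaw_def peval_simps Y pc)
      ultimately show ?thesis by (simp add: vsum)
    qed
    then show ?thesis using vacuum_matrix_pos[of n "\<lambda>k i. peval V Y (C k i) \<xi>"] by (simp add: pc)
  qed
  have "unital_cp_bimodule_map bpoly_alg const (vlaw V \<xi> Y)"
    unfolding unital_cp_bimodule_map_def using cp vlaw_simps[OF Y]
    by (intro conjI) (simp_all add: bpoly_alg_def)
  \<comment> \<open>Adding 1 keeps the radius positive when the norm of \<open>Y\<close> is
    0.\<close>
  moreover have "exp_bounded_by 1 (cnorm (Lop V) Y + 1) (vlaw V \<xi> Y)"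
  proof -
    interpret L: op_algebra V "Lop V" by (rule op_algebra_Lop)
    let ?R = "cnorm (Lop V) Y + 1"
    have R: "?R > 0" using L.cnorm_nonneg'[OF Y] by simp
    have "hnorm V (peval V Y (monomial b0 bs) h) \<le> ?R ^ length bs * norm b0 * prod_list (map norm bs) * hnorm V h"
      if "h \<in> elems V" for b0 bs h
      using that
    proof (induction bs arbitrary: b0)
      case Nil
      then show ?case using hnorm_lact[of h b0] Y by (simp add: monomial_Nil peval_simps)
    next
      case (Cons b bs)
      let ?w = "peval V Y (monomial b bs) h"
      have w: "?w \<in> elems V" using Cons pc by blast
      have "hnorm V (peval V Y (monomial b0 (b # bs)) h) = hnorm V (lact V b0 (Y ?w))"
        using Cons w Y by (simp add: monomial_Cons peval_simps pc op_closed)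
      also have "\<dots> \<le> norm b0 * hnorm V (Y ?w)" by (rule hnorm_lact[OF op_closed[OF Y w]])
      also have "\<dots> \<le> norm b0 * (?R * hnorm V ?w)"
        by (intro mult_left_mono order_trans[OF L.cnorm_bound[OF Y w]] mult_right_mono) simp_all
      also have "\<dots> \<le> norm b0 * (?R * (?R ^ length bs * norm b * prod_list (map norm bs) * hnorm V h))"
        using Cons R by (intro mult_left_mono) simp_all
      finally show ?case by (simp add: mult_ac)
    qed
    then have "hnorm V (peval V Y (monomial b0 bs) \<xi>) \<le> ?R ^ length bs * norm b0 * prod_list (map norm bs)" for b0 bs
      using hnorm_xi xi_closed by (metis mult.right_neutral)
    moreover have "norm (vlaw V \<xi> Y p) \<le> hnorm V (peval V Y p \<xi>)" for p
      using cauchy_schwarz[OF xi_closed pc[OF xi_closed], of p] by (simp add: vlaw_def hnorm_xi)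
    ultimately show ?thesis unfolding exp_bounded_by_def by (simp, meson order_trans)
  qed
  moreover have "cnorm (Lop V) Y + 1 > 0"
    using op_algebra.cnorm_nonneg'[OF op_algebra_Lop Y] by simp
  ultimately show ?thesis unfolding bvalued_law_def using zero_less_one by blast
qed

end

lemma bvalued_law_eqI:
  assumes "bvalued_law \<mu>" "bvalued_law \<nu>" "\<And>b0 bs. \<mu> (monomial b0 bs) = \<nu> (monomial b0 bs)"
  shows "\<mu> = \<nu>"
proof
  interpret m: law \<mu> by unfold_locales (rule assms)
  interpret n: law \<nu> by unfold_locales (rule assms)
  show "\<mu> p = \<nu> p" for p
    by (induction p rule: bpoly_monomial_induct) (simp_all add: assms(3) m.law_add n.law_add)
qed

text \<open>Evaluation of \<open>p\<close> at \<open>L2_X\<close> is left multiplication by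
  \<open>p\<close> on classes of polynomials, here applied to the class of 1.\<close>

lemma (in law) vlaw_L2_X: "vlaw (L2 \<mu>) (L2_one \<mu>) (L2_X \<mu>) = \<mu>"
proof
  have ev: "peval (L2 \<mu>) (L2_X \<mu>) p (emb (pre_L2 \<mu>) q) = emb (pre_L2 \<mu>) (p * q)" for p q
  proof (induction p arbitrary: q rule: bpoly_induct)
    case (const b)
    show ?case
      using pre.emb_lact[of q b] pre.emb_closed[of q]
      by (simp add: L2.peval_simps L2_X_adjointable pre_L2_simps L2_def[symmetric])
  next
    case X
    show ?case
      using pre.emb_closed[of q] by (simp add: L2.peval_simps L2_X_adjointable pre_L2_simps L2_def[symmetric] L2_X_emb)
  next
    case (add p p')
    then show ?case
      using pre.emb_closed[of q] pre.emb_add[of "p * q" "p' * q"]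
      by (simp add: L2.peval_simps L2_X_adjointable pre_L2_simps L2_def[symmetric] ring_class.ring_distribs)
  next
    case (mult p p')
    then show ?case
      using pre.emb_closed[of q] by (simp add: L2.peval_simps L2_X_adjointable pre_L2_simps L2_def[symmetric] mult.assoc)
  qed
  show "vlaw (L2 \<mu>) (L2_one \<mu>) (L2_X \<mu>) p = \<mu> p" for p
    using ev[of p 1] pre.inn_emb[of 1 p]
    by (simp add: vlaw_def L2_one_def) (simp add: L2_def pre_L2_simps bpoly_star_one)
qed

subsection \<open>The Bernoulli part of a centred operator\<close>

lemma (in prehilb) adj_pair_rank1:
  assumes "x \<in> elems V" "y \<in> elems V"
  shows "adj_pair (\<lambda>u. ract V x (inn V y u)) (\<lambda>u. ract V y (inn V x u)) (hnorm V x * hnorm V y)"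
proof -
  have "hnorm V (ract V x (inn V y u)) \<le> hnorm V x * hnorm V y * hnorm V u" if "u \<in> elems V" for u
  proof -
    have "hnorm V (ract V x (inn V y u)) \<le> hnorm V x * norm (inn V y u)" by (rule hnorm_ract) fact
    also have "\<dots> \<le> hnorm V x * (hnorm V y * hnorm V u)"
      by (rule mult_left_mono[OF cauchy_schwarz]) (simp_all add: assms that)
    finally show ?thesis by (simp add: mult.assoc)
  qed
  then show ?thesis using assms by (simp add: adj_pair_def inn_ract inn_ract_left star_inn)
qed

text \<open>With \<open>P\<close> the projection onto \<open>\<B>\<xi>\<close> and \<open>Q = 1 - P\<close>, the operators below are \<open>QxP\<close>, \<open>PxQ\<close>,
  \<open>PxQ + QxP\<close> and \<open>QxQ\<close>, as \<open>PxP = 0\<close>.\<close>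

locale centred_op = pointed_hilb V \<xi> for V :: "('b::unital_cstar_algebra, 'v) bimod" and \<xi> +
  fixes x :: "'v \<Rightarrow> 'v"
  assumes x_adjointable: "x \<in> adjointable V"
    and x_sym: "h \<in> elems V \<Longrightarrow> k \<in> elems V \<Longrightarrow> inn V (x h) k = inn V h (x k)"
    and x_centred: "inn V \<xi> (x \<xi>) = 0"
begin

definition cre :: "'v \<Rightarrow> 'v" where "cre = (\<lambda>h\<in>elems V. ract V (x \<xi>) (inn V \<xi> h))"
definition ann :: "'v \<Rightarrow> 'v" where "ann = (\<lambda>h\<in>elems V. ract V \<xi> (inn V (x \<xi>) h))"
definition bern :: "'v \<Rightarrow> 'v" where "bern = add (Lop V) cre ann"
definition diag :: "'v \<Rightarrow> 'v" where "diag = (\<lambda>h\<in>elems V. hminus V (x h) (bern h))"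

sublocale L: op_algebra V "Lop V" by (rule op_algebra_Lop)

lemma x_xi_closed [simp]: "x \<xi> \<in> elems V" by (rule op_closed[OF x_adjointable xi_closed])

lemma cre_adjointable: "cre \<in> adjointable V"
  unfolding cre_def by (rule restrict_adjointable[OF adj_pair_rank1]) simp_all

lemma ann_adjointable: "ann \<in> adjointable V"
  unfolding ann_def by (rule restrict_adjointable[OF adj_pair_rank1]) simp_all

lemma bern_adjointable: "bern \<in> adjointable V"
  unfolding bern_def by (rule L.add_adjointable[OF cre_adjointable ann_adjointable])

lemma cre_apply: "h \<in> elems V \<Longrightarrow> cre h = ract V (x \<xi>) (inn V \<xi> h)" by (simp add: cre_def)
lemma ann_apply: "h \<in> elems V \<Longrightarrow> ann h = ract V \<xi> (inn V (x \<xi>) h)" by (simp add: ann_def)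
lemma bern_apply: "h \<in> elems V \<Longrightarrow> bern h = hadd V (ract V (x \<xi>) (inn V \<xi> h)) (ract V \<xi> (inn V (x \<xi>) h))"
  by (simp add: bern_def L.add_apply cre_adjointable ann_adjointable cre_apply ann_apply)

lemma inn_cre: "h \<in> elems V \<Longrightarrow> k \<in> elems V \<Longrightarrow> inn V (cre h) k = inn V h (ann k)"
  by (simp add: cre_apply ann_apply inn_ract inn_ract_left star_inn)

lemma bern_sym: "h \<in> elems V \<Longrightarrow> k \<in> elems V \<Longrightarrow> inn V (bern h) k = inn V h (bern k)"
  by (simp add: bern_apply inn_add_left inn_add_right inn_ract inn_ract_left star_inn add.commute)

lemma x_xi_centred: "inn V (x \<xi>) \<xi> = 0"
  using star_inn[OF xi_closed x_xi_closed] by (simp add: x_centred star_zero)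

lemma bern_xi: "bern \<xi> = x \<xi>"
  by (simp add: bern_apply inn_xi x_xi_centred ract_one ract_zero add_zero_right)

lemma diag_eq_minus: "diag = x \<ominus>\<^bsub>Lop V\<^esub> bern"
proof (rule extensionalityI[of _ "elems V"])
  have "x \<ominus>\<^bsub>Lop V\<^esub> bern \<in> adjointable V" by (rule L.minus_adjointable[OF x_adjointable bern_adjointable])
  then show "x \<ominus>\<^bsub>Lop V\<^esub> bern \<in> extensional (elems V)" by (auto simp: adjointable_def PiE_def)
qed (simp_all add: diag_def L.minus_apply x_adjointable bern_adjointable)

lemma diag_adjointable: "diag \<in> adjointable V"
  unfolding diag_eq_minus by (rule L.minus_adjointable[OF x_adjointable bern_adjointable])

lemma diag_apply: "h \<in> elems V \<Longrightarrow> diag h = hminus V (x h) (bern h)"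
  by (simp add: diag_def)

lemma diag_sym: "h \<in> elems V \<Longrightarrow> k \<in> elems V \<Longrightarrow> inn V (diag h) k = inn V h (diag k)"
  by (simp add: diag_apply inn_hminus_left inn_hminus_right op_closed x_adjointable bern_adjointable x_sym bern_sym)

lemma diag_xi: "diag \<xi> = hzero V"
  by (simp add: diag_apply bern_xi hminus_self)

lemma hnorm_compress:
  assumes h: "h \<in> elems V"
  shows "hnorm V (hminus V h (ract V \<xi> (inn V \<xi> h))) \<le> hnorm V h"
proof -
  let ?q = "hminus V h (ract V \<xi> (inn V \<xi> h))"
  have eq: "inn V h h - inn V ?q ?q = star (inn V \<xi> h) * inn V \<xi> h"
    using h by (simp add: inn_hminus_left inn_hminus_right inn_ract inn_ract_left star_inn inn_xi)
  have "norm (inn V ?q ?q) \<le> norm (inn V h h)"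
    by (rule norm_mono_pos) (use h in \<open>simp_all add: inn_pos eq pos_star_mult\<close>)
  then show ?thesis by (simp add: hnorm_def)
qed

text \<open>The operator is the compression \<open>QxQ\<close>, and \<open>Q\<close> is a
  contraction by \<open>hnorm_compress\<close>. The equality is verified through inner products,
  where centredness of \<open>x\<close> accounts for \<open>PxP = 0\<close>.\<close>

lemma diag_bound:
  assumes C: "\<And>h. h \<in> elems V \<Longrightarrow> hnorm V (x h) \<le> C * hnorm V h" "C \<ge> 0" and h: "h \<in> elems V"
  shows "hnorm V (diag h) \<le> C * hnorm V h"
proof -
  let ?q = "hminus V h (ract V \<xi> (inn V \<xi> h))"
  have q: "?q \<in> elems V" using h by auto
  have xq: "x ?q = hminus V (x h) (ract V (x \<xi>) (inn V \<xi> h))"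
    using h by (simp add: op_hminus[OF x_adjointable] op_ract[OF x_adjointable])
  have "diag h = hminus V (x ?q) (ract V \<xi> (inn V \<xi> (x ?q)))"
    unfolding xq
  proof (rule inn_eqI)
    fix z assume "z \<in> elems V"
    then show "inn V z (diag h) = inn V z (hminus V (hminus V (x h) (ract V (x \<xi>) (inn V \<xi> h)))
        (ract V \<xi> (inn V \<xi> (hminus V (x h) (ract V (x \<xi>) (inn V \<xi> h))))))"
      using h by (simp add: diag_apply bern_apply inn_hminus_right inn_add_right inn_ract op_closed x_adjointable x_sym x_centred)
  qed (use h in \<open>simp_all add: op_closed diag_adjointable x_adjointable\<close>)
  then have "hnorm V (diag h) \<le> hnorm V (x ?q)" using hnorm_compress[OF op_closed[OF x_adjointable q]] by simp
  also have "\<dots> \<le> C * hnorm V ?q" by (rule C(1)[OF q])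
  also have "\<dots> \<le> C * hnorm V h" by (rule mult_left_mono[OF hnorm_compress[OF h] C(2)])
  finally show ?thesis .
qed

text \<open>Two applications of \<open>bern\<close> with \<open>b\<close> between them, moved to the
  left side of the inner product, send \<open>xi\<close> to \<open>x xi\<close> and then to a
  multiple of \<open>xi\<close> by \<open>\<eta> (star b)\<close>. They therefore contribute the
  factor \<open>\<eta> b\<close>, and moments are computed two letters at a time.\<close>

lemma bern_moments:
  assumes var: "\<And>b. inn V (x \<xi>) (lact V b (x \<xi>)) = \<eta> b"
  shows "vlaw V \<xi> bern (monomial b0 bs) = bool_moment \<eta> b0 bs"
proof -
  note bc = op_closed[OF bern_adjointable] and pc = peval_closed[OF bern_adjointable]
  have eta_star: "star (\<eta> (star b)) = \<eta> b" for b
    by (simp add: var[symmetric] star_inn inn_lact star_star)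
  have Z2: "bern (lact V (star b) (x \<xi>)) = ract V \<xi> (\<eta> (star b))" for b
  proof -
    have "inn V \<xi> (lact V (star b) (x \<xi>)) = 0"
      by (simp add: inn_lact_right star_star xi_central inn_ract_left x_centred)
    then show ?thesis by (simp add: bern_apply var ract_zero add_zero)
  qed
  have step: "inn V \<xi> (bern (lact V b (bern w))) = \<eta> b * inn V \<xi> w" if w: "w \<in> elems V" for b w
  proof -
    have "inn V \<xi> (bern (lact V b (bern w))) = inn V (bern \<xi>) (lact V b (bern w))"
      by (rule bern_sym[symmetric]) (use bc w in auto)
    also have "\<dots> = inn V (lact V (star b) (x \<xi>)) (bern w)"
      unfolding bern_xi by (rule inn_lact_right) (use bc w in auto)
    also have "\<dots> = inn V (bern (lact V (star b) (x \<xi>))) w"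
      by (rule bern_sym[symmetric]) (use w in auto)
    also have "\<dots> = \<eta> b * inn V \<xi> w" by (simp add: Z2 inn_ract_left w eta_star)
    finally show ?thesis .
  qed
  have left: "inn V \<xi> (lact V b w) = b * inn V \<xi> w" if "w \<in> elems V" for b w
    using that by (simp add: inn_lact_right xi_central inn_ract_left star_star)
  show ?thesis
  proof (induction bs arbitrary: b0 rule: induct_list012)
    case 1
    then show ?case by (simp add: monomial_Nil vlaw_simps bern_adjointable)
  next
    case (2 b1)
    have "inn V \<xi> (bern (lact V b1 \<xi>)) = 0"
      using bern_sym[of \<xi> "lact V b1 \<xi>"] by (simp add: bern_xi xi_central inn_ract x_xi_centred)
    then show ?case
      by (simp add: monomial_Cons monomial_Nil vlaw_def peval_simps bern_adjointable pc left bc)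
  next
    case (3 b1 b2 bs)
    then show ?case
      by (simp add: monomial_Cons vlaw_def peval_simps bern_adjointable pc left bc step mult.assoc)
  qed
qed

text \<open>The law of \<open>bern\<close> provides existence for the definite description in
  \<open>nu_bool\<close>; uniqueness holds because monomials span the polynomials.\<close>

lemma nu_bool_eq:
  assumes "\<And>b. inn V (x \<xi>) (lact V b (x \<xi>)) = \<eta> b"
  shows "nu_bool \<eta> = vlaw V \<xi> bern"
  unfolding nu_bool_def
proof (rule the_equality)
  show "bvalued_law (vlaw V \<xi> bern) \<and> (\<forall>b0 bs. vlaw V \<xi> bern (monomial b0 bs) = bool_moment \<eta> b0 bs)"
    using bvalued_law_vlaw[OF bern_adjointable bern_sym] bern_moments[OF assms] by blast
  then show "\<nu> = vlaw V \<xi> bern" if "bvalued_law \<nu> \<and> (\<forall>b0 bs. \<nu> (monomial b0 bs) = bool_moment \<eta> b0 bs)" for \<nu>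
    using that by (intro bvalued_law_eqI) auto
qed

end

subsection \<open>The \<open>T\<close>-free product\<close>

context prehilb
begin

text \<open>The difference of the two vectors is orthogonal to all embedded vectors, and some of
  these come arbitrarily close to it.\<close>

lemma emb_separates:
  assumes "c \<in> elems (completion V)" "d \<in> elems (completion V)"
    and eq: "\<And>v. v \<in> elems V \<Longrightarrow> inn (completion V) c (emb V v) = inn (completion V) d (emb V v)"
  shows "c = d"
proof -
  interpret C: hilb "completion V" by (rule hilb_completion)
  let ?e = "hminus (completion V) c d"
  have e: "?e \<in> elems (completion V)" using assms(1,2) by auto
  have "hnorm (completion V) ?e \<le> r" if r: "r > 0" for r
  proof -
    obtain v where v: "v \<in> elems V" "hnorm (completion V) (hminus (completion V) (emb V v) ?e) < r"
      by (rule emb_dense[OF e r])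
    have ev: "emb V v \<in> elems (completion V)" by (rule emb_closed[OF v(1)])
    have "inn (completion V) ?e (emb V v) = 0"
      using C.inn_hminus_left[OF ev assms(1,2)] eq[OF v(1)] by simp
    then have "norm (inn (completion V) ?e ?e) = norm (inn (completion V) ?e (hminus (completion V) (emb V v) ?e))"
      using C.inn_hminus_right[OF e ev e] by simp
    also have "\<dots> \<le> hnorm (completion V) ?e * hnorm (completion V) (hminus (completion V) (emb V v) ?e)"
      by (rule C.cauchy_schwarz) (use e ev in auto)
    also have "\<dots> \<le> hnorm (completion V) ?e * r" using v(2) by (intro mult_left_mono) simp_all
    finally have "hnorm (completion V) ?e * hnorm (completion V) ?e \<le> hnorm (completion V) ?e * r"
      by (simp add: C.hnorm_sq[symmetric] power2_eq_square)
    then show ?thesis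
      using r C.hnorm_nonneg[of ?e] mult_le_cancel_left_pos[of "hnorm (completion V) ?e" _ r]
      by (cases "hnorm (completion V) ?e = 0") (simp, metis order.not_eq_order_implies_strict)
  qed
  then have "hnorm (completion V) ?e \<le> 0 + r" if "r > 0" for r using that by simp
  then have "hnorm (completion V) ?e \<le> 0" by (rule field_le_epsilon)
  then have "?e = hzero (completion V)" using C.hnorm_eq_0[OF e] C.hnorm_nonneg[of ?e] by simp
  then show ?thesis by (rule C.hminus_eq_zero_imp[OF assms(1,2)])
qed

text \<open>The values of the two adjoints have equal inner products with embedded vectors, so
  \<open>emb_separates\<close> identifies the adjoints, and with them the operators.\<close>

lemma op_eq_dense:
  assumes "S \<in> adjointable (completion V)" "T \<in> adjointable (completion V)"
    and eq: "\<And>v. v \<in> elems V \<Longrightarrow> S (emb V v) = T (emb V v)"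
  shows "S = T"
proof -
  interpret C: hilb "completion V" by (rule hilb_completion)
  interpret L: op_algebra "completion V" "Lop (completion V)" by (rule C.op_algebra_Lop)
  have adj_eq: "adj (Lop (completion V)) S k = adj (Lop (completion V)) T k" if k: "k \<in> elems (completion V)" for k
  proof (rule emb_separates)
    fix v assume v: "v \<in> elems V"
    show "inn (completion V) (adj (Lop (completion V)) S k) (emb V v) = inn (completion V) (adj (Lop (completion V)) T k) (emb V v)"
      using L.inn_adj_right[OF assms(1) k emb_closed[OF v]] L.inn_adj_right[OF assms(2) k emb_closed[OF v]] eq[OF v] by simp
  qed (use k assms L.adj_adjointable C.op_closed in auto)
  have "adj (Lop (completion V)) S = adj (Lop (completion V)) T"
    using L.adj_adjointable[OF assms(1)] L.adj_adjointable[OF assms(2)] adj_eq by (rule C.op_eqI)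
  from arg_cong[OF this, of "adj (Lop (completion V))"] show ?thesis
    unfolding L.adj_adj'[OF assms(1)] L.adj_adj'[OF assms(2)] .
qed

end

text \<open>Closure under deletion of the first letter expresses connectedness to the empty string
  in the ambient tree. \<open>Tree_subtree\<close> derives it from membership in
  \<open>Tree N\<close>.\<close>

definition subtree :: "nat \<Rightarrow> nat list set \<Rightarrow> bool" where
  "subtree N T \<longleftrightarrow> T \<subseteq> alt_strings N \<and> [] \<in> T \<and> (\<forall>j s. j # s \<in> T \<longrightarrow> s \<in> T)"

locale tfree_product =
  fixes N :: nat and T :: "nat list set" and H :: "nat \<Rightarrow> ('b::unital_cstar_algebra, 'h) bimod" and \<xi> :: "nat \<Rightarrow> 'h"
  assumes subtree: "subtree N T"
    and pointed: "j \<in> {1..N} \<Longrightarrow> pointed_hilb (H j) (\<xi> j)"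
begin

lemma T_Nil: "[] \<in> T" using subtree by (simp add: subtree_def)

lemma T_tl: "j # s \<in> T \<Longrightarrow> s \<in> T" using subtree by (auto simp: subtree_def)

lemma T_letter: "j # s \<in> T \<Longrightarrow> j \<in> {1..N}"
  using subtree by (auto simp: subtree_def alt_strings_def)

lemma T_alt: "j # s \<in> T \<Longrightarrow> s = [] \<or> hd s \<noteq> j"
proof -
  assume "j # s \<in> T"
  then have "distinct_adj (j # s)" using subtree by (auto simp: subtree_def alt_strings_def)
  then show ?thesis by (cases s) auto
qed

lemma hilbH: "j \<in> {1..N} \<Longrightarrow> hilb (H j)"
  by (rule pointed_hilb.axioms(1)[OF pointed])

lemma prehilbH: "j \<in> {1..N} \<Longrightarrow> prehilb (H j)"
  by (rule hilb.axioms(1)[OF hilbH])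

definition tensors :: "nat list \<Rightarrow> 'h list \<Rightarrow> bool" where
  "tensors s hs \<longleftrightarrow> list_all2 (\<lambda>j h. j \<in> {1..N} \<and> h \<in> elems (H j)) s hs"

lemma tensors_simps [simp]: "tensors [] hs \<longleftrightarrow> hs = []"
  "tensors (j # s) hs \<longleftrightarrow> (\<exists>h hs'. hs = h # hs' \<and> j \<in> {1..N} \<and> h \<in> elems (H j) \<and> tensors s hs')"
  by (auto simp: tensors_def list_all2_Cons1)

lemma tensor_inn_add:
  "tensors s hs \<Longrightarrow> tensors s ks \<Longrightarrow> tensor_inn H s (b + c) hs ks = tensor_inn H s b hs ks + tensor_inn H s c hs ks"
proof (induction s arbitrary: b c hs ks)
  case (Cons j s)
  then obtain h hs' k ks' where *: "hs = h # hs'" "ks = k # ks'" "j \<in> {1..N}" "h \<in> elems (H j)" "k \<in> elems (H j)"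
    "tensors s hs'" "tensors s ks'" by auto
  interpret prehilb "H j" by (rule prehilbH) fact
  show ?case using * Cons.IH by (simp add: inn_lact_add)
qed simp

lemma tensor_inn_scalar:
  "tensors s hs \<Longrightarrow> tensors s ks \<Longrightarrow> tensor_inn H s (b * scalar z) hs ks = tensor_inn H s b hs ks * scalar z"
proof (induction s arbitrary: b hs ks)
  case (Cons j s)
  then obtain h hs' k ks' where *: "hs = h # hs'" "ks = k # ks'" "j \<in> {1..N}" "h \<in> elems (H j)" "k \<in> elems (H j)"
    "tensors s hs'" "tensors s ks'" by auto
  interpret hilb "H j" by (rule hilbH) fact
  show ?case using * Cons.IH by (simp add: lact_mult lact_scalar lact_ract inn_ract)
qed simp

lemma tensor_inn_star:
  "tensors s hs \<Longrightarrow> tensors s ks \<Longrightarrow> star (tensor_inn H s b hs ks) = tensor_inn H s (star b) ks hs"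
proof (induction s arbitrary: b hs ks)
  case (Cons j s)
  then obtain h hs' k ks' where *: "hs = h # hs'" "ks = k # ks'" "j \<in> {1..N}" "h \<in> elems (H j)" "k \<in> elems (H j)"
    "tensors s hs'" "tensors s ks'" by auto
  interpret prehilb "H j" by (rule prehilbH) fact
  show ?case using * Cons.IH by (simp add: star_inn inn_lact)
qed simp

lemma tensor_inn_zero: "tensors s hs \<Longrightarrow> tensors s ks \<Longrightarrow> tensor_inn H s 0 hs ks = 0"
  using tensor_inn_add[of s hs ks 0 0] by simp

text \<open>The Gram matrix of tensors is positive also after insertion of a positive matrix \<open>M\<close>, which is
  what the induction on the number of factors needs: writing \<open>M = C\<^sup>*C\<close>, one factor turns \<open>M\<close> into a
  sum of Gram matrices of the vectors \<open>C\<^bsub>ki\<^esub> h\<^sub>i\<close>.\<close>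

lemma tensor_inn_pos:
  assumes "finite I" "\<And>i. i \<in> I \<Longrightarrow> tensors s (hs i)"
    and "\<And>i j. i \<in> I \<Longrightarrow> j \<in> I \<Longrightarrow> star (M i j) = M j i" "\<And>v. pos (mform I M v v)"
  shows "pos (mform I (\<lambda>i j. tensor_inn H s (M i j) (hs i) (hs j)) v v)"
  using assms(2-)
proof (induction s arbitrary: hs M)
  case Nil
  have "mform I (\<lambda>i j. tensor_inn H [] (M i j) (hs i) (hs j)) v v = mform I M v v"
    unfolding mform_def using Nil(1) by (intro sum.cong) simp_all
  then show ?case using Nil by simp
next
  case (Cons a s)
  show ?case
  proof (cases "I = {}")
    case True
    then show ?thesis by (simp add: mform_def)
  next
    case False
    then have a: "a \<in> {1..N}" using Cons.prems(1) by fastforce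
    interpret hilb "H a" by (rule hilbH[OF a])
    define h where "h = (\<lambda>i. hd (hs i))"
    have hs: "hs i = h i # tl (hs i)" "h i \<in> elems (H a)" "tensors s (tl (hs i))" if "i \<in> I" for i
      using Cons.prems(1)[OF that] by (auto simp: h_def)
    obtain C where C: "\<forall>i\<in>I. \<forall>j\<in>I. M i j = (\<Sum>k\<in>I. star (C k i) * C k j)"
      using matrix_square_root[OF assms(1) Cons.prems(2,3)] by blast
    define M' where "M' = (\<lambda>i j. inn (H a) (h i) (lact (H a) (M i j) (h j)))"
    have sum_lact: "inn (H a) u (lact (H a) (\<Sum>k\<in>F. f k) w) = (\<Sum>k\<in>F. inn (H a) u (lact (H a) (f k) w))"
      if "u \<in> elems (H a)" "w \<in> elems (H a)" for u w f and F :: "'c set"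
      using that by (induction F rule: infinite_finite_induct) (simp_all add: lact_zero_left inn_lact_add)
    have M': "M' i j = (\<Sum>k\<in>I. inn (H a) (lact (H a) (C k i) (h i)) (lact (H a) (C k j) (h j)))"
      if "i \<in> I" "j \<in> I" for i j
    proof -
      have "M' i j = (\<Sum>k\<in>I. inn (H a) (h i) (lact (H a) (star (C k i) * C k j) (h j)))"
        using bspec[OF bspec[OF C that(1)] that(2)] sum_lact[OF hs(2)[OF that(1)] hs(2)[OF that(2)]] by (simp add: M'_def)
      also have "\<dots> = (\<Sum>k\<in>I. inn (H a) (lact (H a) (C k i) (h i)) (lact (H a) (C k j) (h j)))"
        using hs(2)[OF that(1)] hs(2)[OF that(2)] by (simp add: lact_mult inn_lact)
      finally show ?thesis .
    qed
    have "star (M' i j) = M' j i" if "i \<in> I" "j \<in> I" for i j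
      using that hs(2) Cons.prems(2)[OF that] by (simp add: M'_def star_inn inn_lact)
    moreover have "pos (mform I M' v v)" for v
    proof -
      have "mform I M' v v = (\<Sum>i\<in>I. \<Sum>j\<in>I. \<Sum>k\<in>I. star (v i) * inn (H a) (lact (H a) (C k i) (h i)) (lact (H a) (C k j) (h j)) * v j)"
        unfolding mform_def by (intro sum.cong) (simp_all add: M' sum_distrib_left sum_distrib_right)
      also have "\<dots> = (\<Sum>i\<in>I. \<Sum>k\<in>I. \<Sum>j\<in>I. star (v i) * inn (H a) (lact (H a) (C k i) (h i)) (lact (H a) (C k j) (h j)) * v j)"
        by (rule sum.cong[OF HOL.refl], rule sum.swap)
      also have "\<dots> = (\<Sum>k\<in>I. \<Sum>i\<in>I. \<Sum>j\<in>I. star (v i) * inn (H a) (lact (H a) (C k i) (h i)) (lact (H a) (C k j) (h j)) * v j)"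
        by (rule sum.swap)
      also have "pos \<dots>"
        by (rule pos_sum, rule gram_pos[OF assms(1)]) (use hs(2) in auto)
      finally show ?thesis .
    qed
    ultimately have "pos (mform I (\<lambda>i j. tensor_inn H s (M' i j) (tl (hs i)) (tl (hs j))) v v)"
      by (intro Cons.IH hs(3))
    also have "mform I (\<lambda>i j. tensor_inn H s (M' i j) (tl (hs i)) (tl (hs j))) v v
        = mform I (\<lambda>i j. tensor_inn H (a # s) (M i j) (hs i) (hs j)) v v"
      unfolding mform_def
    proof (intro sum.cong HOL.refl)
      fix i j assume ij: "i \<in> I" "j \<in> I"
      have "tensor_inn H (a # s) (M i j) (hs i) (hs j) = tensor_inn H s (M' i j) (tl (hs i)) (tl (hs j))"
        by (subst hs(1)[OF ij(1)], subst hs(1)[OF ij(2)]) (simp add: M'_def)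
      then show "star (v i) * tensor_inn H s (M' i j) (tl (hs i)) (tl (hs j)) * v j
          = star (v i) * tensor_inn H (a # s) (M i j) (hs i) (hs j) * v j" by simp
    qed
    finally show ?thesis .
  qed
qed

definition gens :: "'h gen set" where
  "gens = {x. fst x \<in> T \<and> snd x \<in> simple_tensors H \<xi> (fst x)}"

lemma simple_tensors_Nil [simp]: "hs \<in> simple_tensors H \<xi> [] \<longleftrightarrow> hs = []"
  by (simp add: simple_tensors_def)

lemma simple_tensors_Cons: "hs \<in> simple_tensors H \<xi> (j # s) \<longleftrightarrow>
    (\<exists>h hs'. hs = h # hs' \<and> h \<in> hcirc (H j) (\<xi> j) \<and> hs' \<in> simple_tensors H \<xi> s)"
  by (auto simp: simple_tensors_def list_all2_Cons1)

lemma simple_tensors_tensors: "s \<in> T \<Longrightarrow> hs \<in> simple_tensors H \<xi> s \<Longrightarrow> tensors s hs"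
proof (induction s arbitrary: hs)
  case (Cons j s)
  then show ?case using T_tl[of j s] T_letter[of j s] by (auto simp: simple_tensors_Cons hcirc_def)
qed simp

lemma gens_tensors: "x \<in> gens \<Longrightarrow> tensors (fst x) (snd x)"
  by (auto simp: gens_def intro: simple_tensors_tensors)

abbreviation "PT \<equiv> pre_tfree T H \<xi>"

lemma PT_simps: "elems PT = {v. Poly_Mapping.keys v \<subseteq> gens}" "hzero PT = 0" "hadd PT v w = v + w"
  "ract PT v b = Poly_Mapping.map (\<lambda>a. a * b) v"
  by (auto simp: pre_tfree_def gens_def)

text \<open>The inner product with a coefficient \<open>b\<close> inserted between the two tensors.
  It computes \<open>inn u (b v)\<close> independently of how the left action is written on
  generators; see \<open>inn_lact_PT\<close>.\<close>

definition bform :: "'b \<Rightarrow> 'h gen \<Rightarrow> 'h gen \<Rightarrow> 'b" where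
  "bform b x y = (if fst x = fst y then tensor_inn H (fst x) b (snd x) (snd y) else 0)"

definition bsum :: "'b \<Rightarrow> ('h gen \<Rightarrow>\<^sub>0 'b) \<Rightarrow> ('h gen \<Rightarrow>\<^sub>0 'b) \<Rightarrow> 'b" where
  "bsum b v w = (\<Sum>x\<in>Poly_Mapping.keys v. \<Sum>y\<in>Poly_Mapping.keys w.
     star (Poly_Mapping.lookup v x) * bform b x y * Poly_Mapping.lookup w y)"

lemma inn_PT: "inn PT v w = bsum 1 v w"
  by (simp add: pre_tfree_def bsum_def bform_def gen_inn_def)

lemma bsum_superset:
  assumes "finite S" "finite R" "Poly_Mapping.keys v \<subseteq> S" "Poly_Mapping.keys w \<subseteq> R"
  shows "bsum b v w = (\<Sum>x\<in>S. \<Sum>y\<in>R. star (Poly_Mapping.lookup v x) * bform b x y * Poly_Mapping.lookup w y)"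
proof -
  have "bsum b v w = (\<Sum>x\<in>Poly_Mapping.keys v. \<Sum>y\<in>R. star (Poly_Mapping.lookup v x) * bform b x y * Poly_Mapping.lookup w y)"
    unfolding bsum_def by (intro sum.cong sum.mono_neutral_left assms) (auto simp: in_keys_iff)
  also have "\<dots> = (\<Sum>x\<in>S. \<Sum>y\<in>R. star (Poly_Mapping.lookup v x) * bform b x y * Poly_Mapping.lookup w y)"
    by (intro sum.mono_neutral_left assms) (auto simp: in_keys_iff star_zero)
  finally show ?thesis .
qed

lemma bsum_add_right: "bsum b u (v + w) = bsum b u v + bsum b u w"
proof -
  let ?S = "Poly_Mapping.keys u" and ?R = "Poly_Mapping.keys v \<union> Poly_Mapping.keys w"
  have k: "Poly_Mapping.keys (v + w) \<subseteq> ?R" by (rule Poly_Mapping.keys_add)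
  show ?thesis
    by (subst (1 2 3) bsum_superset[of ?S ?R])
      (use k in \<open>auto simp: lookup_add algebra_simps sum.distrib\<close>)
qed

lemma bsum_add_left: "bsum b (u + v) w = bsum b u w + bsum b v w"
proof -
  let ?R = "Poly_Mapping.keys w" and ?S = "Poly_Mapping.keys u \<union> Poly_Mapping.keys v"
  have k: "Poly_Mapping.keys (u + v) \<subseteq> ?S" by (rule Poly_Mapping.keys_add)
  show ?thesis
    by (subst (1 2 3) bsum_superset[of ?S ?R])
      (use k in \<open>auto simp: lookup_add star_add algebra_simps sum.distrib\<close>)
qed

lemma bsum_single: "bsum b (Poly_Mapping.single x c) (Poly_Mapping.single y d) = star c * bform b x y * d"
  by (subst bsum_superset[of "{x}" "{y}"]) auto

lemma bsum_zero [simp]: "bsum b 0 v = 0" "bsum b v 0 = 0"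
  by (simp_all add: bsum_def)

lemma lookup_map_mult: "Poly_Mapping.lookup (Poly_Mapping.map (\<lambda>a. a * b) v) x = Poly_Mapping.lookup v x * (b::'b)"
  by (simp add: map.rep_eq when_def)

lemma map_mult_add: "Poly_Mapping.map (\<lambda>a. a * b) (v + w) = Poly_Mapping.map (\<lambda>a. a * b) v + Poly_Mapping.map (\<lambda>a. a * (b::'b)) w"
  by (rule poly_mapping_eqI) (simp add: lookup_map_mult lookup_add algebra_simps)

lemma map_mult_zero: "Poly_Mapping.map (\<lambda>a. a * (b::'b)) 0 = 0"
  by (rule poly_mapping_eqI) (simp add: lookup_map_mult)

lemma map_mult_single: "Poly_Mapping.map (\<lambda>a. a * b) (Poly_Mapping.single x c) = Poly_Mapping.single x (c * (b::'b))"
  by (rule poly_mapping_eqI) (simp add: lookup_map_mult lookup_single when_def)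

lemma elems_induct [consumes 1, case_names zero single add]:
  assumes "v \<in> elems PT" "P 0" "\<And>x c. x \<in> gens \<Longrightarrow> P (Poly_Mapping.single x c)" "\<And>v w. P v \<Longrightarrow> P w \<Longrightarrow> P (v + w)"
  shows "P v"
proof -
  have "P (\<Sum>x\<in>F. Poly_Mapping.single x (Poly_Mapping.lookup v x))" if "F \<subseteq> Poly_Mapping.keys v" "finite F" for F
    using that(2,1)
  proof (induction F rule: finite_induct)
    case (insert x F)
    then have "x \<in> gens" using assms(1) by (auto simp: PT_simps)
    from assms(4)[OF assms(3)[OF this]] insert show ?case by simp
  qed (simp add: assms(2))
  moreover have "(\<Sum>x\<in>Poly_Mapping.keys v. Poly_Mapping.single x (Poly_Mapping.lookup v x)) = v"
    by (rule poly_mapping_eqI) (simp add: lookup_sum lookup_single when_def in_keys_iff)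
  ultimately show ?thesis by (metis subset_refl finite_keys)
qed

lemma bsum_map_right: "w \<in> elems PT \<Longrightarrow> v \<in> elems PT \<Longrightarrow> bsum b v (Poly_Mapping.map (\<lambda>a. a * c) w) = bsum b v w * c"
proof (induction w rule: elems_induct)
  case (single y d)
  from single(2) show ?case
  proof (induction v rule: elems_induct)
    case (single x a)
    show ?case by (simp add: map_mult_single bsum_single mult.assoc)
  qed (simp_all add: bsum_add_left algebra_simps)
next
  case (add w w')
  then show ?case by (simp add: map_mult_add bsum_add_right algebra_simps)
qed (simp add: map_mult_zero)

lemma lact_PT_superset:
  assumes "finite S" "Poly_Mapping.keys v \<subseteq> S"
  shows "lact PT b v = (\<Sum>x\<in>S. gen_lact H b x (Poly_Mapping.lookup v x))"
proof -
  have z: "gen_lact H b x 0 = 0" for x by (cases "(H, b, x, 0::'b)" rule: gen_lact.cases) simp_all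
  have "lact PT b v = (\<Sum>x\<in>Poly_Mapping.keys v. gen_lact H b x (Poly_Mapping.lookup v x))"
    by (simp add: pre_tfree_def)
  also have "\<dots> = (\<Sum>x\<in>S. gen_lact H b x (Poly_Mapping.lookup v x))"
    using assms by (intro sum.mono_neutral_left) (auto simp: in_keys_iff z)
  finally show ?thesis .
qed

lemma gen_lact_add: "gen_lact H b x (c + d) = gen_lact H b x c + gen_lact H b x d"
  by (cases "(H, b, x, c)" rule: gen_lact.cases) (simp_all add: single_add algebra_simps)

lemma lact_PT_add: "lact PT b (v + w) = lact PT b v + lact PT b w"
proof -
  let ?S = "Poly_Mapping.keys v \<union> Poly_Mapping.keys w"
  have k: "Poly_Mapping.keys (v + w) \<subseteq> ?S" by (rule Poly_Mapping.keys_add)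
  show ?thesis
    by (subst (1 2 3) lact_PT_superset[of ?S])
      (use k in \<open>auto simp: lookup_add gen_lact_add sum.distrib\<close>)
qed

lemma lact_PT_single: "lact PT b (Poly_Mapping.single x c) = gen_lact H b x c"
  by (subst lact_PT_superset[of "{x}"]) auto

lemma lact_PT_zero: "lact PT b 0 = 0"
  by (subst lact_PT_superset[of "{}"]) auto

lemma gens_cases:
  assumes "x \<in> gens"
  obtains "x = ([], [])" | j s h hs where "x = (j # s, h # hs)" "j \<in> {1..N}" "h \<in> hcirc (H j) (\<xi> j)" "(s, hs) \<in> gens" "j # s \<in> T"
proof -
  obtain s hs where x: "x = (s, hs)" by (cases x)
  show ?thesis
  proof (cases s)
    case Nil
    then show ?thesis using assms that(1) by (simp add: x gens_def)
  next
    case (Cons j s')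
    then have T: "j # s' \<in> T" using assms by (simp add: x gens_def)
    obtain h hs' where "hs = h # hs'" "h \<in> hcirc (H j) (\<xi> j)" "hs' \<in> simple_tensors H \<xi> s'"
      using assms Cons by (auto simp: x gens_def simple_tensors_Cons)
    then show ?thesis using that(2)[of j s' h hs'] T T_letter[OF T] T_tl[OF T] by (simp add: x gens_def Cons)
  qed
qed

lemma hcirc_lact: "j \<in> {1..N} \<Longrightarrow> h \<in> hcirc (H j) (\<xi> j) \<Longrightarrow> lact (H j) b h \<in> hcirc (H j) (\<xi> j)"
proof -
  assume j: "j \<in> {1..N}" and h: "h \<in> hcirc (H j) (\<xi> j)"
  interpret pointed_hilb "H j" "\<xi> j" by (rule pointed[OF j])
  show ?thesis using h by (simp add: hcirc_def inn_lact xi_central inn_ract)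
qed

lemma gen_lact_closed:
  assumes "x \<in> gens"
  shows "gen_lact H b x c \<in> elems PT"
  using assms
proof (cases rule: gens_cases)
  case 1
  then show ?thesis using assms by (auto simp: PT_simps)
next
  case (2 j s h hs)
  then have "(j # s, lact (H j) b h # hs) \<in> gens"
    by (simp add: gens_def simple_tensors_Cons hcirc_lact)
  then show ?thesis using 2 by (auto simp: PT_simps)
qed

lemma bform_lact: 
  assumes "x \<in> gens" "y \<in> gens"
  shows "bsum 1 (Poly_Mapping.single y d) (gen_lact H b x c) = star d * bform b y x * c"
  using assms(1)
proof (cases rule: gens_cases)
  case 1
  then show ?thesis using gens_tensors[OF assms(2)]
    by (cases "fst y = []") (simp_all add: bsum_single bform_def mult.assoc)
next
  case (2 j s h hs)
  interpret hilb "H j" by (rule hilbH[OF 2(2)])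
  show ?thesis
  proof (cases "fst y = j # s")
    case True
    then obtain k ks where y: "y = (j # s, k # ks)" "k \<in> elems (H j)" using gens_tensors[OF assms(2)] by (cases y) auto
    then show ?thesis using 2 by (simp add: bsum_single bform_def lact_one hcirc_def)
  next
    case False
    then show ?thesis using 2 by (simp add: bsum_single bform_def)
  qed
qed

lemma inn_lact_PT:
  assumes "v \<in> elems PT" "u \<in> elems PT"
  shows "inn PT u (lact PT b v) = bsum b u v"
  using assms
proof (induction v rule: elems_induct)
  case (single x c)
  from single(2) show ?case
  proof (induction u rule: elems_induct)
    case (single y d)
    then show ?case using bform_lact[OF \<open>x \<in> gens\<close> single] by (simp add: inn_PT lact_PT_single bsum_single)
  qed (simp_all add: inn_PT bsum_add_left)
qed (simp_all add: inn_PT lact_PT_add lact_PT_zero bsum_add_right)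

lemma bform_add: "x \<in> gens \<Longrightarrow> y \<in> gens \<Longrightarrow> bform (b + c) x y = bform b x y + bform c x y"
  using gens_tensors[of x] gens_tensors[of y] by (cases "fst x = fst y") (simp_all add: bform_def tensor_inn_add)

lemma bform_star: "x \<in> gens \<Longrightarrow> y \<in> gens \<Longrightarrow> star (bform b x y) = bform (star b) y x"
  using gens_tensors[of x] gens_tensors[of y] by (cases "fst x = fst y") (simp_all add: bform_def tensor_inn_star star_zero)

lemma bform_scalar: "x \<in> gens \<Longrightarrow> y \<in> gens \<Longrightarrow> bform (scalar z) x y = bform 1 x y * scalar z"
  using gens_tensors[of x] gens_tensors[of y] tensor_inn_scalar[of "fst x" "snd x" "snd y" 1 z]
  by (cases "fst x = fst y") (simp_all add: bform_def)

lemma bsum_props: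
  assumes v: "v \<in> elems PT" and w: "w \<in> elems PT"
  shows "bsum (b + c) v w = bsum b v w + bsum c v w" "star (bsum b v w) = bsum (star b) w v"
    "bsum (scalar z) v w = bsum 1 v w * scalar z"
proof -
  have k: "x \<in> gens" if "x \<in> Poly_Mapping.keys v" for x using v that by (auto simp: PT_simps)
  have l: "x \<in> gens" if "x \<in> Poly_Mapping.keys w" for x using w that by (auto simp: PT_simps)
  show "bsum (b + c) v w = bsum b v w + bsum c v w"
    unfolding bsum_def by (simp add: bform_add k l algebra_simps sum.distrib)
  show "star (bsum b v w) = bsum (star b) w v"
    unfolding bsum_def by (subst sum.swap) (simp add: star_sum star_mult star_star bform_star k l mult.assoc)
  have t: "a * (f * scalar z) * d = a * f * d * scalar z" for a f d :: 'b
    by (simp add: mult_scaleC_left mult_scaleC_right)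
  show "bsum (scalar z) v w = bsum 1 v w * scalar z"
    unfolding bsum_def by (simp add: bform_scalar k l t sum_distrib_right)
qed

text \<open>Summands at different strings are orthogonal, so the sum splits over strings. Within one
  string \<open>tensor_inn_pos\<close> is applied to the matrix with all entries 1, whose form is
  \<open>star s * s\<close> with \<open>s\<close> the sum of the coefficients.\<close>

lemma bsum_pos:
  assumes v: "v \<in> elems PT"
  shows "pos (bsum 1 v v)"
proof -
  let ?K = "Poly_Mapping.keys v"
  have k: "x \<in> gens" if "x \<in> ?K" for x using v that by (auto simp: PT_simps)
  let ?f = "\<lambda>x y. star (Poly_Mapping.lookup v x) * bform 1 x y * Poly_Mapping.lookup v y"
  have "bsum 1 v v = (\<Sum>s\<in>fst ` ?K. \<Sum>x\<in>{x\<in>?K. fst x = s}. \<Sum>y\<in>?K. ?f x y)"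
    unfolding bsum_def by (rule sum.image_gen) simp
  also have "\<dots> = (\<Sum>s\<in>fst ` ?K. \<Sum>x\<in>{x\<in>?K. fst x = s}. \<Sum>y\<in>{y\<in>?K. fst y = s}. ?f x y)"
    by (intro sum.cong HOL.refl sum.mono_neutral_right) (auto simp: bform_def)
  also have "pos \<dots>"
  proof (rule pos_sum)
    fix s assume "s \<in> fst ` ?K"
    let ?I = "{x\<in>?K. fst x = s}"
    have "pos (mform ?I (\<lambda>x y. tensor_inn H s 1 (snd x) (snd y)) (Poly_Mapping.lookup v) (Poly_Mapping.lookup v))"
    proof (rule tensor_inn_pos)
      show "tensors s (snd x)" if "x \<in> ?I" for x using gens_tensors[OF k] that by auto
      show "pos (mform ?I (\<lambda>_ _. 1 :: 'b) u u)" for u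
      proof -
        have "mform ?I (\<lambda>_ _. 1) u u = star (\<Sum>x\<in>?I. u x) * (\<Sum>x\<in>?I. u x)"
          by (simp add: mform_def star_sum sum_product)
        then show ?thesis by (simp add: pos_star_mult)
      qed
    qed (simp_all add: star_one)
    also have "mform ?I (\<lambda>x y. tensor_inn H s 1 (snd x) (snd y)) (Poly_Mapping.lookup v) (Poly_Mapping.lookup v)
        = (\<Sum>x\<in>?I. \<Sum>y\<in>?I. ?f x y)"
      unfolding mform_def by (intro sum.cong HOL.refl) (simp add: bform_def)
    finally show "pos (\<Sum>x\<in>?I. \<Sum>y\<in>?I. ?f x y)" .
  qed
  finally show ?thesis .
qed

lemma lact_PT_closed: "v \<in> elems PT \<Longrightarrow> lact PT b v \<in> elems PT"
proof (induction v rule: elems_induct)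
  case (add v w)
  have "Poly_Mapping.keys (lact PT b v + lact PT b w) \<subseteq> Poly_Mapping.keys (lact PT b v) \<union> Poly_Mapping.keys (lact PT b w)"
    by (rule Poly_Mapping.keys_add)
  then show ?case using add by (simp add: lact_PT_add PT_simps) blast
qed (simp_all add: lact_PT_zero lact_PT_single gen_lact_closed, simp add: PT_simps)

lemma lact_PT_mult:
  assumes "v \<in> elems PT" "u \<in> elems PT"
  shows "inn PT u (lact PT (b * c) v) = inn PT u (lact PT b (lact PT c v))"
  using assms
proof (induction v rule: elems_induct)
  case (single x d)
  from single(1) show ?case
  proof (cases rule: gens_cases)
    case 1
    then show ?thesis by (simp add: lact_PT_single mult.assoc)
  next
    case (2 j s h hs)
    interpret hilb "H j" by (rule hilbH[OF 2(2)])
    show ?thesis using 2 by (simp add: lact_PT_single lact_mult hcirc_def)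
  qed
qed (simp_all add: lact_PT_add lact_PT_zero inn_PT bsum_add_right)

lemma keys_map_mult: "Poly_Mapping.keys (Poly_Mapping.map (\<lambda>a. a * (b::'b)) v) \<subseteq> Poly_Mapping.keys v"
  by (auto simp: in_keys_iff lookup_map_mult)

lemma prehilb_PT: "prehilb PT"
proof
  fix u v w :: "'h gen \<Rightarrow>\<^sub>0 'b" and b c :: 'b and z :: complex
  show "hzero PT \<in> elems PT" by (simp add: PT_simps)
  assume u: "u \<in> elems PT"
  show "lact PT b u \<in> elems PT" by (rule lact_PT_closed[OF u])
  show "ract PT u b \<in> elems PT" using u keys_map_mult[of b u] by (auto simp: PT_simps)
  show "hadd PT (hzero PT) u = u" by (simp add: PT_simps)
  show "ract PT u (b + c) = hadd PT (ract PT u b) (ract PT u c)"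
    unfolding PT_simps by (rule poly_mapping_eqI, simp only: lookup_map_mult lookup_add, simp add: algebra_simps)
  show "ract PT u (b * c) = ract PT (ract PT u b) c"
    unfolding PT_simps by (rule poly_mapping_eqI) (simp add: lookup_map_mult mult.assoc)
  show "ract PT u 1 = u" "ract PT u 0 = hzero PT"
    unfolding PT_simps
    by (rule poly_mapping_eqI, simp only: lookup_map_mult, simp, rule poly_mapping_eqI, simp only: lookup_map_mult, simp)
  show "pos (inn PT u u)" using bsum_pos[OF u] by (simp add: inn_PT)
  assume v: "v \<in> elems PT"
  show "hadd PT u v \<in> elems PT" using u v Poly_Mapping.keys_add[of u v] by (auto simp: PT_simps)
  show "hadd PT u v = hadd PT v u" by (simp add: PT_simps add.commute)
  show "ract PT (hadd PT u v) b = hadd PT (ract PT u b) (ract PT v b)" by (simp add: PT_simps map_mult_add)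
  show "inn PT u (ract PT v b) = inn PT u v * b"
    using bsum_map_right[OF v u, of 1 b] by (simp add: inn_PT PT_simps)
  show "star (inn PT u v) = inn PT v u" using bsum_props(2)[OF u v, of 1] by (simp add: inn_PT star_one)
  then have sym: "star (inn PT u v) = inn PT v u" .
  show "inn PT (lact PT b u) v = inn PT u (lact PT (star b) v)"
    using bsum_props(2)[OF v lact_PT_closed[OF u, of b], of 1] bsum_props(2)[OF v u, of b]
      inn_lact_PT[OF u v, of b] inn_lact_PT[OF v u, of "star b"]
    by (simp add: inn_PT star_one)
  show "inn PT u (lact PT (b + c) v) = inn PT u (lact PT b v) + inn PT u (lact PT c v)"
    by (simp add: inn_lact_PT[OF v u] bsum_props(1)[OF u v])
  show "inn PT u (lact PT (b * c) v) = inn PT u (lact PT b (lact PT c v))" by (rule lact_PT_mult[OF v u])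
  show "inn PT u (lact PT 1 v) = inn PT u v" using inn_lact_PT[OF v u, of 1] by (simp add: inn_PT)
  show "inn PT u (lact PT (scalar z) v) = inn PT u v * scalar z"
    using inn_lact_PT[OF v u, of "scalar z"] bsum_props(3)[OF u v, of z] by (simp add: inn_PT)
  assume w: "w \<in> elems PT"
  show "hadd PT (hadd PT u v) w = hadd PT u (hadd PT v w)" by (simp add: PT_simps add.assoc)
  show "inn PT u (hadd PT v w) = inn PT u v + inn PT u w" by (simp add: PT_simps inn_PT bsum_add_right)
qed

sublocale P: prehilb PT by (rule prehilb_PT)

end

context prehilb
begin

end

section \<open>The embeddings of operators on formal combinations of tensors\<close>

context tfree_product
begin

lemma PT_sum_closed: "(\<And>i. i \<in> F \<Longrightarrow> f i \<in> elems PT) \<Longrightarrow> (\<Sum>i\<in>F. f i) \<in> elems PT"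
proof (induction F rule: infinite_finite_induct)
  case (insert i F)
  then have "hadd PT (f i) (\<Sum>i\<in>F. f i) \<in> elems PT" by (intro P.add_closed) auto
  then show ?case using insert by (simp add: PT_simps)
qed (use P.zero_closed in \<open>simp_all add: PT_simps\<close>)

lemma PT_inn_sum_right: "inn PT u (\<Sum>i\<in>F. f i) = (\<Sum>i\<in>F. inn PT u (f i))"
  by (induction F rule: infinite_finite_induct) (simp_all add: inn_PT bsum_add_right)

lemma PT_inn_sum_left: "inn PT (\<Sum>i\<in>F. f i) u = (\<Sum>i\<in>F. inn PT (f i) u)"
  by (induction F rule: infinite_finite_induct) (simp_all add: inn_PT bsum_add_left)

lemma PT_hnorm_sum: "(\<And>i. i \<in> F \<Longrightarrow> f i \<in> elems PT) \<Longrightarrow> hnorm PT (\<Sum>i\<in>F. f i) \<le> (\<Sum>i\<in>F. hnorm PT (f i))"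
proof (induction F rule: infinite_finite_induct)
  case (insert i F)
  have "hnorm PT (hadd PT (f i) (\<Sum>i\<in>F. f i)) \<le> hnorm PT (f i) + hnorm PT (\<Sum>i\<in>F. f i)"
    using insert by (intro P.hnorm_triangle PT_sum_closed) auto
  then show ?case using insert by (simp add: PT_simps)
qed (use P.hnorm_zero in \<open>simp_all add: PT_simps\<close>)

definition unit_gen :: "nat list \<Rightarrow> 'h list \<Rightarrow> 'h gen \<Rightarrow>\<^sub>0 'b" where
  "unit_gen s hs = Poly_Mapping.single (s, hs) 1"

lemma unit_gen_closed: "s \<in> T \<Longrightarrow> hs \<in> simple_tensors H \<xi> s \<Longrightarrow> unit_gen s hs \<in> elems PT"
  by (simp add: unit_gen_def PT_simps gens_def)

lemma inn_unit_gen: "inn PT (unit_gen s hs) (unit_gen s' hs') = (if s = s' then tensor_inn H s 1 hs hs' else 0)"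
  by (simp add: unit_gen_def inn_PT bsum_single bform_def star_one)

lemma inn_lact_unit_gen:
  assumes "s \<in> T" "hs \<in> simple_tensors H \<xi> s" "s' \<in> T" "hs' \<in> simple_tensors H \<xi> s'"
  shows "inn PT (unit_gen s hs) (lact PT b (unit_gen s' hs')) = (if s = s' then tensor_inn H s b hs hs' else 0)"
  using inn_lact_PT[OF unit_gen_closed[OF assms(3,4)] unit_gen_closed[OF assms(1,2)], of b]
  by (simp add: unit_gen_def bsum_single bform_def star_one)

text \<open>Representative, before completion, of the vector \<open>tensor_left\<close>;
  \<open>tleft_eq\<close> makes the connection.\<close>

definition theta :: "nat \<Rightarrow> 'h \<Rightarrow> nat list \<Rightarrow> 'h list \<Rightarrow> 'h gen \<Rightarrow>\<^sub>0 'b" where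
  "theta j h s hs = lact PT (inn (H j) (\<xi> j) h) (unit_gen s hs)
     + unit_gen (j # s) (hminus (H j) h (lact (H j) (inn (H j) (\<xi> j) h) (\<xi> j)) # hs)"

lemma centred_part:
  assumes "j \<in> {1..N}" "h \<in> elems (H j)"
  shows "hminus (H j) h (lact (H j) (inn (H j) (\<xi> j) h) (\<xi> j)) \<in> hcirc (H j) (\<xi> j)"
proof -
  interpret pointed_hilb "H j" "\<xi> j" by (rule pointed[OF assms(1)])
  show ?thesis using assms(2)
    by (simp add: hcirc_def inn_hminus_left xi_central inn_ract_left inn_xi star_inn)
qed

lemma theta_parts:
  assumes "j # s \<in> T" "hs \<in> simple_tensors H \<xi> s" "h \<in> elems (H j)"
  shows "lact PT b (unit_gen s hs) \<in> elems PT"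
    "unit_gen (j # s) (hminus (H j) h (lact (H j) (inn (H j) (\<xi> j) h) (\<xi> j)) # hs) \<in> elems PT"
    "theta j h s hs \<in> elems PT"
proof -
  have j: "j \<in> {1..N}" by (rule T_letter[OF assms(1)])
  show 1: "lact PT b (unit_gen s hs) \<in> elems PT" for b
    by (rule lact_PT_closed[OF unit_gen_closed[OF T_tl[OF assms(1)] assms(2)]])
  show 2: "unit_gen (j # s) (hminus (H j) h (lact (H j) (inn (H j) (\<xi> j) h) (\<xi> j)) # hs) \<in> elems PT"
    using centred_part[OF j assms(3)] assms(1,2) by (intro unit_gen_closed) (simp_all add: simple_tensors_Cons)
  from P.add_closed[OF 1 2] show "theta j h s hs \<in> elems PT" by (simp add: theta_def PT_simps(3))
qed

lemma inn_theta_unit: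
  assumes "j # s \<in> T" "hs \<in> simple_tensors H \<xi> s" "h \<in> elems (H j)" "s' \<in> T" "hs' \<in> simple_tensors H \<xi> s'"
    "s' \<noteq> s" "s' \<noteq> j # s"
  shows "inn PT (theta j h s hs) (unit_gen s' hs') = 0" "inn PT (unit_gen s' hs') (theta j h s hs) = 0"
proof -
  show 1: "inn PT (unit_gen s' hs') (theta j h s hs) = 0"
    using theta_parts[OF assms(1-3)] unit_gen_closed[OF assms(4,5)] assms
    by (simp add: theta_def inn_PT bsum_add_right)
      (simp add: inn_PT[symmetric] inn_lact_unit_gen T_tl inn_unit_gen)
  show "inn PT (theta j h s hs) (unit_gen s' hs') = 0"
    using P.star_inn[OF unit_gen_closed[OF assms(4,5)] theta_parts(3)[OF assms(1-3)]] by (simp add: 1 star_zero)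
qed

text \<open>These are the inner products of the tensor product of \<open>H j\<close> with the
  summand at \<open>s\<close>. The mixed terms vanish, since alternation excludes
  \<open>s = j # s'\<close>, and the other two recombine because \<open>h\<close> and
  \<open>k\<close> split orthogonally along \<open>\<xi> j\<close>.\<close>

lemma inn_theta:
  assumes "j # s \<in> T" "hs \<in> simple_tensors H \<xi> s" "h \<in> elems (H j)"
    "j # s' \<in> T" "hs' \<in> simple_tensors H \<xi> s'" "k \<in> elems (H j)"
  shows "inn PT (theta j h s hs) (theta j k s' hs') = (if s = s' then tensor_inn H s (inn (H j) h k) hs hs' else 0)"
proof -
  have j: "j \<in> {1..N}" by (rule T_letter[OF assms(1)])
  interpret pointed_hilb "H j" "\<xi> j" by (rule pointed[OF j])
  have sT: "s \<in> T" "s' \<in> T" using assms T_tl by auto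
  let ?w = "unit_gen s hs" and ?w' = "unit_gen s' hs'"
  let ?b = "inn (H j) (\<xi> j) h" and ?c = "inn (H j) (\<xi> j) k"
  let ?h = "hminus (H j) h (lact (H j) ?b (\<xi> j))" and ?k = "hminus (H j) k (lact (H j) ?c (\<xi> j))"
  note w = unit_gen_closed[OF sT(1) assms(2)] and w' = unit_gen_closed[OF sT(2) assms(5)]
  note p = theta_parts[OF assms(1-3)] and p' = theta_parts[OF assms(4-6)]
  have ht: "?h # hs \<in> simple_tensors H \<xi> (j # s)" "?k # hs' \<in> simple_tensors H \<xi> (j # s')"
    using centred_part[OF j assms(3)] centred_part[OF j assms(6)] assms by (simp_all add: simple_tensors_Cons)
  have ne: "s \<noteq> j # s'" "s' \<noteq> j # s" using T_alt[OF assms(1)] T_alt[OF assms(4)] by auto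
  have A: "inn PT (lact PT ?b ?w) (lact PT ?c ?w') = (if s = s' then tensor_inn H s (star ?b * ?c) hs hs' else 0)"
    using inn_lact_unit_gen[OF sT(1) assms(2) sT(2) assms(5), of "star ?b * ?c"] w w'
    by (simp add: P.inn_lact P.inn_lact_mult lact_PT_closed)
  have B: "inn PT (lact PT ?b ?w) (unit_gen (j # s') (?k # hs')) = 0"
    using inn_lact_unit_gen[OF assms(4) ht(2) sT(1) assms(2), of ?b] ne
      P.star_inn[OF p'(2) p(1)[of ?b]] by (simp add: star_zero)
  have C: "inn PT (unit_gen (j # s) (?h # hs)) (lact PT ?c ?w') = 0"
    using inn_lact_unit_gen[OF assms(1) ht(1) sT(2) assms(5), of ?c] ne by simp
  have D: "inn PT (unit_gen (j # s) (?h # hs)) (unit_gen (j # s') (?k # hs'))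
      = (if s = s' then tensor_inn H s (inn (H j) ?h ?k) hs hs' else 0)"
    using assms(3,6) by (simp add: inn_unit_gen lact_one)
  have hk: "star ?b * ?c + inn (H j) ?h ?k = inn (H j) h k"
    using assms(3,6) by (simp add: inn_hminus_left inn_hminus_right xi_central inn_ract inn_ract_left inn_xi star_inn)
  have "inn PT (theta j h s hs) (theta j k s' hs')
      = inn PT (lact PT ?b ?w) (lact PT ?c ?w') + inn PT (lact PT ?b ?w) (unit_gen (j # s') (?k # hs'))
      + (inn PT (unit_gen (j # s) (?h # hs)) (lact PT ?c ?w') + inn PT (unit_gen (j # s) (?h # hs)) (unit_gen (j # s') (?k # hs')))"
    by (simp add: theta_def inn_PT bsum_add_right bsum_add_left algebra_simps)
  also have "\<dots> = (if s = s' then tensor_inn H s (inn (H j) h k) hs hs' else 0)"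
    unfolding A B C D hk[symmetric]
    using tensor_inn_add[OF simple_tensors_tensors[OF sT(1) assms(2)] simple_tensors_tensors[OF sT(1)], of hs' "star ?b * ?c" "inn (H j) ?h ?k"] assms(5)
    by (cases "s = s'") simp_all
  finally show ?thesis .
qed

lemma hnorm_theta:
  assumes "j # s \<in> T" "hs \<in> simple_tensors H \<xi> s" "h \<in> elems (H j)"
  shows "hnorm PT (theta j h s hs) \<le> hnorm (H j) h * hnorm PT (unit_gen s hs)"
proof -
  have j: "j \<in> {1..N}" by (rule T_letter[OF assms(1)])
  interpret pointed_hilb "H j" "\<xi> j" by (rule pointed[OF j])
  have sT: "s \<in> T" by (rule T_tl[OF assms(1)])
  let ?w = "unit_gen s hs"
  note w = unit_gen_closed[OF sT assms(2)]
  have "norm (inn PT (theta j h s hs) (theta j h s hs)) = norm (inn PT ?w (lact PT (inn (H j) h h) ?w))"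
    using inn_theta[OF assms assms] inn_lact_unit_gen[OF sT assms(2) sT assms(2)] by simp
  also have "\<dots> \<le> hnorm PT ?w * hnorm PT (lact PT (inn (H j) h h) ?w)"
    using w by (intro P.cauchy_schwarz) auto
  also have "\<dots> \<le> hnorm PT ?w * (norm (inn (H j) h h) * hnorm PT ?w)"
    using w by (intro mult_left_mono P.hnorm_lact) auto
  also have "\<dots> = (hnorm (H j) h * hnorm PT ?w)\<^sup>2"
    by (simp add: power_mult_distrib hnorm_sq power2_eq_square[of "hnorm PT ?w"])
  finally show ?thesis by (subst P.hnorm_le_iff) simp_all
qed

text \<open>\<open>reduce j g = Some (h, w)\<close> if the generator \<open>g\<close> is \<open>h \<otimes> w\<close> under the identification of
  \<open>\<H>\<^sub>j \<otimes> \<H>\<^sub>s\<^sup>\<circ>\<close> with \<open>\<H>\<^sub>s\<^sup>\<circ> \<oplus> \<H>\<^bsub>js\<^esub>\<^sup>\<circ>\<close>, and \<open>None\<close> if \<open>\<lambda>\<^sub>j\<close> vanishes on it.\<close>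

definition reduce :: "nat \<Rightarrow> 'h gen \<Rightarrow> ('h \<times> 'h gen) option" where
  "reduce j g = (if fst g \<noteq> [] \<and> hd (fst g) = j then Some (hd (snd g), (tl (fst g), tl (snd g)))
     else if j # fst g \<in> T then Some (\<xi> j, g) else None)"

lemma reduce_Some:
  assumes "g \<in> gens" "reduce j g = Some (h, (s, hs))" "j \<in> {1..N}"
  shows "j # s \<in> T" "hs \<in> simple_tensors H \<xi> s" "h \<in> elems (H j)"
    "P.eqv (Poly_Mapping.single g 1) (theta j h s hs)"
proof -
  interpret pointed_hilb "H j" "\<xi> j" by (rule pointed[OF assms(3)])
  have "j # s \<in> T \<and> hs \<in> simple_tensors H \<xi> s \<and> h \<in> elems (H j) \<and> P.eqv (Poly_Mapping.single g 1) (theta j h s hs)"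
  proof (cases "fst g \<noteq> [] \<and> hd (fst g) = j")
    case True
    have "g \<noteq> ([], [])" using True by auto
    have "\<exists>k. g = (j # s, k # hs) \<and> k \<in> hcirc (H j) (\<xi> j) \<and> (s, hs) \<in> gens \<and> j # s \<in> T \<and> k = h"
      using assms(1)
    proof (cases rule: gens_cases)
      case 1
      then show ?thesis using \<open>g \<noteq> ([], [])\<close> by simp
    next
      case 2
      then show ?thesis using True assms(2) by (auto simp: reduce_def)
    qed
    then obtain k where g: "g = (j # s, k # hs)" "k \<in> hcirc (H j) (\<xi> j)" "(s, hs) \<in> gens" "j # s \<in> T" "k = h"
      by blast
    have h: "h \<in> elems (H j)" "inn (H j) h (\<xi> j) = 0" using g by (auto simp: hcirc_def)
    have "inn (H j) (\<xi> j) h = 0" using star_inn[OF h(1) xi_closed] h(2) by (simp add: star_zero)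
    moreover have "hminus (H j) h (hzero (H j)) = h"
      using h(1) by (intro inn_eqI) (auto simp: inn_hminus_right)
    ultimately have th: "theta j h s hs = lact PT 0 (unit_gen s hs) + Poly_Mapping.single g 1"
      by (simp add: theta_def lact_zero_left unit_gen_def g)
    have hs: "hs \<in> simple_tensors H \<xi> s" using g by (simp add: gens_def)
    have z: "inn PT z (lact PT 0 (unit_gen s hs)) = 0" if "z \<in> elems PT" for z
      using P.inn_lact_add[OF that unit_gen_closed[OF T_tl[OF g(4)] hs], of 0 0] by simp
    have "P.eqv (Poly_Mapping.single g 1) (theta j h s hs)"
      unfolding P.eqv_def using z by (simp add: th inn_PT bsum_add_right)
    then show ?thesis using g h hs by simp
  next
    case False
    then have *: "j # s \<in> T" "h = \<xi> j" "g = (s, hs)" using assms(2) by (auto simp: reduce_def split: if_splits)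
    have hs: "hs \<in> simple_tensors H \<xi> s" using * assms(1) by (simp add: gens_def)
    have z0: "hminus (H j) (\<xi> j) (lact (H j) 1 (\<xi> j)) = hzero (H j)" by (simp add: lact_one hminus_self)
    have sT: "s \<in> T" by (rule T_tl[OF *(1)])
    have jT: "hzero (H j) # hs \<in> simple_tensors H \<xi> (j # s)" using hs by (simp add: simple_tensors_Cons hcirc_def)
    have null: "inn PT z (unit_gen (j # s) (hzero (H j) # hs)) = 0" if z: "z \<in> elems PT" for z
    proof -
      have "inn PT (unit_gen (j # s) (hzero (H j) # hs)) (unit_gen (j # s) (hzero (H j) # hs)) = 0"
        using tensor_inn_zero[OF simple_tensors_tensors[OF sT hs] simple_tensors_tensors[OF sT hs]]
        by (simp add: inn_unit_gen lact_zero_right)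
      then have "hnorm PT (unit_gen (j # s) (hzero (H j) # hs)) = 0" by (simp add: hnorm_def)
      then show ?thesis using P.cauchy_schwarz[OF z unit_gen_closed[OF *(1) jT]] by simp
    qed
    have "inn PT z (theta j h s hs) = inn PT z (unit_gen s hs)" if z: "z \<in> elems PT" for z
    proof -
      have "inn PT z (theta j h s hs) = inn PT z (lact PT 1 (unit_gen s hs)) + inn PT z (unit_gen (j # s) (hzero (H j) # hs))"
        by (simp add: theta_def *(2) inn_xi z0 inn_PT bsum_add_right)
      then show ?thesis using null[OF z] P.inn_lact_one[OF z unit_gen_closed[OF sT hs]] by simp
    qed
    then show ?thesis using * hs by (simp add: P.eqv_def unit_gen_def)
  qed
  then show "j # s \<in> T" "hs \<in> simple_tensors H \<xi> s" "h \<in> elems (H j)"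
    "P.eqv (Poly_Mapping.single g 1) (theta j h s hs)" by simp_all
qed

lemma single_gen_closed: "g \<in> gens \<Longrightarrow> Poly_Mapping.single g c \<in> elems PT"
  by (simp add: PT_simps)

text \<open>Such a generator lies in a summand orthogonal to all spaces on which
  \<open>lam j\<close> acts. Extension by zero is therefore compatible with adjoints.\<close>

lemma reduce_None:
  assumes "g \<in> gens" "reduce j g = None" "j # s \<in> T" "hs \<in> simple_tensors H \<xi> s" "h \<in> elems (H j)"
  shows "inn PT (theta j h s hs) (Poly_Mapping.single g 1) = 0" "inn PT (Poly_Mapping.single g 1) (theta j h s hs) = 0"
proof -
  obtain s' hs' where g: "g = (s', hs')" by (cases g)
  have "s' \<noteq> j # s" "j # s' \<notin> T" using assms(2) by (auto simp: reduce_def g split: if_splits)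
  moreover have "s' \<noteq> s" using \<open>j # s' \<notin> T\<close> assms(3) by auto
  moreover have "s' \<in> T" "hs' \<in> simple_tensors H \<xi> s'" using assms(1) by (simp_all add: g gens_def)
  ultimately show "inn PT (theta j h s hs) (Poly_Mapping.single g 1) = 0" "inn PT (Poly_Mapping.single g 1) (theta j h s hs) = 0"
    using inn_theta_unit[OF assms(3-5), of s' hs'] by (simp_all add: g unit_gen_def)
qed

definition lam_gen :: "nat \<Rightarrow> ('h \<Rightarrow> 'h) \<Rightarrow> 'h gen \<Rightarrow> 'h gen \<Rightarrow>\<^sub>0 'b" where
  "lam_gen j x g = (case reduce j g of None \<Rightarrow> 0 | Some (h, (s, hs)) \<Rightarrow> theta j (x h) s hs)"

text \<open>Prescribed on generators and extended to formal combinations, it respects the relations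
  of the tensor product up to null vectors. The formal adjoint of \<open>lam_id\<close> and the
  bound of \<open>lam_bound\<close> let it descend to the completion.\<close>

definition lam :: "nat \<Rightarrow> ('h \<Rightarrow> 'h) \<Rightarrow> ('h gen \<Rightarrow>\<^sub>0 'b) \<Rightarrow> 'h gen \<Rightarrow>\<^sub>0 'b" where
  "lam j x v = (\<Sum>g\<in>Poly_Mapping.keys v. ract PT (lam_gen j x g) (Poly_Mapping.lookup v g))"

lemma lam_gen_closed:
  assumes "j \<in> {1..N}" "\<And>h. h \<in> elems (H j) \<Longrightarrow> x h \<in> elems (H j)" "g \<in> gens"
  shows "lam_gen j x g \<in> elems PT"
proof (cases "reduce j g")
  case None
  then show ?thesis using P.zero_closed by (simp add: lam_gen_def PT_simps)
next
  case (Some a)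
  obtain h s hs where a: "a = (h, (s, hs))" by (metis prod_cases3)
  note r = reduce_Some[OF assms(3) Some[unfolded a] assms(1)]
  show ?thesis using theta_parts(3)[OF r(1,2) assms(2)[OF r(3)]] by (simp add: lam_gen_def Some a)
qed

lemma keys_gens: "v \<in> elems PT \<Longrightarrow> g \<in> Poly_Mapping.keys v \<Longrightarrow> g \<in> gens"
  by (auto simp: PT_simps)

lemma lam_closed:
  assumes "j \<in> {1..N}" "\<And>h. h \<in> elems (H j) \<Longrightarrow> x h \<in> elems (H j)" "v \<in> elems PT"
  shows "lam j x v \<in> elems PT"
  unfolding lam_def by (intro PT_sum_closed P.ract_closed lam_gen_closed assms keys_gens[OF assms(3)])

lemma inn_lam_right:
  assumes "j \<in> {1..N}" "\<And>h. h \<in> elems (H j) \<Longrightarrow> x h \<in> elems (H j)" "v \<in> elems PT" "u \<in> elems PT"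
  shows "inn PT u (lam j x v) = (\<Sum>g\<in>Poly_Mapping.keys v. inn PT u (lam_gen j x g) * Poly_Mapping.lookup v g)"
  unfolding lam_def PT_inn_sum_right
  by (intro sum.cong HOL.refl P.inn_ract assms(4) lam_gen_closed assms(1,2) keys_gens[OF assms(3)])

lemma inn_lam_left:
  assumes "j \<in> {1..N}" "\<And>h. h \<in> elems (H j) \<Longrightarrow> x h \<in> elems (H j)" "v \<in> elems PT" "u \<in> elems PT"
  shows "inn PT (lam j x v) u = (\<Sum>g\<in>Poly_Mapping.keys v. star (Poly_Mapping.lookup v g) * inn PT (lam_gen j x g) u)"
  unfolding lam_def PT_inn_sum_left
  by (intro sum.cong HOL.refl P.inn_ract_left assms(4) lam_gen_closed assms(1,2) keys_gens[OF assms(3)])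

lemma inn_keys:
  assumes "v \<in> elems PT" "u \<in> elems PT"
  shows "inn PT u v = (\<Sum>g\<in>Poly_Mapping.keys v. inn PT u (Poly_Mapping.single g 1) * Poly_Mapping.lookup v g)"
    "inn PT v u = (\<Sum>g\<in>Poly_Mapping.keys v. star (Poly_Mapping.lookup v g) * inn PT (Poly_Mapping.single g 1) u)"
proof -
  have v: "v = (\<Sum>g\<in>Poly_Mapping.keys v. ract PT (Poly_Mapping.single g 1) (Poly_Mapping.lookup v g))"
    by (rule poly_mapping_eqI) (simp add: lookup_sum PT_simps map_mult_single lookup_single when_def in_keys_iff)
  have g: "Poly_Mapping.single g 1 \<in> elems PT" if "g \<in> Poly_Mapping.keys v" for g
    using keys_gens[OF assms(1) that] by (rule single_gen_closed)
  show "inn PT u v = (\<Sum>g\<in>Poly_Mapping.keys v. inn PT u (Poly_Mapping.single g 1) * Poly_Mapping.lookup v g)"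
    by (subst v) (simp add: PT_inn_sum_right P.inn_ract[OF assms(2) g])
  show "inn PT v u = (\<Sum>g\<in>Poly_Mapping.keys v. star (Poly_Mapping.lookup v g) * inn PT (Poly_Mapping.single g 1) u)"
    by (subst v) (simp add: PT_inn_sum_left P.inn_ract_left[OF g assms(2)])
qed

lemma inn_lam_gen:
  assumes j: "j \<in> {1..N}" and x: "\<And>h. h \<in> elems (H j) \<Longrightarrow> x h \<in> elems (H j)"
    and y: "\<And>h. h \<in> elems (H j) \<Longrightarrow> y h \<in> elems (H j)"
    and z: "\<And>h. h \<in> elems (H j) \<Longrightarrow> z h \<in> elems (H j)"
    and xy: "\<And>h k. h \<in> elems (H j) \<Longrightarrow> k \<in> elems (H j) \<Longrightarrow> inn (H j) (x h) (y k) = inn (H j) h (z k)"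
    and g: "g \<in> gens" and g': "g' \<in> gens"
  shows "inn PT (lam_gen j x g) (lam_gen j y g') = inn PT (Poly_Mapping.single g 1) (lam_gen j z g')"
proof (cases "reduce j g'")
  case None
  then show ?thesis by (simp add: lam_gen_def inn_PT)
next
  case (Some a')
  obtain h' s' hs' where a': "a' = (h', (s', hs'))" by (metis prod_cases3)
  note r' = reduce_Some[OF g' Some[unfolded a'] j]
  have l': "lam_gen j w g' = theta j (w h') s' hs'" for w by (simp add: lam_gen_def Some a')
  show ?thesis
  proof (cases "reduce j g")
    case None
    then show ?thesis
      using reduce_None(2)[OF g None r'(1,2) z[OF r'(3)]] by (simp add: l') (simp add: lam_gen_def inn_PT)
  next
    case (Some a)
    obtain h s hs where a: "a = (h, (s, hs))" by (metis prod_cases3)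
    note r = reduce_Some[OF g Some[unfolded a] j]
    have "inn PT (Poly_Mapping.single g 1) (theta j (z h') s' hs') = inn PT (theta j h s hs) (theta j (z h') s' hs')"
      by (rule P.eqv_inn_left[OF r(4) single_gen_closed[OF g] theta_parts(3)[OF r(1-3)] theta_parts(3)[OF r'(1,2) z[OF r'(3)]]])
    also have "\<dots> = inn PT (theta j (x h) s hs) (theta j (y h') s' hs')"
      using inn_theta[OF r(1-3) r'(1,2) z[OF r'(3)]] inn_theta[OF r(1,2) x[OF r(3)] r'(1,2) y[OF r'(3)]] xy[OF r(3) r'(3)]
      by simp
    finally show ?thesis by (simp add: l') (simp add: lam_gen_def Some a)
  qed
qed

text \<open>A weak form of multiplicativity: if \<open>x'\<close> is adjoint to \<open>x\<close> and
  \<open>z\<close> is \<open>x' y\<close>, then \<open>lam j x'\<close> times \<open>lam j y\<close>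
  is \<open>lam j z\<close> up to null vectors. The hypothesis encodes this by inner products on
  \<open>H j\<close> alone.\<close>

lemma inn_lam_lam:
  assumes j: "j \<in> {1..N}" and x: "\<And>h. h \<in> elems (H j) \<Longrightarrow> x h \<in> elems (H j)"
    and y: "\<And>h. h \<in> elems (H j) \<Longrightarrow> y h \<in> elems (H j)"
    and z: "\<And>h. h \<in> elems (H j) \<Longrightarrow> z h \<in> elems (H j)"
    and xy: "\<And>h k. h \<in> elems (H j) \<Longrightarrow> k \<in> elems (H j) \<Longrightarrow> inn (H j) (x h) (y k) = inn (H j) h (z k)"
    and u: "u \<in> elems PT" and v: "v \<in> elems PT"
  shows "inn PT (lam j x u) (lam j y v) = inn PT u (lam j z v)"
proof -
  have "inn PT (lam j x u) (lam_gen j y g') = inn PT u (lam_gen j z g')" if g': "g' \<in> gens" for g'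
  proof -
    have "inn PT (lam j x u) (lam_gen j y g') = (\<Sum>g\<in>Poly_Mapping.keys u. star (Poly_Mapping.lookup u g) * inn PT (lam_gen j x g) (lam_gen j y g'))"
      by (rule inn_lam_left[OF j x u lam_gen_closed[OF j y g']])
    also have "\<dots> = (\<Sum>g\<in>Poly_Mapping.keys u. star (Poly_Mapping.lookup u g) * inn PT (Poly_Mapping.single g 1) (lam_gen j z g'))"
      by (intro sum.cong HOL.refl arg_cong2[where f = "(*)"] inn_lam_gen[OF j x y z xy _ g'] keys_gens[OF u])
    also have "\<dots> = inn PT u (lam_gen j z g')" by (rule inn_keys(2)[OF u lam_gen_closed[OF j z g'], symmetric])
    finally show ?thesis .
  qed
  then show ?thesis
    using inn_lam_right[OF j y v lam_closed[OF j x u]] inn_lam_right[OF j z v u] keys_gens[OF v] by simp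
qed

text \<open>As \<open>lam j\<close> of the identity is only the projection onto the summands where
  \<open>lam j\<close> acts, \<open>inn_lam_lam\<close> does not cover this. For pairs of generators
  of which exactly one is reducible, \<open>reduce_None\<close> makes both sides vanish.\<close>

lemma lam_id: "u \<in> elems PT \<Longrightarrow> v \<in> elems PT \<Longrightarrow> j \<in> {1..N} \<Longrightarrow>
    (\<And>h. h \<in> elems (H j) \<Longrightarrow> x h \<in> elems (H j)) \<Longrightarrow> (\<And>h. h \<in> elems (H j) \<Longrightarrow> y h \<in> elems (H j)) \<Longrightarrow>
    (\<And>h k. h \<in> elems (H j) \<Longrightarrow> k \<in> elems (H j) \<Longrightarrow> inn (H j) (x h) k = inn (H j) h (y k)) \<Longrightarrow>
    inn PT (lam j x u) v = inn PT u (lam j y v)"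
proof -
  assume u: "u \<in> elems PT" and v: "v \<in> elems PT" and j: "j \<in> {1..N}"
    and x: "\<And>h. h \<in> elems (H j) \<Longrightarrow> x h \<in> elems (H j)" and y: "\<And>h. h \<in> elems (H j) \<Longrightarrow> y h \<in> elems (H j)"
    and xy: "\<And>h k. h \<in> elems (H j) \<Longrightarrow> k \<in> elems (H j) \<Longrightarrow> inn (H j) (x h) k = inn (H j) h (y k)"
  interpret Hj: pointed_hilb "H j" "\<xi> j" by (rule pointed[OF j])
  have yx: "inn (H j) (y h) k = inn (H j) h (x k)" if "h \<in> elems (H j)" "k \<in> elems (H j)" for h k
    using xy[OF that(2,1)] Hj.star_inn[OF that(2) y[OF that(1)]] Hj.star_inn[OF x[OF that(2)] that(1)] by simp
  have gen: "inn PT (lam_gen j x g) (Poly_Mapping.single g' 1) = inn PT (Poly_Mapping.single g 1) (lam_gen j y g')"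
    if g: "g \<in> gens" and g': "g' \<in> gens" for g g'
  proof (cases "reduce j g")
    case None
    note gN = None
    show ?thesis
    proof (cases "reduce j g'")
      case None
      then show ?thesis using gN by (simp add: lam_gen_def inn_PT)
    next
      case (Some a)
      obtain h s hs where a: "a = (h, (s, hs))" by (metis prod_cases3)
      note r = reduce_Some[OF g' Some[unfolded a] j]
      show ?thesis using reduce_None(2)[OF g gN r(1,2) y[OF r(3)]] by (simp add: lam_gen_def gN Some a) (simp add: inn_PT)
    qed
  next
    case (Some a)
    note gS = Some
    obtain h s hs where a: "a = (h, (s, hs))" by (metis prod_cases3)
    note r = reduce_Some[OF g Some[unfolded a] j]
    show ?thesis
    proof (cases "reduce j g'")
      case None
      then show ?thesis using reduce_None(1)[OF g' None r(1,2) x[OF r(3)]] by (simp add: lam_gen_def gS a) (simp add: inn_PT)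
    next
      case (Some a')
      obtain h' s' hs' where a': "a' = (h', (s', hs'))" by (metis prod_cases3)
      note r' = reduce_Some[OF g' Some[unfolded a'] j]
      have "inn PT (theta j (x h) s hs) (Poly_Mapping.single g' 1) = inn PT (theta j (x h) s hs) (theta j h' s' hs')"
        using r'(4) theta_parts(3)[OF r(1,2) x[OF r(3)]] by (simp add: P.eqv_def)
      also have "\<dots> = inn PT (theta j h s hs) (theta j (y h') s' hs')"
        using inn_theta[OF r(1,2) x[OF r(3)] r'(1-3)] inn_theta[OF r(1-3) r'(1,2) y[OF r'(3)]] xy[OF r(3) r'(3)] by simp
      also have "\<dots> = inn PT (Poly_Mapping.single g 1) (theta j (y h') s' hs')"
        by (rule P.eqv_inn_left[OF r(4) single_gen_closed[OF g] theta_parts(3)[OF r(1-3)] theta_parts(3)[OF r'(1,2) y[OF r'(3)]], symmetric])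
      finally show ?thesis by (simp add: lam_gen_def gS Some a a')
    qed
  qed
  have "inn PT (lam_gen j x g) v = (\<Sum>g'\<in>Poly_Mapping.keys v. inn PT (lam_gen j x g) (Poly_Mapping.single g' 1) * Poly_Mapping.lookup v g')"
    if "g \<in> gens" for g by (rule inn_keys(1)[OF v lam_gen_closed[OF j x that]])
  moreover have "inn PT (Poly_Mapping.single g 1) (lam j y v) = (\<Sum>g'\<in>Poly_Mapping.keys v. inn PT (Poly_Mapping.single g 1) (lam_gen j y g') * Poly_Mapping.lookup v g')"
    if "g \<in> gens" for g by (rule inn_lam_right[OF j y v single_gen_closed[OF that]])
  ultimately have "inn PT (lam_gen j x g) v = inn PT (Poly_Mapping.single g 1) (lam j y v)" if "g \<in> gens" for g
    using that gen keys_gens[OF v] by simp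
  then show "inn PT (lam j x u) v = inn PT u (lam j y v)"
    using inn_lam_left[OF j x u v] inn_keys(2)[OF u lam_closed[OF j y v]] keys_gens[OF u] by simp
qed

text \<open>The triangle inequality over the generators of \<open>v\<close>. The constant depends on
  \<open>v\<close>, but \<open>z\<close> enters through \<open>D\<close> alone; applied to powers
  this is an orbit bound fit for \<open>symmetric_bound\<close>.\<close>

lemma hnorm_lam_le:
  assumes j: "j \<in> {1..N}" and z: "\<And>h. h \<in> elems (H j) \<Longrightarrow> z h \<in> elems (H j)" and v: "v \<in> elems PT"
    and D: "\<And>h. h \<in> elems (H j) \<Longrightarrow> hnorm (H j) (z h) \<le> D * hnorm (H j) h" "D \<ge> 0"
  shows "hnorm PT (lam j z v) \<le> D * (\<Sum>g\<in>Poly_Mapping.keys v. (case reduce j g of None \<Rightarrow> 0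
    | Some (h, (s, hs)) \<Rightarrow> hnorm (H j) h * hnorm PT (unit_gen s hs)) * norm (Poly_Mapping.lookup v g))"
    (is "_ \<le> D * (\<Sum>g\<in>_. ?c g * _)")
proof -
  have "hnorm PT (lam j z v) \<le> (\<Sum>g\<in>Poly_Mapping.keys v. hnorm PT (ract PT (lam_gen j z g) (Poly_Mapping.lookup v g)))"
    unfolding lam_def by (intro PT_hnorm_sum P.ract_closed lam_gen_closed j z keys_gens[OF v])
  also have "\<dots> \<le> (\<Sum>g\<in>Poly_Mapping.keys v. D * (?c g * norm (Poly_Mapping.lookup v g)))"
  proof (rule sum_mono)
    fix g assume "g \<in> Poly_Mapping.keys v"
    then have g: "g \<in> gens" by (rule keys_gens[OF v])
    have "hnorm PT (lam_gen j z g) \<le> D * ?c g"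
    proof (cases "reduce j g")
      case None
      then show ?thesis by (simp add: lam_gen_def hnorm_def inn_PT)
    next
      case (Some a)
      obtain h s hs where a: "a = (h, (s, hs))" by (metis prod_cases3)
      note r = reduce_Some[OF g Some[unfolded a] j]
      have "hnorm PT (theta j (z h) s hs) \<le> hnorm (H j) (z h) * hnorm PT (unit_gen s hs)"
        by (rule hnorm_theta[OF r(1,2) z[OF r(3)]])
      also have "\<dots> \<le> D * hnorm (H j) h * hnorm PT (unit_gen s hs)"
        by (rule mult_right_mono[OF D(1)[OF r(3)]]) simp
      finally show ?thesis by (simp add: lam_gen_def Some a mult.assoc)
    qed
    then have "hnorm PT (lam_gen j z g) * norm (Poly_Mapping.lookup v g) \<le> D * ?c g * norm (Poly_Mapping.lookup v g)"
      by (rule mult_right_mono) simp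
    then show "hnorm PT (ract PT (lam_gen j z g) (Poly_Mapping.lookup v g)) \<le> D * (?c g * norm (Poly_Mapping.lookup v g))"
    proof -
      have "lam_gen j z g \<in> elems PT" by (rule lam_gen_closed[OF j z g])
      from P.hnorm_ract[OF this, of "Poly_Mapping.lookup v g"]
      have "hnorm PT (ract PT (lam_gen j z g) (Poly_Mapping.lookup v g)) \<le> hnorm PT (lam_gen j z g) * norm (Poly_Mapping.lookup v g)" .
      then show ?thesis using \<open>_ \<le> D * ?c g * norm (Poly_Mapping.lookup v g)\<close> by (simp add: mult.assoc)
    qed
  qed
  finally show ?thesis by (simp add: sum_distrib_left)
qed

text \<open>For \<open>t = \<lambda>\<^sub>j(y x)\<close>, where \<open>y\<close> is the adjoint of \<open>x\<close>, the vector \<open>t\<^sup>m v\<close> is \<open>\<lambda>\<^sub>j((y x)\<^sup>m) v\<close> up to null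
  vectors; hence its norm is bounded by \<open>C\<^bsup>2m\<^esup>\<close> times a constant depending on \<open>v\<close>.\<close>

lemma lam_bound:
  assumes j: "j \<in> {1..N}" and xy: "prehilb.adj_pair (H j) x y C" and v: "v \<in> elems PT"
  shows "hnorm PT (lam j x v) \<le> C * hnorm PT v"
proof -
  interpret Hj: pointed_hilb "H j" "\<xi> j" by (rule pointed[OF j])
  note X = Hj.adj_pairD[OF xy] and Y = Hj.adj_pairD[OF Hj.adj_pair_sym[OF xy]]
  define z where "z = (\<lambda>h. y (x h))"
  have z: "z h \<in> elems (H j)" if "h \<in> elems (H j)" for h using that X Y by (simp add: z_def)
  have zsym: "inn (H j) (z h) k = inn (H j) h (z k)" if "h \<in> elems (H j)" "k \<in> elems (H j)" for h k
    using Y(4)[OF X(1)[OF that(1)] that(2)] X(4)[OF that(1) X(1)[OF that(2)]] by (simp add: z_def)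
  have zm: "(z ^^ m) h \<in> elems (H j)" if "h \<in> elems (H j)" for m h
    using that by (induction m) (auto intro: z)
  have zD: "hnorm (H j) ((z ^^ m) h) \<le> (C * C) ^ m * hnorm (H j) h" if h: "h \<in> elems (H j)" for m h
  proof (induction m)
    case (Suc m)
    have "hnorm (H j) (z ((z ^^ m) h)) \<le> C * hnorm (H j) (x ((z ^^ m) h))"
      unfolding z_def by (rule Y(6)) (use X(1) zm[OF h, of m, unfolded z_def] in simp)
    also have "\<dots> \<le> C * (C * hnorm (H j) ((z ^^ m) h))"
      by (rule mult_left_mono[OF X(6)[OF zm[OF h]] X(3)])
    also have "\<dots> \<le> C * (C * ((C * C) ^ m * hnorm (H j) h))"
      using Suc X(3) by (intro mult_left_mono) auto
    finally show ?case by (simp add: mult_ac)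
  qed simp
  have t: "lam j z u \<in> elems PT" if "u \<in> elems PT" for u by (rule lam_closed[OF j z that])
  have tsym: "inn PT (lam j z u) w = inn PT u (lam j z w)" if "u \<in> elems PT" "w \<in> elems PT" for u w
    by (rule lam_id[OF that j z z zsym])
  have tm: "(lam j z ^^ m) v \<in> elems PT" for m using v by (induction m) (auto intro: t)
  have iter: "inn PT u ((lam j z ^^ Suc m) v) = inn PT u (lam j (z ^^ Suc m) v)" if u: "u \<in> elems PT" for m u
    using u
  proof (induction m arbitrary: u)
    case (Suc m)
    have "inn PT u ((lam j z ^^ Suc (Suc m)) v) = inn PT (lam j z u) ((lam j z ^^ Suc m) v)"
      using tsym[OF Suc.prems tm[of "Suc m"]] by simp
    also have "\<dots> = inn PT (lam j z u) (lam j (z ^^ Suc m) v)" by (rule Suc.IH[OF t[OF Suc.prems]])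
    also have "\<dots> = inn PT u (lam j (z ^^ Suc (Suc m)) v)"
    proof (rule inn_lam_lam[OF j z zm zm _ Suc.prems v])
      fix h k assume hk: "h \<in> elems (H j)" "k \<in> elems (H j)"
      show "inn (H j) (z h) ((z ^^ Suc m) k) = inn (H j) h ((z ^^ Suc (Suc m)) k)"
        using zsym[OF hk(1) zm[OF hk(2), of "Suc m"]] by simp
    qed
    finally show ?case .
  qed simp
  define K where "K = (\<Sum>g\<in>Poly_Mapping.keys v. (case reduce j g of None \<Rightarrow> 0
    | Some (h, (s, hs)) \<Rightarrow> hnorm (H j) h * hnorm PT (unit_gen s hs)) * norm (Poly_Mapping.lookup v g))"
  have K0: "K \<ge> 0" unfolding K_def
    by (intro sum_nonneg mult_nonneg_nonneg) (auto split: option.splits simp: Hj.hnorm_nonneg)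
  have orbit: "hnorm PT ((lam j z ^^ m) v) \<le> (K + hnorm PT v) * (C * C) ^ m" for m
  proof (cases m)
    case 0
    then show ?thesis using K0 by simp
  next
    case (Suc m')
    have "P.eqv ((lam j z ^^ m) v) (lam j (z ^^ m) v)"
      unfolding P.eqv_def using iter[of _ m'] by (simp only: Suc) simp
    then have "hnorm PT ((lam j z ^^ m) v) = hnorm PT (lam j (z ^^ m) v)"
      by (rule P.eqv_hnorm[OF _ tm lam_closed[OF j zm v]])
    also have "\<dots> \<le> (C * C) ^ m * K"
      unfolding K_def by (rule hnorm_lam_le[OF j zm v zD]) simp_all
    also have "\<dots> \<le> (K + hnorm PT v) * (C * C) ^ m"
      using X(3) by (simp add: mult.commute[of _ K] mult_right_mono)
    finally show ?thesis .
  qed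
  have tb: "hnorm PT (lam j z v) \<le> (C * C) * hnorm PT v"
    by (rule P.symmetric_bound[OF t tsym v _ orbit]) simp_all
  have "inn PT (lam j x v) (lam j x v) = inn PT v (lam j z v)"
    by (rule inn_lam_lam[OF j X(1) X(1) z _ v v]) (use X(1,4) in \<open>simp_all add: z_def\<close>)
  then have "norm (inn PT (lam j x v) (lam j x v)) \<le> hnorm PT v * hnorm PT (lam j z v)"
    using P.cauchy_schwarz[OF v t[OF v]] by simp
  also have "\<dots> \<le> hnorm PT v * ((C * C) * hnorm PT v)" by (rule mult_left_mono[OF tb]) simp
  also have "\<dots> = (C * hnorm PT v)\<^sup>2" by (simp add: power2_eq_square mult_ac)
  finally show ?thesis using X(3) by (subst P.hnorm_le_iff) simp_all
qed

lemma lam_adj_pair: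
  assumes j: "j \<in> {1..N}" and xy: "prehilb.adj_pair (H j) x y C"
  shows "P.adj_pair (lam j x) (lam j y) C"
proof -
  interpret Hj: pointed_hilb "H j" "\<xi> j" by (rule pointed[OF j])
  note X = Hj.adj_pairD[OF xy]
  show ?thesis
    unfolding P.adj_pair_def using X(3) lam_closed[OF j X(1)] lam_closed[OF j X(2)] lam_bound[OF j xy]
      lam_id[OF _ _ j X(1) X(2) X(4)] by simp
qed

lemma lam_theta:
  assumes j: "j \<in> {1..N}" and xy: "prehilb.adj_pair (H j) x y C"
    and "j # s \<in> T" "hs \<in> simple_tensors H \<xi> s" "h \<in> elems (H j)"
  shows "P.eqv (lam j x (theta j h s hs)) (theta j (x h) s hs)"
  unfolding P.eqv_def
proof
  interpret Hj: pointed_hilb "H j" "\<xi> j" by (rule pointed[OF j])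
  note X = Hj.adj_pairD[OF xy]
  fix u assume u: "u \<in> elems PT"
  note th = theta_parts(3)[OF assms(3-5)] and th' = theta_parts(3)[OF assms(3,4) X(1)[OF assms(5)]]
  have gen: "inn PT (lam_gen j y g) (theta j h s hs) = inn PT (Poly_Mapping.single g 1) (theta j (x h) s hs)"
    if g: "g \<in> gens" for g
  proof (cases "reduce j g")
    case None
    then show ?thesis using reduce_None(2)[OF g None assms(3,4) X(1)[OF assms(5)]] by (simp add: lam_gen_def) (simp add: inn_PT)
  next
    case (Some a)
    obtain k s' hs' where a: "a = (k, (s', hs'))" by (metis prod_cases3)
    note r = reduce_Some[OF g Some[unfolded a] j]
    have "inn PT (Poly_Mapping.single g 1) (theta j (x h) s hs) = inn PT (theta j k s' hs') (theta j (x h) s hs)"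
      by (rule P.eqv_inn_left[OF r(4) single_gen_closed[OF g] theta_parts(3)[OF r(1-3)] th'])
    also have "\<dots> = inn PT (theta j (y k) s' hs') (theta j h s hs)"
      using inn_theta[OF r(1-3) assms(3,4) X(1)[OF assms(5)]] inn_theta[OF r(1,2) X(2)[OF r(3)] assms(3-5)] X(5)[OF r(3) assms(5)]
      by simp
    finally show ?thesis by (simp add: lam_gen_def Some a)
  qed
  have "inn PT u (lam j x (theta j h s hs)) = inn PT (lam j y u) (theta j h s hs)"
    using P.adj_pairD(5)[OF lam_adj_pair[OF j xy] u th] .
  also have "\<dots> = inn PT u (theta j (x h) s hs)"
  proof -
    have "inn PT (lam j y u) (theta j h s hs) = (\<Sum>g\<in>Poly_Mapping.keys u. star (Poly_Mapping.lookup u g) * inn PT (lam_gen j y g) (theta j h s hs))"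
      by (rule inn_lam_left[OF j X(2) u th])
    also have "\<dots> = inn PT u (theta j (x h) s hs)"
      unfolding inn_keys(2)[OF u th'] by (intro sum.cong) (simp_all add: gen keys_gens[OF u])
    finally show ?thesis .
  qed
  finally show "inn PT u (lam j x (theta j h s hs)) = inn PT u (theta j (x h) s hs)" .
qed

end

section \<open>The completed product and the operators prescribed by
  \<open>lambda_op\<close>\<close>

context tfree_product
begin

abbreviation "KT \<equiv> tfree T H \<xi>"
abbreviation "vac \<equiv> tfree_vec T H \<xi>"
abbreviation "tens \<equiv> simple T H \<xi>"
abbreviation "tleft \<equiv> tensor_left T H \<xi>"
abbreviation "lambda \<equiv> lambda_op T H \<xi>"

lemma KT_eq: "KT = completion PT" by (rule tfree_def)

lemma tens_eq: "tens s hs = emb PT (unit_gen s hs)"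
  by (simp add: simple_def unit_gen_def)

lemma hilb_KT: "hilb KT"
  unfolding KT_eq by (rule P.hilb_completion)

sublocale K: pointed_hilb KT vac
proof (intro pointed_hilb.intro pointed_hilb_axioms.intro hilb_KT)
  have u: "unit_gen [] [] \<in> elems PT" by (rule unit_gen_closed) (simp_all add: T_Nil)
  have v: "vac = emb PT (unit_gen [] [])" by (simp add: tfree_vec_def tens_eq)
  show "vac \<in> elems KT" unfolding v KT_eq by (rule P.emb_closed[OF u])
  show "lact KT b vac = ract KT vac b" for b
    unfolding v KT_eq P.emb_lact[OF u, symmetric] P.emb_ract[OF u, symmetric]
    by (simp add: unit_gen_def lact_PT_single PT_simps map_mult_single)
  show "inn KT vac vac = 1" unfolding v KT_eq P.inn_emb[OF u u] by (simp add: inn_unit_gen)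
qed

lemma tens_closed: "s \<in> T \<Longrightarrow> hs \<in> simple_tensors H \<xi> s \<Longrightarrow> tens s hs \<in> elems KT"
  unfolding tens_eq KT_eq by (intro P.emb_closed unit_gen_closed)

lemma inn_vac_tens:
  assumes "s \<in> T" "hs \<in> simple_tensors H \<xi> s" "s \<noteq> []"
  shows "inn KT vac (tens s hs) = 0"
  unfolding tfree_vec_def tens_eq KT_eq
  by (subst P.inn_emb) (use assms in \<open>auto simp: unit_gen_closed T_Nil inn_unit_gen\<close>)

lemma tleft_eq:
  assumes "j # s \<in> T" "hs \<in> simple_tensors H \<xi> s" "h \<in> elems (H j)"
  shows "tleft j h s hs = emb PT (theta j h s hs)"
proof -
  note p = theta_parts[OF assms]
  have "emb PT (theta j h s hs) = hadd KT (emb PT (lact PT (inn (H j) (\<xi> j) h) (unit_gen s hs)))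
      (emb PT (unit_gen (j # s) (hminus (H j) h (lact (H j) (inn (H j) (\<xi> j) h) (\<xi> j)) # hs)))"
    unfolding KT_eq P.emb_add[OF p(1,2), symmetric] by (simp add: theta_def PT_simps)
  then show ?thesis
    unfolding P.emb_lact[OF unit_gen_closed[OF T_tl[OF assms(1)] assms(2)]] tensor_left_def Let_def tens_eq KT_eq by simp
qed

lemma tleft_closed: "j # s \<in> T \<Longrightarrow> hs \<in> simple_tensors H \<xi> s \<Longrightarrow> h \<in> elems (H j) \<Longrightarrow> tleft j h s hs \<in> elems KT"
  by (simp only: tleft_eq) (simp only: KT_eq P.emb_closed[OF theta_parts(3)])

lemma tleft_xi:
  assumes "j # s \<in> T" "hs \<in> simple_tensors H \<xi> s"
  shows "tleft j (\<xi> j) s hs = tens s hs"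
proof -
  have j: "j \<in> {1..N}" by (rule T_letter[OF assms(1)])
  interpret Hj: pointed_hilb "H j" "\<xi> j" by (rule pointed[OF j])
  have g: "(s, hs) \<in> gens" using assms T_tl by (auto simp: gens_def)
  have r: "reduce j (s, hs) = Some (\<xi> j, (s, hs))"
    using T_alt[OF assms(1)] assms(1) by (auto simp: reduce_def)
  have "emb PT (unit_gen s hs) = emb PT (theta j (\<xi> j) s hs)"
    unfolding unit_gen_def
    by (rule P.emb_eqI[OF reduce_Some(4)[OF g r j] single_gen_closed[OF g] theta_parts(3)[OF assms Hj.xi_closed]])
  then show ?thesis using tleft_eq[OF assms Hj.xi_closed] by (simp add: tens_eq)
qed

lemma tleft_circ:
  assumes "j # s \<in> T" "hs \<in> simple_tensors H \<xi> s" "h \<in> hcirc (H j) (\<xi> j)"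
  shows "tleft j h s hs = tens (j # s) (h # hs)"
proof -
  have j: "j \<in> {1..N}" by (rule T_letter[OF assms(1)])
  have h: "h \<in> elems (H j)" using assms(3) by (simp add: hcirc_def)
  have g: "(j # s, h # hs) \<in> gens" using assms by (simp add: gens_def simple_tensors_Cons)
  have r: "reduce j (j # s, h # hs) = Some (h, (s, hs))" by (simp add: reduce_def)
  have "emb PT (unit_gen (j # s) (h # hs)) = emb PT (theta j h s hs)"
    unfolding unit_gen_def
    by (rule P.emb_eqI[OF reduce_Some(4)[OF g r j] single_gen_closed[OF g] theta_parts(3)[OF assms(1,2) h]])
  then show ?thesis using tleft_eq[OF assms(1,2) h] by (simp add: tens_eq)
qed

lemma gens_eqvI:
  assumes "v \<in> elems PT" "w \<in> elems PT"
    and "\<And>g. g \<in> gens \<Longrightarrow> inn PT (Poly_Mapping.single g 1) v = inn PT (Poly_Mapping.single g 1) w"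
  shows "P.eqv v w"
  unfolding P.eqv_def
proof
  fix u assume u: "u \<in> elems PT"
  show "inn PT u v = inn PT u w"
    unfolding inn_keys(2)[OF u assms(1)] inn_keys(2)[OF u assms(2)]
    by (intro sum.cong HOL.refl arg_cong2[where f = "(*)"] assms(3) keys_gens[OF u])
qed

text \<open>Formal tensors are not additive in a factor, so both sides are tested against
  generators. There \<open>inn_theta\<close> reduces the claim to additivity of
  \<open>tensor_inn\<close> in its coefficient.\<close>

lemma tleft_add:
  assumes "j # s \<in> T" "hs \<in> simple_tensors H \<xi> s" "h \<in> elems (H j)" "k \<in> elems (H j)"
  shows "tleft j (hadd (H j) h k) s hs = hadd KT (tleft j h s hs) (tleft j k s hs)"
proof -
  have j: "j \<in> {1..N}" by (rule T_letter[OF assms(1)])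
  interpret Hj: pointed_hilb "H j" "\<xi> j" by (rule pointed[OF j])
  have hk: "hadd (H j) h k \<in> elems (H j)" using assms by auto
  note th = theta_parts(3)[OF assms(1-3)] and tk = theta_parts(3)[OF assms(1,2,4)] and thk = theta_parts(3)[OF assms(1,2) hk]
  have "P.eqv (theta j (hadd (H j) h k) s hs) (hadd PT (theta j h s hs) (theta j k s hs))"
  proof (rule gens_eqvI[OF thk])
    fix g assume g: "g \<in> gens"
    show "inn PT (Poly_Mapping.single g 1) (theta j (hadd (H j) h k) s hs)
        = inn PT (Poly_Mapping.single g 1) (hadd PT (theta j h s hs) (theta j k s hs))"
    proof (cases "reduce j g")
      case None
      show ?thesis
        using reduce_None(2)[OF g None assms(1,2) hk] reduce_None(2)[OF g None assms(1-3)] reduce_None(2)[OF g None assms(1,2,4)]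
          P.inn_add_right[OF single_gen_closed[OF g, of 1] th tk] by simp
    next
      case (Some a)
      obtain l s' hs' where a: "a = (l, (s', hs'))" by (metis prod_cases3)
      note r = reduce_Some[OF g Some[unfolded a] j]
      note gl = P.eqv_inn_left[OF r(4) single_gen_closed[OF g] theta_parts(3)[OF r(1-3)]]
      have ts: "tensors s' hs'" "tensors s hs"
        using simple_tensors_tensors[OF T_tl[OF r(1)] r(2)] simple_tensors_tensors[OF T_tl[OF assms(1)] assms(2)] .
      show ?thesis
        unfolding P.inn_add_right[OF single_gen_closed[OF g, of 1] th tk] gl[OF th] gl[OF tk] gl[OF thk]
          inn_theta[OF r(1-3) assms(1-3)] inn_theta[OF r(1-3) assms(1,2,4)] inn_theta[OF r(1-3) assms(1,2) hk]
        using ts assms(3,4) r(3) by (cases "s' = s") (simp_all add: Hj.inn_add_right tensor_inn_add)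
    qed
  qed (use th tk in auto)
  then have "emb PT (theta j (hadd (H j) h k) s hs) = emb PT (hadd PT (theta j h s hs) (theta j k s hs))"
    by (rule P.emb_eqI[OF _ thk]) (use th tk in auto)
  then show ?thesis
    unfolding P.emb_add[OF th tk] tleft_eq[OF assms(1-3)] tleft_eq[OF assms(1,2,4)] tleft_eq[OF assms(1,2) hk] KT_eq .
qed

lemma tleft_lact:
  assumes "j # s \<in> T" "hs \<in> simple_tensors H \<xi> s" "h \<in> elems (H j)"
  shows "tleft j (lact (H j) b h) s hs = lact KT b (tleft j h s hs)"
proof -
  have j: "j \<in> {1..N}" by (rule T_letter[OF assms(1)])
  interpret Hj: pointed_hilb "H j" "\<xi> j" by (rule pointed[OF j])
  have bh: "lact (H j) b h \<in> elems (H j)" using assms(3) by auto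
  note th = theta_parts[OF assms] and tbh = theta_parts(3)[OF assms(1,2) bh]
  let ?c = "inn (H j) (\<xi> j) h"
  let ?h = "hminus (H j) h (lact (H j) ?c (\<xi> j))"
  have c: "inn (H j) (\<xi> j) (lact (H j) b h) = b * ?c"
    using assms(3) by (simp add: Hj.inn_lact_right Hj.xi_central Hj.inn_ract_left star_star)
  have "hminus (H j) (lact (H j) b h) (lact (H j) (b * ?c) (\<xi> j)) = lact (H j) b ?h"
    using assms(3) by (simp add: hminus_def Hj.lact_add_right Hj.lact_ract Hj.lact_mult)
  then have 1: "theta j (lact (H j) b h) s hs = lact PT (b * ?c) (unit_gen s hs) + lact PT b (unit_gen (j # s) (?h # hs))"
    by (simp add: theta_def c unit_gen_def lact_PT_single)
  have 2: "lact PT b (theta j h s hs) = lact PT b (lact PT ?c (unit_gen s hs)) + lact PT b (unit_gen (j # s) (?h # hs))"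
    by (simp add: theta_def lact_PT_add)
  have "P.eqv (theta j (lact (H j) b h) s hs) (lact PT b (theta j h s hs))"
    unfolding P.eqv_def
  proof
    fix z assume z: "z \<in> elems PT"
    have "inn PT z (lact PT (b * ?c) (unit_gen s hs)) = inn PT z (lact PT b (lact PT ?c (unit_gen s hs)))"
      by (rule P.inn_lact_mult[OF z unit_gen_closed[OF T_tl[OF assms(1)] assms(2)]])
    then show "inn PT z (theta j (lact (H j) b h) s hs) = inn PT z (lact PT b (theta j h s hs))"
      unfolding 1 2 by (simp add: inn_PT bsum_add_right)
  qed
  then have "emb PT (theta j (lact (H j) b h) s hs) = emb PT (lact PT b (theta j h s hs))"
    by (rule P.emb_eqI[OF _ tbh]) (use th(3) in auto)
  then show ?thesis
    unfolding P.emb_lact[OF th(3)] tleft_eq[OF assms] tleft_eq[OF assms(1,2) bh] KT_eq .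
qed

lemma tleft_zero: "j # s \<in> T \<Longrightarrow> hs \<in> simple_tensors H \<xi> s \<Longrightarrow> tleft j (hzero (H j)) s hs = hzero KT"
proof -
  assume a: "j # s \<in> T" "hs \<in> simple_tensors H \<xi> s"
  interpret Hj: pointed_hilb "H j" "\<xi> j" by (rule pointed[OF T_letter[OF a(1)]])
  have "tleft j (lact (H j) 0 (\<xi> j)) s hs = lact KT 0 (tleft j (\<xi> j) s hs)"
    by (rule tleft_lact[OF a Hj.xi_closed])
  then show ?thesis
    unfolding Hj.lact_zero_left[OF Hj.xi_closed] K.lact_zero_left[OF tleft_closed[OF a Hj.xi_closed]] .
qed

lemma op_eqI_tens:
  assumes "S \<in> adjointable KT" "R \<in> adjointable KT"
    and eq: "\<And>s hs. s \<in> T \<Longrightarrow> hs \<in> simple_tensors H \<xi> s \<Longrightarrow> S (tens s hs) = R (tens s hs)"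
  shows "S = R"
proof -
  have "S (emb PT v) = R (emb PT v)" if "v \<in> elems PT" for v
  proof -
    have "v \<in> elems PT \<and> S (emb PT v) = R (emb PT v)"
      using that
    proof (induction v rule: elems_induct)
      case zero
      have "S (emb PT (hzero PT)) = R (emb PT (hzero PT))"
        using K.op_zero[OF assms(1)] K.op_zero[OF assms(2)] unfolding P.emb_zero KT_eq by simp
      then show ?case using P.zero_closed by (simp add: PT_simps)
    next
      case (single g c)
      obtain s hs where g: "g = (s, hs)" by (cases g)
      have s: "s \<in> T" "hs \<in> simple_tensors H \<xi> s" using single by (simp_all add: g gens_def)
      have "Poly_Mapping.single g c = ract PT (unit_gen s hs) c"
        by (simp add: unit_gen_def g PT_simps map_mult_single)
      then have "emb PT (Poly_Mapping.single g c) = ract KT (tens s hs) c"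
        unfolding tens_eq KT_eq using P.emb_ract[OF unit_gen_closed[OF s]] by simp
      then show ?case
        using eq[OF s] K.op_ract[OF assms(1) tens_closed[OF s]] K.op_ract[OF assms(2) tens_closed[OF s]] single_gen_closed[OF single]
        by simp
    next
      case (add v w)
      then have v: "v \<in> elems PT" and w: "w \<in> elems PT" by auto
      have e: "emb PT (v + w) = hadd KT (emb PT v) (emb PT w)"
        using P.emb_add[OF v w] by (simp add: PT_simps(3) KT_eq)
      have ec: "emb PT v \<in> elems KT" "emb PT w \<in> elems KT" unfolding KT_eq by (rule P.emb_closed[OF v], rule P.emb_closed[OF w])
      show ?case
        using add K.op_add[OF assms(1) ec] K.op_add[OF assms(2) ec] P.add_closed[OF v w] by (simp add: e PT_simps(3))
    qed
    then show ?thesis ..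
  qed
  then show ?thesis using assms(1,2) unfolding KT_eq by (intro P.op_eq_dense)
qed

text \<open>All simple tensors are covered: one that begins with \<open>j\<close> is
  \<open>tleft\<close> of its first factor, one that \<open>j\<close> can extend is
  \<open>tleft\<close> of \<open>\<xi> j\<close>, and the rest are handled by
  \<open>L0\<close>.\<close>

lemma lambda_unique:
  assumes j: "j \<in> {1..N}"
    and "L \<in> adjointable KT" "L' \<in> adjointable KT"
    and L: "\<And>s hs h. j # s \<in> T \<Longrightarrow> hs \<in> simple_tensors H \<xi> s \<Longrightarrow> h \<in> elems (H j) \<Longrightarrow> L (tleft j h s hs) = L' (tleft j h s hs)"
    and L0: "\<And>s hs. s \<in> T \<Longrightarrow> s = [] \<or> hd s \<noteq> j \<Longrightarrow> j # s \<notin> T \<Longrightarrow> hs \<in> simple_tensors H \<xi> s \<Longrightarrow> L (tens s hs) = L' (tens s hs)"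
  shows "L = L'"
proof (rule op_eqI_tens[OF assms(2,3)])
  interpret Hj: pointed_hilb "H j" "\<xi> j" by (rule pointed[OF j])
  fix s hs assume s: "s \<in> T" "hs \<in> simple_tensors H \<xi> s"
  show "L (tens s hs) = L' (tens s hs)"
  proof (cases "s = [] \<or> hd s \<noteq> j")
    case True
    show ?thesis
    proof (cases "j # s \<in> T")
      case True
      then show ?thesis using L[OF True s(2) Hj.xi_closed] tleft_xi[OF True s(2)] by simp
    qed (use L0[OF s(1) True] s(2) in auto)
  next
    case False
    then obtain s' where s': "s = j # s'" by (cases s) auto
    then obtain h hs' where hs: "hs = h # hs'" "h \<in> hcirc (H j) (\<xi> j)" "hs' \<in> simple_tensors H \<xi> s'"
      using s(2) by (auto simp: simple_tensors_Cons)
    have "h \<in> elems (H j)" using hs(2) by (simp add: hcirc_def)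
    then show ?thesis using L[of s' hs' h] s(1) hs tleft_circ[of j s' hs' h] by (simp add: s')
  qed
qed

context
  fixes j x y C
  assumes j: "j \<in> {1..N}" and xy: "prehilb.adj_pair (H j) x y C"
begin

lemma extend_lam_tleft:
  assumes "j # s \<in> T" "hs \<in> simple_tensors H \<xi> s" "h \<in> elems (H j)"
  shows "P.extend (lam j x) (tleft j h s hs) = tleft j (x h) s hs"
proof -
  interpret Hj: pointed_hilb "H j" "\<xi> j" by (rule pointed[OF j])
  note X = Hj.adj_pairD[OF xy]
  note th = theta_parts(3)[OF assms]
  have "P.extend (lam j x) (emb PT (theta j h s hs)) = emb PT (lam j x (theta j h s hs))"
    by (rule P.extend_emb[OF lam_adj_pair[OF j xy] th])
  also have "\<dots> = emb PT (theta j (x h) s hs)"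
    by (rule P.emb_eqI[OF lam_theta[OF j xy assms] lam_closed[OF j X(1) th] theta_parts(3)[OF assms(1,2) X(1)[OF assms(3)]]])
  finally show ?thesis unfolding tleft_eq[OF assms] tleft_eq[OF assms(1,2) X(1)[OF assms(3)]] .
qed

lemma extend_lam_zero:
  assumes "s \<in> T" "s = [] \<or> hd s \<noteq> j" "j # s \<notin> T" "hs \<in> simple_tensors H \<xi> s"
  shows "P.extend (lam j x) (tens s hs) = hzero KT"
proof -
  have "reduce j (s, hs) = None" using assms by (auto simp: reduce_def)
  then have "lam j x (unit_gen s hs) = hzero PT"
    using map_mult_zero[of "1::'b"] by (simp add: lam_def unit_gen_def lam_gen_def PT_simps del: mult_1_right)
  then show ?thesis
    using P.extend_emb[OF lam_adj_pair[OF j xy] unit_gen_closed[OF assms(1,4)]] by (simp add: tens_eq P.emb_zero KT_eq)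
qed

lemma extend_lam_adjointable: "P.extend (lam j x) \<in> adjointable KT"
  unfolding KT_eq by (rule P.extend_adjointable[OF lam_adj_pair[OF j xy]])

text \<open>This settles the definite description in \<open>lambda_op\<close>: the extension of
  \<open>lam j x\<close> has the prescribed values, and \<open>lambda_unique\<close> excludes any
  other operator.\<close>

lemma lambda_eq: "lambda j x = P.extend (lam j x)"
  unfolding lambda_op_def
proof (rule the_equality)
  show "P.extend (lam j x) \<in> adjointable KT \<and>
    (\<forall>s\<in>T. (s = [] \<or> hd s \<noteq> j) \<longrightarrow> (\<forall>hs\<in>simple_tensors H \<xi> s.
        if j # s \<in> T then \<forall>h\<in>elems (H j). P.extend (lam j x) (tleft j h s hs) = tleft j (x h) s hs
        else P.extend (lam j x) (tens s hs) = hzero KT))"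
    using extend_lam_adjointable extend_lam_tleft extend_lam_zero by simp
  fix L assume L: "L \<in> adjointable KT \<and>
    (\<forall>s\<in>T. (s = [] \<or> hd s \<noteq> j) \<longrightarrow> (\<forall>hs\<in>simple_tensors H \<xi> s.
        if j # s \<in> T then \<forall>h\<in>elems (H j). L (tleft j h s hs) = tleft j (x h) s hs
        else L (tens s hs) = hzero KT))"
  note L' = L[THEN conjunct2, rule_format]
  show "L = P.extend (lam j x)"
  proof (rule lambda_unique[OF j _ extend_lam_adjointable])
    fix s hs h assume *: "j # s \<in> T" "hs \<in> simple_tensors H \<xi> s" "h \<in> elems (H j)"
    show "L (tleft j h s hs) = P.extend (lam j x) (tleft j h s hs)"
      using L'[OF T_tl[OF *(1)] T_alt[OF *(1)] *(2)] * extend_lam_tleft[OF *] by simp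
  next
    fix s hs assume *: "s \<in> T" "s = [] \<or> hd s \<noteq> j" "j # s \<notin> T" "hs \<in> simple_tensors H \<xi> s"
    show "L (tens s hs) = P.extend (lam j x) (tens s hs)"
      using L'[OF *(1,2,4)] *(3) extend_lam_zero[OF *] by simp
  qed (use L in simp)
qed

lemma lambda_adjointable': "lambda j x \<in> adjointable KT"
  unfolding lambda_eq by (rule extend_lam_adjointable)

lemma lambda_bound:
  assumes "h \<in> elems KT"
  shows "hnorm KT (lambda j x h) \<le> C * hnorm KT h"
  using P.extend_bound[OF lam_adj_pair[OF j xy]] assms unfolding lambda_eq KT_eq by simp

lemma inn_lambda:
  assumes "h \<in> elems KT" "k \<in> elems KT"
  shows "inn KT (lambda j x h) k = inn KT h (P.extend (lam j y) k)"
  using P.extend_adjoint[OF lam_adj_pair[OF j xy]] assms unfolding lambda_eq KT_eq by simp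

end

lemma adjointable_pairE:
  assumes "j \<in> {1..N}" "x \<in> adjointable (H j)"
  obtains y C where "prehilb.adj_pair (H j) x y C"
  using hilb.adjointableE[OF hilbH[OF assms(1)] assms(2)] .

lemma lambda_adjointable:
  assumes "j \<in> {1..N}" "x \<in> adjointable (H j)"
  shows "lambda j x \<in> adjointable KT"
proof -
  obtain y C where xy: "prehilb.adj_pair (H j) x y C" using adjointable_pairE[OF assms] .
  show ?thesis by (rule lambda_adjointable'[OF assms(1) xy])
qed

lemma lambda_tleft:
  assumes "j # s \<in> T" "x \<in> adjointable (H j)" "hs \<in> simple_tensors H \<xi> s" "h \<in> elems (H j)"
  shows "lambda j x (tleft j h s hs) = tleft j (x h) s hs"
proof -
  note j = T_letter[OF assms(1)]
  obtain y C where xy: "prehilb.adj_pair (H j) x y C" using adjointable_pairE[OF j assms(2)] .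
  show ?thesis unfolding lambda_eq[OF j xy] by (rule extend_lam_tleft[OF j xy assms(1,3,4)])
qed

lemma lambda_zero:
  assumes "j \<in> {1..N}" "x \<in> adjointable (H j)" "s \<in> T" "s = [] \<or> hd s \<noteq> j" "j # s \<notin> T" "hs \<in> simple_tensors H \<xi> s"
  shows "lambda j x (tens s hs) = hzero KT"
proof -
  obtain y C where xy: "prehilb.adj_pair (H j) x y C" using adjointable_pairE[OF assms(1,2)] .
  show ?thesis unfolding lambda_eq[OF assms(1) xy] by (rule extend_lam_zero[OF assms(1) xy assms(3-6)])
qed

lemma lambda_adjoint:
  assumes j: "j \<in> {1..N}" and x: "x \<in> adjointable (H j)" and y: "y \<in> adjointable (H j)"
    and xy: "\<And>h k. h \<in> elems (H j) \<Longrightarrow> k \<in> elems (H j) \<Longrightarrow> inn (H j) (x h) k = inn (H j) h (y k)"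
    and "u \<in> elems KT" "v \<in> elems KT"
  shows "inn KT (lambda j x u) v = inn KT u (lambda j y v)"
proof -
  interpret Hj: pointed_hilb "H j" "\<xi> j" by (rule pointed[OF j])
  obtain x' C where X: "Hj.adj_pair x x' C" using adjointable_pairE[OF j x] .
  have p: "Hj.adj_pair x y C"
    using Hj.adj_pairD(1,3,6)[OF X] Hj.op_closed[OF y] xy by (simp add: Hj.adj_pair_def)
  show ?thesis
    using inn_lambda[OF j p assms(5,6)] lambda_eq[OF j Hj.adj_pair_sym[OF p]] by simp
qed

lemma peval_lambda_tleft:
  assumes "j # s \<in> T" "x \<in> adjointable (H j)" "hs \<in> simple_tensors H \<xi> s" "h \<in> elems (H j)"
  shows "peval KT (lambda j x) q (tleft j h s hs) = tleft j (peval (H j) x q h) s hs"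
proof -
  have j: "j \<in> {1..N}" by (rule T_letter[OF assms(1)])
  interpret Hj: pointed_hilb "H j" "\<xi> j" by (rule pointed[OF j])
  note la = lambda_adjointable[OF j assms(2)]
  show ?thesis
    using assms(4)
  proof (induction q arbitrary: h rule: bpoly_induct)
    case (const b)
    then show ?case using assms by (simp add: K.peval_simps Hj.peval_simps la tleft_closed tleft_lact)
  next
    case X
    then show ?case using assms by (simp add: K.peval_simps Hj.peval_simps la tleft_closed lambda_tleft)
  next
    case (add p q)
    then show ?case using assms by (simp add: K.peval_simps Hj.peval_simps la tleft_closed tleft_add Hj.peval_closed)
  next
    case (mult p q)
    then show ?case using assms by (simp add: K.peval_simps Hj.peval_simps la tleft_closed Hj.peval_closed)
  qed
qed

text \<open>A diagonal operator, constant on each summand. In \<open>creation_sum_bound\<close> the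
  weight \<open>f\<close> counts children.\<close>

definition grade :: "(nat list \<Rightarrow> real) \<Rightarrow> ('h gen \<Rightarrow>\<^sub>0 'b) \<Rightarrow> 'h gen \<Rightarrow>\<^sub>0 'b" where
  "grade f v = Poly_Mapping.mapp (\<lambda>g c. scaleR (f (fst g)) c) v"

lemma lookup_grade: "Poly_Mapping.lookup (grade f v) g = scaleR (f (fst g)) (Poly_Mapping.lookup v g)"
  by (simp add: grade_def lookup_mapp when_def in_keys_iff)

lemma keys_grade: "Poly_Mapping.keys (grade f v) \<subseteq> Poly_Mapping.keys v"
  by (auto simp: in_keys_iff lookup_grade)

lemma grade_closed: "v \<in> elems PT \<Longrightarrow> grade f v \<in> elems PT"
  using keys_grade[of f v] by (auto simp: PT_simps)

lemma grade_sym: "inn PT (grade f u) v = inn PT u (grade f v)"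
  unfolding inn_PT
  by (subst (1 2) bsum_superset[of "Poly_Mapping.keys u" "Poly_Mapping.keys v"])
    (auto simp: keys_grade[THEN subsetD] lookup_grade bform_def star_scaleR intro!: sum.cong)

lemma funpow_grade: "(grade f ^^ m) v = grade (\<lambda>s. f s ^ m) v"
  by (induction m) (auto intro!: poly_mapping_eqI simp: lookup_grade)

text \<open>Powers of \<open>grade f\<close> are again of this form, with weights
  \<open>f s ^ m\<close>. The triangle inequality over the generators of \<open>v\<close> is then an
  orbit bound of rate \<open>D\<close>.\<close>

lemma grade_bound:
  assumes "\<And>s. \<bar>f s\<bar> \<le> D" "v \<in> elems PT"
  shows "hnorm PT (grade f v) \<le> D * hnorm PT v"
proof (rule P.symmetric_bound[of "grade f" v D "\<Sum>g\<in>Poly_Mapping.keys v. hnorm PT (Poly_Mapping.single g (Poly_Mapping.lookup v g))"])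
  show D: "0 \<le> D" using assms(1)[of "[]"] by linarith
  fix m
  have gs: "grade (\<lambda>s. f s ^ m) v = (\<Sum>g\<in>Poly_Mapping.keys v. Poly_Mapping.single g (scaleR (f (fst g) ^ m) (Poly_Mapping.lookup v g)))"
    by (rule poly_mapping_eqI) (simp add: lookup_sum lookup_grade lookup_single when_def in_keys_iff)
  have "hnorm PT ((grade f ^^ m) v) \<le> (\<Sum>g\<in>Poly_Mapping.keys v. hnorm PT (Poly_Mapping.single g (scaleR (f (fst g) ^ m) (Poly_Mapping.lookup v g))))"
    unfolding funpow_grade gs by (intro PT_hnorm_sum single_gen_closed keys_gens[OF assms(2)])
  also have "\<dots> \<le> (\<Sum>g\<in>Poly_Mapping.keys v. hnorm PT (Poly_Mapping.single g (Poly_Mapping.lookup v g)) * D ^ m)"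
  proof (rule sum_mono)
    fix g assume g: "g \<in> Poly_Mapping.keys v"
    let ?c = "Poly_Mapping.lookup v g"
    have "Poly_Mapping.single g (scaleR (f (fst g) ^ m) ?c) = ract PT (Poly_Mapping.single g ?c) (scalar (complex_of_real (f (fst g) ^ m)))"
      unfolding PT_simps map_mult_single by (simp add: scaleC_of_real del: of_real_power)
    then have "hnorm PT (Poly_Mapping.single g (scaleR (f (fst g) ^ m) ?c)) = \<bar>f (fst g)\<bar> ^ m * hnorm PT (Poly_Mapping.single g ?c)"
      using P.hnorm_ract_scalar[OF single_gen_closed[OF keys_gens[OF assms(2) g], of ?c]]
      by (simp only: norm_of_real power_abs)
    also have "\<dots> \<le> D ^ m * hnorm PT (Poly_Mapping.single g ?c)"
      using assms(1) by (intro mult_right_mono power_mono) simp_all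
    finally show "hnorm PT (Poly_Mapping.single g (scaleR (f (fst g) ^ m) ?c)) \<le> hnorm PT (Poly_Mapping.single g ?c) * D ^ m"
      by (simp add: mult.commute)
  qed
  finally show "hnorm PT ((grade f ^^ m) v) \<le> (\<Sum>g\<in>Poly_Mapping.keys v. hnorm PT (Poly_Mapping.single g (Poly_Mapping.lookup v g))) * D ^ m"
    by (simp add: sum_distrib_right)
qed (simp_all add: grade_closed grade_sym assms(2))

lemma grade_op:
  assumes "\<And>s. \<bar>f s\<bar> \<le> D"
  obtains G where "G \<in> adjointable KT" "\<And>h. h \<in> elems KT \<Longrightarrow> hnorm KT (G h) \<le> D * hnorm KT h"
    "\<And>s hs. s \<in> T \<Longrightarrow> hs \<in> simple_tensors H \<xi> s \<Longrightarrow> G (tens s hs) = ract KT (tens s hs) (of_real (f s))"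
proof -
  have D: "0 \<le> D" using assms[of "[]"] by linarith
  have p: "P.adj_pair (grade f) (grade f) D"
    unfolding P.adj_pair_def using grade_closed grade_sym grade_bound[OF assms] D by simp
  show ?thesis
  proof (rule that[of "P.extend (grade f)"])
    show "P.extend (grade f) \<in> adjointable KT" unfolding KT_eq by (rule P.extend_adjointable[OF p])
    show "hnorm KT (P.extend (grade f) h) \<le> D * hnorm KT h" if "h \<in> elems KT" for h
      using P.extend_bound[OF p] that unfolding KT_eq by simp
    show "P.extend (grade f) (tens s hs) = ract KT (tens s hs) (of_real (f s))"
      if s: "s \<in> T" "hs \<in> simple_tensors H \<xi> s" for s hs
    proof -
      have "grade f (unit_gen s hs) = ract PT (unit_gen s hs) (of_real (f s))"
        by (rule poly_mapping_eqI)
          (auto simp: lookup_grade unit_gen_def PT_simps map_mult_single lookup_single when_def of_real_def)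
      then show ?thesis
        unfolding tens_eq KT_eq using P.extend_emb[OF p unit_gen_closed[OF s]] P.emb_ract[OF unit_gen_closed[OF s]] by simp
    qed
  qed
qed

end

subsection \<open>Tree-independent families\<close>

abbreviation osum :: "('b::unital_cstar_algebra, 'v) bimod \<Rightarrow> 'i set \<Rightarrow> ('i \<Rightarrow> 'v \<Rightarrow> 'v) \<Rightarrow> 'v \<Rightarrow> 'v" where
  "osum V F Y \<equiv> (\<Oplus>\<^bsub>Lop V\<^esub>i\<in>F. Y i)"

context hilb
begin

lemma osum_adjointable: "(\<And>i. i \<in> F \<Longrightarrow> Y i \<in> adjointable V) \<Longrightarrow> osum V F Y \<in> adjointable V"
  by (rule op_algebra.finsum_adjointable[OF op_algebra_Lop])

lemma osum_empty: "h \<in> elems V \<Longrightarrow> osum V {} Y h = hzero V"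
proof -
  interpret L: op_algebra V "Lop V" by (rule op_algebra_Lop)
  show "h \<in> elems V \<Longrightarrow> osum V {} Y h = hzero V" by simp
qed

lemma osum_insert:
  assumes "finite F" "i \<notin> F" "\<And>j. j \<in> insert i F \<Longrightarrow> Y j \<in> adjointable V" "h \<in> elems V"
  shows "osum V (insert i F) Y h = hadd V (Y i h) (osum V F Y h)"
proof -
  interpret L: op_algebra V "Lop V" by (rule op_algebra_Lop)
  have "osum V (insert i F) Y = Y i \<oplus>\<^bsub>Lop V\<^esub> osum V F Y"
    using assms by (intro L.finsum_insert) (auto simp: L.carrier_A)
  then show ?thesis using assms osum_adjointable[of F Y] by (simp add: L.add_apply)
qed

lemma inn_osum:
  assumes "finite F" "\<And>i. i \<in> F \<Longrightarrow> Y i \<in> adjointable V" "h \<in> elems V" "z \<in> elems V"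
  shows "inn V z (osum V F Y h) = (\<Sum>i\<in>F. inn V z (Y i h))"
  by (rule op_algebra.inn_finsum[OF op_algebra_Lop assms])

lemma inn_osum_left:
  assumes "finite F" "\<And>i. i \<in> F \<Longrightarrow> Y i \<in> adjointable V" "h \<in> elems V" "z \<in> elems V"
  shows "inn V (osum V F Y h) z = (\<Sum>i\<in>F. inn V (Y i h) z)"
proof -
  have "osum V F Y h \<in> elems V" by (rule op_closed[OF osum_adjointable[OF assms(2)] assms(3)])
  then have "star (inn V z (osum V F Y h)) = inn V (osum V F Y h) z" using assms(4) by (simp add: star_inn)
  moreover have "star (\<Sum>i\<in>F. inn V z (Y i h)) = (\<Sum>i\<in>F. inn V (Y i h) z)"
    unfolding star_sum using assms by (intro sum.cong HOL.refl star_inn) (auto intro: op_closed)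
  ultimately show ?thesis by (simp add: inn_osum[OF assms])
qed

lemma osum_sym:
  assumes "finite F" "\<And>i. i \<in> F \<Longrightarrow> Y i \<in> adjointable V"
    and "\<And>i h k. i \<in> F \<Longrightarrow> h \<in> elems V \<Longrightarrow> k \<in> elems V \<Longrightarrow> inn V (Y i h) k = inn V h (Z i k)"
    and "\<And>i. i \<in> F \<Longrightarrow> Z i \<in> adjointable V" "h \<in> elems V" "k \<in> elems V"
  shows "inn V (osum V F Y h) k = inn V h (osum V F Z k)"
  using assms by (simp add: inn_osum inn_osum_left)

lemma add_interchange:
  assumes "a \<in> elems V" "b \<in> elems V" "c \<in> elems V" "d \<in> elems V"
  shows "hadd V (hadd V a b) (hadd V c d) = hadd V (hadd V a c) (hadd V b d)"
  by (rule inn_eqI) (use assms in \<open>simp_all add: inn_add_right\<close>)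

lemma peval_shift:
  assumes "Y \<in> adjointable V" "h \<in> elems V"
  shows "peval V Y q h = hadd V (peval V Y (q + const (- c)) h) (lact V c h)"
proof -
  have "(q + const (- c)) + const c = q" by (simp add: const_add[symmetric] const_zero add.assoc)
  then have "peval V Y q h = peval V Y ((q + const (- c)) + const c) h" by (simp only:)
  then show ?thesis unfolding peval_simps(3)[OF assms] peval_simps(1)[OF assms] .
qed

end

context
  fixes V :: "('b::unital_cstar_algebra, 'v) bimod" and T :: "nat list set" and \<mu> :: "nat \<Rightarrow> 'b bpoly \<Rightarrow> 'b"
    and Y :: "nat \<Rightarrow> 'v \<Rightarrow> 'v" and v :: 'v
begin

text \<open>In a \<open>T\<close>-free product, with \<open>v\<close> the vacuum vector, these vectors lie in the summand at \<open>s\<close>.\<close>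

inductive tvec :: "nat list \<Rightarrow> 'v \<Rightarrow> bool" where
  tvec_base: "tvec [] (lact V b v)"
| tvec_step: "tvec s h \<Longrightarrow> i # s \<in> T \<Longrightarrow> \<mu> i q = 0 \<Longrightarrow> tvec (i # s) (peval V (Y i) q h)"

inductive tspan :: "nat list set \<Rightarrow> 'v \<Rightarrow> bool" for S where
  tspan_zero: "tspan S (hzero V)"
| tspan_gen: "tvec s h \<Longrightarrow> s \<in> S \<Longrightarrow> tspan S h"
| tspan_add: "tspan S h \<Longrightarrow> tspan S k \<Longrightarrow> tspan S (hadd V h k)"

end

lemma subtree_Nil: "subtree N T \<Longrightarrow> [] \<in> T"
  by (simp add: subtree_def)

lemma subtree_letter: "subtree N T \<Longrightarrow> i # s \<in> T \<Longrightarrow> i \<in> {1..N}"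
  by (auto simp: subtree_def alt_strings_def)

text \<open>The base vector is arbitrary, because in a composed tree the operators of one block act
  on top of any word \<open>h\<close> of the other blocks, not only on the vacuum. Expectation zero
  with respect to a central unit vector is added in \<open>tree_free\<close>.\<close>

locale tree_family = hilb V for V :: "('b::unital_cstar_algebra, 'v) bimod" and N T +
  fixes \<mu> :: "nat \<Rightarrow> 'b bpoly \<Rightarrow> 'b" and Y :: "nat \<Rightarrow> 'v \<Rightarrow> 'v" and v :: 'v
  assumes subtree: "subtree N T"
    and Y_adjointable: "i \<in> {1..N} \<Longrightarrow> Y i \<in> adjointable V"
    and v_closed: "v \<in> elems V"
    and laws: "i \<in> {1..N} \<Longrightarrow> bvalued_law (\<mu> i)"
    and kill: "tvec V T \<mu> Y v s h \<Longrightarrow> i \<in> {1..N} \<Longrightarrow> s = [] \<or> hd s \<noteq> i \<Longrightarrow> i # s \<notin> T \<Longrightarrow> Y i h = hzero V"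
begin

abbreviation "tv \<equiv> tvec V T \<mu> Y v"
abbreviation "ts \<equiv> tspan V T \<mu> Y v"

lemma law_mu: "i \<in> {1..N} \<Longrightarrow> law (\<mu> i)"
  by (rule law.intro[OF laws])

lemma tv_in_T: "tv s h \<Longrightarrow> s \<in> T"
  by (induction rule: tvec.induct) (auto simp: subtree_Nil[OF subtree])

lemma tv_closed: "tv s h \<Longrightarrow> h \<in> elems V"
  by (induction rule: tvec.induct) (simp_all add: v_closed peval_closed Y_adjointable[OF subtree_letter[OF subtree]])

lemma ts_closed: "ts S h \<Longrightarrow> h \<in> elems V"
  by (induction rule: tspan.induct) (auto dest: tv_closed)

end

text \<open>Freeness for \<open>T\<close> relative to given laws, as a property of operators that
  does not refer to a tree-free product realising them.\<close>

locale tree_free = tree_family V N T \<mu> Y v + pointed_hilb V v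
  for V :: "('b::unital_cstar_algebra, 'v) bimod" and N T \<mu> Y v +
  assumes centred: "tvec V T \<mu> Y v s h \<Longrightarrow> s \<noteq> [] \<Longrightarrow> inn V v h = 0"
begin

lemma ts_centred: "ts S h \<Longrightarrow> [] \<notin> S \<Longrightarrow> inn V v h = 0"
proof (induction rule: tspan.induct)
  case (tspan_gen s h)
  then show ?case by (intro centred[of s h]) auto
qed (auto simp: xi_closed inn_add_right ts_closed)

end

locale tree_pair = A: tree_family V N T \<mu> Y v + B: tree_family W N T \<mu> Z w
  for V :: "('b::unital_cstar_algebra, 'v) bimod" and W :: "('b, 'w) bimod" and N T \<mu> Y Z v w
begin

inductive tpair :: "nat list \<Rightarrow> 'v \<Rightarrow> 'w \<Rightarrow> bool" where
  tpair_base: "tpair [] (lact V b v) (lact W b w)"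
| tpair_step: "tpair s h k \<Longrightarrow> i # s \<in> T \<Longrightarrow> \<mu> i q = 0 \<Longrightarrow> tpair (i # s) (peval V (Y i) q h) (peval W (Z i) q k)"

inductive rspan :: "'v \<Rightarrow> 'w \<Rightarrow> bool" where
  rspan_gen: "tpair s h k \<Longrightarrow> rspan h k"
| rspan_add: "rspan h k \<Longrightarrow> rspan h' k' \<Longrightarrow> rspan (hadd V h h') (hadd W k k')"

lemma tpair_tvec: "tpair s h k \<Longrightarrow> A.tv s h \<and> B.tv s k"
  by (induction rule: tpair.induct) (auto intro: tvec.intros)

lemma tpair_closed: "tpair s h k \<Longrightarrow> h \<in> elems V" "tpair s h k \<Longrightarrow> k \<in> elems W"
  using tpair_tvec A.tv_closed B.tv_closed by blast+

lemma rspan_closed: "rspan h k \<Longrightarrow> h \<in> elems V \<and> k \<in> elems W"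
  by (induction rule: rspan.induct) (auto dest: tpair_closed)

lemma rspan_zero: "rspan (hzero V) (hzero W)"
  using rspan_gen[OF tpair_base[of 0]] A.lact_zero_left[OF A.v_closed] B.lact_zero_left[OF B.v_closed] by simp

lemma rspan_base: "rspan v w"
  using rspan_gen[OF tpair_base[of 1]] A.lact_one[OF A.v_closed] B.lact_one[OF B.v_closed] by simp

lemma tpair_lact:
  assumes "tpair s h k"
  shows "tpair s (lact V c h) (lact W c k)"
  using assms
proof cases
  case (tpair_base b)
  then show ?thesis
    using tpair.tpair_base[of "c * b"] A.lact_mult[OF A.v_closed] B.lact_mult[OF B.v_closed] by simp
next
  case (tpair_step s' h' k' i q)
  note i = subtree_letter[OF A.subtree tpair_step(5)]
  interpret l: law "\<mu> i" by (rule A.law_mu[OF i])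
  have "\<mu> i (const c * q) = 0" using tpair_step(6) by (simp add: l.law_left)
  from tpair.tpair_step[OF tpair_step(4,5) this]
  show ?thesis
    using tpair_closed[OF tpair_step(4)] A.Y_adjointable[OF i] B.Y_adjointable[OF i] tpair_step(1-3)
    by (simp add: A.peval_simps B.peval_simps A.peval_closed B.peval_closed)
qed

lemma rspan_lact: "rspan h k \<Longrightarrow> rspan (lact V c h) (lact W c k)"
proof (induction rule: rspan.induct)
  case (rspan_gen s h k)
  then show ?case by (intro rspan.rspan_gen tpair_lact)
next
  case (rspan_add h k h' k')
  then show ?case
    using rspan_closed[OF rspan_add.hyps(1)] rspan_closed[OF rspan_add.hyps(2)]
    by (simp add: A.lact_add_right B.lact_add_right rspan.rspan_add)
qed

lemma rspan_step:
  assumes "tpair s h k" "i # s \<in> T"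
  shows "rspan (peval V (Y i) q h) (peval W (Z i) q k)"
proof -
  note i = subtree_letter[OF A.subtree assms(2)]
  interpret l: law "\<mu> i" by (rule A.law_mu[OF i])
  have "\<mu> i (q + const (- \<mu> i q)) = 0" by (simp add: l.law_add l.law_const)
  from rspan_add[OF rspan_gen[OF tpair_step[OF assms this]] rspan_gen[OF tpair_lact[OF assms(1)], of "\<mu> i q"]]
  show ?thesis
    using A.peval_shift[OF A.Y_adjointable[OF i] tpair_closed(1)[OF assms(1)], of q "\<mu> i q"]
      B.peval_shift[OF B.Y_adjointable[OF i] tpair_closed(2)[OF assms(1)], of q "\<mu> i q"] by simp
qed

text \<open>Three cases: the letter extends the word, and \<open>rspan_step\<close> splits off its
  expectation; or both families kill the word; or the letter equals the first one and is absorbed by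
  replacing \<open>q\<close> with \<open>X * q\<close>.\<close>

lemma tpair_op:
  assumes p: "tpair s h k" and i: "i \<in> {1..N}"
  shows "rspan (Y i h) (Z i k)"
proof -
  note Yi = A.Y_adjointable[OF i] and Zi = B.Y_adjointable[OF i]
  consider "i # s \<in> T" | "s = [] \<or> hd s \<noteq> i" "i # s \<notin> T" | "s \<noteq> []" "hd s = i" by blast
  then show ?thesis
  proof cases
    case 1
    then show ?thesis
      using rspan_step[OF p 1, of X] tpair_closed[OF p] by (simp add: A.peval_simps(2)[OF Yi] B.peval_simps(2)[OF Zi])
  next
    case 2
    have "Y i h = hzero V" "Z i k = hzero W"
      using A.kill[OF _ i 2] B.kill[OF _ i 2] tpair_tvec[OF p] by simp_all
    then show ?thesis using rspan_zero by simp
  next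
    case 3
    from p show ?thesis
    proof cases
      case (tpair_step s' h' k' j q)
      then have j: "j = i" using 3 by simp
      note s' = tpair_closed[OF tpair_step(4)]
      have "rspan (peval V (Y i) (X * q) h') (peval W (Z i) (X * q) k')"
        using rspan_step[OF tpair_step(4), of i "X * q"] tpair_step(5) by (simp add: j)
      then show ?thesis
        using s' tpair_step(2,3) Yi Zi by (simp add: j A.peval_simps B.peval_simps A.peval_closed B.peval_closed)
    qed (use 3 in simp)
  qed
qed

lemma rspan_op: "rspan h k \<Longrightarrow> i \<in> {1..N} \<Longrightarrow> rspan (Y i h) (Z i k)"
proof (induction rule: rspan.induct)
  case (rspan_gen s h k)
  then show ?case by (intro tpair_op)
next
  case (rspan_add h k h' k')
  then show ?case
    using rspan_closed[OF rspan_add.hyps(1)] rspan_closed[OF rspan_add.hyps(2)]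
    by (simp add: A.op_add[OF A.Y_adjointable] B.op_add[OF B.Y_adjointable] rspan.rspan_add)
qed

lemma rspan_osum:
  assumes "rspan h k" "F \<subseteq> {1..N}"
  shows "rspan (osum V F Y h) (osum W F Z k)"
proof -
  have "finite F" using assms(2) finite_subset by blast
  then show ?thesis
    using assms(2)
  proof (induction F rule: finite_induct)
    case empty
    then show ?case using rspan_closed[OF assms(1)] by (simp add: A.osum_empty B.osum_empty rspan_zero)
  next
    case (insert i F)
    have "osum V (insert i F) Y h = hadd V (Y i h) (osum V F Y h)" "osum W (insert i F) Z k = hadd W (Z i k) (osum W F Z k)"
      using insert.hyps insert.prems rspan_closed[OF assms(1)]
      by (auto intro!: A.osum_insert B.osum_insert A.Y_adjointable B.Y_adjointable)
    then show ?case using insert assms(1) by (auto intro!: rspan_add rspan_op)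
  qed
qed

abbreviation "SY \<equiv> osum V {1..N} Y"
abbreviation "SZ \<equiv> osum W {1..N} Z"

lemma SY_adjointable: "SY \<in> adjointable V" by (rule A.osum_adjointable[OF A.Y_adjointable])
lemma SZ_adjointable: "SZ \<in> adjointable W" by (rule B.osum_adjointable[OF B.Y_adjointable])

lemma rspan_peval: "rspan h k \<Longrightarrow> rspan (peval V SY p h) (peval W SZ p k)"
proof (induction p arbitrary: h k rule: bpoly_induct)
  case (const b)
  then show ?case
    using rspan_lact[OF const] rspan_closed[OF const] by (simp add: A.peval_simps[OF SY_adjointable] B.peval_simps[OF SZ_adjointable] del: One_nat_def)
next
  case X
  then show ?case
    using rspan_osum[OF X] rspan_closed[OF X] by (simp add: A.peval_simps[OF SY_adjointable] B.peval_simps[OF SZ_adjointable] del: One_nat_def)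
next
  case (add p q)
  then show ?case
    using rspan_add[OF add.IH(1) add.IH(2), of h k h k] rspan_closed[OF add.prems]
    by (simp add: A.peval_simps[OF SY_adjointable] B.peval_simps[OF SZ_adjointable] del: One_nat_def)
next
  case (mult p q)
  then show ?case
    using mult.IH(1)[OF mult.IH(2), of h k] rspan_closed[OF mult.prems]
    by (simp add: A.peval_simps[OF SY_adjointable] B.peval_simps[OF SZ_adjointable] del: One_nat_def)
qed

text \<open>The coefficient along \<open>v\<close> is read off in \<open>W\<close>, where the base
  vector is a central unit vector. In \<open>V\<close> the base vector is arbitrary, so an inner
  product there would not isolate the coefficient.\<close>

lemma rspan_decompose:
  assumes "tree_free W N T \<mu> Z w" "rspan h k"
  shows "\<exists>y. A.ts (T - {[]}) y \<and> h = hadd V (lact V (inn W w k) v) y"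
  using assms(2)
proof (induction rule: rspan.induct)
  case (rspan_gen s h k)
  interpret B': tree_free W N T \<mu> Z w by (rule assms(1))
  note t = tpair_tvec[OF rspan_gen]
  show ?case
  proof (cases "s = []")
    case True
    with rspan_gen obtain b where b: "h = lact V b v" "k = lact W b w" by (auto elim: tpair.cases)
    have "inn W w k = b" by (simp add: b B'.xi_central B.inn_ract B'.xi_closed B'.inn_xi)
    then show ?thesis using b A.v_closed by (intro exI[of _ "hzero V"]) (simp add: tspan.tspan_zero A.add_zero_right)
  next
    case False
    then have "A.ts (T - {[]}) h" using t A.tv_in_T[of s h] by (intro tspan.tspan_gen[of V T \<mu> Y v s h]) auto
    moreover have "inn W w k = 0" using B'.centred[of s k] t False by simp
    ultimately show ?thesis using A.v_closed A.ts_closed by (intro exI[of _ h]) (simp add: A.lact_zero_left A.add_zero)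
  qed
next
  case (rspan_add h k h' k')
  obtain y where y: "A.ts (T - {[]}) y" "h = hadd V (lact V (inn W w k) v) y" using rspan_add.IH(1) by blast
  obtain y' where y': "A.ts (T - {[]}) y'" "h' = hadd V (lact V (inn W w k') v) y'" using rspan_add.IH(2) by blast
  have c: "y \<in> elems V" "y' \<in> elems V" using A.ts_closed y(1) y'(1) by simp_all
  have "inn W w (hadd W k k') = inn W w k + inn W w k'"
    using rspan_closed[OF rspan_add.hyps(1)] rspan_closed[OF rspan_add.hyps(2)] B.v_closed by (simp add: B.inn_add_right)
  moreover have "hadd V h h' = hadd V (lact V (inn W w k + inn W w k') v) (hadd V y y')"
    using c A.v_closed by (simp add: y(2) y'(2) A.lact_add_left A.add_interchange)
  ultimately show ?case using tspan.tspan_add[OF y(1) y'(1)] by (intro exI[of _ "hadd V y y'"]) simp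
qed

lemma vlaw_eq:
  assumes "tree_free V N T \<mu> Y v" "tree_free W N T \<mu> Z w"
  shows "vlaw V v SY = vlaw W w SZ"
proof
  fix p
  interpret A': tree_free V N T \<mu> Y v by (rule assms(1))
  obtain y where y: "A.ts (T - {[]}) y" "peval V SY p v = hadd V (lact V (inn W w (peval W SZ p w)) v) y"
    using rspan_decompose[OF assms(2) rspan_peval[OF rspan_base, of p]] by blast
  have "inn V v y = 0" using A'.ts_centred[OF y(1)] by simp
  then have "inn V v (peval V SY p v) = inn W w (peval W SZ p w)"
    using A.ts_closed[OF y(1)] unfolding y(2) by (simp add: A.inn_add_right A'.xi_closed A'.xi_central A.inn_ract A'.inn_xi)
  then show "vlaw V v SY p = vlaw W w SZ p" by (simp add: vlaw_def)
qed

end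

lemma (in tfree_product) tree_free_lambda:
  assumes x: "\<And>j. j \<in> {1..N} \<Longrightarrow> x j \<in> adjointable (H j)"
    and law: "\<And>j. j \<in> {1..N} \<Longrightarrow> vlaw (H j) (\<xi> j) (x j) = \<mu> j"
    and bv: "\<And>j. j \<in> {1..N} \<Longrightarrow> bvalued_law (\<mu> j)"
  shows "tree_free KT N T \<mu> (\<lambda>j. lambda j (x j)) vac"
proof -
  \<comment> \<open>Words are simple tensors, except over the empty string, where the coefficient
    \<open>b\<close> of the vacuum has no tensor factor to enter.\<close>
  have form: "(s = [] \<and> (\<exists>b. h = lact KT b vac)) \<or> (s \<noteq> [] \<and> s \<in> T \<and> (\<exists>hs\<in>simple_tensors H \<xi> s. h = tens s hs))"
    if "tvec KT T \<mu> (\<lambda>j. lambda j (x j)) vac s h" for s h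
    using that
  proof (induction rule: tvec.induct)
    case (tvec_step s h i q)
    note i = T_letter[OF tvec_step.hyps(2)]
    interpret Hi: pointed_hilb "H i" "\<xi> i" by (rule pointed[OF i])
    interpret l: law "\<mu> i" by (rule law.intro[OF bv[OF i]])
    have circ: "peval (H i) (x i) r (\<xi> i) \<in> hcirc (H i) (\<xi> i)" if "\<mu> i r = 0" for r
    proof -
      have c: "peval (H i) (x i) r (\<xi> i) \<in> elems (H i)" by (rule Hi.peval_closed[OF x[OF i] Hi.xi_closed])
      have "inn (H i) (\<xi> i) (peval (H i) (x i) r (\<xi> i)) = 0" using that law[OF i] by (simp add: vlaw_def fun_eq_iff)
      then have "inn (H i) (peval (H i) (x i) r (\<xi> i)) (\<xi> i) = 0"
        using Hi.star_inn[OF Hi.xi_closed c] by (simp add: star_zero)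
      then show ?thesis using c by (simp add: hcirc_def)
    qed
    have main: "\<exists>ks\<in>simple_tensors H \<xi> (i # s). peval KT (lambda i (x i)) r (tens s hs) = tens (i # s) ks"
      if hs: "hs \<in> simple_tensors H \<xi> s" and r: "\<mu> i r = 0" for hs r
    proof
      have "peval KT (lambda i (x i)) r (tens s hs) = tleft i (peval (H i) (x i) r (\<xi> i)) s hs"
        using peval_lambda_tleft[OF tvec_step.hyps(2) x[OF i] hs Hi.xi_closed] tleft_xi[OF tvec_step.hyps(2) hs] by simp
      also have "\<dots> = tens (i # s) (peval (H i) (x i) r (\<xi> i) # hs)"
        by (rule tleft_circ[OF tvec_step.hyps(2) hs circ[OF r]])
      finally show "peval KT (lambda i (x i)) r (tens s hs) = tens (i # s) (peval (H i) (x i) r (\<xi> i) # hs)" .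
      show "peval (H i) (x i) r (\<xi> i) # hs \<in> simple_tensors H \<xi> (i # s)"
        using hs circ[OF r] by (simp add: simple_tensors_Cons)
    qed
    show ?case
    proof (cases "s = []")
      case True
      then obtain b where b: "h = lact KT b vac" using tvec_step.IH by auto
      have "peval KT (lambda i (x i)) q h = peval KT (lambda i (x i)) (q * const b) (tens s [])"
        using K.peval_simps[OF lambda_adjointable[OF i x[OF i]] K.xi_closed] b True by (simp add: tfree_vec_def)
      \<comment> \<open>The coefficient of the vacuum moves into the polynomial, which stays centred
        by right modularity of the law.\<close>
      moreover have "\<mu> i (q * const b) = 0" using tvec_step.hyps(3) by (simp add: l.law_right)
      ultimately show ?thesis using main[of "[]" "q * const b"] True tvec_step.hyps(2) by (simp add: simple_tensors_def)
    next
      case False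
      then obtain hs where "hs \<in> simple_tensors H \<xi> s" "h = tens s hs" using tvec_step.IH by auto
      then show ?thesis using main[OF _ tvec_step.hyps(3)] tvec_step.hyps(2) by auto
    qed
  qed auto
  show ?thesis
  proof (intro tree_free.intro tree_family.intro tree_family_axioms.intro tree_free_axioms.intro
      K.hilb_axioms K.pointed_hilb_axioms subtree bv K.xi_closed lambda_adjointable x)
    show "inn KT vac h = 0" if "tvec KT T \<mu> (\<lambda>j. lambda j (x j)) vac s h" "s \<noteq> []" for s h
      using form[OF that(1)] that(2) inn_vac_tens by auto
    show "lambda i (x i) h = hzero KT"
      if t: "tvec KT T \<mu> (\<lambda>j. lambda j (x j)) vac s h" and i: "i \<in> {1..N}" and s: "s = [] \<or> hd s \<noteq> i" "i # s \<notin> T" for s h i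
    proof (cases "s = []")
      case True
      then obtain b where b: "h = ract KT (tens [] []) b" using form[OF t] K.xi_central by (auto simp: tfree_vec_def)
      have "lambda i (x i) (tens [] []) = hzero KT"
        using lambda_zero[OF i x[OF i] T_Nil, of "[]"] s True by (simp add: simple_tensors_def)
      then show ?thesis
        using K.op_ract[OF lambda_adjointable[OF i x[OF i]] K.xi_closed, of b] b by (simp add: tfree_vec_def K.ract_zero_left)
    next
      case False
      then show ?thesis using form[OF t] lambda_zero[OF i x[OF i] _ s] by auto
    qed
  qed
qed

subsection \<open>Composition of trees\<close>

text \<open>On a path from the empty string each edge adds or deletes a first letter, so by
  induction along the path all suffixes of its vertices lie in \<open>T\<close>.\<close>

lemma Tree_subtree:
  assumes "T \<in> Tree N"
  shows "subtree N T"
proof -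
  have T: "T \<subseteq> alt_strings N" "[] \<in> T"
    and conn: "\<And>s t. s \<in> T \<Longrightarrow> t \<in> T \<Longrightarrow> (s, t) \<in> ((free_edges N \<union> (free_edges N)\<inverse>) \<inter> T \<times> T)\<^sup>*"
    using assms by (auto simp: Tree_def)
  have "\<forall>v. suffix v t \<longrightarrow> v \<in> T" if "([], t) \<in> ((free_edges N \<union> (free_edges N)\<inverse>) \<inter> T \<times> T)\<^sup>*" for t
    using that
  proof (induction rule: rtrancl_induct)
    case base
    then show ?case using T(2) by (simp add: suffix_bot.bot_unique)
  next
    case (step u t)
    then show ?case by (auto simp: free_edges_def suffix_Cons)
  qed
  then have "s \<in> T" if "j # s \<in> T" for j s using conn[OF T(2) that] suffix_ConsI[of s s j] by blast
  then show ?thesis using T by (simp add: subtree_def)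
qed

abbreviation "biota M \<equiv> iota (\<lambda>_. M)"

lemma biota_eq: "biota M i a = (i - 1) * M + a"
  by (simp add: iota_def)

text \<open>The block of a letter, a left inverse of \<open>biota\<close> in the block index.
  Letters and blocks both count from 1, whence the shifts.\<close>

definition blk :: "nat \<Rightarrow> nat \<Rightarrow> nat" where
  "blk M l = (l - 1) div M + 1"

lemma blk_biota:
  assumes "1 \<le> i" "a \<in> {1..M}"
  shows "blk M (biota M i a) = i"
proof -
  have "biota M i a - 1 = (a - 1) + (i - 1) * M" using assms by (simp add: biota_eq)
  moreover have "((a - 1) + (i - 1) * M) div M = i - 1"
    using assms by (subst div_mult_self1) auto
  ultimately show ?thesis using assms(1) by (simp add: blk_def)
qed

lemma biota_inject:
  assumes "1 \<le> i" "1 \<le> j" "a \<in> {1..M}" "b \<in> {1..M}" "biota M i a = biota M j b"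
  shows "i = j \<and> a = b"
proof -
  have "i = j" using blk_biota[OF assms(1,3)] blk_biota[OF assms(2,4)] assms(5) by simp
  then show ?thesis using assms(5) by (simp add: biota_eq)
qed

lemma biota_range:
  assumes "i \<in> {1..N}" "a \<in> {1..M}"
  shows "biota M i a \<in> {1..N * M}"
proof -
  have "(i - 1) * M + M \<le> N * M" using assms(1) mult_le_mono1[of "(i - 1) + 1" N M] by (simp add: algebra_simps)
  then show ?thesis using assms(2) by (simp add: biota_eq)
qed

text \<open>The composed word \<open>w\<close> together with its string \<open>bs\<close> of blocks.
  For block strings in the outer tree, \<open>bw_unique\<close> recovers \<open>bs\<close> from
  \<open>w\<close>.\<close>

inductive bword :: "nat \<Rightarrow> nat list set \<Rightarrow> nat list \<Rightarrow> nat list \<Rightarrow> bool" for M S where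
  bword_Nil: "bword M S [] []"
| bword_Cons: "bword M S bs w \<Longrightarrow> s \<in> S \<Longrightarrow> s \<noteq> [] \<Longrightarrow> bword M S (i # bs) (map (biota M i) s @ w)"

lemma tree_comp_bword: "tree_comp T (\<lambda>_. M) (\<lambda>_. S) = {w. \<exists>bs\<in>T. bword M S bs w}"
proof -
  have 1: "bword M S is (concat (map2 (\<lambda>j s. map (biota M j) s) is ss))"
    if "list_all2 (\<lambda>j s. s \<in> S - {[]}) is ss" for "is" ss
    using that by (induction rule: list_all2_induct) (auto intro: bword.intros)
  have 2: "\<exists>ss. list_all2 (\<lambda>j s. s \<in> S - {[]}) bs ss \<and> w = concat (map2 (\<lambda>j s. map (biota M j) s) bs ss)"
    if "bword M S bs w" for bs w
    using that
  proof (induction rule: bword.induct)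
    case (bword_Cons bs w s i)
    then obtain ss where "list_all2 (\<lambda>j s. s \<in> S - {[]}) bs ss" "w = concat (map2 (\<lambda>j s. map (biota M j) s) bs ss)" by blast
    then show ?case using bword_Cons.hyps by (intro exI[of _ "s # ss"]) simp
  qed simp
  show ?thesis
  proof (rule Set.set_eqI, rule iffI)
    fix w assume "w \<in> tree_comp T (\<lambda>_. M) (\<lambda>_. S)"
    then obtain "is" ss where "is \<in> T" "list_all2 (\<lambda>j s. s \<in> S - {[]}) is ss" "w = concat (map2 (\<lambda>j s. map (biota M j) s) is ss)"
      by (auto simp: tree_comp_def)
    then show "w \<in> {w. \<exists>bs\<in>T. bword M S bs w}" using 1[of "is" ss] by blast
  next
    fix w assume "w \<in> {w. \<exists>bs\<in>T. bword M S bs w}"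
    then obtain bs where "bs \<in> T" "bword M S bs w" by blast
    then show "w \<in> tree_comp T (\<lambda>_. M) (\<lambda>_. S)" using 2[of bs w] unfolding tree_comp_def by blast
  qed
qed

lemma subtree_alt: "subtree N T \<Longrightarrow> i # s \<in> T \<Longrightarrow> s = [] \<or> hd s \<noteq> i"
  by (cases s) (auto simp: subtree_def alt_strings_def)

lemma subtree_tl: "subtree N T \<Longrightarrow> i # s \<in> T \<Longrightarrow> s \<in> T"
  by (auto simp: subtree_def)

locale tree_composition =
  fixes N M :: nat and T S :: "nat list set"
  assumes T: "subtree N T" and S: "subtree M S"
begin

abbreviation "C \<equiv> tree_comp T (\<lambda>_. M) (\<lambda>_. S)"
abbreviation "bw \<equiv> bword M S"
abbreviation "io \<equiv> biota M"

lemma in_C: "w \<in> C \<longleftrightarrow> (\<exists>bs\<in>T. bw bs w)"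
  by (simp add: tree_comp_bword)

lemma S_letters: "s \<in> S \<Longrightarrow> set s \<subseteq> {1..M}"
  using S by (auto simp: subtree_def alt_strings_def)

lemma bw_blk: "bw bs w \<Longrightarrow> set bs \<subseteq> {1..N} \<Longrightarrow> (w = [] \<longleftrightarrow> bs = []) \<and> (bs \<noteq> [] \<longrightarrow> blk M (hd w) = hd bs)"
proof (induction rule: bword.induct)
  case (bword_Cons bs w s i)
  then obtain a s' where "s = a # s'" "a \<in> {1..M}" using S_letters[of s] by (cases s) auto
  then show ?case using bword_Cons.prems by (simp add: blk_biota)
qed simp

lemma T_letters: "bs \<in> T \<Longrightarrow> set bs \<subseteq> {1..N}"
  using T by (auto simp: subtree_def alt_strings_def)

lemma C_I:
  assumes "bw bs w" "i # bs \<in> T" "s \<in> S"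
  shows "map (io i) s @ w \<in> C"
  using assms bword_Cons[of M S bs w s i] subtree_tl[OF T assms(2)] in_C by (cases "s = []") auto

lemma C_ConsE:
  assumes "l # u \<in> C"
  obtains i bs a s w where "bw bs w" "i # bs \<in> T" "a # s \<in> S" "i \<in> {1..N}" "a \<in> {1..M}" "l = io i a" "u = map (io i) s @ w"
proof -
  obtain bs where bs: "bs \<in> T" "bw bs (l # u)" using assms in_C by blast
  from bs(2) show thesis
  proof cases
    case (bword_Cons bs' w s i)
    then obtain a s' where s: "s = a # s'" by (cases s) auto
    show thesis
      by (rule that[of bs' w i a s'])
        (use bword_Cons bs(1) s S_letters[of s] T_letters[of bs] in auto)
  qed
qed

text \<open>As \<open>i # bs\<close> alternates, what follows the first piece begins in another
  block; the first piece is the longest prefix inside block \<open>i\<close>.\<close>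

lemma split_unique:
  assumes "bw bs w" "i # bs \<in> T" "s \<in> S" "bw bs' w'" "i # bs' \<in> T" "s' \<in> S" "map (io i) s @ w = map (io i) s' @ w'"
  shows "s = s' \<and> w = w'"
proof -
  have i: "1 \<le> i" using T_letters[OF assms(2)] by simp
  have tw: "takeWhile (\<lambda>l. blk M l = i) (map (io i) s @ w) = map (io i) s"
    if "bw bs w" "i # bs \<in> T" "s \<in> S" for bs w s
  proof -
    note s = that(3)
    have "w = [] \<or> blk M (hd w) \<noteq> i"
      using bw_blk[OF that(1) T_letters[OF subtree_tl[OF T that(2)]]] subtree_alt[OF T that(2)] by auto
    then have "takeWhile (\<lambda>l. blk M l = i) w = []" by (cases w) auto
    moreover have "blk M l = i" if "l \<in> set (map (io i) s)" for l
      using that S_letters[OF s] blk_biota[OF i] by auto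
    ultimately show ?thesis using takeWhile_append2[of "map (io i) s" "\<lambda>l. blk M l = i" w] by simp
  qed
  have eq: "map (io i) s = map (io i) s'" using tw[OF assms(1-3)] tw[OF assms(4-6)] assms(7) by simp
  have "inj_on (io i) (set s \<union> set s')" by (auto simp: inj_on_def biota_eq)
  then have "s = s'" using eq by (simp add: map_inj_on)
  then show ?thesis using assms(7) by simp
qed

lemma bw_unique: "bw bs w \<Longrightarrow> bw bs' w \<Longrightarrow> bs \<in> T \<Longrightarrow> bs' \<in> T \<Longrightarrow> bs = bs'"
proof (induction arbitrary: bs' rule: bword.induct)
  case bword_Nil
  then show ?case using bw_blk[OF bword_Nil.prems(1) T_letters] by auto
next
  case (bword_Cons bs w s i)
  have ne: "map (io i) s @ w \<noteq> []" using bword_Cons.hyps by simp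
  from bword_Cons.prems(1) show ?case
  proof cases
    case bword_Nil
    then show ?thesis using ne by simp
  next
    case (bword_Cons bs1 w1 s1 i1)
    have "i = i1"
      using bw_blk[OF bword.bword_Cons[OF \<open>bw bs w\<close> \<open>s \<in> S\<close> \<open>s \<noteq> []\<close>] T_letters[OF \<open>i # bs \<in> T\<close>]]
        bw_blk[OF \<open>bw bs' (map (io i) s @ w)\<close> T_letters[OF \<open>bs' \<in> T\<close>]] bword_Cons(1) by simp
    moreover have "w = w1"
      using split_unique[OF \<open>bw bs w\<close> \<open>i # bs \<in> T\<close> \<open>s \<in> S\<close> bword_Cons(3) _ bword_Cons(4)] bword_Cons \<open>bs' \<in> T\<close> \<open>i = i1\<close> by simp
    ultimately show ?thesis
      using bword_Cons.IH[of bs1] bword_Cons(1,3) subtree_tl[OF T, of i bs] subtree_tl[OF T, of i1 bs1] \<open>i # bs \<in> T\<close> \<open>bs' \<in> T\<close>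
      by simp
  qed
qed

text \<open>By unique splitting, a further letter of block \<open>i\<close> can only prolong the
  piece \<open>s\<close>; for empty \<open>s\<close> it opens the block.\<close>

lemma C_Cons_same:
  assumes "bw bs w" "i # bs \<in> T" "s \<in> S" "a \<in> {1..M}" "io i a # map (io i) s @ w \<in> C"
  shows "a # s \<in> S"
proof -
  obtain i' bs' a' s' w' where *: "bw bs' w'" "i' # bs' \<in> T" "a' # s' \<in> S" "i' \<in> {1..N}" "a' \<in> {1..M}"
    "io i a = io i' a'" "map (io i) s @ w = map (io i') s' @ w'"
    using C_ConsE[OF assms(5)] by metis
  have "i = i' \<and> a = a'" using T_letters[OF assms(2)] * assms(4) by (intro biota_inject) auto
  moreover have "s = s'"
    using split_unique[OF assms(1-3) *(1) _ subtree_tl[OF S *(3)]] * calculation by simp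
  ultimately show ?thesis using *(3) by simp
qed

text \<open>A letter from a block that \<open>w\<close> does not begin with starts a new piece. That
  piece has length 1, since a second letter would put the first letter of \<open>w\<close> in block
  \<open>i\<close>.\<close>

lemma C_Cons_new:
  assumes "bw bs w" "bs \<in> T" "i \<in> {1..N}" "bs = [] \<or> hd bs \<noteq> i" "a \<in> {1..M}" "io i a # w \<in> C"
  shows "i # bs \<in> T \<and> [a] \<in> S"
proof -
  obtain i' bs' a' s' w' where *: "bw bs' w'" "i' # bs' \<in> T" "a' # s' \<in> S" "i' \<in> {1..N}" "a' \<in> {1..M}"
    "io i a = io i' a'" "w = map (io i') s' @ w'"
    using C_ConsE[OF assms(6)] by metis
  have i: "i = i' \<and> a = a'" using assms(3,5) * by (intro biota_inject) auto
  have "s' = []"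
  proof (rule ccontr)
    assume "s' \<noteq> []"
    then obtain c s1 where s1: "s' = c # s1" by (cases s') auto
    then have "c \<in> {1..M}" using S_letters[OF *(3)] by simp
    then have "blk M (hd w) = i" using * i s1 assms(3) by (simp add: blk_biota)
    moreover have "w \<noteq> []" using * s1 by simp
    ultimately show False using bw_blk[OF assms(1) T_letters[OF assms(2)]] assms(4) by auto
  qed
  moreover have "bs = bs'"
    using bw_unique[OF assms(1) _ assms(2) subtree_tl[OF T *(2)]] * calculation by simp
  ultimately show ?thesis using * i by simp
qed

lemma bw_alt: "bw bs w \<Longrightarrow> bs \<in> T \<Longrightarrow> set w \<subseteq> {1..N * M} \<and> distinct_adj w"
proof (induction rule: bword.induct)
  case (bword_Cons bs w s i)
  note b = subtree_tl[OF T bword_Cons.prems]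
  have i: "i \<in> {1..N}" using T_letters[OF bword_Cons.prems] by simp
  have "distinct_adj s" using S bword_Cons.hyps by (auto simp: subtree_def alt_strings_def)
  moreover have "inj_on (io i) (set s)" by (auto simp: inj_on_def biota_eq)
  ultimately have d: "distinct_adj (map (io i) s)" by (simp add: distinct_adj_map_iff)
  have "last (map (io i) s) \<noteq> hd w" if "w \<noteq> []"
  proof -
    have "last s \<in> {1..M}" using S_letters[OF bword_Cons.hyps(2)] last_in_set[OF bword_Cons.hyps(3)] by blast
    then have "blk M (last (map (io i) s)) = i" using bword_Cons.hyps(3) i by (simp add: last_map blk_biota)
    moreover have "blk M (hd w) \<noteq> i" using bw_blk[OF bword_Cons.hyps(1) T_letters[OF b]] that subtree_alt[OF T bword_Cons.prems] by auto
    ultimately show ?thesis by auto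
  qed
  moreover have "set (map (io i) s) \<subseteq> {1..N * M}" using S_letters[OF bword_Cons.hyps(2)] biota_range[OF i] by auto
  ultimately show ?case using bword_Cons.IH[OF b] d by (auto simp: distinct_adj_append_iff)
qed simp

lemma subtree_C: "subtree (N * M) C"
  unfolding subtree_def
proof (intro conjI allI impI)
  show "C \<subseteq> alt_strings (N * M)"
  proof
    fix w assume "w \<in> C"
    then obtain bs where "bs \<in> T" "bw bs w" using in_C by blast
    then show "w \<in> alt_strings (N * M)" using bw_alt[of bs w] by (simp add: alt_strings_def)
  qed
  show "[] \<in> C" using subtree_Nil[OF T] bword_Nil in_C by blast
  fix l u assume "l # u \<in> C"
  then obtain i bs a s w where *: "bw bs w" "i # bs \<in> T" "a # s \<in> S" "u = map (io i) s @ w"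
    by (rule C_ConsE) metis
  then show "u \<in> C" using C_I[OF *(1,2) subtree_tl[OF S *(3)]] by simp
qed

end

section \<open>Counting children in composed trees\<close>

definition kids :: "nat \<Rightarrow> nat list set \<Rightarrow> nat list \<Rightarrow> nat" where
  "kids N T s = card {j \<in> {1..N}. j # s \<in> T}"

context tree_composition
begin

lemma kids_C_Nil: "kids (N * M) C [] \<le> kids N T [] * kids M S []"
proof -
  have "{l \<in> {1..N * M}. [l] \<in> C} \<subseteq> (\<lambda>(i, a). io i a) ` ({i \<in> {1..N}. [i] \<in> T} \<times> {a \<in> {1..M}. [a] \<in> S})"
  proof
    fix l assume "l \<in> {l \<in> {1..N * M}. [l] \<in> C}"
    then have "[l] \<in> C" by simp
    then obtain i bs a s w where *: "bw bs w" "i # bs \<in> T" "a # s \<in> S" "i \<in> {1..N}" "a \<in> {1..M}" "l = io i a" "[] = map (io i) s @ w"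
      by (rule C_ConsE)
    have "bs = []" using bw_blk[OF *(1) T_letters[OF subtree_tl[OF T *(2)]]] *(7) by simp
    then show "l \<in> (\<lambda>(i, a). io i a) ` ({i \<in> {1..N}. [i] \<in> T} \<times> {a \<in> {1..M}. [a] \<in> S})"
      using * by (intro image_eqI[of _ _ "(i, a)"]) auto
  qed
  then have "kids (N * M) C [] \<le> card ((\<lambda>(i, a). io i a) ` ({i \<in> {1..N}. [i] \<in> T} \<times> {a \<in> {1..M}. [a] \<in> S}))"
    unfolding kids_def by (intro card_mono) auto
  also have "\<dots> \<le> card ({i \<in> {1..N}. [i] \<in> T} \<times> {a \<in> {1..M}. [a] \<in> S})" by (rule card_image_le) auto
  finally show ?thesis by (simp add: kids_def card_cartesian_product)
qed

text \<open>A child continues the piece \<open>s\<close> in block \<open>i\<close>, or it opens one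
  of the \<open>N - 1\<close> other blocks with a one-letter string of \<open>S\<close>.\<close>

lemma kids_C_Cons:
  assumes "bw bs w" "i # bs \<in> T" "s \<in> S" "s \<noteq> []"
  shows "kids (N * M) C (map (io i) s @ w) \<le> kids M S s + (N - 1) * kids M S []"
proof -
  let ?u = "map (io i) s @ w"
  let ?A = "io i ` {a \<in> {1..M}. a # s \<in> S}" and ?B = "(\<lambda>(j, a). io j a) ` (({1..N} - {i}) \<times> {a \<in> {1..M}. [a] \<in> S})"
  have i: "i \<in> {1..N}" using T_letters[OF assms(2)] by simp
  note b = bword_Cons[OF assms(1,3,4), of i]
  have "{l \<in> {1..N * M}. l # ?u \<in> C} \<subseteq> ?A \<union> ?B"
  proof
    fix l assume "l \<in> {l \<in> {1..N * M}. l # ?u \<in> C}"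
    then have l: "l # ?u \<in> C" by simp
    then obtain j a where ja: "j \<in> {1..N}" "a \<in> {1..M}" "l = io j a" by (rule C_ConsE) blast
    show "l \<in> ?A \<union> ?B"
    proof (cases "j = i")
      case True
      then show ?thesis using C_Cons_same[OF assms(1-3) ja(2)] l ja by auto
    next
      case False
      then have "[a] \<in> S" using C_Cons_new[OF b assms(2) ja(1) _ ja(2)] l ja(3) by simp
      then show ?thesis using False ja by (intro UnI2 image_eqI[of _ _ "(j, a)"]) auto
    qed
  qed
  then have "kids (N * M) C ?u \<le> card (?A \<union> ?B)" unfolding kids_def by (intro card_mono) auto
  also have "\<dots> \<le> card ?A + card ?B" by (rule card_Un_le)
  also have "\<dots> \<le> card {a \<in> {1..M}. a # s \<in> S} + card (({1..N} - {i}) \<times> {a \<in> {1..M}. [a] \<in> S})"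
    by (intro add_mono card_image_le) auto
  also have "\<dots> = kids M S s + (N - 1) * kids M S []" using i by (simp add: kids_def card_cartesian_product)
  finally show ?thesis .
qed

end

lemma subtree_tree_pow: "subtree N T \<Longrightarrow> subtree (N ^ k) (tree_pow N T k)"
proof (induction k)
  case 0
  then show ?case by (auto simp: subtree_def alt_strings_def)
next
  case (Suc k)
  interpret tree_composition N "N ^ k" T "tree_pow N T k" by unfold_locales (use Suc in auto)
  show ?case using subtree_C by simp
qed

lemma tree_pow_composition: "subtree N T \<Longrightarrow> tree_composition N (N ^ k) T (tree_pow N T k)"
  by unfold_locales (simp_all add: subtree_tree_pow)

text \<open>At nonempty strings the bound on the number of children starts from 0 and grows by
  \<open>(N - 1) n^k\<close> from level \<open>k\<close> to \<open>k + 1\<close>, which sums to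
  \<open>(N - 1)(n^k - 1)/(n - 1)\<close>. The second claim is this bound cleared of the quotient, a
  form that also makes the induction linear.\<close>

lemma kids_tree_pow:
  assumes T: "subtree N T" and n: "n = kids N T []" "1 \<le> n"
  shows "kids (N ^ k) (tree_pow N T k) [] \<le> n ^ k"
    and "s \<in> tree_pow N T k \<Longrightarrow> s \<noteq> [] \<Longrightarrow> (n - 1) * kids (N ^ k) (tree_pow N T k) s + (N - 1) \<le> (N - 1) * n ^ k"
proof -
  show root: "kids (N ^ k) (tree_pow N T k) [] \<le> n ^ k" for k
  proof (induction k)
    case 0
    have "{j :: nat. j = 1 \<and> [j] \<in> {[], [1]}} = {1}" by auto
    then show ?case by (simp add: kids_def)
  next
    case (Suc k)
    interpret tree_composition N "N ^ k" T "tree_pow N T k" by (rule tree_pow_composition[OF T])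
    show ?case using le_trans[OF kids_C_Nil mult_le_mono2[OF Suc]] by (simp add: n(1)[symmetric])
  qed
  show "s \<in> tree_pow N T k \<Longrightarrow> s \<noteq> [] \<Longrightarrow> (n - 1) * kids (N ^ k) (tree_pow N T k) s + (N - 1) \<le> (N - 1) * n ^ k"
  proof (induction k arbitrary: s)
    case 0
    then show ?case by (simp add: kids_def)
  next
    case (Suc k)
    interpret tree_composition N "N ^ k" T "tree_pow N T k" by (rule tree_pow_composition[OF T])
    obtain bs where bs: "bs \<in> T" "bw bs s" using Suc.prems in_C by auto
    from bs(2) show ?case
    proof cases
      case (bword_Cons bs' w t i)
      have "kids (N ^ Suc k) (tree_pow N T (Suc k)) s \<le> kids (N ^ k) (tree_pow N T k) t + (N - 1) * n ^ k"
        using le_trans[OF kids_C_Cons[OF bword_Cons(3) bs(1)[unfolded bword_Cons(1)] bword_Cons(4,5)]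
            add_left_mono[OF mult_le_mono2[OF root[of k]]]] bword_Cons(2) by simp
      then have "(n - 1) * kids (N ^ Suc k) (tree_pow N T (Suc k)) s + (N - 1)
          \<le> (n - 1) * (kids (N ^ k) (tree_pow N T k) t + (N - 1) * n ^ k) + (N - 1)"
        by (intro add_mono mult_le_mono2) auto
      also have "\<dots> \<le> (N - 1) * n ^ k + (n - 1) * ((N - 1) * n ^ k)"
        using Suc.IH[OF bword_Cons(4,5)] by (simp add: add_mult_distrib2)
      also have "\<dots> = (N - 1) * n ^ Suc k" using n(2) by (cases n) (simp_all add: algebra_simps)
      finally show ?thesis .
    qed (use Suc.prems in simp)
  qed
qed

section \<open>Block sums of a family that is free for a composed tree\<close>

lemma (in tree_family) tv_lact: "tv s h \<Longrightarrow> tv s (lact V c h)"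
proof (erule tvec.cases)
  fix b assume "s = []" "h = lact V b v"
  then show ?thesis using tvec_base[of V T \<mu> Y v "c * b"] lact_mult[OF v_closed] by simp
next
  fix s' h' i q assume *: "s = i # s'" "h = peval V (Y i) q h'" "tv s' h'" "i # s' \<in> T" "\<mu> i q = 0"
  note i = subtree_letter[OF subtree *(4)]
  interpret l: law "\<mu> i" by (rule law_mu[OF i])
  have "\<mu> i (const c * q) = 0" using *(5) by (simp add: l.law_left)
  from tvec_step[OF *(3,4) this] show ?thesis
    using * tv_closed[OF *(3)] Y_adjointable[OF i] by (simp add: peval_simps peval_closed)
qed

locale block_family = tree_composition N M T S + F: tree_free V "N * M" "tree_comp T (\<lambda>_. M) (\<lambda>_. S)" "\<lambda>_. \<nu>" Y v
  for N M :: nat and T S and V :: "('b::unital_cstar_algebra, 'v) bimod" and \<nu> Y v +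
  assumes nu: "bvalued_law \<nu>"
begin

abbreviation "YB i \<equiv> \<lambda>a. Y (io i a)"
abbreviation "B i \<equiv> osum V {1..M} (YB i)"

lemma YB_adjointable: "i \<in> {1..N} \<Longrightarrow> a \<in> {1..M} \<Longrightarrow> YB i a \<in> adjointable V"
  by (rule F.Y_adjointable[OF biota_range])

lemma B_adjointable: "i \<in> {1..N} \<Longrightarrow> B i \<in> adjointable V"
  by (rule F.osum_adjointable[OF YB_adjointable])

lemma bw_hd_other:
  assumes "bw bs w" "bs \<in> T" "bs = [] \<or> hd bs \<noteq> i" "i \<in> {1..N}" "a \<in> {1..M}"
  shows "w = [] \<or> hd w \<noteq> io i a"
  using bw_blk[OF assms(1) T_letters[OF assms(2)]] assms(3-5) blk_biota[of i a M] by auto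

lemma tvec_block:
  assumes "bw bs w" "i # bs \<in> T" "F.tv w h" "tvec V S (\<lambda>_. \<nu>) (YB i) h s x"
  shows "s \<in> S \<and> F.tv (map (io i) s @ w) x"
  using assms(4)
proof (induction rule: tvec.induct)
  case (tvec_base b)
  then show ?case using F.tv_lact[OF assms(3)] subtree_Nil[OF S] by simp
next
  case (tvec_step s x a q)
  have "io i a # map (io i) s @ w \<in> C" using C_I[OF assms(1,2) tvec_step.hyps(2)] by simp
  then show ?case using tvec.tvec_step[of V C "\<lambda>_. \<nu>" Y v "map (io i) s @ w" x "io i a" q] tvec_step by simp
qed

text \<open>On top of a word \<open>w\<close> to which block \<open>i\<close> may be added, the
  operators of this block form a family for the inner tree with base vector \<open>h\<close>. A
  letter forbidden in \<open>S\<close> is forbidden in the composed tree by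
  \<open>C_Cons_same\<close>, so it kills.\<close>

lemma block_subfamily:
  assumes "bw bs w" "i # bs \<in> T" "F.tv w h"
  shows "tree_family V M S (\<lambda>_. \<nu>) (YB i) h"
proof (intro tree_family.intro tree_family_axioms.intro F.hilb_axioms S F.tv_closed[OF assms(3)] nu)
  have i: "i \<in> {1..N}" using T_letters[OF assms(2)] by simp
  show "YB i a \<in> adjointable V" if "a \<in> {1..M}" for a by (rule YB_adjointable[OF i that])
  show "YB i a x = hzero V" if t: "tvec V S (\<lambda>_. \<nu>) (YB i) h s x" and a: "a \<in> {1..M}" and s: "s = [] \<or> hd s \<noteq> a" "a # s \<notin> S" for s x a
  proof (rule F.kill)
    note st = tvec_block[OF assms t]
    show "F.tv (map (io i) s @ w) x" using st by simp
    show "io i a \<in> {1..N * M}" by (rule biota_range[OF i a])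
    show "io i a # map (io i) s @ w \<notin> C" using C_Cons_same[OF assms(1,2) _ a] st s(2) by blast
    show "map (io i) s @ w = [] \<or> hd (map (io i) s @ w) \<noteq> io i a"
    proof (cases "s = []")
      case True
      then show ?thesis using bw_hd_other[OF assms(1) subtree_tl[OF T assms(2)] subtree_alt[OF T assms(2)] i a] by simp
    next
      case False
      then show ?thesis using s(1) by (simp add: hd_map biota_eq)
    qed
  qed
qed

context
  fixes W :: "('b, 'w) bimod" and Z w0 \<rho>
  assumes model: "tree_free W M S (\<lambda>_. \<nu>) Z w0" and rho: "\<rho> = vlaw W w0 (osum W {1..M} Z)" and rho_law: "bvalued_law \<rho>"
begin

text \<open>Comparison with the model shows that \<open>q(B\<^sub>i) h\<close> has no component along \<open>h\<close> itself.\<close>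

lemma block_step_gen:
  assumes "bw bs w" "i # bs \<in> T" "F.tv w h" "\<rho> q = 0"
  shows "F.ts {u. bw (i # bs) u} (peval V (B i) q h)"
proof -
  interpret sub: tree_family V M S "\<lambda>_. \<nu>" "YB i" h by (rule block_subfamily[OF assms(1-3)])
  interpret W: tree_free W M S "\<lambda>_. \<nu>" Z w0 by (rule model)
  interpret p: tree_pair V W M S "\<lambda>_. \<nu>" "YB i" Z h w0 by unfold_locales
  obtain y where y: "sub.ts (S - {[]}) y" "peval V (B i) q h = hadd V (lact V (inn W w0 (peval W (osum W {1..M} Z) q w0)) h) y"
    using p.rspan_decompose[OF model p.rspan_peval[OF p.rspan_base, of q]] by blast
  have "inn W w0 (peval W (osum W {1..M} Z) q w0) = 0" using assms(4) rho by (simp add: vlaw_def)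
  then have "peval V (B i) q h = y"
    using y sub.ts_closed[OF y(1)] F.tv_closed[OF assms(3)] by (simp add: F.lact_zero_left F.add_zero)
  moreover have "F.ts {u. bw (i # bs) u} y"
    using y(1)
  proof (induction rule: tspan.induct)
    case (tspan_gen s x)
    note t = tvec_block[OF assms(1-3) tspan_gen(1)]
    have "bw (i # bs) (map (io i) s @ w)" using bword_Cons[OF assms(1)] t tspan_gen(2) by simp
    then show ?case using t by (intro tspan.tspan_gen[of V C "\<lambda>_. \<nu>" Y v "map (io i) s @ w"]) simp_all
  qed (auto intro: tspan.intros)
  ultimately show ?thesis by simp
qed

lemma block_step:
  assumes "i # bs \<in> T" "\<rho> q = 0" "F.ts {w. bw bs w} x"
  shows "F.ts {u. bw (i # bs) u} (peval V (B i) q x)"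
proof -
  have "i \<in> {1..N}" using T_letters[OF assms(1)] by simp
  then have ad: "peval V (B i) q \<in> adjointable V" by (intro F.peval_adjointable B_adjointable)
  show ?thesis
    using assms(3)
  proof (induction rule: tspan.induct)
    case tspan_zero
    then show ?case using F.op_zero[OF ad] by (simp add: tspan.tspan_zero)
  next
    case (tspan_gen w h)
    then show ?case using block_step_gen[OF _ assms(1) _ assms(2)] by simp
  next
    case (tspan_add h k)
    then show ?case
      using F.op_add[OF ad F.ts_closed[OF tspan_add.hyps(1)] F.ts_closed[OF tspan_add.hyps(2)]] by (simp add: tspan.tspan_add)
  qed
qed

lemma tvec_blocks:
  assumes "tvec V T (\<lambda>_. \<rho>) B v bs x"
  shows "bs \<in> T \<and> F.ts {w. bw bs w} x"
  using assms
proof (induction rule: tvec.induct)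
  case (tvec_base b)
  have "F.ts {w. bw [] w} (lact V b v)"
    by (rule tspan_gen[OF tvec.tvec_base]) (simp add: bword_Nil)
  then show ?case using subtree_Nil[OF T] by simp
next
  case (tvec_step bs x i q)
  then show ?case using block_step by simp
qed

text \<open>Both conditions descend from the fine family. Words over a nonempty block string are
  nonempty, hence have expectation 0. By \<open>C_Cons_new\<close> every letter of a forbidden block
  is forbidden in the composed tree, so each term of the block sum vanishes.\<close>

lemma tree_free_blocks: "tree_free V N T (\<lambda>_. \<rho>) B v"
proof (intro tree_free.intro tree_family.intro tree_family_axioms.intro tree_free_axioms.intro
    F.hilb_axioms F.pointed_hilb_axioms T rho_law F.v_closed B_adjointable)
  show "inn V v x = 0" if "tvec V T (\<lambda>_. \<rho>) B v bs x" "bs \<noteq> []" for bs x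
  proof (rule F.ts_centred)
    note t = tvec_blocks[OF that(1)]
    show "F.ts {w. bw bs w} x" using t by simp
    show "[] \<notin> {w. bw bs w}" using bw_blk[of bs "[]"] T_letters[of bs] t that(2) by auto
  qed
  show "B i x = hzero V" if t: "tvec V T (\<lambda>_. \<rho>) B v bs x" and i: "i \<in> {1..N}" and bs: "bs = [] \<or> hd bs \<noteq> i" "i # bs \<notin> T" for bs x i
  proof -
    note t' = tvec_blocks[OF t]
    have zero: "YB i a x = hzero V" if a: "a \<in> {1..M}" for a
      using conjunct2[OF t']
    proof (induction rule: tspan.induct)
      case tspan_zero
      then show ?case by (rule F.op_zero[OF YB_adjointable[OF i a]])
    next
      case (tspan_gen w h)
      then have w: "bw bs w" by simp
      have "io i a # w \<notin> C" using C_Cons_new[OF w _ i bs(1) a] t' bs(2) by blast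
      then show ?case using F.kill[OF tspan_gen(1) biota_range[OF i a]] bw_hd_other[OF w _ bs(1) i a] t' by blast
    next
      case (tspan_add h k)
      then show ?case
        using F.op_add[OF YB_adjointable[OF i a] F.ts_closed[OF tspan_add.hyps(1)] F.ts_closed[OF tspan_add.hyps(2)]]
        by (simp add: F.add_zero)
    qed
    have x: "x \<in> elems V" using F.ts_closed t' by blast
    show ?thesis
    proof (rule F.inn_eqI)
      show "B i x \<in> elems V" by (rule F.op_closed[OF B_adjointable[OF i] x])
      show "inn V z (B i x) = inn V z (hzero V)" if "z \<in> elems V" for z
        using zero that by (subst F.inn_osum[OF _ YB_adjointable[OF i] x that]) simp_all
    qed simp
  qed
qed

end

lemma osum_blocks: "osum V {1..N} B = osum V {1..N * M} Y"
proof (rule F.op_eqI)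
  show B: "osum V {1..N} B \<in> adjointable V" by (rule F.osum_adjointable[OF B_adjointable])
  show Y: "osum V {1..N * M} Y \<in> adjointable V" by (rule F.osum_adjointable[OF F.Y_adjointable])
  have inj: "inj_on (\<lambda>(i, a). io i a) ({1..N} \<times> {1..M})"
    using biota_inject[of _ _ _ M] by (fastforce simp: inj_on_def)
  have "(\<lambda>(i, a). io i a) ` ({1..N} \<times> {1..M}) = {1..N * M}"
  proof (rule card_subset_eq)
    show "(\<lambda>(i, a). io i a) ` ({1..N} \<times> {1..M}) \<subseteq> {1..N * M}" using biota_range[of _ N _ M] by auto
    show "card ((\<lambda>(i, a). io i a) ` ({1..N} \<times> {1..M})) = card {1..N * M}"
      unfolding card_image[OF inj] card_cartesian_product by simp
  qed simp
  then have bij: "bij_betw (\<lambda>(i, a). io i a) ({1..N} \<times> {1..M}) {1..N * M}" using inj by (simp add: bij_betw_def)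
  fix h assume h: "h \<in> elems V"
  show "osum V {1..N} B h = osum V {1..N * M} Y h"
  proof (rule F.inn_eqI)
    fix z assume z: "z \<in> elems V"
    have "inn V z (osum V {1..N} B h) = (\<Sum>i\<in>{1..N}. \<Sum>a\<in>{1..M}. inn V z (Y (io i a) h))"
      by (subst F.inn_osum[OF _ B_adjointable h z]) (auto intro!: sum.cong F.inn_osum[OF _ YB_adjointable h z])
    also have "\<dots> = (\<Sum>(i, a)\<in>{1..N} \<times> {1..M}. inn V z (Y (io i a) h))" by (rule sum.cartesian_product)
    also have "\<dots> = (\<Sum>x\<in>{1..N} \<times> {1..M}. inn V z (Y ((\<lambda>(i, a). io i a) x) h))" by (intro sum.cong) auto
    also have "\<dots> = (\<Sum>l\<in>{1..N * M}. inn V z (Y l h))" by (rule sum.reindex_bij_betw[OF bij])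
    also have "\<dots> = inn V z (osum V {1..N * M} Y h)" by (subst F.inn_osum[OF _ F.Y_adjointable h z]) simp_all
    finally show "inn V z (osum V {1..N} B h) = inn V z (osum V {1..N * M} Y h)" .
  qed (rule F.op_closed[OF B h], rule F.op_closed[OF Y h])
qed

end

section \<open>Laws of iterated tree convolutions\<close>

lemma boxplus_vlaw:
  "boxplus N T \<mu> = vlaw (tfree T (\<lambda>j. L2 (\<mu> j)) (\<lambda>j. L2_one (\<mu> j))) (tfree_vec T (\<lambda>j. L2 (\<mu> j)) (\<lambda>j. L2_one (\<mu> j)))
     (osum (tfree T (\<lambda>j. L2 (\<mu> j)) (\<lambda>j. L2_one (\<mu> j))) {1..N}
       (\<lambda>j. lambda_op T (\<lambda>j. L2 (\<mu> j)) (\<lambda>j. L2_one (\<mu> j)) j (L2_X (\<mu> j))))"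
  unfolding boxplus_def Let_def law_of_Lop ..

lemma (in law) pointed_hilb_L2: "pointed_hilb (L2 \<mu>) (L2_one \<mu>)"
  by (rule L2.pointed_hilb_axioms)

lemma tfree_product_L2:
  assumes "subtree N T" "\<And>j. j \<in> {1..N} \<Longrightarrow> bvalued_law (\<mu> j)"
  shows "tfree_product N T (\<lambda>j. L2 (\<mu> j)) (\<lambda>j. L2_one (\<mu> j))"
proof (rule tfree_product.intro)
  show "subtree N T" by (rule assms(1))
  show "pointed_hilb (L2 (\<mu> j)) (L2_one (\<mu> j))" if "j \<in> {1..N}" for j
    by (rule law.pointed_hilb_L2[OF law.intro[OF assms(2)[OF that]]])
qed

lemma tree_free_L2:
  assumes "subtree N T" "\<And>j. j \<in> {1..N} \<Longrightarrow> bvalued_law (\<mu> j)"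
  shows "tree_free (tfree T (\<lambda>j. L2 (\<mu> j)) (\<lambda>j. L2_one (\<mu> j))) N T \<mu>
     (\<lambda>j. lambda_op T (\<lambda>j. L2 (\<mu> j)) (\<lambda>j. L2_one (\<mu> j)) j (L2_X (\<mu> j))) (tfree_vec T (\<lambda>j. L2 (\<mu> j)) (\<lambda>j. L2_one (\<mu> j)))"
proof -
  interpret tfree_product N T "\<lambda>j. L2 (\<mu> j)" "\<lambda>j. L2_one (\<mu> j)" by (rule tfree_product_L2[OF assms])
  show ?thesis
    by (rule tree_free_lambda) (simp_all add: law.L2_X_adjointable law.vlaw_L2_X law.intro assms(2))
qed

lemma bvalued_law_boxplus:
  assumes "subtree N T" "\<And>j. j \<in> {1..N} \<Longrightarrow> bvalued_law (\<mu> j)"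
  shows "bvalued_law (boxplus N T \<mu>)"
proof -
  interpret tfree_product N T "\<lambda>j. L2 (\<mu> j)" "\<lambda>j. L2_one (\<mu> j)" by (rule tfree_product_L2[OF assms])
  note l = law.intro[OF assms(2)]
  note ad = lambda_adjointable[OF _ law.L2_X_adjointable[OF l]]
  show ?thesis
    unfolding boxplus_vlaw
    by (intro K.bvalued_law_vlaw K.osum_adjointable K.osum_sym ad lambda_adjoint law.L2_X_adjointable[OF l] law.L2_X_symmetric[OF l])
      simp_all
qed

lemma bvalued_law_boxplus_pow: "subtree N T \<Longrightarrow> bvalued_law \<nu> \<Longrightarrow> bvalued_law (boxplus_pow N T k \<nu>)"
  by (induction k) (simp_all add: bvalued_law_boxplus)

text \<open>This serves level \<open>k = 0\<close>. After its expectation is subtracted, a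
  polynomial in \<open>Y 1\<close> applied to \<open>v\<close> is a word over the string
  \<open>[1]\<close>, which is centred.\<close>

lemma (in tree_free) vlaw_single:
  assumes "N = 1" "[1] \<in> T"
  shows "vlaw V v (osum V {1..N} Y) = \<mu> 1"
proof
  fix p
  have Y1: "Y 1 \<in> adjointable V" and l: "law (\<mu> 1)" using Y_adjointable law_mu assms(1) by auto
  have ad: "osum V {1..N} Y \<in> adjointable V" by (rule osum_adjointable[OF Y_adjointable])
  have os: "osum V {1..N} Y = Y 1"
  proof (rule op_eqI[OF ad Y1])
    fix h assume h: "h \<in> elems V"
    show "osum V {1..N} Y h = Y 1 h"
    proof (rule inn_eqI)
      fix z assume z: "z \<in> elems V"
      show "inn V z (osum V {1..N} Y h) = inn V z (Y 1 h)"
        by (subst inn_osum[OF _ Y_adjointable h z]) (simp_all add: assms(1))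
    qed (rule op_closed[OF ad h], rule op_closed[OF Y1 h])
  qed
  have t: "tv [] v" using tvec_base[of V T \<mu> Y v 1] lact_one[OF v_closed] by simp
  have m: "\<mu> 1 (p + const (- \<mu> 1 p)) = 0" by (simp add: law.law_add[OF l] law.law_const[OF l] del: One_nat_def)
  have "inn V v (peval V (Y 1) (p + const (- \<mu> 1 p)) v) = 0"
    by (rule centred[OF tvec_step[where \<mu> = \<mu>, OF t assms(2) m]]) simp
  then have "inn V v (peval V (Y 1) p v) = \<mu> 1 p"
    using peval_shift[OF Y1 v_closed, of p "\<mu> 1 p"] v_closed peval_closed[OF Y1 v_closed]
    by (simp add: inn_add_right xi_central inn_ract inn_xi)
  then show "vlaw V v (osum V {1..N} Y) p = \<mu> 1 p" unfolding os vlaw_def .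
qed

text \<open>The induction hypothesis is applied to the model of a block, a tree-free product of
  \<open>L2\<close>-spaces, and not to \<open>V\<close>. Hence the statement is general in
  \<open>V\<close>, \<open>Y\<close> and \<open>v\<close>, and the type of \<open>V\<close> is that
  of such products. The block sums in \<open>V\<close> are then compared with the outer product over
  \<open>L2\<close> of the block law.\<close>

lemma vlaw_tree_pow:
  fixes V :: "('b::unital_cstar_algebra, ('b, 'b L2_elem) tfree_elem) bimod"
  assumes T: "subtree N T" and nu: "bvalued_law \<nu>" and "tree_free V (N ^ k) (tree_pow N T k) (\<lambda>_. \<nu>) Y v"
  shows "vlaw V v (osum V {1..N ^ k} Y) = boxplus_pow N T k \<nu>"
  using assms(3)
proof (induction k arbitrary: V Y v)
  case 0
  then show ?case using tree_free.vlaw_single[OF 0] by simp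
next
  case (Suc k)
  let ?S = "tree_pow N T k" and ?r = "boxplus_pow N T k \<nu>"
  interpret tree_free V "N * N ^ k" "tree_comp T (\<lambda>_. N ^ k) (\<lambda>_. ?S)" "\<lambda>_. \<nu>" Y v using Suc.prems by simp
  interpret c: tree_composition N "N ^ k" T ?S by (rule tree_pow_composition[OF T])
  interpret b: block_family N "N ^ k" T ?S V \<nu> Y v by unfold_locales (rule nu)
  note model = tree_free_L2[OF subtree_tree_pow[OF T, of k], of "\<lambda>_. \<nu>", OF nu]
  note rho_law = bvalued_law_boxplus_pow[OF T nu, of k]
  have blocks: "tree_free V N T (\<lambda>_. ?r) b.B v"
    by (rule b.tree_free_blocks[OF model Suc.IH[OF model, symmetric] rho_law])
  note top = tree_free_L2[OF T, of "\<lambda>_. ?r", OF rho_law]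
  have "tree_pair V (tfree T (\<lambda>j. L2 ?r) (\<lambda>j. L2_one ?r)) N T (\<lambda>_. ?r) b.B
     (\<lambda>j. lambda_op T (\<lambda>j. L2 ?r) (\<lambda>j. L2_one ?r) j (L2_X ?r)) v (tfree_vec T (\<lambda>j. L2 ?r) (\<lambda>j. L2_one ?r))"
    by (intro tree_pair.intro tree_free.axioms(1)[OF blocks] tree_free.axioms(1)[OF top])
  from tree_pair.vlaw_eq[OF this blocks top]
  show ?case unfolding b.osum_blocks by (simp add: boxplus_vlaw del: One_nat_def)
qed

subsection \<open>Norm estimates\<close>

context tfree_product
begin

lemma lambda_add:
  assumes j: "j \<in> {1..N}" and x: "x \<in> adjointable (H j)" and y: "y \<in> adjointable (H j)"
  shows "lambda j (add (Lop (H j)) x y) = add (Lop KT) (lambda j x) (lambda j y)"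
proof -
  interpret Hj: pointed_hilb "H j" "\<xi> j" by (rule pointed[OF j])
  interpret Lj: op_algebra "H j" "Lop (H j)" by (rule Hj.op_algebra_Lop)
  interpret L: op_algebra KT "Lop KT" by (rule K.op_algebra_Lop)
  have xy: "add (Lop (H j)) x y \<in> adjointable (H j)" by (rule Lj.add_adjointable[OF x y])
  note la = lambda_adjointable[OF j x] lambda_adjointable[OF j y]
  show ?thesis
  proof (rule lambda_unique[OF j lambda_adjointable[OF j xy] L.add_adjointable[OF la]])
    fix s hs h assume *: "j # s \<in> T" "hs \<in> simple_tensors H \<xi> s" "h \<in> elems (H j)"
    show "lambda j (add (Lop (H j)) x y) (tleft j h s hs) = add (Lop KT) (lambda j x) (lambda j y) (tleft j h s hs)"
      unfolding L.add_apply[OF la tleft_closed[OF *]] lambda_tleft[OF *(1) xy *(2,3)] lambda_tleft[OF *(1) x *(2,3)]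
        lambda_tleft[OF *(1) y *(2,3)] Lj.add_apply[OF x y *(3)]
      by (rule tleft_add[OF *(1,2) Hj.op_closed[OF x *(3)] Hj.op_closed[OF y *(3)]])
  next
    fix s hs assume *: "s \<in> T" "s = [] \<or> hd s \<noteq> j" "j # s \<notin> T" "hs \<in> simple_tensors H \<xi> s"
    show "lambda j (add (Lop (H j)) x y) (tens s hs) = add (Lop KT) (lambda j x) (lambda j y) (tens s hs)"
      unfolding L.add_apply[OF la tens_closed[OF *(1,4)]] lambda_zero[OF j x *] lambda_zero[OF j y *] lambda_zero[OF j xy *]
      by (simp add: K.add_zero)
  qed
qed

abbreviation "SL x \<equiv> osum KT {1..N} (\<lambda>j. lambda j (x j))"

lemma SL_adjointable: "(\<And>j. j \<in> {1..N} \<Longrightarrow> x j \<in> adjointable (H j)) \<Longrightarrow> SL x \<in> adjointable KT"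
  by (intro K.osum_adjointable lambda_adjointable)

lemma SL_adjoint:
  assumes "\<And>j. j \<in> {1..N} \<Longrightarrow> x j \<in> adjointable (H j)" "\<And>j. j \<in> {1..N} \<Longrightarrow> y j \<in> adjointable (H j)"
    and "\<And>j h k. j \<in> {1..N} \<Longrightarrow> h \<in> elems (H j) \<Longrightarrow> k \<in> elems (H j) \<Longrightarrow> inn (H j) (x j h) k = inn (H j) h (y j k)"
    and "u \<in> elems KT" "v \<in> elems KT"
  shows "inn KT (SL x u) v = inn KT u (SL y v)"
  by (rule K.osum_sym) (use assms in \<open>simp_all add: lambda_adjointable lambda_adjoint\<close>)

lemma inn_SL:
  assumes "\<And>j. j \<in> {1..N} \<Longrightarrow> x j \<in> adjointable (H j)" "u \<in> elems KT" "z \<in> elems KT"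
  shows "inn KT z (SL x u) = (\<Sum>j\<in>{1..N}. inn KT z (lambda j (x j) u))"
  by (rule K.inn_osum) (use assms in \<open>simp_all add: lambda_adjointable\<close>)

lemma SL_add:
  assumes "\<And>j. j \<in> {1..N} \<Longrightarrow> x j \<in> adjointable (H j)" "\<And>j. j \<in> {1..N} \<Longrightarrow> y j \<in> adjointable (H j)" "u \<in> elems KT"
    and w: "\<And>j. j \<in> {1..N} \<Longrightarrow> w j = add (Lop (H j)) (x j) (y j)"
  shows "SL w u = hadd KT (SL x u) (SL y u)"
proof (rule K.inn_eqI)
  interpret L: op_algebra KT "Lop KT" by (rule K.op_algebra_Lop)
  have xy: "w j \<in> adjointable (H j)" if "j \<in> {1..N}" for j
    unfolding w[OF that] using op_algebra.add_adjointable[OF hilb.op_algebra_Lop[OF hilbH[OF that]] assms(1)[OF that] assms(2)[OF that]] .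
  have cl: "SL w u \<in> elems KT" "SL x u \<in> elems KT" "SL y u \<in> elems KT"
    by - (rule K.op_closed[OF SL_adjointable[OF xy] assms(3)], assumption, rule K.op_closed[OF SL_adjointable[OF assms(1)] assms(3)], assumption,
      rule K.op_closed[OF SL_adjointable[OF assms(2)] assms(3)])
  show "SL w u \<in> elems KT" by (rule cl(1))
  show "hadd KT (SL x u) (SL y u) \<in> elems KT" by (rule K.add_closed[OF cl(2,3)])
  fix z assume z: "z \<in> elems KT"
  have "inn KT z (lambda j (w j) u) = inn KT z (lambda j (x j) u) + inn KT z (lambda j (y j) u)"
    if j: "j \<in> {1..N}" for j
  proof -
    note la = lambda_adjointable[OF j assms(1)[OF j]] lambda_adjointable[OF j assms(2)[OF j]]
    show ?thesis
      unfolding w[OF j] lambda_add[OF j assms(1)[OF j] assms(2)[OF j]] L.add_apply[OF la assms(3)]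
      by (rule K.inn_add_right[OF z K.op_closed[OF la(1) assms(3)] K.op_closed[OF la(2) assms(3)]])
  qed
  then have "(\<Sum>j\<in>{1..N}. inn KT z (lambda j (w j) u))
      = (\<Sum>j\<in>{1..N}. inn KT z (lambda j (x j) u)) + (\<Sum>j\<in>{1..N}. inn KT z (lambda j (y j) u))"
    by (simp add: sum.distrib)
  moreover have "inn KT z (SL w u) = (\<Sum>j\<in>{1..N}. inn KT z (lambda j (w j) u))"
    by (rule inn_SL[OF xy assms(3) z])
  moreover have "inn KT z (SL x u) = (\<Sum>j\<in>{1..N}. inn KT z (lambda j (x j) u))" by (rule inn_SL[OF assms(1,3) z])
  moreover have "inn KT z (SL y u) = (\<Sum>j\<in>{1..N}. inn KT z (lambda j (y j) u))" by (rule inn_SL[OF assms(2,3) z])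
  ultimately show "inn KT z (SL w u) = inn KT z (hadd KT (SL x u) (SL y u))"
    unfolding K.inn_add_right[OF z cl(2,3)] by simp
qed

text \<open>Operators that vanish at the distinguished vectors act at the leftmost letter only, so that
  those of different letters are orthogonal and their sum is no larger than the largest of them.\<close>

lemma lambda_orthogonal:
  assumes i: "i \<in> {1..N}" and j: "j \<in> {1..N}" and "i \<noteq> j"
    and x: "x \<in> adjointable (H i)" "x (\<xi> i) = hzero (H i)"
    and y: "y \<in> adjointable (H j)" "y (\<xi> j) = hzero (H j)" "\<And>h. h \<in> elems (H j) \<Longrightarrow> y h \<in> hcirc (H j) (\<xi> j)"
    and u: "u \<in> elems KT"
  shows "lambda i x (lambda j y u) = hzero KT"
proof -
  interpret L: op_algebra KT "Lop KT" by (rule K.op_algebra_Lop)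
  interpret Hi: pointed_hilb "H i" "\<xi> i" by (rule pointed[OF i])
  interpret Hj: pointed_hilb "H j" "\<xi> j" by (rule pointed[OF j])
  note la = lambda_adjointable[OF i x(1)] lambda_adjointable[OF j y(1)]
  have other: "lambda l z (tens s hs) = hzero KT"
    if l: "l \<in> {1..N}" "z \<in> adjointable (H l)" "z (\<xi> l) = hzero (H l)" and s: "s \<in> T" "hs \<in> simple_tensors H \<xi> s" "s = [] \<or> hd s \<noteq> l"
    for l z s hs
  proof (cases "l # s \<in> T")
    case True
    interpret Hl: pointed_hilb "H l" "\<xi> l" by (rule pointed[OF l(1)])
    show ?thesis
      using lambda_tleft[OF True l(2) s(2) Hl.xi_closed] tleft_xi[OF True s(2)] tleft_zero[OF True s(2)] l(3) by simp
  qed (use lambda_zero[OF l(1,2) s(1,3) _ s(2)] in auto)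
  have "mult (Lop KT) (lambda i x) (lambda j y) = zero (Lop KT)"
  proof (rule op_eqI_tens[OF L.mult_adjointable[OF la] L.zero_adjointable])
    fix s hs assume s: "s \<in> T" "hs \<in> simple_tensors H \<xi> s"
    have "lambda i x (lambda j y (tens s hs)) = hzero KT"
    proof (cases "s = [] \<or> hd s \<noteq> j")
      case True
      then show ?thesis using other[OF j y(1,2) s] K.op_zero[OF la(1)] by simp
    next
      case False
      then obtain s' where s': "s = j # s'" by (cases s) auto
      then obtain h hs' where hs: "hs = h # hs'" "h \<in> hcirc (H j) (\<xi> j)" "hs' \<in> simple_tensors H \<xi> s'"
        using s(2) by (auto simp: simple_tensors_Cons)
      have jT: "j # s' \<in> T" using s(1) s' by simp
      have h: "h \<in> elems (H j)" using hs(2) by (simp add: hcirc_def)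
      have "lambda j y (tens s hs) = tens s (y h # hs')"
        using lambda_tleft[OF jT y(1) hs(3) h] tleft_circ[OF jT hs(3,2)] tleft_circ[OF jT hs(3) y(3)[OF h]] by (simp add: s' hs(1))
      moreover have "y h # hs' \<in> simple_tensors H \<xi> s" using y(3)[OF h] hs(3) by (simp add: s' simple_tensors_Cons)
      ultimately show ?thesis using other[OF i x s(1), of "y h # hs'"] assms(3) s' by simp
    qed
    then show "mult (Lop KT) (lambda i x) (lambda j y) (tens s hs) = zero (Lop KT) (tens s hs)"
      using tens_closed[OF s] by simp
  qed
  then have "mult (Lop KT) (lambda i x) (lambda j y) u = zero (Lop KT) u" by simp
  then show ?thesis using u by simp
qed

text \<open>Products of different summands vanish, so powers of the sum are sums of powers. Each
  orbit grows like \<open>R^m\<close> up to a factor of order \<open>N\<close>, and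
  \<open>symmetric_bound\<close> removes that factor.\<close>

lemma diagonal_sum_bound:
  assumes d: "\<And>j. j \<in> {1..N} \<Longrightarrow> d j \<in> adjointable (H j)" and d_xi: "\<And>j. j \<in> {1..N} \<Longrightarrow> d j (\<xi> j) = hzero (H j)"
    and d_sym: "\<And>j h k. j \<in> {1..N} \<Longrightarrow> h \<in> elems (H j) \<Longrightarrow> k \<in> elems (H j) \<Longrightarrow> inn (H j) (d j h) k = inn (H j) h (d j k)"
    and bd: "\<And>j h. j \<in> {1..N} \<Longrightarrow> h \<in> elems (H j) \<Longrightarrow> hnorm (H j) (d j h) \<le> R * hnorm (H j) h" and R: "0 \<le> R"
    and h: "h \<in> elems KT"
  shows "hnorm KT (SL d h) \<le> R * hnorm KT h"
proof -
  have circ: "d j k \<in> hcirc (H j) (\<xi> j)" if j: "j \<in> {1..N}" and k: "k \<in> elems (H j)" for j k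
  proof -
    interpret Hj: pointed_hilb "H j" "\<xi> j" by (rule pointed[OF j])
    show ?thesis
      using d_sym[OF j k Hj.xi_closed] d_xi[OF j] k Hj.op_closed[OF d[OF j] k] by (simp add: hcirc_def)
  qed
  note la = lambda_adjointable[OF _ d]
  let ?D = "\<lambda>j. lambda j (d j)"
  have Dcl: "(?D j ^^ m) h \<in> elems KT" if "j \<in> {1..N}" for j m
    using h by (induction m) (simp_all add: K.op_closed[OF la[OF that that]])
  have Sd: "SL d \<in> adjointable KT" by (rule SL_adjointable[OF d])
  have Scl: "(SL d ^^ m) h \<in> elems KT" for m
    using h by (induction m) (simp_all add: K.op_closed[OF Sd] del: One_nat_def)
  have Dbd: "hnorm KT ((?D j ^^ m) h) \<le> R ^ m * hnorm KT h" if j: "j \<in> {1..N}" for j m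
  proof (induction m)
    case (Suc m)
    have "prehilb.adj_pair (H j) (d j) (d j) R"
      using hilb.op_closed[OF hilbH[OF j] d[OF j]] d_sym[OF j] bd[OF j] R hilb.axioms(1)[OF hilbH[OF j]]
      by (simp add: prehilb.adj_pair_def)
    from lambda_bound[OF j this Dcl[OF j, of m]]
    have "hnorm KT ((?D j ^^ Suc m) h) \<le> R * hnorm KT ((?D j ^^ m) h)" by simp
    also have "\<dots> \<le> R * (R ^ m * hnorm KT h)" by (rule mult_left_mono[OF Suc R])
    finally show ?case by (simp add: mult.assoc)
  qed simp
  have pow: "\<forall>z\<in>elems KT. inn KT z ((SL d ^^ Suc m) h) = (\<Sum>j\<in>{1..N}. inn KT z ((?D j ^^ Suc m) h))" for m
  proof (induction m)
    case 0
    show ?case using inn_SL[OF d h] by simp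
  next
    case (Suc m)
    show ?case
    proof
      fix z assume z: "z \<in> elems KT"
      have Sz: "SL d z \<in> elems KT" by (rule K.op_closed[OF SL_adjointable[OF d] z])
      have "inn KT z ((SL d ^^ Suc (Suc m)) h) = inn KT (SL d z) ((SL d ^^ Suc m) h)"
        using SL_adjoint[OF d d d_sym z Scl[of "Suc m"]] by simp
      also have "\<dots> = (\<Sum>j\<in>{1..N}. inn KT (SL d z) ((?D j ^^ Suc m) h))" using Suc Sz by blast
      also have "\<dots> = (\<Sum>j\<in>{1..N}. inn KT z ((?D j ^^ Suc (Suc m)) h))"
      proof (rule sum.cong[OF HOL.refl])
        fix j assume j: "j \<in> {1..N}"
        have "inn KT (SL d z) ((?D j ^^ Suc m) h) = (\<Sum>i\<in>{1..N}. inn KT z (?D i ((?D j ^^ Suc m) h)))"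
          using SL_adjoint[OF d d d_sym z Dcl[OF j, of "Suc m"]] inn_SL[OF d Dcl[OF j, of "Suc m"] z] by simp
        also have "\<dots> = (\<Sum>i\<in>{1..N}. if i = j then inn KT z (?D j ((?D j ^^ Suc m) h)) else 0)"
        proof (rule sum.cong[OF HOL.refl])
          fix i assume i: "i \<in> {1..N}"
          have "?D i (?D j ((?D j ^^ m) h)) = hzero KT" if "i \<noteq> j"
            by (rule lambda_orthogonal[OF i j that d[OF i] d_xi[OF i] d[OF j] d_xi[OF j] circ[OF j] Dcl[OF j]])
          then show "inn KT z (?D i ((?D j ^^ Suc m) h)) = (if i = j then inn KT z (?D j ((?D j ^^ Suc m) h)) else 0)"
            using z by simp
        qed
        also have "\<dots> = inn KT z (?D j ((?D j ^^ Suc m) h))" using j by (simp add: sum.delta del: funpow.simps)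
        finally show "inn KT (SL d z) ((?D j ^^ Suc m) h) = inn KT z ((?D j ^^ Suc (Suc m)) h)" by simp
      qed
      finally show "inn KT z ((SL d ^^ Suc (Suc m)) h) = (\<Sum>j\<in>{1..N}. inn KT z ((?D j ^^ Suc (Suc m)) h))" .
    qed
  qed
  \<comment> \<open>The added 1 covers \<open>m = 0\<close> also when \<open>N = 0\<close>.\<close>
  have bound: "hnorm KT ((SL d ^^ m) h) \<le> (real N + 1) * hnorm KT h * R ^ m" for m
  proof (cases m)
    case 0
    then show ?thesis by (simp add: algebra_simps)
  next
    case (Suc m')
    let ?u = "(SL d ^^ m) h"
    have "(hnorm KT ?u)\<^sup>2 = norm (\<Sum>j\<in>{1..N}. inn KT ?u ((?D j ^^ m) h))"
      using pow[of m'] Scl[of m] by (simp only: K.hnorm_sq Suc)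
    also have "\<dots> \<le> (\<Sum>j\<in>{1..N}. hnorm KT ?u * (R ^ m * hnorm KT h))"
    proof (rule sum_norm_le)
      fix j assume j: "j \<in> {1..N}"
      have "norm (inn KT ?u ((?D j ^^ m) h)) \<le> hnorm KT ?u * hnorm KT ((?D j ^^ m) h)"
        by (rule K.cauchy_schwarz[OF Scl Dcl[OF j]])
      also have "\<dots> \<le> hnorm KT ?u * (R ^ m * hnorm KT h)" by (rule mult_left_mono[OF Dbd[OF j]]) simp
      finally show "norm (inn KT ?u ((?D j ^^ m) h)) \<le> hnorm KT ?u * (R ^ m * hnorm KT h)" .
    qed
    also have "\<dots> = hnorm KT ?u * (real N * hnorm KT h * R ^ m)" by simp
    finally have "hnorm KT ?u * hnorm KT ?u \<le> hnorm KT ?u * (real N * hnorm KT h * R ^ m)" by (simp add: power2_eq_square)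
    then have "hnorm KT ?u \<le> real N * hnorm KT h * R ^ m"
      using R by (cases "hnorm KT ?u = 0") (simp_all add: mult_le_cancel_left order.strict_iff_order)
    also have "\<dots> \<le> (real N + 1) * hnorm KT h * R ^ m" using R by (intro mult_right_mono) simp_all
    finally show ?thesis .
  qed
  show ?thesis
    by (rule K.symmetric_bound[OF K.op_closed[OF SL_adjointable[OF d]] SL_adjoint[OF d d d_sym] h R bound])
qed

text \<open>\<open>(\<Sum>\<^sub>j \<lambda>\<^sub>j(a\<^sub>j)) (\<Sum>\<^sub>j \<lambda>\<^sub>j(c\<^sub>j))\<close> acts on the summand at \<open>s\<close> as \<open>b\<close> times the number of children
  of \<open>s\<close> in \<open>T\<close>.\<close>

lemma creation_sum_bound:
  fixes D :: real
  assumes c: "\<And>j. j \<in> {1..N} \<Longrightarrow> c j \<in> adjointable (H j)" and a: "\<And>j. j \<in> {1..N} \<Longrightarrow> a j \<in> adjointable (H j)"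
    and ca: "\<And>j h k. j \<in> {1..N} \<Longrightarrow> h \<in> elems (H j) \<Longrightarrow> k \<in> elems (H j) \<Longrightarrow> inn (H j) (c j h) k = inn (H j) h (a j k)"
    and c_xi: "\<And>j. j \<in> {1..N} \<Longrightarrow> c j (\<xi> j) \<in> hcirc (H j) (\<xi> j)"
    and c_circ: "\<And>j h. j \<in> {1..N} \<Longrightarrow> h \<in> hcirc (H j) (\<xi> j) \<Longrightarrow> c j h = hzero (H j)"
    and a_xi: "\<And>j. j \<in> {1..N} \<Longrightarrow> a j (\<xi> j) = hzero (H j)"
    and ac_xi: "\<And>j. j \<in> {1..N} \<Longrightarrow> a j (c j (\<xi> j)) = lact (H j) b (\<xi> j)"
    and kids: "\<And>s. s \<in> T \<Longrightarrow> real (kids N T s) \<le> D" and D: "0 \<le> D"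
    and h: "h \<in> elems KT"
  shows "hnorm KT (SL c h) \<le> sqrt (norm b * D) * hnorm KT h" "hnorm KT (SL a h) \<le> sqrt (norm b * D) * hnorm KT h"
proof -
  interpret L: op_algebra KT "Lop KT" by (rule K.op_algebra_Lop)
  \<comment> \<open>The weight is 0 off \<open>T\<close>, since \<open>grade_op\<close> asks for a
    bound at all strings.\<close>
  define f where "f s = (if s \<in> T then real (kids N T s) else 0)" for s
  have f: "\<bar>f s\<bar> \<le> D" for s using kids[of s] D by (simp add: f_def)
  obtain G where G: "G \<in> adjointable KT" "\<And>h. h \<in> elems KT \<Longrightarrow> hnorm KT (G h) \<le> D * hnorm KT h"
    "\<And>s hs. s \<in> T \<Longrightarrow> hs \<in> simple_tensors H \<xi> s \<Longrightarrow> G (tens s hs) = ract KT (tens s hs) (of_real (f s))"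
    by (rule grade_op[of f D, OF f], rule that)
  note Sc = SL_adjointable[OF c] and Sa = SL_adjointable[OF a]
  have ct: "lambda j (c j) (tens s hs) = (if j # s \<in> T then tens (j # s) (c j (\<xi> j) # hs) else hzero KT)"
    if j: "j \<in> {1..N}" and s: "s \<in> T" "hs \<in> simple_tensors H \<xi> s" for j s hs
  proof -
    interpret Hj: pointed_hilb "H j" "\<xi> j" by (rule pointed[OF j])
    consider "j # s \<in> T" | "j # s \<notin> T" "s = [] \<or> hd s \<noteq> j" | "j # s \<notin> T" "s \<noteq> []" "hd s = j" by blast
    then show ?thesis
    proof cases
      case 1
      then show ?thesis
        using lambda_tleft[OF 1 c[OF j] s(2) Hj.xi_closed] tleft_xi[OF 1 s(2)] tleft_circ[OF 1 s(2) c_xi[OF j]] by simp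
    next
      case 2
      then show ?thesis using lambda_zero[OF j c[OF j] s(1) 2(2,1) s(2)] by simp
    next
      case 3
      then obtain s' where s': "s = j # s'" by (cases s) auto
      then obtain k hs' where hs: "hs = k # hs'" "k \<in> hcirc (H j) (\<xi> j)" "hs' \<in> simple_tensors H \<xi> s'"
        using s(2) by (auto simp: simple_tensors_Cons)
      have jT: "j # s' \<in> T" using s(1) s' by simp
      have k: "k \<in> elems (H j)" using hs(2) by (simp add: hcirc_def)
      show ?thesis
        using lambda_tleft[OF jT c[OF j] hs(3) k] tleft_circ[OF jT hs(3,2)] c_circ[OF j hs(2)] tleft_zero[OF jT hs(3)] 3 by (simp add: s' hs(1))
    qed
  qed
  \<comment> \<open>For \<open>i\<close> different from \<open>j\<close>, the tensor created by
    \<open>c j\<close> does not begin with \<open>i\<close>. So \<open>a i\<close> either acts on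
    \<open>\<xi> i\<close>, which it annihilates, or the string \<open>i # j # s\<close> lies
    outside \<open>T\<close>.\<close>
  have act: "lambda i (a i) (lambda j (c j) (tens s hs)) = (if i = j \<and> j # s \<in> T then lact KT b (tens s hs) else hzero KT)"
    if i: "i \<in> {1..N}" and j: "j \<in> {1..N}" and s: "s \<in> T" "hs \<in> simple_tensors H \<xi> s" for i j s hs
  proof (cases "j # s \<in> T")
    case False
    then show ?thesis using ct[OF j s] K.op_zero[OF lambda_adjointable[OF i a[OF i]]] by simp
  next
    case jT: True
    interpret Hi: pointed_hilb "H i" "\<xi> i" by (rule pointed[OF i])
    interpret Hj: pointed_hilb "H j" "\<xi> j" by (rule pointed[OF j])
    have cs: "c j (\<xi> j) # hs \<in> simple_tensors H \<xi> (j # s)" using c_xi[OF j] s(2) by (simp add: simple_tensors_Cons)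
    have ce: "c j (\<xi> j) \<in> elems (H j)" by (rule Hj.op_closed[OF c[OF j] Hj.xi_closed])
    show ?thesis
    proof (cases "i = j")
      case True
      then show ?thesis
        using ct[OF j s] jT lambda_tleft[OF jT a[OF j] s(2) ce] tleft_circ[OF jT s(2) c_xi[OF j]] ac_xi[OF j]
          tleft_lact[OF jT s(2) Hj.xi_closed] tleft_xi[OF jT s(2)] by simp
    next
      case False
      show ?thesis
      proof (cases "i # j # s \<in> T")
        case True
        then show ?thesis
          using ct[OF j s] jT False lambda_tleft[OF True a[OF i] cs Hi.xi_closed] tleft_xi[OF True cs] a_xi[OF i] tleft_zero[OF True cs] by simp
      next
        case iT: False
        then show ?thesis using ct[OF j s] jT False lambda_zero[OF i a[OF i] jT _ iT cs] by simp
      qed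
    qed
  qed
  have "mult (Lop KT) (SL a) (SL c) = mult (Lop KT) (left_mult KT b) G"
  proof (rule op_eqI_tens[OF L.mult_adjointable[OF Sa Sc] L.mult_adjointable[OF K.left_mult_adjointable G(1)]])
    fix s hs assume s: "s \<in> T" "hs \<in> simple_tensors H \<xi> s"
    note t = tens_closed[OF s]
    have "SL a (SL c (tens s hs)) = lact KT b (G (tens s hs))"
    proof (rule K.inn_eqI)
      show "SL a (SL c (tens s hs)) \<in> elems KT" by (rule K.op_closed[OF Sa K.op_closed[OF Sc t]])
      show "lact KT b (G (tens s hs)) \<in> elems KT" by (rule K.lact_closed[OF K.op_closed[OF G(1) t]])
      fix z assume z: "z \<in> elems KT"
      have ac': "inn (H j) (a j h) k = inn (H j) h (c j k)" if "j \<in> {1..N}" "h \<in> elems (H j)" "k \<in> elems (H j)" for j h k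
      proof -
        interpret Hj: pointed_hilb "H j" "\<xi> j" by (rule pointed[OF that(1)])
        show ?thesis
          using ca[OF that(1,3,2)] Hj.star_inn[OF that(3) Hj.op_closed[OF a[OF that(1)] that(2)]]
            Hj.star_inn[OF Hj.op_closed[OF c[OF that(1)] that(3)] that(2)] by simp
      qed
      have "inn KT z (SL a (SL c (tens s hs))) = (\<Sum>i\<in>{1..N}. inn KT z (lambda i (a i) (SL c (tens s hs))))"
        by (rule inn_SL[OF a K.op_closed[OF Sc t] z])
      also have "\<dots> = (\<Sum>i\<in>{1..N}. \<Sum>j\<in>{1..N}. inn KT z (lambda i (a i) (lambda j (c j) (tens s hs))))"
      proof (rule sum.cong[OF HOL.refl])
        fix i assume i: "i \<in> {1..N}"
        note li = lambda_adjointable[OF i c[OF i]]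
        have move: "inn KT z (lambda i (a i) w) = inn KT (lambda i (c i) z) w" if "w \<in> elems KT" for w
          using lambda_adjoint[OF i c[OF i] a[OF i] ca[OF i] z that] by simp
        have "inn KT z (lambda i (a i) (SL c (tens s hs))) = (\<Sum>j\<in>{1..N}. inn KT (lambda i (c i) z) (lambda j (c j) (tens s hs)))"
          using move[OF K.op_closed[OF Sc t]] inn_SL[OF c t K.op_closed[OF li z]] by simp
        also have "\<dots> = (\<Sum>j\<in>{1..N}. inn KT z (lambda i (a i) (lambda j (c j) (tens s hs))))"
          by (intro sum.cong[OF HOL.refl] move[symmetric] K.op_closed[OF lambda_adjointable[OF _ c] t])
        finally show "inn KT z (lambda i (a i) (SL c (tens s hs))) = (\<Sum>j\<in>{1..N}. inn KT z (lambda i (a i) (lambda j (c j) (tens s hs))))" .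
      qed
      also have "\<dots> = (\<Sum>i\<in>{1..N}. \<Sum>j\<in>{1..N}. if i = j then (if j # s \<in> T then inn KT z (lact KT b (tens s hs)) else 0) else 0)"
        using act[OF _ _ s] z by (intro sum.cong[OF HOL.refl]) auto
      also have "\<dots> = (\<Sum>i\<in>{1..N}. if i # s \<in> T then inn KT z (lact KT b (tens s hs)) else 0)"
        by (intro sum.cong[OF HOL.refl]) (simp add: sum.delta)
      also have "\<dots> = of_nat (kids N T s) * inn KT z (lact KT b (tens s hs))"
        by (simp add: sum.If_cases kids_def Int_def)
      also have "\<dots> = inn KT z (lact KT b (G (tens s hs)))"
        using z t s(1) by (simp add: G(3)[OF s] f_def K.lact_ract K.inn_ract mult_of_nat_commute)
      finally show "inn KT z (SL a (SL c (tens s hs))) = inn KT z (lact KT b (G (tens s hs)))" .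
    qed
    then show "mult (Lop KT) (SL a) (SL c) (tens s hs) = mult (Lop KT) (left_mult KT b) G (tens s hs)"
      using t K.op_closed[OF G(1) t] by simp
  qed
  then have "mult (Lop KT) (SL a) (SL c) h = mult (Lop KT) (left_mult KT b) G h" if "h \<in> elems KT" for h by simp
  then have SaSc: "SL a (SL c h) = lact KT b (G h)" if "h \<in> elems KT" for h
    using that K.op_closed[OF G(1) that] by simp
  have bd: "hnorm KT (SL c h) \<le> sqrt (norm b * D) * hnorm KT h" if h: "h \<in> elems KT" for h
  proof (rule power2_le_imp_le)
    have Gh: "G h \<in> elems KT" by (rule K.op_closed[OF G(1) h])
    have "(hnorm KT (SL c h))\<^sup>2 = norm (inn KT h (lact KT b (G h)))"
      using SL_adjoint[OF c a ca h K.op_closed[OF Sc h]] SaSc[OF h] by (simp add: K.hnorm_sq)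
    also have "\<dots> \<le> hnorm KT h * hnorm KT (lact KT b (G h))" using h Gh by (intro K.cauchy_schwarz) auto
    also have "\<dots> \<le> hnorm KT h * (norm b * (D * hnorm KT h))"
      using K.hnorm_lact[OF Gh, of b] mult_left_mono[OF G(2)[OF h] norm_ge_zero[of b]] by (intro mult_left_mono) simp_all
    also have "\<dots> = (sqrt (norm b * D) * hnorm KT h)\<^sup>2" using D by (simp add: power_mult_distrib power2_eq_square algebra_simps)
    finally show "(hnorm KT (SL c h))\<^sup>2 \<le> (sqrt (norm b * D) * hnorm KT h)\<^sup>2" .
  qed (use D in simp)
  show "hnorm KT (SL c h) \<le> sqrt (norm b * D) * hnorm KT h" by (rule bd[OF h])
  have "K.adj_pair (SL c) (SL a) (sqrt (norm b * D))"
    using K.op_closed[OF Sc] K.op_closed[OF Sa] SL_adjoint[OF c a ca] bd D by (simp add: K.adj_pair_def)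
  from K.adj_pairD(6)[OF K.adj_pair_sym[OF this] h]
  show "hnorm KT (SL a h) \<le> sqrt (norm b * D) * hnorm KT h" .
qed

end

section \<open>Splitting the sum into its Bernoulli and diagonal parts\<close>

context centred_op
begin

lemma x_eq_bern_add_diag: "x = add (Lop V) bern diag"
proof (rule op_eqI[OF x_adjointable L.add_adjointable[OF bern_adjointable diag_adjointable]])
  fix h assume h: "h \<in> elems V"
  have cl: "x h \<in> elems V" "bern h \<in> elems V"
    using op_closed[OF x_adjointable h] op_closed[OF bern_adjointable h] .
  show "x h = add (Lop V) bern diag h"
    unfolding L.add_apply[OF bern_adjointable diag_adjointable h] diag_apply[OF h]
    by (rule inn_eqI) (use cl in \<open>simp_all add: inn_add_right inn_hminus_right\<close>)
qed

lemma cre_xi: "cre \<xi> = x \<xi>"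
proof -
  have "ract V (x \<xi>) 1 = x \<xi>" by (rule inn_eqI) (simp_all add: inn_ract)
  then show ?thesis by (simp add: cre_apply inn_xi)
qed

lemma cre_circ:
  assumes "h \<in> hcirc V \<xi>"
  shows "cre h = hzero V"
proof -
  have h: "h \<in> elems V" "inn V h \<xi> = 0" using assms by (simp_all add: hcirc_def)
  then have "inn V \<xi> h = 0" using star_inn[OF h(1) xi_closed] by (simp add: star_zero)
  then show ?thesis
    using h(1) by (intro inn_eqI) (simp_all add: cre_apply inn_ract)
qed

lemma ann_xi: "ann \<xi> = hzero V"
  by (rule inn_eqI) (simp_all add: ann_apply inn_ract x_xi_centred)

lemma ann_cre_xi: "ann (cre \<xi>) = lact V (inn V (x \<xi>) (x \<xi>)) \<xi>"
  unfolding cre_xi by (simp add: ann_apply xi_central)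

lemma x_xi_circ: "x \<xi> \<in> hcirc V \<xi>"
  by (simp add: hcirc_def x_xi_centred)

end

locale tfree_centred = tfree_product N T H \<xi>
  for N T and H :: "nat \<Rightarrow> ('b::unital_cstar_algebra, 'h) bimod" and \<xi> +
  fixes x :: "nat \<Rightarrow> 'h \<Rightarrow> 'h"
  assumes centred: "j \<in> {1..N} \<Longrightarrow> centred_op (H j) (\<xi> j) (x j)"
begin

abbreviation "bern j \<equiv> centred_op.bern (H j) (\<xi> j) (x j)"
abbreviation "diag j \<equiv> centred_op.diag (H j) (\<xi> j) (x j)"
abbreviation "cre j \<equiv> centred_op.cre (H j) (\<xi> j) (x j)"
abbreviation "ann j \<equiv> centred_op.ann (H j) (\<xi> j) (x j)"

lemma SL_bern_bound:
  fixes D :: real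
  assumes kids: "\<And>s. s \<in> T \<Longrightarrow> real (kids N T s) \<le> D" and D: "0 \<le> D"
    and b: "\<And>j. j \<in> {1..N} \<Longrightarrow> inn (H j) (x j (\<xi> j)) (x j (\<xi> j)) = b" and h: "h \<in> elems KT"
  shows "hnorm KT (SL bern h) \<le> 2 * sqrt (norm b * D) * hnorm KT h"
proof -
  note c = centred_op.cre_adjointable[OF centred] and a = centred_op.ann_adjointable[OF centred]
  have bounds: "hnorm KT (SL cre h) \<le> sqrt (norm b * D) * hnorm KT h" "hnorm KT (SL ann h) \<le> sqrt (norm b * D) * hnorm KT h"
  proof -
    note bd = creation_sum_bound[of cre ann b D h]
    have p: "cre j (\<xi> j) \<in> hcirc (H j) (\<xi> j)" "ann j (cre j (\<xi> j)) = lact (H j) b (\<xi> j)" if "j \<in> {1..N}" for j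
      using centred_op.x_xi_circ[OF centred[OF that]] centred_op.ann_cre_xi[OF centred[OF that]] b[OF that]
      by (simp_all add: centred_op.cre_xi[OF centred[OF that]])
    show "hnorm KT (SL cre h) \<le> sqrt (norm b * D) * hnorm KT h"
      by (rule bd(1)[OF c a centred_op.inn_cre[OF centred] p(1) centred_op.cre_circ[OF centred] centred_op.ann_xi[OF centred] p(2) kids D h])
    show "hnorm KT (SL ann h) \<le> sqrt (norm b * D) * hnorm KT h"
      by (rule bd(2)[OF c a centred_op.inn_cre[OF centred] p(1) centred_op.cre_circ[OF centred] centred_op.ann_xi[OF centred] p(2) kids D h])
  qed
  have cl: "SL cre h \<in> elems KT" "SL ann h \<in> elems KT"
    by - (rule K.op_closed[OF SL_adjointable[OF c] h], assumption, rule K.op_closed[OF SL_adjointable[OF a] h])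
  have "SL bern h = hadd KT (SL cre h) (SL ann h)"
    by (rule SL_add[OF c a h centred_op.bern_def[OF centred]])
  then show ?thesis using K.hnorm_triangle[OF cl] bounds by (simp del: One_nat_def)
qed

lemma SL_diff_bound:
  assumes bd: "\<And>j h. j \<in> {1..N} \<Longrightarrow> h \<in> elems (H j) \<Longrightarrow> hnorm (H j) (x j h) \<le> R * hnorm (H j) h" and R: "0 \<le> R" and h: "h \<in> elems KT"
  shows "hnorm KT (hminus KT (SL x h) (SL bern h)) \<le> R * hnorm KT h"
proof -
  note b = centred_op.bern_adjointable[OF centred] and d = centred_op.diag_adjointable[OF centred]
  have cl: "SL bern h \<in> elems KT" "SL diag h \<in> elems KT"
    by - (rule K.op_closed[OF SL_adjointable[OF b] h], assumption, rule K.op_closed[OF SL_adjointable[OF d] h])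
  have eq: "SL x h = hadd KT (SL bern h) (SL diag h)"
    by (rule SL_add[OF b d h centred_op.x_eq_bern_add_diag[OF centred]])
  have "hminus KT (SL x h) (SL bern h) = SL diag h"
    unfolding eq by (rule K.inn_eqI) (use cl in \<open>simp_all add: K.inn_add_right K.inn_hminus_right del: One_nat_def\<close>)
  moreover have "hnorm KT (SL diag h) \<le> R * hnorm KT h"
    by (rule diagonal_sum_bound[OF d centred_op.diag_xi[OF centred] centred_op.diag_sym[OF centred]
        centred_op.diag_bound[OF centred bd R] R h])
  ultimately show ?thesis by simp
qed

end

section \<open>Dilations and the construction of \<open>Y\<close> and \<open>Z\<close>\<close>

context op_algebra
begin

text \<open>The scalar acts by left multiplication with \<open>of_real c\<close>, matching the
  substitution in \<open>dil\<close>. Real scalars are central and self-adjoint, so symmetry of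
  \<open>S\<close> is preserved.\<close>

lemma scaled_self_adjoint:
  assumes S: "S \<in> adjointable V" and sym: "\<And>h k. h \<in> elems V \<Longrightarrow> k \<in> elems V \<Longrightarrow> inn V (S h) k = inn V h (S k)"
  shows "self_adjoint A (left_mult V (of_real c) \<otimes>\<^bsub>A\<^esub> S)"
proof -
  have m: "left_mult V (of_real c) \<otimes>\<^bsub>A\<^esub> S \<in> adjointable V" by (rule mult_adjointable[OF left_mult_adjointable S])
  have oc: "of_real c = (scalar (complex_of_real c) :: 'b)" 
    by (subst of_real_def) (rule scaleC_of_real[symmetric])
  have "adj A (left_mult V (of_real c) \<otimes>\<^bsub>A\<^esub> S) = left_mult V (of_real c) \<otimes>\<^bsub>A\<^esub> S"
  proof (rule adj_eqI[OF m m])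
    fix h k assume h: "h \<in> elems V" and k: "k \<in> elems V"
    have "inn V (ract V (S h) (of_real c)) k = inn V h (ract V (S k) (of_real c))"
      using h k op_closed[OF S] sym star_scaleC[of "complex_of_real c" "1::'b"]
      by (simp add: inn_ract inn_ract_left oc star_one mult_scalar)
    then show "inn V ((left_mult V (of_real c) \<otimes>\<^bsub>A\<^esub> S) h) k = inn V h ((left_mult V (of_real c) \<otimes>\<^bsub>A\<^esub> S) k)"
      using h k op_closed[OF S] by (simp add: oc lact_scalar)
  qed
  then show ?thesis using m by (simp add: self_adjoint_def carrier_A)
qed

lemma mult_minus:
  assumes "R \<in> adjointable V" "S \<in> adjointable V" "T \<in> adjointable V"
  shows "(R \<otimes>\<^bsub>A\<^esub> S) \<ominus>\<^bsub>A\<^esub> (R \<otimes>\<^bsub>A\<^esub> T) = R \<otimes>\<^bsub>A\<^esub> (S \<ominus>\<^bsub>A\<^esub> T)"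
  using assms unfolding carrier_A[symmetric] by (simp add: a_minus_def r_distr r_minus)

lemma law_of_scaled:
  assumes S: "S \<in> adjointable V"
  shows "law_of A (left_mult V) (\<lambda>a. inn V v (a v)) (left_mult V (of_real c) \<otimes>\<^bsub>A\<^esub> S) = dil c (vlaw V v S)"
proof
  fix p
  interpret e: bpoly_hom A "left_mult V" S by (rule bpoly_hom_op[OF S])
  show "law_of A (left_mult V) (\<lambda>a. inn V v (a v)) (left_mult V (of_real c) \<otimes>\<^bsub>A\<^esub> S) p = dil c (vlaw V v S) p"
    by (simp add: law_of_def dil_def vlaw_def e.eval_dilate bpoly_eval_eq_peval[OF S])
qed

lemma cnorm_scaled_le:
  assumes S: "S \<in> adjointable V" and c: "0 \<le> c" and R: "0 \<le> R" and bd: "\<And>h. h \<in> elems V \<Longrightarrow> hnorm V (S h) \<le> R * hnorm V h"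
  shows "cnorm A (left_mult V (of_real c) \<otimes>\<^bsub>A\<^esub> S) \<le> c * R"
proof (rule cnorm_le)
  fix h assume h: "h \<in> elems V"
  have "hnorm V ((left_mult V (of_real c) \<otimes>\<^bsub>A\<^esub> S) h) \<le> norm (of_real c :: 'b) * hnorm V (S h)"
    using hnorm_lact[OF op_closed[OF S h], of "of_real c"] h op_closed[OF S h] by simp
  also have "\<dots> \<le> c * (R * hnorm V h)" using c bd[OF h] by (simp add: mult_left_mono)
  finally show "hnorm V ((left_mult V (of_real c) \<otimes>\<^bsub>A\<^esub> S) h) \<le> c * R * hnorm V h" by simp
qed (use c R in simp)

end

lemma kids_le: "kids N T s \<le> N"
proof -
  have "kids N T s \<le> card {1..N}" unfolding kids_def by (rule card_mono) auto
  then show ?thesis by simp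
qed

text \<open>Nonempty strings are treated by \<open>kids_tree_pow\<close>. The root has at most
  \<open>n^k\<close> children, which the same bound covers because \<open>n <= N\<close>.\<close>

lemma kids_tree_pow_bound:
  assumes T: "subtree N T" and n: "n = kids N T []" "2 \<le> n" and s: "s \<in> tree_pow N T k"
  shows "real (kids (N ^ k) (tree_pow N T k) s) \<le> (real N - 1) * real n ^ k / (real n - 1)"
proof -
  have nN: "n \<le> N" unfolding n(1) by (rule kids_le)
  have "(real n - 1) * real (kids (N ^ k) (tree_pow N T k) s) \<le> (real N - 1) * real n ^ k"
  proof (cases "s = []")
    case True
    have "real (kids (N ^ k) (tree_pow N T k) []) \<le> real n ^ k"
      using kids_tree_pow(1)[OF T n(1), of k] n(2) of_nat_mono[where 'a = real] by fastforce
    then show ?thesis unfolding True using n(2) nN by (intro mult_mono) auto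
  next
    case False
    have "(n - 1) * kids (N ^ k) (tree_pow N T k) s \<le> (N - 1) * n ^ k"
      using kids_tree_pow(2)[OF T n(1) _ s False] n(2) by linarith
    then have "real ((n - 1) * kids (N ^ k) (tree_pow N T k) s) \<le> real ((N - 1) * n ^ k)" by (rule of_nat_mono)
    then show ?thesis using n(2) nN by (simp add: of_nat_diff)
  qed
  then show ?thesis using n(2) by (simp add: pos_le_divide_eq mult.commute)
qed

theorem theorem8p10:
  fixes N k n :: nat
    and T :: "nat list set"
    and \<eta> :: "'b::unital_cstar_algebra \<Rightarrow> 'b"
    and \<mu> :: "nat \<Rightarrow> 'b bpoly \<Rightarrow> 'b"
  assumes "T \<in> Tree N"
    and "n = card {j \<in> {1..N}. [j] \<in> T}"
    and "n \<ge> 2"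
    and "\<And>j. j \<in> {1..N ^ k} \<Longrightarrow> bvalued_law (\<mu> j) \<and> mean_zero (\<mu> j) \<and> has_variance (\<mu> j) \<eta>"
  shows "\<exists>(A :: 'b operator cstar_struct) (\<iota> :: 'b \<Rightarrow> 'b operator) E Y Z.
     bvalued_prob_space A \<iota> E \<and> self_adjoint A Y \<and> self_adjoint A Z \<and>
     law_of A \<iota> E Y
       = dil (real n powr (- (real k / 2))) (boxplus (N ^ k) (tree_pow N T k) \<mu>) \<and>
     law_of A \<iota> E Z
       = dil (real n powr (- (real k / 2))) (boxplus_pow N T k (nu_bool \<eta>)) \<and>
     cnorm A Z \<le> 2 * sqrt ((real N - 1) / (real n - 1) * norm (\<eta> 1)) \<and>
     cnorm A (Y \<ominus>\<^bsub>A\<^esub> Z)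
       \<le> real n powr (- (real k / 2)) * Max ((\<lambda>j. rad (\<mu> j)) ` {1..N ^ k})"
proof -
  let ?T = "tree_pow N T k" and ?M = "N ^ k" and ?H = "\<lambda>j. L2 (\<mu> j)" and ?xi = "\<lambda>j. L2_one (\<mu> j)" and ?x = "\<lambda>j. L2_X (\<mu> j)"
  define c where "c = real n powr (- (real k / 2))"
  define R where "R = Max ((\<lambda>j. rad (\<mu> j)) ` {1..?M})"
  \<comment> \<open>A bound for the number of children at every string. Its factor
    \<open>n^k\<close> is cancelled by the square of \<open>c\<close> in \<open>c2\<close>.\<close>
  define D where "D = (real N - 1) * real n ^ k / (real n - 1)"
  have T: "subtree N T" by (rule Tree_subtree[OF assms(1)])
  have n: "n = kids N T []" using assms(2) by (simp add: kids_def)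
  have "n \<le> N" unfolding n by (rule kids_le)
  then have N: "2 \<le> N" using assms(3) by simp
  \<comment> \<open>The index 1 provides a concrete model of \<open>nu_bool \<eta>\<close>, and its
    radius shows that the maximum \<open>R\<close> is nonnegative.\<close>
  then have one: "1 \<in> {1..?M}" by simp
  have law: "law (\<mu> j)" if "j \<in> {1..?M}" for j using assms(4)[OF that] by (simp add: law.intro)
  have bv: "bvalued_law (\<mu> j)" if "j \<in> {1..?M}" for j using assms(4)[OF that] by simp
  have mean: "inn (?H j) (?xi j) (?x j (?xi j)) = 0" and var: "inn (?H j) (?x j (?xi j)) (lact (?H j) b (?x j (?xi j))) = \<eta> b"
    if j: "j \<in> {1..?M}" for j b
  proof -
    interpret l: law "\<mu> j" by (rule law[OF j])
    note ad = l.L2_X_adjointable and xi = l.L2.xi_closed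
    have x: "?x j (?xi j) \<in> elems (?H j)" by (rule l.L2.op_closed[OF ad xi])
    have v: "inn (?H j) (?xi j) (peval (?H j) (?x j) p (?xi j)) = \<mu> j p" for p
      using l.vlaw_L2_X by (simp add: vlaw_def fun_eq_iff)
    show "inn (?H j) (?xi j) (?x j (?xi j)) = 0"
      using v[of X] assms(4)[OF j] l.L2.peval_simps(2)[OF ad xi] by (simp add: mean_zero_def)
    have "peval (?H j) (?x j) (X * const b * X) (?xi j) = ?x j (lact (?H j) b (?x j (?xi j)))"
      using x xi by (simp add: l.L2.peval_simps[OF ad])
    then show "inn (?H j) (?x j (?xi j)) (lact (?H j) b (?x j (?xi j))) = \<eta> b"
      using v[of "X * const b * X"] assms(4)[OF j] l.L2_X_symmetric[OF xi l.L2.lact_closed[OF x], of b]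
      by (simp add: has_variance_def)
  qed
  interpret tfree_centred ?M ?T ?H ?xi ?x
  proof (intro tfree_centred.intro tfree_centred_axioms.intro tfree_product_L2[OF subtree_tree_pow[OF T] bv])
    show "centred_op (?H j) (?xi j) (?x j)" if j: "j \<in> {1..?M}" for j
      using law.pointed_hilb_L2[OF law[OF j]] law.L2_X_adjointable[OF law[OF j]] law.L2_X_symmetric[OF law[OF j]] mean[OF j]
      by (intro centred_op.intro centred_op_axioms.intro)
  qed
  interpret A: op_algebra KT "Lop_total KT" by (rule K.op_algebra_Lop_total)
  note x_ad = law.L2_X_adjointable[OF law] and b_ad = centred_op.bern_adjointable[OF centred]
  let ?Y = "left_mult KT (of_real c) \<otimes>\<^bsub>Lop_total KT\<^esub> SL ?x" and ?Z = "left_mult KT (of_real c) \<otimes>\<^bsub>Lop_total KT\<^esub> SL bern"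
  have Sx: "SL ?x \<in> adjointable KT" by (rule SL_adjointable[OF x_ad])
  have Sb: "SL bern \<in> adjointable KT" by (rule SL_adjointable[OF b_ad])
  have saY: "self_adjoint (Lop_total KT) ?Y"
    by (rule A.scaled_self_adjoint[OF Sx SL_adjoint[OF x_ad x_ad law.L2_X_symmetric[OF law]]])
  have saZ: "self_adjoint (Lop_total KT) ?Z"
    by (rule A.scaled_self_adjoint[OF Sb SL_adjoint[OF b_ad b_ad centred_op.bern_sym[OF centred]]])
  \<comment> \<open>Equal variances give all the Bernoulli parts the same law, whichever
    \<open>\<mu> j\<close> they come from.\<close>
  have nu: "nu_bool \<eta> = vlaw (?H j) (?xi j) (bern j)" if "j \<in> {1..?M}" for j
    by (rule centred_op.nu_bool_eq[OF centred[OF that] var[OF that]])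
  have nu_law: "bvalued_law (nu_bool \<eta>)"
    unfolding nu[OF one]
    by (rule pointed_hilb.bvalued_law_vlaw[OF pointed[OF one] b_ad[OF one] centred_op.bern_sym[OF centred[OF one]]])
  have free: "tree_free KT ?M ?T (\<lambda>_. nu_bool \<eta>) (\<lambda>j. lambda j (bern j)) vac"
    by (rule tree_free_lambda[OF b_ad nu[symmetric] nu_law])
  have lawY: "law_of (Lop_total KT) (left_mult KT) (\<lambda>a. inn KT vac (a vac)) ?Y = dil c (boxplus ?M ?T \<mu>)"
    unfolding A.law_of_scaled[OF Sx] boxplus_vlaw ..
  have lawZ: "law_of (Lop_total KT) (left_mult KT) (\<lambda>a. inn KT vac (a vac)) ?Z = dil c (boxplus_pow N T k (nu_bool \<eta>))"
    unfolding A.law_of_scaled[OF Sb] vlaw_tree_pow[OF T nu_law free] ..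
  have c: "0 \<le> c" by (simp add: c_def)
  have D: "0 \<le> D" using N assms(3) by (simp add: D_def)
  have c2: "c\<^sup>2 * real n ^ k = 1"
  proof -
    have "c\<^sup>2 = real n powr (- real k)" unfolding c_def power2_eq_square by (simp add: powr_add[symmetric])
    then show ?thesis using assms(3) by (simp add: powr_minus powr_realpow)
  qed
  have normZ: "cnorm (Lop_total KT) ?Z \<le> 2 * sqrt ((real N - 1) / (real n - 1) * norm (\<eta> 1))"
  proof -
    have "inn (?H j) (?x j (?xi j)) (?x j (?xi j)) = \<eta> 1" if j: "j \<in> {1..?M}" for j
    proof -
      interpret l: law "\<mu> j" by (rule law[OF j])
      show ?thesis using var[OF j, of 1] l.L2.lact_one[OF l.L2.op_closed[OF l.L2_X_adjointable l.L2.xi_closed]] by simp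
    qed
    then have "hnorm KT (SL bern h) \<le> 2 * sqrt (norm (\<eta> 1) * D) * hnorm KT h" if "h \<in> elems KT" for h
      using SL_bern_bound[OF kids_tree_pow_bound[OF T n assms(3)] _ _ that] D unfolding D_def by blast
    then have "cnorm (Lop_total KT) ?Z \<le> c * (2 * sqrt (norm (\<eta> 1) * D))"
      using D by (intro A.cnorm_scaled_le[OF Sb c]) simp_all
    also have "\<dots> = 2 * sqrt (c\<^sup>2 * (norm (\<eta> 1) * D))" using c by (simp add: real_sqrt_mult)
    also have "c\<^sup>2 * (norm (\<eta> 1) * D) = (c\<^sup>2 * real n ^ k) * ((real N - 1) / (real n - 1) * norm (\<eta> 1))"
      by (simp add: D_def)
    finally show ?thesis unfolding c2 by simp
  qed
  have R: "0 \<le> R" "\<And>j. j \<in> {1..?M} \<Longrightarrow> rad (\<mu> j) \<le> R"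
  proof -
    show le: "rad (\<mu> j) \<le> R" if "j \<in> {1..?M}" for j unfolding R_def using that by (intro Max_ge) auto
    show "0 \<le> R" using law.rad_nonneg[OF law[OF one]] le[OF one] by simp
  qed
  have normYZ: "cnorm (Lop_total KT) (?Y \<ominus>\<^bsub>Lop_total KT\<^esub> ?Z) \<le> c * R"
  proof -
    have "hnorm KT ((SL ?x \<ominus>\<^bsub>Lop_total KT\<^esub> SL bern) h) \<le> R * hnorm KT h" if h: "h \<in> elems KT" for h
      unfolding A.minus_apply[OF Sx Sb h]
    proof (rule SL_diff_bound[OF _ R(1) h])
      fix j u assume j: "j \<in> {1..?M}" and u: "u \<in> elems (?H j)"
      show "hnorm (?H j) (?x j u) \<le> R * hnorm (?H j) u"
        using law.L2_X_bound[OF law[OF j] u] mult_right_mono[OF R(2)[OF j], of "hnorm (?H j) u"]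
          prehilb.hnorm_nonneg[OF hilb.axioms(1)[OF hilbH[OF j]], of u] by linarith
    qed
    moreover have "?Y \<ominus>\<^bsub>Lop_total KT\<^esub> ?Z = left_mult KT (of_real c) \<otimes>\<^bsub>Lop_total KT\<^esub> (SL ?x \<ominus>\<^bsub>Lop_total KT\<^esub> SL bern)"
      by (rule A.mult_minus[OF K.left_mult_adjointable Sx Sb])
    ultimately show ?thesis
      using A.cnorm_scaled_le[OF A.minus_adjointable[OF Sx Sb] c R(1)] by simp
  qed
  show ?thesis
    using K.bvalued_prob_space_Lop_total saY saZ lawY lawZ normZ normYZ unfolding c_def R_def by blast
qed

end
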